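(* Consider the model, the groups $G_1,\ldots,G_{K_0}$ and the multiscale statistics $\widehat d_{ij}$ described in the context, and assume that conditions (C1)–(C9) listed in the context hold. Then, as $T\to\infty$, \[ \max_{1\le k\le K_0}\ \max_{i,j\in G_k}\ \widehat d_{ij} = O_p\big(\sqrt{\log n+\log T}\big), \] \[ \min_{1\le k<k'\le K_0}\ \min_{i\in G_k,\ j\in G_{k'}}\ \widehat d_{ij}\ \ge\ c_0\sqrt{T h_{\max}}+o_p\big(\sqrt{T h_{\max}}\big), \] where $c_0$ is a fixed positive constant that does not depend on $T$ (nor on $n=n(T)$).
   Context: **Model.** For each $T$, with $n=n(T)\ge 2$ (bounded or diverging), one observes real random variables $(Y_{it},X_{it})$, $1\le i\le n$, $1\le t\le T$, with $Y_{it}=m_i(X_{it})+\alpha_i+\gamma_t+\varepsilon_{it}$, where $m_i:[0,1]\to\mathbb R$ are unknown functions, $E[\varepsilon_{it}\mid X_{it}]=0$, and $\alpha_i,\gamma_t$ are (random) fixed effects, allowed to be arbitrarily correlated with the regressors; the $\alpha_i$ may be arbitrarily correlated across $i$. Normalization: $E[m_i(X_{it})]=0$ for all $i,t$. There is a fixed number $K_0$ of groups: $\{1,\ldots,n\}$ is the disjoint union of $G_1,\ldots,G_{K_0}$ (the groups $G_k=G_{k,n}$ may depend on $n$), and $m_i=g_k$ for all $i\in G_k$, with $g_k\ne g_{k'}$ for $k\neq k'$. All asymptotics are for $T\to\infty$. **Estimators.** $K$ is a kernel, $K_h(\varphi)=h^{-1}K(\varphi/h)$. Put $\widehat Y^*_{it}=Y_{it}-\overline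 Y_i-\overline Y_t^{(i)}+\overline{\overline Y}^{(i)}$ with $\overline Y_i=\frac1T\sum_{t=1}^T Y_{it}$, $\overline Y_t^{(i)}=\frac1{n-1}\sum_{j\ne i}Y_{jt}$, $\overline{\overline Y}^{(i)}=\frac1{(n-1)T}\sum_{j\neq i}\sum_{t=1}^T Y_{jt}$. The local linear estimator is $\widehat m_{i,h}(x)=\sum_{t=1}^T W_{it}(x,h)\widehat Y^*_{it}\big/\sum_{t=1}^T W_{it}(x,h)$, with $W_{it}(x,h)=K_h(X_{it}-x)\{S_{i,2}(x,h)-\frac{X_{it}-x}{h}S_{i,1}(x,h)\}$, $S_{i,\ell}(x,h)=\frac1T\sum_{t=1}^T K_h(X_{it}-x)\big(\frac{X_{it}-x}{h}\big)^\ell$. Let $\kappa_\ell(x,h)=\int_{-x/h}^{(1-x)/h}u^\ell K(u)\,du$, $s(x,h)=\dfrac{\int_{-x/h}^{(1-x)/h}K^2(u)[\kappa_2(x,h)-\kappa_1(x,h)u]^2du}{\{\kappa_0(x,h)\kappa_2(x,h)-\kappa_1(x,h)^2\}^2}$, $\widehat f_{i,h}(x)=\{\kappa_0(x,h)T\}^{-1}\sum_{t=1}^T K_h(X_{it}-x)$, $\widehat\sigma^2_{i,h}=\frac1T\sum_{t=1}^T\{\widehat Y^*_{it}-\widehat m_{i,h}(X_{it})\}^2$, $\widehat\nu_{ij}(x,h)=\big\{\widehat\sigma_{i,h}^2/\widehat f_{i,h}(x)+\widehat\sigma_{j,h}^2/\widehat f_{j,h}(x)\big\}s(x,h)$, and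 $\widehat\psi_{ij}(x,h)=\sqrt{Th}\,\dfrac{\widehat m_{i,h}(x)-\widehat m_{j,h}(x)}{\sqrt{\widehat\nu_{ij}(x,h)}}$. **Multiscale statistic.** $\widehat d_{ij}=\max_{(x,h)\in\mathcal G_T}\{|\widehat\psi_{ij}(x,h)|-\lambda(2h)\}$ with $\lambda(r)=\sqrt{2\log(1/r)}$. The grid $\mathcal G_T$ is a subset of $\mathcal G=\{(x,h): x\in[0,1],\ h_{\min}\le h\le h_{\max}\}$ such that $|\mathcal G_T|\le CT^\beta$ for some fixed constants $C,\beta>0$, and $\mathcal G_T$ becomes dense in $\mathcal G$ as $T\to\infty$, understood to imply that for each $x\in[0,1]$ there are $(x_T,h_T)\in\mathcal G_T$ with $x_T\to x$ and $\liminf_{T} h_T/h_{\max}>0$. **Conditions.** (C1) The processes $\mathcal P_i=\{(X_{it},\varepsilon_{it}):t=1,2,\ldots\}$ are independent across $i$, and each is strictly stationary and strongly mixing with mixing coefficients $\alpha_i(\ell)\le\alpha(\ell)$ for all $i$, where $\alpha(\ell)$ decays exponentially fast to zero as $\ell\to\infty$. (C2) Each $X_{it}$ has a density $f_i$ such that (a) $f_i$ has support $[0,1]$; (b) $0<c\le f_i(x)\le C<\infty$ for all $x\in[0,1]$ and all $i$, with constants $c,C$ independent of $x,i$; (c) $f_i$ is twice continuously differentiable on $[0,1]$ with first and second derivatives bounded in absolute value uniformly over $i$. Moreover $(X_{it},X_{it+\ell})$ has a joint density $f_{i,\ell}$ with $f_{i,\ell}(x,x')\le C<\infty$, $C$ independent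 of $i,x,x',\ell$. (C3) $\sigma_i^2=E[\varepsilon_{it}^2]=E[\varepsilon_{it}^2\mid X_{it}=x]$ for all $x\in[0,1]$, and $0<c\le\sigma_i^2\le C<\infty$ for all $i$ with $c,C$ independent of $i$. (C4) $f_i=f_j$ and $\sigma_i^2=\sigma_j^2$ for all $i,j\in G_k$ and every $1\le k\le K_0$. (C5) There are a real $\theta>4$ and a natural number $\ell^*$ such that for every integer $\ell$ with $|\ell|\ge\ell^*$ and some constant $C<\infty$: $\max_{1\le i\le n}\sup_{x\in[0,1]}E[|\varepsilon_{it}|^\theta\mid X_{it}=x]\le C$ and $\max_{1\le i\le n}\sup_{x,x'\in[0,1]}E[|\varepsilon_{it}\varepsilon_{it+\ell}|\mid X_{it}=x,X_{it+\ell}=x']\le C$. (C6) Each $g_k$ is twice continuously differentiable on $[0,1]$ with $|g_k''(v)-g_k''(w)|\le L|v-w|$ for all $v,w\in[0,1]$ and some constant $L$; and for every $1\le k<k'\le K_0$ there is $x\in[0,1]$ with $g_k(x)\ne g_{k'}(x)$. (C7) $n=n(T)\le C\,\dfrac{(T^{1/2}\wedge Th_{\min})^{(\theta-\delta)/2}}{T^{1+\delta}}$ for some small $\delta>0$ and a sufficiently large constant $C>0$, where $a\wedge b=\min\{a,b\}$ and $\theta$ is from (C5). (C8) $h_{\min}=aT^{-B}$, $h_{\max}=AT^{-b}$ with positive constants $a,A,b,B$, $0<b\le B<1$. (C9) $K$ is non-negative, bounded, integrates to one, is symmetric about zero, has compact support $[-1,1]$, and $|K(v)-K(w)|\le L|v-w|$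 for some $L$ and all $v,w\in\mathbb R$. *)

theory Defs
  imports "HOL-Probability.Probability"
begin

text \<open>
  The probability space is allowed to change with the index. Measurability is part of both
  definitions because \<^const>\<open>measure\<close> assigns the value 0 to non-measurable sets.
\<close>

definition bigO_prob :: "(nat \<Rightarrow> 'a measure) \<Rightarrow> (nat \<Rightarrow> 'a \<Rightarrow> real) \<Rightarrow> (nat \<Rightarrow> real) \<Rightarrow> bool" where
  "bigO_prob M Z r \<longleftrightarrow>
     (\<forall>\<^sub>F T in sequentially. Z T \<in> borel_measurable (M T)) \<and>
     (\<forall>e>0. \<exists>C. \<forall>\<^sub>F T in sequentially.
        measure (M T) {w \<in> space (M T). \<bar>Z T w\<bar> > C * r T} \<le> e)"

definition smallo_prob :: "(nat \<Rightarrow> 'a measure) \<Rightarrow> (nat \<Rightarrow> 'a \<Rightarrow> real) \<Rightarrow> (nat \<Rightarrow> real) \<Rightarrow> bool" where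
  "smallo_prob M Z r \<longleftrightarrow>
     (\<forall>\<^sub>F T in sequentially. Z T \<in> borel_measurable (M T)) \<and>
     (\<forall>d>0. (\<lambda>T. measure (M T) {w \<in> space (M T). \<bar>Z T w\<bar> > d * r T}) \<longlonglongrightarrow> 0)"

definition strictly_stationary :: "'a measure \<Rightarrow> 'b measure \<Rightarrow> (nat \<Rightarrow> 'a \<Rightarrow> 'b) \<Rightarrow> bool" where
  "strictly_stationary M N Z \<longleftrightarrow>
     (\<forall>J d. finite J \<longrightarrow> J \<subseteq> {1..} \<longrightarrow>
        distr M (PiM J (\<lambda>_. N)) (\<lambda>w. \<lambda>t\<in>J. Z (t + d) w) =
        distr M (PiM J (\<lambda>_. N)) (\<lambda>w. \<lambda>t\<in>J. Z t w))"

definition events_of :: "'a measure \<Rightarrow> 'b measure \<Rightarrow> (nat \<Rightarrow> 'a \<Rightarrow> 'b) \<Rightarrow> nat set \<Rightarrow> 'a set set" where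
  "events_of M N Z S = sigma_sets (space M) (\<Union>t\<in>S. {Z t -` A \<inter> space M | A. A \<in> sets N})"

definition mixing_coeff :: "'a measure \<Rightarrow> 'b measure \<Rightarrow> (nat \<Rightarrow> 'a \<Rightarrow> 'b) \<Rightarrow> nat \<Rightarrow> real" where
  "mixing_coeff M N Z l =
     Sup {\<bar>measure M (A \<inter> B) - measure M A * measure M B\<bar> | A B t.
            1 \<le> t \<and> A \<in> events_of M N Z {1..t} \<and> B \<in> events_of M N Z {t + l..}}"

definition sigma_of :: "'a measure \<Rightarrow> ('a \<Rightarrow> 'b::topological_space) \<Rightarrow> 'a measure" where
  "sigma_of M X = vimage_algebra (space M) X borel"

text \<open>
  The estimators are functions of the realised data \<open>X i t\<close>, \<open>Y i t\<close> with
  \<open>i\<close> in \<open>{1..n}\<close> and \<open>t\<close> in \<open>{1..T}\<close>.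
\<close>

definition Kh :: "(real \<Rightarrow> real) \<Rightarrow> real \<Rightarrow> real \<Rightarrow> real" where
  "Kh K h v = K (v / h) / h"

definition Y_star :: "nat \<Rightarrow> nat \<Rightarrow> (nat \<Rightarrow> nat \<Rightarrow> real) \<Rightarrow> nat \<Rightarrow> nat \<Rightarrow> real" where
  "Y_star n T Y i t =
     Y i t - (\<Sum>s=1..T. Y i s) / real T
       - (\<Sum>j\<in>{1..n} - {i}. Y j t) / (real n - 1)
       + (\<Sum>j\<in>{1..n} - {i}. \<Sum>s=1..T. Y j s) / ((real n - 1) * real T)"

definition S_loc :: "(real \<Rightarrow> real) \<Rightarrow> nat \<Rightarrow> (nat \<Rightarrow> nat \<Rightarrow> real) \<Rightarrow> nat \<Rightarrow> nat \<Rightarrow> real \<Rightarrow> real \<Rightarrow> real" where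
  "S_loc K T X i l x h = (\<Sum>t=1..T. Kh K h (X i t - x) * ((X i t - x) / h) ^ l) / real T"

definition W_loc :: "(real \<Rightarrow> real) \<Rightarrow> nat \<Rightarrow> (nat \<Rightarrow> nat \<Rightarrow> real) \<Rightarrow> nat \<Rightarrow> nat \<Rightarrow> real \<Rightarrow> real \<Rightarrow> real" where
  "W_loc K T X i t x h =
     Kh K h (X i t - x) * (S_loc K T X i 2 x h - (X i t - x) / h * S_loc K T X i 1 x h)"

definition m_hat ::
  "(real \<Rightarrow> real) \<Rightarrow> nat \<Rightarrow> nat \<Rightarrow> (nat \<Rightarrow> nat \<Rightarrow> real) \<Rightarrow> (nat \<Rightarrow> nat \<Rightarrow> real) \<Rightarrow> nat \<Rightarrow> real \<Rightarrow> real \<Rightarrow> real" where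
  "m_hat K n T X Y i h x =
     (\<Sum>t=1..T. W_loc K T X i t x h * Y_star n T Y i t) / (\<Sum>t=1..T. W_loc K T X i t x h)"

definition kappa :: "(real \<Rightarrow> real) \<Rightarrow> nat \<Rightarrow> real \<Rightarrow> real \<Rightarrow> real" where
  "kappa K l x h = (LBINT u:{- x / h..(1 - x) / h}. u ^ l * K u)"

definition s_fun :: "(real \<Rightarrow> real) \<Rightarrow> real \<Rightarrow> real \<Rightarrow> real" where
  "s_fun K x h =
     (LBINT u:{- x / h..(1 - x) / h}. (K u)\<^sup>2 * (kappa K 2 x h - kappa K 1 x h * u)\<^sup>2)
       / (kappa K 0 x h * kappa K 2 x h - (kappa K 1 x h)\<^sup>2)\<^sup>2"

definition f_hat :: "(real \<Rightarrow> real) \<Rightarrow> nat \<Rightarrow> (nat \<Rightarrow> nat \<Rightarrow> real) \<Rightarrow> nat \<Rightarrow> real \<Rightarrow> real \<Rightarrow> real" where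
  "f_hat K T X i h x = (\<Sum>t=1..T. Kh K h (X i t - x)) / (kappa K 0 x h * real T)"

definition sigma2_hat ::
  "(real \<Rightarrow> real) \<Rightarrow> nat \<Rightarrow> nat \<Rightarrow> (nat \<Rightarrow> nat \<Rightarrow> real) \<Rightarrow> (nat \<Rightarrow> nat \<Rightarrow> real) \<Rightarrow> nat \<Rightarrow> real \<Rightarrow> real" where
  "sigma2_hat K n T X Y i h =
     (\<Sum>t=1..T. (Y_star n T Y i t - m_hat K n T X Y i h (X i t))\<^sup>2) / real T"

definition nu_hat ::
  "(real \<Rightarrow> real) \<Rightarrow> nat \<Rightarrow> nat \<Rightarrow> (nat \<Rightarrow> nat \<Rightarrow> real) \<Rightarrow> (nat \<Rightarrow> nat \<Rightarrow> real) \<Rightarrow> nat \<Rightarrow> nat \<Rightarrow> real \<Rightarrow> real \<Rightarrow> real" where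
  "nu_hat K n T X Y i j x h =
     (sigma2_hat K n T X Y i h / f_hat K T X i h x + sigma2_hat K n T X Y j h / f_hat K T X j h x)
       * s_fun K x h"

definition psi_hat ::
  "(real \<Rightarrow> real) \<Rightarrow> nat \<Rightarrow> nat \<Rightarrow> (nat \<Rightarrow> nat \<Rightarrow> real) \<Rightarrow> (nat \<Rightarrow> nat \<Rightarrow> real) \<Rightarrow> nat \<Rightarrow> nat \<Rightarrow> real \<Rightarrow> real \<Rightarrow> real" where
  "psi_hat K n T X Y i j x h =
     sqrt (real T * h) * ((m_hat K n T X Y i h x - m_hat K n T X Y j h x)
       / sqrt (nu_hat K n T X Y i j x h))"

definition lam :: "real \<Rightarrow> real" where
  "lam r = sqrt (2 * ln (1 / r))"

definition d_hat ::
  "(real \<Rightarrow> real) \<Rightarrow> (real \<times> real) set \<Rightarrow> nat \<Rightarrow> nat \<Rightarrow> (nat \<Rightarrow> nat \<Rightarrow> real) \<Rightarrow> (nat \<Rightarrow> nat \<Rightarrow> real) \<Rightarrow> nat \<Rightarrow> nat \<Rightarrow> real" where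
  "d_hat K grid n T X Y i j =
     Max ((\<lambda>(x, h). \<bar>psi_hat K n T X Y i j x h\<bar> - lam (2 * h)) ` grid)"

text \<open>
  All objects observed at sample size \<open>T\<close> (including the probability space) carry \<open>T\<close> as
  their first argument, so that the groups may change with the sample size; the group functions
  \<open>g k\<close> do not depend on \<open>T\<close>, and all constants are uniform in \<open>T\<close>. A process that does not
  depend on \<open>T\<close> is the special case of a constant first argument. Sample sizes, individuals,
  times and groups are numbered from 1.

  Functions on the unit interval are total functions whose values outside it are irrelevant.
\<close>

definition panel_model ::
  "(nat \<Rightarrow> 'a measure) \<Rightarrow> (nat \<Rightarrow> nat) \<Rightarrow>
   (nat \<Rightarrow> nat \<Rightarrow> nat \<Rightarrow> 'a \<Rightarrow> real) \<Rightarrow> (nat \<Rightarrow> nat \<Rightarrow> nat \<Rightarrow> 'a \<Rightarrow> real) \<Rightarrow>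
   (nat \<Rightarrow> nat \<Rightarrow> nat \<Rightarrow> 'a \<Rightarrow> real) \<Rightarrow> (nat \<Rightarrow> nat \<Rightarrow> 'a \<Rightarrow> real) \<Rightarrow> (nat \<Rightarrow> nat \<Rightarrow> 'a \<Rightarrow> real) \<Rightarrow>
   (nat \<Rightarrow> nat \<Rightarrow> real \<Rightarrow> real) \<Rightarrow> bool" where
  "panel_model M n Y X \<epsilon> \<alpha> \<gamma> m \<longleftrightarrow>
     (\<forall>T\<ge>1. prob_space (M T) \<and> n T \<ge> 2 \<and>
       (\<forall>i\<in>{1..n T}. \<alpha> T i \<in> borel_measurable (M T)) \<and>
       (\<forall>t\<ge>1. \<gamma> T t \<in> borel_measurable (M T)) \<and>
       (\<forall>i\<in>{1..n T}. \<forall>t\<ge>1.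
          X T i t \<in> borel_measurable (M T) \<and> Y T i t \<in> borel_measurable (M T) \<and>
          (\<forall>w\<in>space (M T). Y T i t w = m T i (X T i t w) + \<alpha> T i w + \<gamma> T t w + \<epsilon> T i t w) \<and>
          integrable (M T) (\<epsilon> T i t) \<and>
          (AE w in M T. real_cond_exp (M T) (sigma_of (M T) (X T i t)) (\<epsilon> T i t) w = 0) \<and>
          integrable (M T) (\<lambda>w. m T i (X T i t w)) \<and>
          (\<integral>w. m T i (X T i t w) \<partial>M T) = 0))"

definition group_structure ::
  "(nat \<Rightarrow> nat) \<Rightarrow> (nat \<Rightarrow> nat \<Rightarrow> real \<Rightarrow> real) \<Rightarrow> nat \<Rightarrow> (nat \<Rightarrow> nat \<Rightarrow> nat set) \<Rightarrow> (nat \<Rightarrow> real \<Rightarrow> real) \<Rightarrow> bool" where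
  "group_structure n m K0 G g \<longleftrightarrow>
     (\<forall>T\<ge>1. (\<Union>k\<in>{1..K0}. G T k) = {1..n T} \<and> disjoint_family_on (G T) {1..K0} \<and>
        (\<forall>k\<in>{1..K0}. \<forall>i\<in>G T k. \<forall>x\<in>{0..1}. m T i x = g k x))"

text \<open>
  Since the bandwidths shrink to 0, the last clause already gives density of the grid in
  the set of all admissible pairs.
\<close>

definition multiscale_grid ::
  "(nat \<Rightarrow> (real \<times> real) set) \<Rightarrow> (nat \<Rightarrow> real) \<Rightarrow> (nat \<Rightarrow> real) \<Rightarrow> bool" where
  "multiscale_grid grid hmin hmax \<longleftrightarrow>
     (\<forall>T\<ge>1. finite (grid T) \<and> grid T \<subseteq> {0..1} \<times> {hmin T..hmax T}) \<and>
     (\<exists>C>0. \<exists>\<beta>>0. \<forall>T\<ge>1. real (card (grid T)) \<le> C * real T powr \<beta>) \<and>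
     (\<forall>x\<in>{0..1}. \<exists>xs hs. (\<forall>\<^sub>F T in sequentially. (xs T, hs T) \<in> grid T) \<and>
        xs \<longlonglongrightarrow> x \<and> liminf (\<lambda>T. ereal (hs T / hmax T)) > 0)"

definition cond_C1 ::
  "(nat \<Rightarrow> 'a measure) \<Rightarrow> (nat \<Rightarrow> nat) \<Rightarrow>
   (nat \<Rightarrow> nat \<Rightarrow> nat \<Rightarrow> 'a \<Rightarrow> real) \<Rightarrow> (nat \<Rightarrow> nat \<Rightarrow> nat \<Rightarrow> 'a \<Rightarrow> real) \<Rightarrow> bool" where
  "cond_C1 M n X \<epsilon> \<longleftrightarrow>
     (\<forall>T\<ge>1. prob_space.indep_vars (M T) (\<lambda>_. PiM {1..} (\<lambda>_. borel))
        (\<lambda>i w. \<lambda>t\<in>{1..}. (X T i t w, \<epsilon> T i t w)) {1..n T}) \<and>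
     (\<forall>T\<ge>1. \<forall>i\<in>{1..n T}. strictly_stationary (M T) borel (\<lambda>t w. (X T i t w, \<epsilon> T i t w))) \<and>
     (\<exists>a :: nat \<Rightarrow> real.
        (\<exists>C>0. \<exists>\<rho>. 0 < \<rho> \<and> \<rho> < 1 \<and> (\<forall>l. a l \<le> C * \<rho> ^ l)) \<and>
        (\<forall>T\<ge>1. \<forall>i\<in>{1..n T}. \<forall>l.
           mixing_coeff (M T) borel (\<lambda>t w. (X T i t w, \<epsilon> T i t w)) l \<le> a l))"

text \<open>
  \<open>f'\<close> and \<open>f''\<close> are the first two derivatives on the unit interval, one-sided at the endpoints.
\<close>

definition twice_cont_diff ::
  "(real \<Rightarrow> real) \<Rightarrow> (real \<Rightarrow> real) \<Rightarrow> (real \<Rightarrow> real) \<Rightarrow> bool" where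
  "twice_cont_diff f f' f'' \<longleftrightarrow>
     (\<forall>x\<in>{0..1}. (f has_real_derivative f' x) (at x within {0..1})) \<and>
     (\<forall>x\<in>{0..1}. (f' has_real_derivative f'' x) (at x within {0..1})) \<and>
     continuous_on {0..1} f''"

text \<open>The joint density is only required for lags \<open>l \<ge> 1\<close>; for \<open>l = 0\<close> there is none.\<close>

definition cond_C2 ::
  "(nat \<Rightarrow> 'a measure) \<Rightarrow> (nat \<Rightarrow> nat) \<Rightarrow> (nat \<Rightarrow> nat \<Rightarrow> nat \<Rightarrow> 'a \<Rightarrow> real) \<Rightarrow>
   (nat \<Rightarrow> nat \<Rightarrow> real \<Rightarrow> real) \<Rightarrow> bool" where
  "cond_C2 M n X f \<longleftrightarrow>
     (\<forall>T\<ge>1. \<forall>i\<in>{1..n T}. (\<forall>t\<ge>1. distributed (M T) lborel (X T i t) (\<lambda>x. ennreal (f T i x))) \<and>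
        (\<forall>x. x \<notin> {0..1} \<longrightarrow> f T i x = 0)) \<and>
     (\<exists>c>0. \<exists>C. \<forall>T\<ge>1. \<forall>i\<in>{1..n T}. \<forall>x\<in>{0..1}. c \<le> f T i x \<and> f T i x \<le> C) \<and>
     (\<exists>D. \<forall>T\<ge>1. \<forall>i\<in>{1..n T}. \<exists>f' f''. twice_cont_diff (f T i) f' f'' \<and>
        (\<forall>x\<in>{0..1}. \<bar>f' x\<bar> \<le> D \<and> \<bar>f'' x\<bar> \<le> D)) \<and>
     (\<exists>C. \<forall>T\<ge>1. \<forall>i\<in>{1..n T}. \<forall>l\<ge>1. \<exists>fl :: real \<times> real \<Rightarrow> real.
        (\<forall>z. 0 \<le> fl z \<and> fl z \<le> C) \<and>
        (\<forall>t\<ge>1. distributed (M T) (lborel \<Otimes>\<^sub>M lborel) (\<lambda>w. (X T i t w, X T i (t + l) w))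
           (\<lambda>z. ennreal (fl z))))"

text \<open>
  Statements about \<open>E[Z | X = x]\<close> for all \<open>x\<close> are read as almost sure statements about
  \<open>E[Z | X]\<close>. For \<open>Z \<ge> 0\<close> the extended version \<^const>\<open>nn_cond_exp\<close> is used, which takes the value
  infinity when \<open>Z\<close> has no moment, whereas \<^const>\<open>real_cond_exp\<close> would return 0.
\<close>

definition cond_C3 ::
  "(nat \<Rightarrow> 'a measure) \<Rightarrow> (nat \<Rightarrow> nat) \<Rightarrow> (nat \<Rightarrow> nat \<Rightarrow> nat \<Rightarrow> 'a \<Rightarrow> real) \<Rightarrow>
   (nat \<Rightarrow> nat \<Rightarrow> nat \<Rightarrow> 'a \<Rightarrow> real) \<Rightarrow> (nat \<Rightarrow> nat \<Rightarrow> real) \<Rightarrow> bool" where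
  "cond_C3 M n X \<epsilon> \<sigma>2 \<longleftrightarrow>
     (\<forall>T\<ge>1. \<forall>i\<in>{1..n T}. \<forall>t\<ge>1.
        integrable (M T) (\<lambda>w. (\<epsilon> T i t w)\<^sup>2) \<and> (\<integral>w. (\<epsilon> T i t w)\<^sup>2 \<partial>M T) = \<sigma>2 T i \<and>
        (AE w in M T. nn_cond_exp (M T) (sigma_of (M T) (X T i t))
           (\<lambda>w. ennreal ((\<epsilon> T i t w)\<^sup>2)) w = ennreal (\<sigma>2 T i))) \<and>
     (\<exists>c>0. \<exists>C. \<forall>T\<ge>1. \<forall>i\<in>{1..n T}. c \<le> \<sigma>2 T i \<and> \<sigma>2 T i \<le> C)"

definition cond_C4 ::
  "nat \<Rightarrow> (nat \<Rightarrow> nat \<Rightarrow> nat set) \<Rightarrow> (nat \<Rightarrow> nat \<Rightarrow> real \<Rightarrow> real) \<Rightarrow> (nat \<Rightarrow> nat \<Rightarrow> real) \<Rightarrow> bool" where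
  "cond_C4 K0 G f \<sigma>2 \<longleftrightarrow>
     (\<forall>T\<ge>1. \<forall>k\<in>{1..K0}. \<forall>i\<in>G T k. \<forall>j\<in>G T k. f T i = f T j \<and> \<sigma>2 T i = \<sigma>2 T j)"

definition cond_C5 ::
  "(nat \<Rightarrow> 'a measure) \<Rightarrow> (nat \<Rightarrow> nat) \<Rightarrow> (nat \<Rightarrow> nat \<Rightarrow> nat \<Rightarrow> 'a \<Rightarrow> real) \<Rightarrow>
   (nat \<Rightarrow> nat \<Rightarrow> nat \<Rightarrow> 'a \<Rightarrow> real) \<Rightarrow> real \<Rightarrow> bool" where
  "cond_C5 M n X \<epsilon> \<theta> \<longleftrightarrow> \<theta> > 4 \<and>
     (\<exists>lstar :: nat. \<exists>C :: real. \<forall>T\<ge>1. \<forall>i\<in>{1..n T}. \<forall>t\<ge>1.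
        (AE w in M T. nn_cond_exp (M T) (sigma_of (M T) (X T i t))
           (\<lambda>w. ennreal (\<bar>\<epsilon> T i t w\<bar> powr \<theta>)) w \<le> ennreal C) \<and>
        (\<forall>s\<ge>1. \<bar>int s - int t\<bar> \<ge> int lstar \<longrightarrow>
           (AE w in M T. nn_cond_exp (M T) (sigma_of (M T) (\<lambda>w. (X T i t w, X T i s w)))
              (\<lambda>w. ennreal \<bar>\<epsilon> T i t w * \<epsilon> T i s w\<bar>) w \<le> ennreal C)))"

definition cond_C6 :: "nat \<Rightarrow> (nat \<Rightarrow> real \<Rightarrow> real) \<Rightarrow> bool" where
  "cond_C6 K0 g \<longleftrightarrow>
     (\<exists>L. \<forall>k\<in>{1..K0}. \<exists>g' g''. twice_cont_diff (g k) g' g'' \<and>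
        (\<forall>v\<in>{0..1}. \<forall>w\<in>{0..1}. \<bar>g'' v - g'' w\<bar> \<le> L * \<bar>v - w\<bar>)) \<and>
     (\<forall>k\<in>{1..K0}. \<forall>k'\<in>{k<..K0}. \<exists>x\<in>{0..1}. g k x \<noteq> g k' x)"

definition cond_C7 :: "(nat \<Rightarrow> nat) \<Rightarrow> (nat \<Rightarrow> real) \<Rightarrow> real \<Rightarrow> bool" where
  "cond_C7 n hmin \<theta> \<longleftrightarrow>
     (\<exists>\<delta>>0. \<exists>C>0. \<forall>T\<ge>1. real (n T) \<le>
        C * (min (real T powr (1/2)) (real T * hmin T) powr ((\<theta> - \<delta>) / 2) / real T powr (1 + \<delta>)))"

definition cond_C8 :: "(nat \<Rightarrow> real) \<Rightarrow> (nat \<Rightarrow> real) \<Rightarrow> bool" where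
  "cond_C8 hmin hmax \<longleftrightarrow>
     (\<exists>a>0. \<exists>A>0. \<exists>b B. 0 < b \<and> b \<le> B \<and> B < 1 \<and>
        (\<forall>T\<ge>1. hmin T = a * real T powr (- B) \<and> hmax T = A * real T powr (- b)))"

definition cond_C9 :: "(real \<Rightarrow> real) \<Rightarrow> bool" where
  "cond_C9 K \<longleftrightarrow>
     (\<forall>v. 0 \<le> K v) \<and> (\<exists>C. \<forall>v. K v \<le> C) \<and> has_bochner_integral lborel K 1 \<and>
     (\<forall>v. K (- v) = K v) \<and> (\<forall>v. v \<notin> {-1..1} \<longrightarrow> K v = 0) \<and>
     (\<exists>L. \<forall>v w. \<bar>K v - K w\<bar> \<le> L * \<bar>v - w\<bar>)"

end

theory Submission
  imports Defs "HOL-Real_Asymp.Real_Asymp"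
begin

text \<open>
  The demeaning removes the fixed effects exactly and leaves the errors plus averages over time and over
  the other individuals. Every remaining term of the local linear estimator is a sum over \<open>t\<close> of a function
  of the data of at most two individuals \<open>i \<noteq> j\<close>. Such a pair of independent strongly mixing processes is again
  strongly mixing, so a blocking argument gives a Bernstein-type tail bound for the errors truncated at a level
  \<open>\<tau>\<close>, and a union bound over \<open>i\<close>, \<open>j\<close>, the bandwidths and a fine mesh of points \<open>x\<close> shows that each sum deviates
  from its mean by \<open>O(sqrt (T h log T))\<close> uniformly, with high probability; the bound on \<open>n\<close> makes it unlikely that any
  error exceeds \<open>\<tau>\<close>. Hence the estimator is within \<open>O(sqrt (log T / (T h)))\<close> of its
  population version, uniformly. Within a group the population versions coincide, so the statistics are
  \<open>O(sqrt (log T))\<close>. Between two groups the population versions differ by a constant near a point where the group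
  functions differ, so at a nearby grid point with \<open>h\<close> of the order \<open>h\<^sub>m\<^sub>a\<^sub>x\<close> the statistic is at least of the
  order \<open>sqrt (T h\<^sub>m\<^sub>a\<^sub>x)\<close>.
\<close>

section \<open>Exponential inequalities under strong mixing\<close>

text \<open>The proof has to cover \<open>n\<close> staying at 2 as well as growing with
  \<open>T\<close>. Cross-sectional averages are therefore neither assumed small nor treated as one
  long sum: each is bounded by the largest of its terms, so only pairs of individuals enter and the
  union bound has polynomially many members. The truncation level is squeezed from both sides.
  Blocks of length a small power of \<open>T\<close> require errors below
  \<open>sqrt (T * h)\<close>, and products of two errors below \<open>sqrt T\<close>, by a power of
  \<open>T\<close>, while the union over all errors requires
  \<open>n * T * \<tau> powr - \<theta>\<close> to vanish; condition (C7) leaves room for such a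
  level. Since only rates are claimed, the variance estimators are merely kept between two positive
  constants, and a bias of order \<open>h\<close> is tolerable: inside a group it cancels because
  the population fits are identical, and between groups a fixed gap dominates it. The variance
  estimators evaluate the fit at the observed regressors, which is why deviations are controlled at
  all \<open>x\<close> in the unit interval and not only on the grid.\<close>

lemma abs_mult_le_half_squares: "\<bar>p * q\<bar> \<le> (p\<^sup>2 + q\<^sup>2) / 2" for p q :: real
proof -
  have "0 \<le> (\<bar>p\<bar> - \<bar>q\<bar>)\<^sup>2" by simp
  then show ?thesis by (simp add: power2_diff abs_mult)
qed

context prob_space
begin

text \<open>
  Among all weights \<open>0 \<le> W \<le> 1\<close> measurable with respect to \<open>F\<close>, the covariance with \<open>Y\<close> is
  largest for the indicator of \<open>{E(Y | F) > E(Y)}\<close>, so a bound for events extends to weights.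
\<close>

lemma expectation_mult_le_of_indicator:
  fixes W Y :: "'a \<Rightarrow> real" and a :: real
  assumes F: "subalgebra M F" and Y: "integrable M Y"
    and mix: "\<And>A. A \<in> sets F \<Longrightarrow> expectation (\<lambda>w. indicator A w * Y w) \<le> prob A * expectation Y + a"
    and W: "W \<in> borel_measurable F" "\<And>w. w \<in> space M \<Longrightarrow> 0 \<le> W w" "\<And>w. w \<in> space M \<Longrightarrow> W w \<le> 1"
  shows "expectation (\<lambda>w. W w * Y w) \<le> expectation W * expectation Y + a"
proof -
  interpret finite_measure_subalgebra M F
    by unfold_locales (rule F)
  let ?c = "real_cond_exp M F Y"
  let ?y = "expectation Y"
  define A where "A = {w \<in> space M. ?c w > ?y}"
  have spF: "space F = space M" using F by (simp add: subalgebra_def)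
  have c_meas [measurable]: "?c \<in> borel_measurable F" by simp
  have A [measurable]: "A \<in> sets F"
    unfolding A_def spF[symmetric] by measurable
  have AM [measurable]: "A \<in> sets M" using A F by (auto simp: subalgebra_def)
  have WM [measurable]: "W \<in> borel_measurable M" using measurable_from_subalg[OF F W(1)] .
  have cM [measurable]: "?c \<in> borel_measurable M" by simp
  have YM [measurable]: "Y \<in> borel_measurable M" using Y by auto
  have ic: "integrable M ?c" using real_cond_exp_int(1)[OF Y] .
  have bnd: "integrable M (\<lambda>w. V w * Z w)"
    if "V \<in> borel_measurable M" "integrable M Z" "\<And>w. w \<in> space M \<Longrightarrow> 0 \<le> V w \<and> V w \<le> 1" for V Z :: "'a \<Rightarrow> real"
  proof (rule Bochner_Integration.integrable_bound[OF that(2)])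
    show "AE w in M. norm (V w * Z w) \<le> norm (Z w)"
      by (rule AE_I2) (use that(3) in \<open>auto simp: abs_mult intro!: mult_left_le_one_le\<close>)
  qed (use that in auto)
  have iW: "integrable M W" by (rule integrable_const_bound[where B=1]) (use W in auto)
  have i1: "integrable M (\<lambda>w. W w * ?c w)" by (rule bnd) (use W ic in auto)
  have i2: "integrable M (\<lambda>w. indicator A w * ?c w)" by (rule bnd) (use ic in \<open>auto simp: indicator_def\<close>)
  have e1: "expectation (\<lambda>w. W w * Y w) = expectation (\<lambda>w. W w * ?c w)"
    by (rule real_cond_exp_intg(2)[symmetric]) (use bnd W Y in auto)
  have e2: "expectation (\<lambda>w. indicator A w * Y w) = expectation (\<lambda>w. indicator A w * ?c w)"
    by (rule real_cond_exp_intg(2)[symmetric]) (use bnd[of "indicator A"] Y in \<open>auto simp: indicator_def\<close>)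
  have "expectation (\<lambda>w. W w * ?c w) - expectation W * ?y = expectation (\<lambda>w. W w * ?c w - W w * ?y)"
    using i1 iW by simp
  also have "\<dots> \<le> expectation (\<lambda>w. indicator A w * ?c w - indicator A w * ?y)"
  proof (rule integral_mono)
    show "integrable M (\<lambda>w. W w * ?c w - W w * ?y)" using i1 iW by simp
    have "integrable M (\<lambda>w. indicator A w * ?y)"
      by (rule integrable_const_bound[where B="\<bar>?y\<bar>"]) (auto intro!: AE_I2 simp: indicator_def)
    then show "integrable M (\<lambda>w. indicator A w * ?c w - indicator A w * ?y)" using i2 by simp
    fix w assume w: "w \<in> space M"
    have "W w * (?c w - ?y) \<le> indicator A w * (?c w - ?y)"
    proof (cases "?c w > ?y")
      case True
      then show ?thesis using W(2,3)[OF w] w by (auto simp: A_def mult_left_le_one_le)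
    next
      case False
      then show ?thesis using W(2)[OF w] by (auto simp: A_def mult_nonneg_nonpos)
    qed
    then show "W w * ?c w - W w * ?y \<le> indicator A w * ?c w - indicator A w * ?y"
      by (simp add: algebra_simps)
  qed
  also have "\<dots> = expectation (\<lambda>w. indicator A w * Y w) - prob A * ?y"
    using i2 by (subst Bochner_Integration.integral_diff) (auto simp: e2 emeasure_eq_measure)
  also have "\<dots> \<le> a" using mix[OF A] by simp
  finally show ?thesis using e1 by simp
qed

text \<open>The case \<open>Y = indicator B\<close> of the previous bound: for indicators its
  hypothesis on events is the mixing inequality itself.\<close>

lemma expectation_indicator_le_of_mixing:
  fixes W :: "'a \<Rightarrow> real" and a :: real
  assumes F: "subalgebra M F" and B: "B \<in> sets M"
    and mix: "\<And>A. A \<in> sets F \<Longrightarrow> prob (A \<inter> B) \<le> prob A * prob B + a"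
    and W: "W \<in> borel_measurable F" "\<And>w. w \<in> space M \<Longrightarrow> 0 \<le> W w" "\<And>w. w \<in> space M \<Longrightarrow> W w \<le> 1"
  shows "expectation (\<lambda>w. W w * indicator B w) \<le> expectation W * prob B + a"
proof -
  have "expectation (\<lambda>w. W w * indicator B w) \<le> expectation W * expectation (indicator B) + a"
  proof (rule expectation_mult_le_of_indicator[OF F _ _ W])
    show "integrable M (indicator B :: 'a \<Rightarrow> real)" using B by (simp add: emeasure_eq_measure)
    fix A assume A: "A \<in> sets F"
    then have "A \<in> sets M" using F by (auto simp: subalgebra_def)
    have "(\<lambda>w. indicator A w * indicator B w :: real) = indicator (A \<inter> B)"
      by (auto simp: indicator_def)
    then show "expectation (\<lambda>w. indicator A w * indicator B w) \<le> prob A * expectation (indicator B) + a"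
      using mix[OF A] B \<open>A \<in> sets M\<close> by simp
  qed auto
  then show ?thesis using B by simp
qed

text \<open>
  Truncating the exponential at 1 turns it into a weight between 0 and 1, so that replacing
  \<open>exp V\<close> by its expectation costs one mixing coefficient per value of \<open>V\<close>, without an exponential factor.
\<close>

lemma min_exp_decouple_step:
  fixes U V :: "'a \<Rightarrow> real" and a :: real
  assumes F: "subalgebra M F" and U: "U \<in> borel_measurable F" "\<And>w. w \<in> space M \<Longrightarrow> 0 \<le> U w"
    and V: "V \<in> borel_measurable M" "finite R" "\<And>w. w \<in> space M \<Longrightarrow> V w \<in> R"
    and mix: "\<And>A v. A \<in> sets F \<Longrightarrow> v \<in> R \<Longrightarrow>
       prob (A \<inter> {w \<in> space M. V w = v}) \<le> prob A * prob {w \<in> space M. V w = v} + a"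
  shows "expectation (\<lambda>w. min 1 (U w * exp (V w)))
     \<le> expectation (\<lambda>w. min 1 (U w * expectation (\<lambda>w. exp (V w)))) + card R * a"
proof -
  note [measurable] = V(1)
  have [measurable]: "U \<in> borel_measurable M" using measurable_from_subalg[OF F U(1)] .
  define p where "p v = prob {w \<in> space M. V w = v}" for v
  define B where "B v = {w \<in> space M. V w = v}" for v
  have Bm [measurable]: "B v \<in> sets M" for v unfolding B_def by measurable
  \<comment> \<open>Any function of \<open>V w\<close> is a finite sum over the values in
    \<open>R\<close>; this reduces the claim to one mixing inequality per value.\<close>
  have split: "f w (V w) = (\<Sum>v\<in>R. f w v * indicator (B v) w)" if "w \<in> space M" for f :: "'a \<Rightarrow> real \<Rightarrow> real" and w
  proof -
    have "(\<Sum>v\<in>R. f w v * indicator (B v) w) = (\<Sum>v\<in>R. if v = V w then f w (V w) else 0)"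
      by (rule sum.cong) (use that in \<open>auto simp: B_def\<close>)
    also have "\<dots> = f w (V w)" using V(2) V(3)[OF that] by simp
    finally show ?thesis by simp
  qed
  let ?g = "\<lambda>v w. min 1 (U w * exp v)"
  have gb: "0 \<le> ?g v w" "?g v w \<le> 1" if "w \<in> space M" for v w using U(2)[OF that] by auto
  have gi: "integrable M (?g v)" for v
    by (rule integrable_const_bound[where B=1]) (use gb in \<open>auto intro!: AE_I2\<close>)
  have gbi: "integrable M (\<lambda>w. ?g v w * indicator (B v) w)" for v
    by (rule integrable_const_bound[where B=1]) (use gb in \<open>auto simp: indicator_def intro!: AE_I2\<close>)
  have psum: "(\<Sum>v\<in>R. p v) = 1"
  proof -
    have "1 = expectation (\<lambda>w. 1::real)" by (simp add: prob_space)
    also have "\<dots> = expectation (\<lambda>w. \<Sum>v\<in>R. 1 * indicator (B v) w)"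
      by (rule Bochner_Integration.integral_cong[OF refl]) (use split[of _ "\<lambda>_ _. 1"] in simp)
    also have "\<dots> = (\<Sum>v\<in>R. prob (B v))"
      by (subst Bochner_Integration.integral_sum) (auto simp: emeasure_eq_measure)
    finally show ?thesis by (simp add: p_def B_def)
  qed
  have eV: "expectation (\<lambda>w. exp (V w)) = (\<Sum>v\<in>R. p v * exp v)"
  proof -
    have "expectation (\<lambda>w. exp (V w)) = expectation (\<lambda>w. \<Sum>v\<in>R. exp v * indicator (B v) w)"
      by (rule Bochner_Integration.integral_cong) (auto intro: split[of _ "\<lambda>_ v. exp v"])
    also have "\<dots> = (\<Sum>v\<in>R. exp v * prob (B v))"
      by (subst Bochner_Integration.integral_sum) (auto simp: emeasure_eq_measure)
    finally show ?thesis by (simp add: p_def B_def mult.commute)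
  qed
  have "expectation (\<lambda>w. min 1 (U w * exp (V w))) = expectation (\<lambda>w. \<Sum>v\<in>R. ?g v w * indicator (B v) w)"
    by (rule Bochner_Integration.integral_cong) (auto intro: split[of _ "\<lambda>w v. ?g v w"])
  also have "\<dots> = (\<Sum>v\<in>R. expectation (\<lambda>w. ?g v w * indicator (B v) w))"
    by (subst Bochner_Integration.integral_sum) (auto simp: gbi)
  also have "\<dots> \<le> (\<Sum>v\<in>R. expectation (?g v) * p v + a)"
  proof (rule sum_mono)
    fix v assume v: "v \<in> R"
    have m: "?g v \<in> borel_measurable F" using U(1) by measurable
    show "expectation (\<lambda>w. ?g v w * indicator (B v) w) \<le> expectation (?g v) * p v + a"
      unfolding p_def B_def[symmetric]
      by (rule expectation_indicator_le_of_mixing[OF F Bm _ m])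
        (use gb mix[OF _ v] in \<open>auto simp: B_def\<close>)
  qed
  also have "\<dots> = expectation (\<lambda>w. \<Sum>v\<in>R. ?g v w * p v) + card R * a"
    by (subst Bochner_Integration.integral_sum) (auto simp: gi sum.distrib)
  \<comment> \<open>Jensen's inequality for the concave function \<open>min 1\<close>, obtained by
    comparing with each argument of the minimum. It moves the average over \<open>v\<close> back
    inside the minimum.\<close>
  also have "expectation (\<lambda>w. \<Sum>v\<in>R. ?g v w * p v) \<le> expectation (\<lambda>w. min 1 (U w * (\<Sum>v\<in>R. p v * exp v)))"
  proof (rule integral_mono)
    show "integrable M (\<lambda>w. \<Sum>v\<in>R. ?g v w * p v)" using gi by auto
    have ps: "0 \<le> (\<Sum>v\<in>R. p v * exp v)" by (auto intro!: sum_nonneg simp: p_def)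
    show "integrable M (\<lambda>w. min 1 (U w * (\<Sum>v\<in>R. p v * exp v)))"
      by (rule integrable_const_bound[where B=1]) (use U(2) ps in \<open>auto intro!: AE_I2\<close>)
    fix w assume w: "w \<in> space M"
    have "(\<Sum>v\<in>R. ?g v w * p v) \<le> (\<Sum>v\<in>R. 1 * p v)"
      by (intro sum_mono mult_right_mono) (auto simp: p_def)
    moreover have "(\<Sum>v\<in>R. ?g v w * p v) \<le> (\<Sum>v\<in>R. (U w * exp v) * p v)"
      by (intro sum_mono mult_right_mono) (auto simp: p_def)
    ultimately show "(\<Sum>v\<in>R. ?g v w * p v) \<le> min 1 (U w * (\<Sum>v\<in>R. p v * exp v))"
      using psum by (simp add: sum_distrib_left mult_ac)
  qed
  finally show ?thesis using eV by simp
qed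

text \<open>The last block is peeled off at each step and the expectation of its exponential is
  absorbed into the constant; the free factor \<open>c\<close> is there to make this induction
  possible. The errors \<open>card R * a\<close> add up and are never multiplied by an exponential
  moment.\<close>

lemma min_exp_decouple:
  fixes V :: "nat \<Rightarrow> 'a \<Rightarrow> real" and \<mu> :: "nat \<Rightarrow> real" and c a :: real
  assumes F: "\<And>k. k < N \<Longrightarrow> subalgebra M (F k)"
    and adapt: "\<And>j k. j < k \<Longrightarrow> k < N \<Longrightarrow> V j \<in> borel_measurable (F k)"
    and V: "\<And>k. k < N \<Longrightarrow> V k \<in> borel_measurable M"
    and R: "finite R" "\<And>k w. k < N \<Longrightarrow> w \<in> space M \<Longrightarrow> V k w \<in> R"
    and mix: "\<And>k A v. k < N \<Longrightarrow> A \<in> sets (F k) \<Longrightarrow> v \<in> R \<Longrightarrow>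
       prob (A \<inter> {w \<in> space M. V k w = v}) \<le> prob A * prob {w \<in> space M. V k w = v} + a"
    and \<mu>: "\<And>k. k < N \<Longrightarrow> expectation (\<lambda>w. exp (V k w)) \<le> \<mu> k"
    and c: "0 \<le> c"
  shows "expectation (\<lambda>w. min 1 (c * (\<Prod>k<N. exp (V k w)))) \<le> c * (\<Prod>k<N. \<mu> k) + N * (card R * a)"
  using assms
proof (induction N arbitrary: c)
  case 0
  then show ?case by (simp add: prob_space)
next
  case (Suc N)
  let ?U = "\<lambda>w. c * (\<Prod>k<N. exp (V k w))"
  have U0: "0 \<le> ?U w" for w using Suc.prems by (auto intro!: mult_nonneg_nonneg prod_nonneg)
  have Um: "?U \<in> borel_measurable (F N)"
    by (intro borel_measurable_times borel_measurable_prod borel_measurable_const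
        measurable_compose[OF Suc.prems(2) borel_measurable_exp]) auto
  have UM [measurable]: "?U \<in> borel_measurable M"
    by (rule measurable_from_subalg[OF Suc.prems(1) Um]) auto
  let ?m = "expectation (\<lambda>w. exp (V N w))"
  have m0: "0 \<le> ?m" by (simp add: integral_nonneg)
  have \<mu>0: "0 \<le> \<mu> k" if "k < Suc N" for k
    by (rule order_trans[OF Bochner_Integration.integral_nonneg Suc.prems(7)[OF that]]) simp
  have "expectation (\<lambda>w. min 1 (c * (\<Prod>k<Suc N. exp (V k w))))
      = expectation (\<lambda>w. min 1 (?U w * exp (V N w)))" by (simp add: mult.assoc)
  also have "\<dots> \<le> expectation (\<lambda>w. min 1 (?U w * ?m)) + card R * a"
    by (rule min_exp_decouple_step[where U = ?U and F = "F N" and V = "V N" and R = R and a = a])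
      (use Suc.prems U0 Um in auto)
  also have "(\<lambda>w. ?U w * ?m) = (\<lambda>w. (c * ?m) * (\<Prod>k<N. exp (V k w)))" by (simp add: mult_ac)
  also have "expectation (\<lambda>w. min 1 ((c * ?m) * (\<Prod>k<N. exp (V k w))))
      \<le> (c * ?m) * (\<Prod>k<N. \<mu> k) + N * (card R * a)"
    by (rule Suc.IH) (use Suc.prems m0 in auto)
  also have "(c * ?m) * (\<Prod>k<N. \<mu> k) \<le> (c * \<mu> N) * (\<Prod>k<N. \<mu> k)"
    using Suc.prems(7)[of N] Suc.prems(8) \<mu>0 by (intro mult_right_mono mult_left_mono prod_nonneg) auto
  finally show ?case by (simp add: algebra_simps)
qed

text \<open>For \<open>x = - y < 0\<close> the claim follows from the Taylor bound for
  \<open>exp y\<close> and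
  \<open>(1 + y + y\<^sup>2/2) * (1 - y + y\<^sup>2) \<ge> 1\<close>.\<close>

lemma exp_le_quadratic:
  assumes "\<bar>x::real\<bar> \<le> 1" shows "exp x \<le> 1 + x + x\<^sup>2"
proof (cases "0 \<le> x")
  case True then show ?thesis using exp_bound[of x] assms by simp
next
  case False
  define y where "y = - x"
  have y: "0 \<le> y" "y \<le> 1" using False assms by (auto simp: y_def)
  have "exp y \<ge> 1 + y + y\<^sup>2 / 2" using exp_lower_Taylor_quadratic[OF y(1)] by simp
  have "1 \<le> (1 + y + y\<^sup>2/2) * (1 - y + y\<^sup>2)"
  proof -
    have "(1 + y + y\<^sup>2/2) * (1 - y + y\<^sup>2) = 1 + y\<^sup>2/2 + y^3 / 2 + y^4/2"
      by (simp add: power2_eq_square power3_eq_cube power4_eq_xxxx field_simps)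
    then show ?thesis using y by simp
  qed
  also have "\<dots> \<le> exp y * (1 - y + y\<^sup>2)"
  proof (rule mult_right_mono)
    have "1 - y + y\<^sup>2 \<ge> 0" using y by (smt (verit) zero_le_power2)
    then show "0 \<le> 1 - y + y\<^sup>2" .
  qed fact
  finally have "exp (- y) \<le> 1 - y + y\<^sup>2"
    by (simp add: exp_minus field_simps)
  then show ?thesis by (simp add: y_def)
qed

text \<open>
  The block sums are rounded up to multiples of \<open>1 / N\<close> in order to take finitely many values.
\<close>

lemma block_sum_tail:
  fixes B :: "nat \<Rightarrow> 'a \<Rightarrow> real" and a :: real
  assumes N: "1 \<le> N"
    and F: "\<And>k. k < N \<Longrightarrow> subalgebra M (F k)" and Q: "\<And>k. k < N \<Longrightarrow> subalgebra M (Q k)"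
    and adapt: "\<And>j k. j < k \<Longrightarrow> k < N \<Longrightarrow> B j \<in> borel_measurable (F k)"
    and BQ: "\<And>k. k < N \<Longrightarrow> B k \<in> borel_measurable (Q k)"
    and bd: "\<And>k w. k < N \<Longrightarrow> w \<in> space M \<Longrightarrow> \<bar>B k w\<bar> \<le> 1"
    and mix: "\<And>k A D. k < N \<Longrightarrow> A \<in> sets (F k) \<Longrightarrow> D \<in> sets (Q k) \<Longrightarrow>
       prob (A \<inter> D) \<le> prob A * prob D + a"
  shows "prob {w \<in> space M. (\<Sum>k<N. B k w) \<ge> s}
    \<le> exp (1 - s + (\<Sum>k<N. expectation (B k) + expectation (\<lambda>w. (B k w)\<^sup>2))) + real N * ((2 * real N + 1) * a)"
proof -
  define V where "V k w = real_of_int \<lceil>real N * B k w\<rceil> / real N" for k w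
  define R where "R = (\<lambda>j::int. real_of_int j / real N) ` {- int N..int N}"
  have Rf: "finite R" by (simp add: R_def)
  have cR: "card R = 2 * N + 1"
  proof -
    have "inj_on (\<lambda>j::int. real_of_int j / real N) {- int N..int N}" using N by (auto simp: inj_on_def)
    then show ?thesis by (simp add: R_def card_image)
  qed
  have N0: "real N > 0" using N by simp
  have VR: "V k w \<in> R" if "k < N" "w \<in> space M" for k w
  proof -
    have b: "\<bar>real N * B k w\<bar> \<le> real N"
      using bd[OF that] N0 by (simp add: abs_mult)
    have "\<lceil>real N * B k w\<rceil> \<le> int N" using b by (simp add: ceiling_le_iff)
    moreover have "- int N \<le> \<lceil>real N * B k w\<rceil>" using b by linarith
    ultimately show ?thesis unfolding V_def R_def by auto
  qed
  have VB: "B k w \<le> V k w" "V k w \<le> B k w + 1 / N" for k w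
  proof -
    show "B k w \<le> V k w" using N0 by (simp add: V_def field_simps)
    have "real_of_int \<lceil>real N * B k w\<rceil> \<le> real N * B k w + 1" by linarith
    then show "V k w \<le> B k w + 1 / N" using N0 by (simp add: V_def field_simps)
  qed
  have Vm: "V k \<in> borel_measurable G" if "B k \<in> borel_measurable G" for k G
    unfolding V_def using that by measurable
  have BM: "B k \<in> borel_measurable M" if "k < N" for k using measurable_from_subalg[OF Q BQ] that by auto
  have VM: "V k \<in> borel_measurable M" if "k < N" for k by (rule Vm) (use BM that in auto)
  \<comment> \<open>The summand \<open>1 / N\<close> pays for the rounding of one block; over the
    \<open>N\<close> blocks it adds up to the 1 in the final exponent.\<close>
  define \<mu> where "\<mu> k = exp (1 / N + (expectation (B k) + expectation (\<lambda>w. (B k w)\<^sup>2)))" for k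
  have \<mu>: "expectation (\<lambda>w. exp (V k w)) \<le> \<mu> k" if k: "k < N" for k
  proof -
    note [measurable] = BM[OF k] VM[OF k]
    have iB: "integrable M (B k)"
      by (rule integrable_const_bound[where B=1]) (use bd[OF k] in \<open>auto intro!: AE_I2\<close>)
    have iB2: "integrable M (\<lambda>w. (B k w)\<^sup>2)"
      by (rule integrable_const_bound[where B=1]) (use bd[OF k] in \<open>auto intro!: AE_I2 simp: abs_square_le_1\<close>)
    have "expectation (\<lambda>w. exp (V k w)) \<le> expectation (\<lambda>w. exp (1/N) * (1 + B k w + (B k w)\<^sup>2))"
    proof (rule integral_mono)
      show "integrable M (\<lambda>w. exp (1/N) * (1 + B k w + (B k w)\<^sup>2))" using iB iB2 by simp
      have e: "exp (V k w) \<le> exp (1/N) * exp (B k w)" for w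
        using VB(2)[of k w] by (simp flip: exp_add)
      show "integrable M (\<lambda>w. exp (V k w))"
      proof (rule integrable_const_bound[where B="exp (1/N) * exp 1"])
        show "AE w in M. norm (exp (V k w)) \<le> exp (1 / N) * exp 1"
        proof (rule AE_I2)
          fix w assume "w \<in> space M"
          then have "exp (B k w) \<le> exp 1" using bd[OF k, of w] by simp
          then have "exp (1/N) * exp (B k w) \<le> exp (1/N) * exp 1" by (intro mult_left_mono) auto
          then show "norm (exp (V k w)) \<le> exp (1 / N) * exp 1" using e[of w] by (simp only: real_norm_def abs_exp_cancel)
        qed
      qed measurable
      fix w assume w: "w \<in> space M"
      have "exp (1/N) * exp (B k w) \<le> exp (1/N) * (1 + B k w + (B k w)\<^sup>2)"
        by (intro mult_left_mono exp_le_quadratic bd[OF k w]) auto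
      then show "exp (V k w) \<le> exp (1/N) * (1 + B k w + (B k w)\<^sup>2)" using e[of w] by linarith
    qed
    also have "\<dots> = exp (1/N) * (1 + (expectation (B k) + expectation (\<lambda>w. (B k w)\<^sup>2)))"
      using iB iB2 by (simp add: prob_space)
    also have "\<dots> \<le> \<mu> k"
      unfolding \<mu>_def exp_add[of "1/N"]
      by (intro mult_left_mono exp_ge_add_one_self) auto
    finally show ?thesis .
  qed
  have mix': "prob (A \<inter> {w \<in> space M. V k w = v}) \<le> prob A * prob {w \<in> space M. V k w = v} + a"
    if "k < N" "A \<in> sets (F k)" for k A v
  proof (rule mix[OF that])
    have "V k \<in> borel_measurable (Q k)" by (rule Vm[OF BQ[OF that(1)]])
    then have "{w \<in> space (Q k). V k w = v} \<in> sets (Q k)" by measurable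
    then show "{w \<in> space M. V k w = v} \<in> sets (Q k)"
      using Q[OF that(1)] by (simp add: subalgebra_def)
  qed
  have SM: "(\<lambda>w. \<Sum>k<N. B k w) \<in> borel_measurable M" by (intro borel_measurable_sum BM) auto
  have PM: "(\<lambda>w. exp (-s) * (\<Prod>k<N. exp (V k w))) \<in> borel_measurable M"
    by (intro borel_measurable_times borel_measurable_prod borel_measurable_const
        measurable_compose[OF VM borel_measurable_exp]) auto
  have "prob {w \<in> space M. (\<Sum>k<N. B k w) \<ge> s}
     = expectation (indicator {w \<in> space M. (\<Sum>k<N. B k w) \<ge> s})"
    using SM by simp
  \<comment> \<open>Chernoff's bound with the truncated exponential: on the event the product is at
    least \<open>exp s\<close>, because rounding was upwards, so the minimum equals 1 there.\<close>
  also have "\<dots> \<le> expectation (\<lambda>w. min 1 (exp (-s) * (\<Prod>k<N. exp (V k w))))"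
  proof (rule integral_mono)
    show "integrable M (indicator {w \<in> space M. (\<Sum>k<N. B k w) \<ge> s} :: _ \<Rightarrow> real)"
      using SM by (simp add: emeasure_eq_measure)
    have "0 \<le> exp (-s) * (\<Prod>k<N. exp (V k w))" for w by (intro mult_nonneg_nonneg prod_nonneg) auto
    then have "\<bar>min 1 (exp (-s) * (\<Prod>k<N. exp (V k w)))\<bar> \<le> 1" for w by (simp add: abs_le_iff min_def)
    then show "integrable M (\<lambda>w. min 1 (exp (-s) * (\<Prod>k<N. exp (V k w))))"
      by (intro integrable_const_bound[where B=1] borel_measurable_min PM) auto
    fix w
    have "(\<Sum>k<N. B k w) \<le> (\<Sum>k<N. V k w)" by (intro sum_mono VB)
    then have "1 \<le> exp (-s) * (\<Prod>k<N. exp (V k w))" if "(\<Sum>k<N. B k w) \<ge> s"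
      using that by (simp add: exp_sum[symmetric] flip: exp_add)
    then show "indicator {w \<in> space M. (\<Sum>k<N. B k w) \<ge> s} w \<le> min 1 (exp (-s) * (\<Prod>k<N. exp (V k w)))"
      by (auto simp: indicator_def intro!: mult_nonneg_nonneg prod_nonneg)
  qed
  also have "\<dots> \<le> exp (-s) * (\<Prod>k<N. \<mu> k) + N * (card R * a)"
    by (rule min_exp_decouple[where F=F]) (use F Vm[OF adapt] VM Rf VR mix' \<mu> in auto)
  also have "exp (-s) * (\<Prod>k<N. \<mu> k) = exp (1 - s + (\<Sum>k<N. expectation (B k) + expectation (\<lambda>w. (B k w)\<^sup>2)))"
  proof -
    have "(\<Prod>k<N. \<mu> k) = exp (\<Sum>k<N. 1 / N + (expectation (B k) + expectation (\<lambda>w. (B k w)\<^sup>2)))"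
      unfolding \<mu>_def by (simp add: exp_sum)
    also have "(\<Sum>k<N. 1 / N + (expectation (B k) + expectation (\<lambda>w. (B k w)\<^sup>2)))
      = 1 + (\<Sum>k<N. expectation (B k) + expectation (\<lambda>w. (B k w)\<^sup>2))"
      using N by (simp add: sum.distrib)
    finally show ?thesis by (simp flip: exp_add add: algebra_simps)
  qed
  finally show ?thesis by (simp add: cR add.commute)
qed

text \<open>
  The time points are cut into blocks of length \<open>r\<close>; the blocks of even and of odd index are treated
  separately, so that neighbouring blocks in a sum are separated by a gap of length \<open>r\<close>.
\<close>

lemma sum_tail_upper:
  fixes V :: "nat \<Rightarrow> 'a \<Rightarrow> real" and P Q :: "nat \<Rightarrow> 'a measure" and a b v \<eta> s :: real
  assumes r: "1 \<le> r" and T: "1 \<le> T"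
    and P: "\<And>t. subalgebra M (P t)" and Q: "\<And>t. subalgebra M (Q t)"
    and P0: "sets (P 0) = {{}, space M}"
    and VP: "\<And>t u. 1 \<le> t \<Longrightarrow> t \<le> u \<Longrightarrow> V t \<in> borel_measurable (P u)"
    and VQ: "\<And>t u. 1 \<le> u \<Longrightarrow> u \<le> t \<Longrightarrow> V t \<in> borel_measurable (Q u)"
    and mix: "\<And>t A B. A \<in> sets (P t) \<Longrightarrow> B \<in> sets (Q (t + r)) \<Longrightarrow> prob (A \<inter> B) \<le> prob A * prob B + a"
    and a: "0 \<le> a"
    and bd: "\<And>t w. t \<in> {1..T} \<Longrightarrow> w \<in> space M \<Longrightarrow> \<bar>V t w\<bar> \<le> b"
    and \<eta>: "0 < \<eta>" "\<eta> * real r * b \<le> 1"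
    and var: "\<And>u. u \<in> {1..T} \<Longrightarrow>
       (\<Sum>t | t \<in> {1..T} \<and> \<bar>int t - int u\<bar> < int r. expectation (\<lambda>w. \<bar>V u w * V t w\<bar>)) \<le> v"
  shows "prob {w \<in> space M. (\<Sum>t=1..T. V t w - expectation (V t)) \<ge> s}
    \<le> 2 * (exp (1 - \<eta> * s / 2 + \<eta>\<^sup>2 * T * v) + real T * ((2 * real T + 1) * a))"
proof -
  \<comment> \<open>Times are numbered from 1 and blocks from 0, so time \<open>t\<close> lies in
    block \<open>(t - 1) div r\<close>. \<open>S p\<close> collects the blocks of parity
    \<open>p\<close>, and \<open>blk p k\<close> is block \<open>2 * k + p\<close>.\<close>
  define S where "S p = {t \<in> {1..T}. ((t - 1) div r) mod 2 = p}" for p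
  define blk where "blk p k = {t \<in> S p. ((t - 1) div r) div 2 = k}" for p k
  have fS [simp]: "finite (S p)" and fb [simp]: "finite (blk p k)" for p k by (auto simp: S_def blk_def)
  have blkT: "t \<in> {1..T}" if "t \<in> blk p k" for t p k using that by (auto simp: blk_def S_def)
  have blk_div: "(t - 1) div r = 2 * k + p" if "t \<in> blk p k" for t p k
    using that by (auto simp: blk_def S_def)
  have blk_bounds: "(2 * k + p) * r + 1 \<le> t \<and> t \<le> (2 * k + p) * r + r" if "t \<in> blk p k" for t p k
  proof -
    have "(t - 1) div r * r \<le> t - 1" by simp
    moreover have "t - 1 < r + (t - 1) div r * r"
      using dividend_less_div_times[of r "t - 1"] r by simp
    moreover have "1 \<le> t" using blkT[OF that] by simp
    ultimately show ?thesis unfolding blk_div[OF that] by linarith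
  qed
  \<comment> \<open>The number of blocks is taken to be \<open>T\<close> whatever \<open>r\<close>
    is; the surplus blocks are empty and contribute nothing.\<close>
  have group: "(\<Sum>k<T. \<Sum>t\<in>blk p k. f t) = (\<Sum>t\<in>S p. f t)" for p and f :: "nat \<Rightarrow> real"
  proof -
    have "(\<lambda>t. ((t - 1) div r) div 2) ` S p \<subseteq> {..<T}"
    proof safe
      fix t assume "t \<in> S p"
      then have "1 \<le> t" "t \<le> T" by (auto simp: S_def)
      moreover have "(t - 1) div r div 2 \<le> t - 1" by (meson div_le_dividend order_trans)
      ultimately show "(t - 1) div r div 2 < T" by linarith
    qed
    from sum.group[OF _ _ this, of f] show ?thesis by (simp add: blk_def)
  qed
  have VM: "V t \<in> borel_measurable M" if "1 \<le> t" for t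
    using measurable_from_subalg[OF P VP[OF that order_refl]] .
  have VVm: "(\<lambda>w. V u w * V t w) \<in> borel_measurable M" if "t \<in> {1..T}" "u \<in> {1..T}" for t u
    by (intro borel_measurable_times VM) (use that in auto)
  have b0: "0 \<le> b"
  proof -
    obtain w where "w \<in> space M" using not_empty by auto
    from bd[OF _ this, of 1] T show ?thesis by (smt (verit) atLeastAtMost_iff order_refl)
  qed
  have VVb: "\<bar>V u w * V t w\<bar> \<le> b * b" if "t \<in> {1..T}" "u \<in> {1..T}" "w \<in> space M" for t u w
    unfolding abs_mult by (intro mult_mono bd) (use that b0 in auto)
  have iV: "integrable M (V t)" if "t \<in> {1..T}" for t
    by (rule integrable_const_bound[where B=b]) (use that bd VM in \<open>auto intro!: AE_I2\<close>)
  have iVV: "integrable M (\<lambda>w. V u w * V t w)" if "t \<in> {1..T}" "u \<in> {1..T}" for t u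
    by (rule integrable_const_bound[where B="b * b"]) (use that VVb VVm in \<open>auto intro!: AE_I2\<close>)
  have v0: "0 \<le> v"
    using T by (intro order_trans[OF sum_nonneg var[of 1]]) auto
  have half: "prob {w \<in> space M. (\<Sum>t\<in>S p. V t w - expectation (V t)) \<ge> s / 2}
      \<le> exp (1 - \<eta> * s / 2 + \<eta>\<^sup>2 * T * v) + real T * ((2 * real T + 1) * a)" if p: "p < 2" for p
  proof -
    define B where "B k w = \<eta> * (\<Sum>t\<in>blk p k. V t w)" for k w
    \<comment> \<open>The preceding block of the same parity ends at
      \<open>(2 * k + p - 1) * r\<close> and the current one starts just after
      \<open>(2 * k + p) * r\<close>, which leaves the gap \<open>r\<close> between past and future.
      For \<open>k = 0\<close> and \<open>p = 0\<close> natural subtraction gives 0: the past is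
      then trivial, so the whole of \<open>M\<close> may serve as the future.\<close>
    define F where "F k = P ((2 * k + p - 1) * r)" for k
    define G where "G k = (if k = 0 \<and> p = 0 then M else Q ((2 * k + p - 1) * r + r))" for k
    let ?s = "\<eta> * s / 2 + \<eta> * (\<Sum>t\<in>S p. expectation (V t))"
    have EB: "(\<Sum>k<T. expectation (B k)) = \<eta> * (\<Sum>t\<in>S p. expectation (V t))"
    proof -
      have "expectation (B k) = \<eta> * (\<Sum>t\<in>blk p k. expectation (V t))" for k
        unfolding B_def using blkT by (simp add: iV Bochner_Integration.integral_sum)
      then show ?thesis by (simp add: group flip: sum_distrib_left)
    qed
    \<comment> \<open>The square of a block sum only pairs times less than \<open>r\<close> apart,
      so each time \<open>u\<close> of the block contributes at most
      \<open>\<eta>\<^sup>2 * v\<close>.\<close>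
    have EB2: "(\<Sum>k<T. expectation (\<lambda>w. (B k w)\<^sup>2)) \<le> \<eta>\<^sup>2 * T * v"
    proof -
      have "expectation (\<lambda>w. (B k w)\<^sup>2) \<le> \<eta>\<^sup>2 * (\<Sum>u\<in>blk p k. v)" for k
      proof -
        have "expectation (\<lambda>w. (B k w)\<^sup>2)
            = expectation (\<lambda>w. \<eta>\<^sup>2 * (\<Sum>u\<in>blk p k. \<Sum>t\<in>blk p k. V u w * V t w))"
          unfolding B_def power_mult_distrib
          by (simp only: power2_eq_square[of "sum _ _"] sum_product)
        also have "\<dots> = \<eta>\<^sup>2 * (\<Sum>u\<in>blk p k. \<Sum>t\<in>blk p k. expectation (\<lambda>w. V u w * V t w))"
          using blkT[of _ p k] by (simp add: iVV Bochner_Integration.integral_sum)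
        also have "\<dots> \<le> \<eta>\<^sup>2 * (\<Sum>u\<in>blk p k. v)"
        proof (intro mult_left_mono sum_mono)
          fix u assume u: "u \<in> blk p k"
          have "(\<Sum>t\<in>blk p k. expectation (\<lambda>w. V u w * V t w))
              \<le> (\<Sum>t\<in>blk p k. expectation (\<lambda>w. \<bar>V u w * V t w\<bar>))"
            by (intro sum_mono integral_mono iVV integrable_abs) (use u blkT in auto)
          also have "\<dots> \<le> (\<Sum>t | t \<in> {1..T} \<and> \<bar>int t - int u\<bar> < int r. expectation (\<lambda>w. \<bar>V u w * V t w\<bar>))"
          proof (rule sum_mono2)
            show "blk p k \<subseteq> {t \<in> {1..T}. \<bar>int t - int u\<bar> < int r}"
            proof
              fix t assume t: "t \<in> blk p k"
              have "\<bar>int t - int u\<bar> < int r" using blk_bounds[OF t] blk_bounds[OF u] by linarith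
              then show "t \<in> {t \<in> {1..T}. \<bar>int t - int u\<bar> < int r}" using blkT[OF t] by simp
            qed
          qed auto
          also have "\<dots> \<le> v" by (rule var) (use u blkT in auto)
          finally show "(\<Sum>t\<in>blk p k. expectation (\<lambda>w. V u w * V t w)) \<le> v" .
        qed auto
        finally show ?thesis .
      qed
      then have "(\<Sum>k<T. expectation (\<lambda>w. (B k w)\<^sup>2)) \<le> (\<Sum>k<T. \<eta>\<^sup>2 * (\<Sum>u\<in>blk p k. v))"
        by (intro sum_mono)
      also have "\<dots> = \<eta>\<^sup>2 * (\<Sum>t\<in>S p. v)" by (subst sum_distrib_left[symmetric], subst group) simp
      also have "\<dots> \<le> \<eta>\<^sup>2 * (T * v)"
      proof (intro mult_left_mono)
        have "card (S p) \<le> card {1..T}" by (rule card_mono) (auto simp: S_def)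
        then show "(\<Sum>t\<in>S p. v) \<le> T * v" using v0 by (simp add: mult_right_mono)
      qed auto
      finally show ?thesis by (simp add: mult.assoc)
    qed
    have "{w \<in> space M. (\<Sum>t\<in>S p. V t w - expectation (V t)) \<ge> s / 2} = {w \<in> space M. (\<Sum>k<T. B k w) \<ge> ?s}"
    proof -
      have "((\<Sum>t\<in>S p. V t w - expectation (V t)) \<ge> s / 2) \<longleftrightarrow> (\<Sum>k<T. B k w) \<ge> ?s" for w
      proof -
        have "(\<Sum>k<T. B k w) = \<eta> * (\<Sum>t\<in>S p. V t w)"
          by (simp add: B_def group flip: sum_distrib_left)
        moreover have "(\<Sum>t\<in>S p. V t w - expectation (V t)) \<ge> s / 2
           \<longleftrightarrow> \<eta> * (\<Sum>t\<in>S p. V t w - expectation (V t)) \<ge> \<eta> * (s / 2)"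
          using \<eta>(1) by (simp add: mult_le_cancel_left_pos)
        ultimately show ?thesis by (simp add: sum_subtractf algebra_simps)
      qed
      then show ?thesis by auto
    qed
    also have "prob \<dots> \<le> exp (1 - ?s + (\<Sum>k<T. expectation (B k) + expectation (\<lambda>w. (B k w)\<^sup>2)))
        + real T * ((2 * real T + 1) * a)"
    proof (rule block_sum_tail[OF T, where F=F and Q=G])
      show "subalgebra M (F k)" "subalgebra M (G k)" for k
        using P Q by (auto simp: F_def G_def subalgebra_def)
      show "B j \<in> borel_measurable (F k)" if "j < k" "k < T" for j k
        unfolding B_def F_def
      proof (intro borel_measurable_times borel_measurable_const borel_measurable_sum VP)
        fix t assume t: "t \<in> blk p j"
        show "1 \<le> t" using blkT[OF t] by simp
        have "t \<le> (2 * j + p + 1) * r" using blk_bounds[OF t] by simp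
        also have "\<dots> \<le> (2 * k + p - 1) * r" using that by (intro mult_right_mono) auto
        finally show "t \<le> (2 * k + p - 1) * r" .
      qed
      show "B k \<in> borel_measurable (G k)" if "k < T" for k
      proof (cases "k = 0 \<and> p = 0")
        case True
        then show ?thesis unfolding B_def G_def using blkT
          by (auto intro!: borel_measurable_times borel_measurable_sum VM)
      next
        case False
        show ?thesis unfolding B_def G_def if_not_P[OF False]
        proof (intro borel_measurable_times borel_measurable_const borel_measurable_sum VQ)
          fix t assume t: "t \<in> blk p k"
          show "1 \<le> (2 * k + p - 1) * r + r" using r by simp
          have "(2 * k + p - 1) * r + r = (2 * k + p - 1 + 1) * r" by simp
          also have "2 * k + p - 1 + 1 = 2 * k + p" using False by auto
          finally show "(2 * k + p - 1) * r + r \<le> t" using blk_bounds[OF t] by simp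
        qed
      qed
      show "\<bar>B k w\<bar> \<le> 1" if "k < T" "w \<in> space M" for k w
      proof -
        have "\<bar>\<Sum>t\<in>blk p k. V t w\<bar> \<le> (\<Sum>t\<in>blk p k. b)"
          by (rule order_trans[OF sum_abs sum_mono]) (use bd blkT that in auto)
        also have "\<dots> \<le> r * b"
        proof -
          have "card (blk p k) \<le> card {(2 * k + p) * r + 1..(2 * k + p) * r + r}"
            by (rule card_mono) (use blk_bounds in \<open>auto simp: subset_eq\<close>)
          then show ?thesis using b0 by (simp add: mult_right_mono)
        qed
        finally have "\<eta> * \<bar>\<Sum>t\<in>blk p k. V t w\<bar> \<le> \<eta> * (r * b)" using \<eta>(1) by (intro mult_left_mono) auto
        then have "\<eta> * \<bar>\<Sum>t\<in>blk p k. V t w\<bar> \<le> 1" using \<eta>(2) by (simp add: mult.assoc)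
        then show ?thesis using \<eta>(1) by (simp add: B_def abs_mult)
      qed
      show "prob (A \<inter> D) \<le> prob A * prob D + a" if "k < T" "A \<in> sets (F k)" "D \<in> sets (G k)" for k A D
      proof (cases "k = 0 \<and> p = 0")
        case True
        then have "A = {} \<or> A = space M" "D \<in> sets M" using that by (auto simp: F_def G_def P0)
        then show ?thesis using a sets.sets_into_space[of D M] by (auto simp: prob_space Int_absorb1)
      next
        case False
        then show ?thesis using that mix by (auto simp: F_def G_def)
      qed
    qed
    also have "1 - ?s + (\<Sum>k<T. expectation (B k) + expectation (\<lambda>w. (B k w)\<^sup>2)) \<le> 1 - \<eta> * s / 2 + \<eta>\<^sup>2 * T * v"
      using EB EB2 by (simp add: sum.distrib)
    finally show ?thesis by simp
  qed
  have ev: "{w \<in> space M. (\<Sum>t\<in>S p. V t w - expectation (V t)) \<ge> s / 2} \<in> sets M" for p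
  proof -
    have "(\<lambda>w. \<Sum>t\<in>S p. V t w - expectation (V t)) \<in> borel_measurable M"
      by (intro borel_measurable_sum borel_measurable_diff VM) (auto simp: S_def)
    then show ?thesis by measurable
  qed
  have "{w \<in> space M. (\<Sum>t=1..T. V t w - expectation (V t)) \<ge> s}
      \<subseteq> {w \<in> space M. (\<Sum>t\<in>S 0. V t w - expectation (V t)) \<ge> s / 2}
      \<union> {w \<in> space M. (\<Sum>t\<in>S 1. V t w - expectation (V t)) \<ge> s / 2}"
  proof -
    have "{1..T} = S 0 \<union> S 1" "S 0 \<inter> S 1 = {}" by (auto simp: S_def)
    then have "(\<Sum>t=1..T. f t) = (\<Sum>t\<in>S 0. f t) + (\<Sum>t\<in>S 1. f t)" for f :: "nat \<Rightarrow> real"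
      by (simp add: sum.union_disjoint)
    then show ?thesis by auto
  qed
  then have "prob {w \<in> space M. (\<Sum>t=1..T. V t w - expectation (V t)) \<ge> s}
      \<le> prob ({w \<in> space M. (\<Sum>t\<in>S 0. V t w - expectation (V t)) \<ge> s / 2}
      \<union> {w \<in> space M. (\<Sum>t\<in>S 1. V t w - expectation (V t)) \<ge> s / 2})"
    by (intro finite_measure_mono sets.Un ev)
  also have "\<dots> \<le> prob {w \<in> space M. (\<Sum>t\<in>S 0. V t w - expectation (V t)) \<ge> s / 2}
      + prob {w \<in> space M. (\<Sum>t\<in>S 1. V t w - expectation (V t)) \<ge> s / 2}"
    by (intro measure_Un_le ev)
  also have "\<dots> \<le> 2 * (exp (1 - \<eta> * s / 2 + \<eta>\<^sup>2 * T * v) + real T * ((2 * real T + 1) * a))"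
    using half[of 0] half[of 1] by simp
  finally show ?thesis .
qed

end

section \<open>Mixing of independent pairs of processes\<close>

text \<open>
  \<open>P t\<close> and \<open>Q t\<close> stand for the past up to \<open>t\<close> and the future from \<open>t\<close>. The mixing inequality is
  one-sided, which is all that upper tail bounds need.
\<close>

definition mixing_array :: "'a measure \<Rightarrow> (nat \<Rightarrow> 'a \<Rightarrow> real) \<Rightarrow> (nat \<Rightarrow> real) \<Rightarrow> bool" where
  "mixing_array M V a \<longleftrightarrow> (\<exists>P Q.
     (\<forall>t. subalgebra M (P t) \<and> subalgebra M (Q t)) \<and> sets (P 0) = {{}, space M} \<and>
     (\<forall>t u. 1 \<le> t \<longrightarrow> t \<le> u \<longrightarrow> V t \<in> borel_measurable (P u)) \<and>
     (\<forall>t u. 1 \<le> u \<longrightarrow> u \<le> t \<longrightarrow> V t \<in> borel_measurable (Q u)) \<and>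
     (\<forall>t l. \<forall>A\<in>sets (P t). \<forall>B\<in>sets (Q (t + l)). measure M (A \<inter> B) \<le> measure M A * measure M B + a l))"

context prob_space
begin

text \<open>The one-sided bound is applied to \<open>V\<close> and to \<open>- V\<close>; both are
  adapted to the same pasts and futures, so one family of mixing inequalities serves both
  tails.\<close>

lemma sum_tail:
  fixes V :: "nat \<Rightarrow> 'a \<Rightarrow> real" and a :: "nat \<Rightarrow> real" and b v \<eta> s :: real
  assumes r: "1 \<le> r" and T: "1 \<le> T"
    and V: "mixing_array M V a" and a: "0 \<le> a r"
    and bd: "\<And>t w. t \<in> {1..T} \<Longrightarrow> w \<in> space M \<Longrightarrow> \<bar>V t w\<bar> \<le> b"
    and \<eta>: "0 < \<eta>" "\<eta> * real r * b \<le> 1"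
    and var: "\<And>u. u \<in> {1..T} \<Longrightarrow>
       (\<Sum>t | t \<in> {1..T} \<and> \<bar>int t - int u\<bar> < int r. expectation (\<lambda>w. \<bar>V u w * V t w\<bar>)) \<le> v"
  shows "prob {w \<in> space M. \<bar>\<Sum>t=1..T. V t w - expectation (V t)\<bar> \<ge> s}
    \<le> 4 * (exp (1 - \<eta> * s / 2 + \<eta>\<^sup>2 * T * v) + real T * ((2 * real T + 1) * a r))"
proof -
  obtain P Q where sub: "\<And>t. subalgebra M (P t)" "\<And>t. subalgebra M (Q t)"
    and P0: "sets (P 0) = {{}, space M}"
    and VP: "\<And>t u. 1 \<le> t \<Longrightarrow> t \<le> u \<Longrightarrow> V t \<in> borel_measurable (P u)"
    and VQ: "\<And>t u. 1 \<le> u \<Longrightarrow> u \<le> t \<Longrightarrow> V t \<in> borel_measurable (Q u)"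
    and mix: "\<And>t l A B. A \<in> sets (P t) \<Longrightarrow> B \<in> sets (Q (t + l)) \<Longrightarrow> prob (A \<inter> B) \<le> prob A * prob B + a l"
    using V unfolding mixing_array_def by metis
  let ?e = "exp (1 - \<eta> * s / 2 + \<eta>\<^sup>2 * T * v) + real T * ((2 * real T + 1) * a r)"
  have VM: "V t \<in> borel_measurable M" if "1 \<le> t" for t
    using measurable_from_subalg[OF sub(1) VP[OF that order_refl]] .
  have Sm [measurable]: "(\<lambda>w. \<Sum>t=1..T. V t w - expectation (V t)) \<in> borel_measurable M"
    by (intro borel_measurable_sum borel_measurable_diff VM) auto
  have up: "prob {w \<in> space M. (\<Sum>t=1..T. V t w - expectation (V t)) \<ge> s} \<le> 2 * ?e"
    by (rule sum_tail_upper[where V = V and P = P and Q = Q and b = b])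
      (use r T sub P0 VP VQ mix a bd \<eta> var in auto)
  have lo: "prob {w \<in> space M. (\<Sum>t=1..T. - V t w - expectation (\<lambda>w. - V t w)) \<ge> s} \<le> 2 * ?e"
    by (rule sum_tail_upper[where V = "\<lambda>t w. - V t w" and P = P and Q = Q and b = b])
      (use r T sub P0 VP VQ mix a bd \<eta> var in auto)
  have lo': "prob {w \<in> space M. - (\<Sum>t=1..T. V t w - expectation (V t)) \<ge> s} \<le> 2 * ?e"
    using lo by (simp add: sum_negf[symmetric] algebra_simps)
  have "prob {w \<in> space M. \<bar>\<Sum>t=1..T. V t w - expectation (V t)\<bar> \<ge> s}
    \<le> prob ({w \<in> space M. (\<Sum>t=1..T. V t w - expectation (V t)) \<ge> s}
      \<union> {w \<in> space M. - (\<Sum>t=1..T. V t w - expectation (V t)) \<ge> s})"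
  proof (rule finite_measure_mono)
    show "{w \<in> space M. (\<Sum>t=1..T. V t w - expectation (V t)) \<ge> s}
      \<union> {w \<in> space M. - (\<Sum>t=1..T. V t w - expectation (V t)) \<ge> s} \<in> sets M"
      by measurable
  qed (auto simp: abs_if split: if_splits)
  also have "\<dots> \<le> prob {w \<in> space M. (\<Sum>t=1..T. V t w - expectation (V t)) \<ge> s}
      + prob {w \<in> space M. - (\<Sum>t=1..T. V t w - expectation (V t)) \<ge> s}"
    by (rule measure_Un_le) measurable
  finally show ?thesis using up lo' by linarith
qed

text \<open>
  Both events are written as sections of sets in the product space; the second inequality is
  integrated over the sections, and the first one is applied to the section probabilities.
\<close>

lemma independent_join_mixing:
  fixes a1 a2 :: real
  assumes F1: "subalgebra M F1" and F2: "subalgebra M F2"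
    and ind: "\<And>A B. A \<in> sets F1 \<Longrightarrow> B \<in> sets F2 \<Longrightarrow> prob (A \<inter> B) = prob A * prob B"
    and A1: "subalgebra F1 A1" and B1: "subalgebra F1 B1"
    and A2: "subalgebra F2 A2" and B2: "subalgebra F2 B2"
    and mix1: "\<And>A B. A \<in> sets A1 \<Longrightarrow> B \<in> sets B1 \<Longrightarrow> prob (A \<inter> B) \<le> prob A * prob B + a1"
    and mix2: "\<And>A B. A \<in> sets A2 \<Longrightarrow> B \<in> sets B2 \<Longrightarrow> prob (A \<inter> B) \<le> prob A * prob B + a2"
    and A: "A \<in> sigma_sets (space M) (sets A1 \<union> sets A2)"
    and B: "B \<in> sigma_sets (space M) (sets B1 \<union> sets B2)"
  shows "prob (A \<inter> B) \<le> prob A * prob B + (a1 + a2)"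
proof -
  have sp: "space F1 = space M" "space F2 = space M" "space A1 = space M" "space A2 = space M"
      "space B1 = space M" "space B2 = space M"
    using F1 F2 A1 A2 B1 B2 by (auto simp: subalgebra_def)
  have sub: "sets F1 \<subseteq> sets M" "sets F2 \<subseteq> sets M" "sets A1 \<subseteq> sets F1" "sets B1 \<subseteq> sets F1"
      "sets A2 \<subseteq> sets F2" "sets B2 \<subseteq> sets F2"
    using F1 F2 A1 A2 B1 B2 by (auto simp: subalgebra_def)
  have idm: "(\<lambda>w. w) \<in> measurable G H" if "sets H \<subseteq> sets G" "space G = space H" for G H :: "'a measure"
  proof (rule measurableI)
    fix A assume "A \<in> sets H"
    then show "(\<lambda>w. w) -` A \<inter> space G \<in> sets G"
      using that sets.sets_into_space[of A H] by (simp add: Int_absorb2 subset_eq)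
  qed (use that in simp)
  define R1 R2 where "R1 = distr M F1 (\<lambda>w. w)" and "R2 = distr M F2 (\<lambda>w. w)"
  define \<Delta> :: "'a \<Rightarrow> 'a \<times> 'a" where "\<Delta> w = (w, w)" for w
  have id1: "(\<lambda>w. w) \<in> measurable M F1" and id2: "(\<lambda>w. w) \<in> measurable M F2"
    using idm sub sp by auto
  \<comment> \<open>Independence of \<open>F1\<close> and \<open>F2\<close>, read through the
    diagonal map: it carries \<open>M\<close> to the product of the two restrictions, which makes
    Fubini available.\<close>
  have prodeq: "distr M (F1 \<Otimes>\<^sub>M F2) \<Delta> = R1 \<Otimes>\<^sub>M R2"
  proof -
    have s: "sigma_sets (space M) {(\<lambda>w. w) -` A \<inter> space M |A. A \<in> sets F} = sets F" if "subalgebra M F" for F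
    proof -
      have "{(\<lambda>w. w) -` A \<inter> space M |A. A \<in> sets F} = sets F"
      proof -
        have "A \<inter> space M = A" if "A \<in> sets F" for A
          using that sets.sets_into_space[of A F] \<open>subalgebra M F\<close> by (auto simp: subalgebra_def)
        then show ?thesis by auto
      qed
      then show ?thesis using that sets.sigma_sets_eq[of F] by (simp add: subalgebra_def)
    qed
    have "indep_var F1 (\<lambda>w. w) F2 (\<lambda>w. w)"
      unfolding indep_var_eq s[OF F1] s[OF F2]
      using id1 id2 ind sub by (auto intro!: indep_setI)
    then show ?thesis unfolding indep_var_distribution_eq R1_def R2_def \<Delta>_def by simp
  qed
  have R2_prob: "prob_space R2" unfolding R2_def by (rule prob_space_distr[OF id2])
  interpret R2: prob_space R2 by (rule R2_prob)
  have R2_eq: "measure R2 C = prob C" if "C \<in> sets F2" for C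
    using that sub sets.sets_into_space[OF that] sp by (auto simp: R2_def measure_distr[OF id2] Int_absorb2)
  \<comment> \<open>Every set of the joined algebra is a diagonal preimage of a product-measurable
    set, since these preimages form a sigma-algebra containing both generators.\<close>
  have diag: "\<exists>C'\<in>sets (G1 \<Otimes>\<^sub>M G2). C = \<Delta> -` C' \<inter> space M"
    if "C \<in> sigma_sets (space M) (sets G1 \<union> sets G2)" "space G1 = space M" "space G2 = space M"
    for C and G1 G2 :: "'a measure"
  proof -
    have "C \<in> sets (vimage_algebra (space M) \<Delta> (G1 \<Otimes>\<^sub>M G2))"
    proof (rule rev_subsetD[OF that(1)], rule sets.sigma_sets_subset')
      have sub': "D \<in> sets (vimage_algebra (space M) \<Delta> (G1 \<Otimes>\<^sub>M G2))"
        if "E \<in> sets (G1 \<Otimes>\<^sub>M G2)" "D = \<Delta> -` E \<inter> space M" for D E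
        using that by (auto simp: sets_vimage_algebra)
      show "sets G1 \<union> sets G2 \<subseteq> sets (vimage_algebra (space M) \<Delta> (G1 \<Otimes>\<^sub>M G2))"
      proof safe
        fix D assume D: "D \<in> sets G1"
        show "D \<in> sets (vimage_algebra (space M) \<Delta> (G1 \<Otimes>\<^sub>M G2))"
          by (rule sub'[of "D \<times> space G2"])
            (use pair_measureI[OF D sets.top[of G2]] sets.sets_into_space[OF D] that in \<open>auto simp: \<Delta>_def\<close>)
      next
        fix D assume D: "D \<in> sets G2"
        show "D \<in> sets (vimage_algebra (space M) \<Delta> (G1 \<Otimes>\<^sub>M G2))"
          by (rule sub'[of "space G1 \<times> D"])
            (use pair_measureI[OF sets.top[of G1] D] sets.sets_into_space[OF D] that in \<open>auto simp: \<Delta>_def\<close>)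
      qed
      have "space (vimage_algebra (space M) \<Delta> (G1 \<Otimes>\<^sub>M G2)) = space M" by simp
      then show "space M \<in> sets (vimage_algebra (space M) \<Delta> (G1 \<Otimes>\<^sub>M G2))"
        by (metis sets.top)
    qed
    moreover have "\<Delta> \<in> space M \<rightarrow> space (G1 \<Otimes>\<^sub>M G2)" using that by (auto simp: \<Delta>_def space_pair_measure)
    ultimately show ?thesis by (auto simp: sets_vimage_algebra2)
  qed
  obtain A' where A': "A' \<in> sets (A1 \<Otimes>\<^sub>M A2)" "A = \<Delta> -` A' \<inter> space M"
    using diag[OF A] sp by auto
  obtain B' where B': "B' \<in> sets (B1 \<Otimes>\<^sub>M B2)" "B = \<Delta> -` B' \<inter> space M"
    using diag[OF B] sp by auto
  have prodsub: "C \<in> sets (F1 \<Otimes>\<^sub>M F2)"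
    if "C \<in> sets (G1 \<Otimes>\<^sub>M G2)" "subalgebra F1 G1" "subalgebra F2 G2" for C G1 G2
  proof -
    have "(\<lambda>z. z) \<in> measurable (F1 \<Otimes>\<^sub>M F2) (G1 \<Otimes>\<^sub>M G2)"
    proof (rule measurable_pair)
      have g: "(\<lambda>w. w) \<in> measurable F1 G1" "(\<lambda>w. w) \<in> measurable F2 G2"
        using that(2,3) by (auto intro!: idm simp: subalgebra_def)
      show "fst \<circ> (\<lambda>z. z) \<in> measurable (F1 \<Otimes>\<^sub>M F2) G1"
        using measurable_compose[OF measurable_fst g(1)] by (simp add: comp_def)
      show "snd \<circ> (\<lambda>z. z) \<in> measurable (F1 \<Otimes>\<^sub>M F2) G2"
        using measurable_compose[OF measurable_snd g(2)] by (simp add: comp_def)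
    qed
    from measurable_sets[OF this that(1)] have "C \<inter> space (F1 \<Otimes>\<^sub>M F2) \<in> sets (F1 \<Otimes>\<^sub>M F2)" by simp
    moreover have "C \<subseteq> space (F1 \<Otimes>\<^sub>M F2)"
      using sets.sets_into_space[OF that(1)] that(2,3) by (auto simp: space_pair_measure subalgebra_def)
    ultimately show ?thesis by (simp add: Int_absorb2)
  qed
  define sec where "sec C x = prob (Pair x -` C)" for C :: "('a \<times> 'a) set" and x
  have secF2: "Pair x -` C \<in> sets F2" if "C \<in> sets (F1 \<Otimes>\<^sub>M F2)" for x C
    by (rule sets_Pair1[OF that])
  \<comment> \<open>Section probabilities of a set in \<open>G1 \<Otimes>\<^sub>M G2\<close> are
    measurable for the small algebra \<open>G1\<close>, not just for \<open>F1\<close>; only this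
    makes the first mixing inequality applicable to them.\<close>
  have sec_meas: "sec C \<in> borel_measurable G1"
    if "C \<in> sets (G1 \<Otimes>\<^sub>M G2)" "subalgebra F1 G1" "subalgebra F2 G2" for C G1 G2
  proof -
    have i: "(\<lambda>w. w) \<in> measurable M G2"
      using that(3) sub sp by (intro idm) (auto simp: subalgebra_def)
    interpret S: prob_space "distr M G2 (\<lambda>w. w)" by (rule prob_space_distr[OF i])
    have "(\<lambda>x. emeasure (distr M G2 (\<lambda>w. w)) (Pair x -` C)) \<in> borel_measurable G1"
      by (rule S.measurable_emeasure_Pair) (use that in simp)
    then have "(\<lambda>x. enn2real (emeasure (distr M G2 (\<lambda>w. w)) (Pair x -` C))) \<in> borel_measurable G1"
      by measurable
    moreover have "enn2real (emeasure (distr M G2 (\<lambda>w. w)) (Pair x -` C)) = sec C x" for x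
    proof -
      have "Pair x -` C \<in> sets G2" by (rule sets_Pair1[OF that(1)])
      moreover from sets.sets_into_space[OF this] have "Pair x -` C \<subseteq> space M"
        using that(3) sp by (simp add: subalgebra_def)
      ultimately show ?thesis
        by (simp add: sec_def emeasure_distr[OF i] Int_absorb2 measure_def)
    qed
    ultimately show ?thesis by simp
  qed
  have FF: "subalgebra F1 F1" "subalgebra F2 F2" by (auto simp: subalgebra_def)
  have Fub: "prob (\<Delta> -` C \<inter> space M) = expectation (sec C)" if C: "C \<in> sets (F1 \<Otimes>\<^sub>M F2)" for C
  proof -
    have \<Delta>m: "\<Delta> \<in> measurable M (F1 \<Otimes>\<^sub>M F2)" unfolding \<Delta>_def using id1 id2 by (rule measurable_Pair)
    have sm: "sec C \<in> borel_measurable F1" by (rule sec_meas[OF C FF])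
    have "emeasure M (\<Delta> -` C \<inter> space M) = emeasure (R1 \<Otimes>\<^sub>M R2) C"
      using C by (simp add: prodeq[symmetric] emeasure_distr[OF \<Delta>m])
    also have "\<dots> = (\<integral>\<^sup>+x. emeasure R2 (Pair x -` C) \<partial>R1)"
      by (rule R2.emeasure_pair_measure_alt) (use C in \<open>simp add: R1_def R2_def\<close>)
    also have "\<dots> = (\<integral>\<^sup>+x. ennreal (sec C x) \<partial>R1)"
      using R2_eq[OF secF2[OF C]] by (simp add: sec_def R2.emeasure_eq_measure)
    also have "\<dots> = (\<integral>\<^sup>+x. ennreal (sec C x) \<partial>M)"
      unfolding R1_def by (rule nn_integral_distr[OF id1]) (use sm in measurable)
    also have "\<dots> = ennreal (expectation (sec C))"
    proof (rule nn_integral_eq_integral)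
      show "integrable M (sec C)"
      proof (rule integrable_const_bound[where B=1])
        show "AE x in M. norm (sec C x) \<le> 1" by (rule AE_I2) (simp add: sec_def)
        show "sec C \<in> borel_measurable M" by (rule measurable_from_subalg[OF F1 sm])
      qed
    qed (simp add: sec_def)
    finally show ?thesis by (simp add: emeasure_eq_measure sec_def integral_nonneg)
  qed
  have A'F: "A' \<in> sets (F1 \<Otimes>\<^sub>M F2)" and B'F: "B' \<in> sets (F1 \<Otimes>\<^sub>M F2)"
    by (rule prodsub[OF A'(1) A1 A2], rule prodsub[OF B'(1) B1 B2])
  have mA: "sec A' \<in> borel_measurable A1" and mB: "sec B' \<in> borel_measurable B1"
    by (rule sec_meas[OF A'(1) A1 A2], rule sec_meas[OF B'(1) B1 B2])
  have MA1: "subalgebra M A1" and MB1: "subalgebra M B1" using sub sp by (auto simp: subalgebra_def)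
  have mAM: "sec A' \<in> borel_measurable M" and mBM: "sec B' \<in> borel_measurable M"
    by (rule measurable_from_subalg[OF MA1 mA], rule measurable_from_subalg[OF MB1 mB])
  have s01: "0 \<le> sec C x" "sec C x \<le> 1" for C x by (auto simp: sec_def)
  have iB: "integrable M (sec B')"
    by (rule integrable_const_bound[where B=1]) (use s01 mBM in \<open>auto intro!: AE_I2\<close>)
  have iAB: "integrable M (\<lambda>x. sec A' x * sec B' x)"
    by (rule integrable_const_bound[where B=1]) (use s01 mBM mAM in \<open>auto intro!: AE_I2 mult_le_one\<close>)
  have "prob (A \<inter> B) = expectation (sec (A' \<inter> B'))"
    using Fub[of "A' \<inter> B'"] A'F B'F by (simp add: A'(2) B'(2) Int_ac vimage_Int)
  also have "\<dots> \<le> expectation (\<lambda>x. sec A' x * sec B' x + a2)"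
  proof (rule integral_mono)
    show "integrable M (sec (A' \<inter> B'))"
    proof (rule integrable_const_bound[where B=1])
      show "AE x in M. norm (sec (A' \<inter> B') x) \<le> 1" by (rule AE_I2) (simp add: s01)
      show "sec (A' \<inter> B') \<in> borel_measurable M"
        by (rule measurable_from_subalg[OF F1 sec_meas[OF sets.Int[OF A'F B'F] FF]])
    qed
    show "integrable M (\<lambda>x. sec A' x * sec B' x + a2)" using iAB by simp
    fix x
    show "sec (A' \<inter> B') x \<le> sec A' x * sec B' x + a2"
      unfolding sec_def vimage_Int by (rule mix2[OF sets_Pair1[OF A'(1)] sets_Pair1[OF B'(1)]])
  qed
  also have "\<dots> = expectation (\<lambda>x. sec A' x * sec B' x) + a2" using iAB by (simp add: prob_space)
  \<comment> \<open>The passage from events to weights is used twice, once for each factor, so that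
    the first mixing inequality applies to a product of two weights.\<close>
  also have "expectation (\<lambda>x. sec A' x * sec B' x) \<le> expectation (sec A') * expectation (sec B') + a1"
  proof (rule expectation_mult_le_of_indicator[OF MA1 iB _ mA s01])
    fix C assume C: "C \<in> sets A1"
    then have CM: "C \<in> sets M" using MA1 by (auto simp: subalgebra_def)
    have "expectation (\<lambda>w. sec B' w * indicator C w) \<le> expectation (sec B') * prob C + a1"
    proof (rule expectation_indicator_le_of_mixing[OF MB1 CM _ mB s01])
      fix D assume "D \<in> sets B1"
      then show "prob (D \<inter> C) \<le> prob D * prob C + a1" using mix1[OF C, of D] by (simp add: Int_commute mult.commute)
    qed
    then show "expectation (\<lambda>w. indicator C w * sec B' w) \<le> prob C * expectation (sec B') + a1"
      by (simp add: mult.commute)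
  qed
  also have "expectation (sec A') * expectation (sec B') = prob A * prob B"
    using Fub[OF A'F] Fub[OF B'F] A'(2) B'(2) by simp
  finally show ?thesis by simp
qed

section \<open>Events generated by a process, and mixing of a function of two processes\<close>

lemma events_of_subset_Pow: "events_of M N Z S \<subseteq> Pow (space M)"
  unfolding events_of_def
  using sigma_sets_into_sp[of "(\<Union>t\<in>S. {Z t -` A \<inter> space M |A. A \<in> sets N})" "space M"]
  by blast

lemma sigma_sets_events_of: "sigma_sets (space M) (events_of M N Z S) = events_of M N Z S"
  unfolding events_of_def by (rule sigma_sets_sigma_sets_eq) auto

lemma sets_sigma_events_of: "sets (sigma (space M) (events_of M N Z S)) = events_of M N Z S"
  by (simp add: sets_measure_of[OF events_of_subset_Pow] sigma_sets_events_of)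

text \<open>Independence is stated for whole paths and mixing for the events of a set of times. This
  inclusion connects them: an event of \<open>Z t\<close> is the preimage of a cylinder under the
  path map.\<close>

lemma events_of_subset_paths:
  assumes "(\<lambda>w. \<lambda>t\<in>I. Z t w) \<in> measurable M (PiM I (\<lambda>_. N))" "S \<subseteq> I"
  shows "events_of M N Z S \<subseteq> sets (vimage_algebra (space M) (\<lambda>w. \<lambda>t\<in>I. Z t w) (PiM I (\<lambda>_. N)))"
    (is "_ \<subseteq> sets ?F")
  unfolding events_of_def
proof (rule sets.sigma_sets_subset')
  show "space M \<in> sets ?F" using sets.top[of ?F] by simp
  show "(\<Union>t\<in>S. {Z t -` A \<inter> space M |A. A \<in> sets N}) \<subseteq> sets ?F"
  proof safe
    fix t A assume t: "t \<in> S" and A: "A \<in> sets N"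
    then have tI: "t \<in> I" using assms by auto
    have c: "(\<lambda>p. p t) -` A \<inter> space (PiM I (\<lambda>_. N)) \<in> sets (PiM I (\<lambda>_. N))"
      by (rule measurable_sets[OF measurable_component_singleton[OF tI] A])
    have "Z t -` A \<inter> space M
        = (\<lambda>w. \<lambda>t\<in>I. Z t w) -` ((\<lambda>p. p t) -` A \<inter> space (PiM I (\<lambda>_. N))) \<inter> space M"
      using measurable_space[OF assms(1)] tI by auto
    then show "Z t -` A \<inter> space M \<in> sets ?F" using in_vimage_algebra[OF c] by simp
  qed
qed

text \<open>Past and future of the pair are the joins of the two pasts and of the two futures, so
  one coefficient is paid for each process; hence the factor 2.\<close>

lemma independent_processes_mixing_array:
  fixes Z1 Z2 :: "nat \<Rightarrow> 'a \<Rightarrow> 'b" and a :: "nat \<Rightarrow> real"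
  assumes ind: "indep_var (PiM {1..} (\<lambda>_. N)) (\<lambda>w. \<lambda>t\<in>{1..}. Z1 t w)
      (PiM {1..} (\<lambda>_. N)) (\<lambda>w. \<lambda>t\<in>{1..}. Z2 t w)"
    and mix1: "\<And>t l A B. 1 \<le> t \<Longrightarrow> A \<in> events_of M N Z1 {1..t} \<Longrightarrow> B \<in> events_of M N Z1 {t + l..} \<Longrightarrow>
      prob (A \<inter> B) \<le> prob A * prob B + a l"
    and mix2: "\<And>t l A B. 1 \<le> t \<Longrightarrow> A \<in> events_of M N Z2 {1..t} \<Longrightarrow> B \<in> events_of M N Z2 {t + l..} \<Longrightarrow>
      prob (A \<inter> B) \<le> prob A * prob B + a l"
    and a: "\<And>l. 0 \<le> a l"
    and v: "\<And>t. 1 \<le> t \<Longrightarrow> v t \<in> borel_measurable (N \<Otimes>\<^sub>M N)"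
    and V: "\<And>t w. 1 \<le> t \<Longrightarrow> w \<in> space M \<Longrightarrow> V t w = v t (Z1 t w, Z2 t w)"
  shows "mixing_array M V (\<lambda>l. 2 * a l)"
proof -
  define path where "path Z = (\<lambda>w. \<lambda>t\<in>{1::nat..}. Z t w)" for Z :: "nat \<Rightarrow> 'a \<Rightarrow> 'b"
  define F where "F Z = vimage_algebra (space M) (path Z) (PiM {1..} (\<lambda>_. N))" for Z
  define J where "J S = sigma (space M) (events_of M N Z1 S \<union> events_of M N Z2 S)" for S
  have pm: "path Z1 \<in> measurable M (PiM {1..} (\<lambda>_. N))" "path Z2 \<in> measurable M (PiM {1..} (\<lambda>_. N))"
    using ind unfolding indep_var_eq path_def by auto
  have FM: "subalgebra M (F Z)" if "path Z \<in> measurable M (PiM {1..} (\<lambda>_. N))" for Z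
  proof -
    have "sets (F Z) \<subseteq> sets M"
      unfolding F_def sets_vimage_algebra
      by (rule sets.sigma_sets_subset) (use measurable_sets[OF that] in auto)
    then show ?thesis by (simp add: subalgebra_def F_def)
  qed
  have indF: "prob (A \<inter> B) = prob A * prob B" if "A \<in> sets (F Z1)" "B \<in> sets (F Z2)" for A B
    using ind that unfolding indep_var_eq F_def path_def sets_vimage_algebra
    by (auto intro: indep_setD)
  have evF: "events_of M N Z S \<subseteq> sets (F Z)" if "path Z \<in> measurable M (PiM {1..} (\<lambda>_. N))" "S \<subseteq> {1..}" for Z S
    using events_of_subset_paths[OF that[unfolded path_def]] by (simp add: F_def path_def)
  have Jsets: "sets (J S) = sigma_sets (space M) (events_of M N Z1 S \<union> events_of M N Z2 S)" for S
    unfolding J_def by (rule sets_measure_of) (use events_of_subset_Pow in blast)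
  have Jspace: "space (J S) = space M" for S
    unfolding J_def by (rule space_measure_of) (use events_of_subset_Pow in blast)
  have JM: "subalgebra M (J S)" if "S \<subseteq> {1..}" for S
  proof -
    have "events_of M N Z1 S \<union> events_of M N Z2 S \<subseteq> sets M"
      using evF[OF pm(1) that] evF[OF pm(2) that] FM[OF pm(1)] FM[OF pm(2)] by (auto simp: subalgebra_def)
    then show ?thesis unfolding subalgebra_def Jspace Jsets by (simp add: sets.sigma_sets_subset)
  qed
  have VJ: "V t \<in> borel_measurable (J S)" if "t \<in> S" "S \<subseteq> {1..}" for t S
  proof -
    have t: "1 \<le> t" using that by auto
    have Zsp: "Z t w \<in> space N" if "path Z \<in> measurable M (PiM {1..} (\<lambda>_. N))" "w \<in> space M" for Z w
    proof -
      have "path Z w \<in> PiE {1..} (\<lambda>_. space N)" using measurable_space[OF that] by (simp add: space_PiM)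
      from PiE_mem[OF this, of t] show ?thesis using t by (simp add: path_def)
    qed
    have zm: "Z t \<in> measurable (J S) N"
      if "events_of M N Z S \<subseteq> sets (J S)" "path Z \<in> measurable M (PiM {1..} (\<lambda>_. N))" for Z
    proof (rule measurableI)
      show "Z t w \<in> space N" if "w \<in> space (J S)" for w
        using that Jspace Zsp \<open>path Z \<in> _\<close> by auto
      show "Z t -` A \<inter> space (J S) \<in> sets (J S)" if "A \<in> sets N" for A
      proof -
        have "Z t -` A \<inter> space M \<in> events_of M N Z S"
          unfolding events_of_def using that \<open>t \<in> S\<close> by (intro sigma_sets.Basic) auto
        then show ?thesis using \<open>events_of M N Z S \<subseteq> _\<close> by (auto simp: Jspace)
      qed
    qed
    have "(\<lambda>w. (Z1 t w, Z2 t w)) \<in> measurable (J S) (N \<Otimes>\<^sub>M N)"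
      by (intro measurable_Pair zm pm) (auto simp: Jsets intro: sigma_sets.Basic)
    from measurable_compose[OF this v[OF t]] show ?thesis
      by (rule measurable_cong[THEN iffD1, rotated]) (use V[OF t] in \<open>simp add: Jspace\<close>)
  qed
  show ?thesis unfolding mixing_array_def
  \<comment> \<open>Paths start at time 1, so the future from time 0 has to be the future from 1,
    which \<open>max 1 t\<close> achieves. The past at time 0 is generated by no variable and is
    trivial.\<close>
  proof (rule exI[of _ "\<lambda>t. J {1..t}"], rule exI[of _ "\<lambda>t. J {max 1 t..}"], intro conjI allI impI ballI)
    show "subalgebra M (J {1..t})" "subalgebra M (J {max 1 t..})" for t by (auto intro!: JM)
    have "sigma_sets (space M) ({{}, space M} \<union> {{}, space M}) = {{}, space M}"
      unfolding Un_absorb by (rule sigma_algebra.sigma_sets_eq[OF sigma_algebra_trivial])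
    then show P0: "sets (J {1..0}) = {{}, space M}"
      unfolding Jsets events_of_def by (simp add: sigma_sets_empty_eq)
    show "V t \<in> borel_measurable (J {1..u})" if "1 \<le> t" "t \<le> u" for t u
      by (rule VJ) (use that in auto)
    show "V t \<in> borel_measurable (J {max 1 u..})" if "1 \<le> u" "u \<le> t" for t u
      by (rule VJ) (use that in auto)
    fix t l A B assume A: "A \<in> sets (J {1..t})" and B: "B \<in> sets (J {max 1 (t + l)..})"
    show "prob (A \<inter> B) \<le> prob A * prob B + 2 * a l"
    proof (cases "t = 0")
      case True
      then have "A = {} \<or> A = space M" using A P0 by auto
      moreover have "B \<in> sets M" using B JM[of "{max 1 (t + l)..}"] by (auto simp: subalgebra_def)
      ultimately show ?thesis using a[of l] sets.sets_into_space[of B M]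
        by (auto simp: prob_space Int_absorb1)
    next
      case False
      let ?al = "\<lambda>Z S. sigma (space M) (events_of M N Z S)"
      have al: "subalgebra (F Z) (?al Z S)" if "path Z \<in> measurable M (PiM {1..} (\<lambda>_. N))" "S \<subseteq> {1..}" for Z S
        using evF[OF that] unfolding subalgebra_def sets_sigma_events_of
        by (simp add: F_def space_measure_of[OF events_of_subset_Pow])
      have tl: "max 1 (t + l) = t + l" using False by simp
      have "prob (A \<inter> B) \<le> prob A * prob B + (a l + a l)"
      proof (rule independent_join_mixing[OF FM[OF pm(1)] FM[OF pm(2)] indF])
        show "subalgebra (F Z1) (?al Z1 {1..t})" "subalgebra (F Z1) (?al Z1 {t + l..})"
          "subalgebra (F Z2) (?al Z2 {1..t})" "subalgebra (F Z2) (?al Z2 {t + l..})"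
          using False by (auto intro!: al pm)
        show "prob (A \<inter> B) \<le> prob A * prob B + a l"
          if "A \<in> sets (?al Z1 {1..t})" "B \<in> sets (?al Z1 {t + l..})" for A B
          using that False by (intro mix1[of t]) (simp_all only: sets_sigma_events_of)
        show "prob (A \<inter> B) \<le> prob A * prob B + a l"
          if "A \<in> sets (?al Z2 {1..t})" "B \<in> sets (?al Z2 {t + l..})" for A B
          using that False by (intro mix2[of t]) (simp_all only: sets_sigma_events_of)
        show "A \<in> sigma_sets (space M) (sets (?al Z1 {1..t}) \<union> sets (?al Z2 {1..t}))"
          using A by (simp only: sets_sigma_events_of Jsets)
        show "B \<in> sigma_sets (space M) (sets (?al Z1 {t + l..}) \<union> sets (?al Z2 {t + l..}))"
          using B tl by (simp only: sets_sigma_events_of Jsets)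
      qed
      then show ?thesis by simp
    qed
  qed
qed

end

section \<open>Concentration of kernel sums\<close>

lemma card_window_le: "card {t \<in> {1..T}. \<bar>int t - int u\<bar> < int k} \<le> 2 * k"
proof -
  have "{t \<in> {1..T}. \<bar>int t - int u\<bar> < int k} \<subseteq> {u + 1 - k..<u + k}" by auto
  then have "card {t \<in> {1..T}. \<bar>int t - int u\<bar> < int k} \<le> card {u + 1 - k..<u + k}"
    by (rule card_mono[rotated]) simp
  then show ?thesis by simp
qed

text \<open>The block length is about \<open>T powr e\<close>: long enough to make mixing
  exponentially small in a power of \<open>T\<close>, short enough for \<open>e \<le> b\<close> to
  keep \<open>r * h\<close> bounded. In the constant \<open>C1\<close>, the at most
  \<open>2 * ls\<close> near times contribute \<open>C0 * h\<close> each, and the at most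
  \<open>2 * r\<close> remaining ones contribute \<open>C0 * h\<^sup>2\<close> each, where
  \<open>r * h \<le> 2 * A\<close>.\<close>

lemma (in prob_space) concentration_bound:
  fixes V :: "nat \<Rightarrow> 'a \<Rightarrow> real" and C0 C1 Cm \<rho> h A b D p \<eta> e :: real
  assumes T: "3 \<le> T" and h: "0 < h" "h \<le> A * real T powr - b" and C: "0 \<le> C0" "0 \<le> Cm" "0 < A"
    and \<rho>: "0 < \<rho>" "\<rho> < 1"
    and e: "e \<le> b" "2 * C0 * (sqrt (ln T) * (T powr e * T powr - \<eta>)) \<le> 1"
    and V: "mixing_array M V (\<lambda>l. Cm * \<rho> ^ l)"
    and bd: "\<And>t w. t \<in> {1..T} \<Longrightarrow> w \<in> space M \<Longrightarrow> \<bar>V t w\<bar> \<le> C0 * (sqrt (T * h) * T powr - \<eta>)"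
    and v1: "\<And>t. t \<in> {1..T} \<Longrightarrow> expectation (\<lambda>w. (V t w)\<^sup>2) \<le> C0 * h"
    and v2: "\<And>s t. s \<in> {1..T} \<Longrightarrow> t \<in> {1..T} \<Longrightarrow> \<bar>int s - int t\<bar> \<ge> int ls \<Longrightarrow>
       expectation (\<lambda>w. \<bar>V s w * V t w\<bar>) \<le> C0 * h\<^sup>2"
    and Vm: "\<And>t. t \<in> {1..T} \<Longrightarrow> V t \<in> borel_measurable M"
    and C1: "C1 = C0 * (2 * ls + 4 * A)" and e0: "0 < e"
  shows "prob {w \<in> space M. \<bar>\<Sum>t=1..T. V t w - expectation (V t)\<bar> \<ge> D * sqrt (T * h * ln T)}
    \<le> 4 * (exp 1 * T powr (C1 - D / 2) + real T * ((2 * real T + 1) * (Cm * \<rho> powr (T powr e))))"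
proof -
  have T1: "1 \<le> T" and T0: "real T > 0" using T by auto
  have lnT: "0 < ln T" using T by simp
  define r where "r = nat \<lceil>T powr e\<rceil>"
  have Te: "1 \<le> T powr e" using T e0 by (intro ge_one_powr_ge_zero) auto
  have r: "1 \<le> r" "T powr e \<le> r" "r \<le> 2 * T powr e"
    using Te unfolding r_def by linarith+
  have rh: "r * h \<le> 2 * A"
  proof -
    have "r * h \<le> (2 * T powr e) * (A * T powr - b)" using r h by (intro mult_mono) auto
    also have "\<dots> = 2 * A * T powr (e - b)" by (simp add: powr_diff powr_minus field_simps)
    also have "\<dots> \<le> 2 * A * T powr 0" using T e C by (intro mult_left_mono powr_mono) auto
    finally show ?thesis using T0 by simp
  qed
  \<comment> \<open>This choice makes both terms of the exponent multiples of \<open>ln T\<close>: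
    \<open>\<eta>'\<^sup>2 * T * h = ln T\<close>, and \<open>\<eta>'\<close> times the threshold is
    \<open>D * ln T\<close>.\<close>
  define \<eta>' where "\<eta>' = sqrt (ln T / (T * h))"
  have \<eta>'0: "0 < \<eta>'" using lnT T0 h by (simp add: \<eta>'_def)
  have Th: "0 < sqrt (T * h)" using T0 h by simp
  have iVV: "integrable M (\<lambda>w. V s w * V t w)" and iVV2: "integrable M (\<lambda>w. (V t w)\<^sup>2)"
    if "s \<in> {1..T}" "t \<in> {1..T}" for s t
  proof -
    let ?b = "C0 * (sqrt (T * h) * T powr - \<eta>)"
    have *: "integrable M (\<lambda>w. V s w * V t w)" if "s \<in> {1..T}" "t \<in> {1..T}" for s t
    proof (rule integrable_const_bound[where B = "?b * ?b"])
      show "AE w in M. norm (V s w * V t w) \<le> ?b * ?b"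
      proof (rule AE_I2)
        fix w assume w: "w \<in> space M"
        show "norm (V s w * V t w) \<le> ?b * ?b"
          unfolding real_norm_def abs_mult
          by (intro mult_mono bd that w) (use order_trans[OF abs_ge_zero bd[OF that(1) w]] in auto)
      qed
    qed (use Vm that in auto)
    from *[OF that] *[OF that(2) that(2)]
    show "integrable M (\<lambda>w. V s w * V t w)" "integrable M (\<lambda>w. (V t w)\<^sup>2)" by (auto simp: power2_eq_square)
  qed
  have near: "expectation (\<lambda>w. \<bar>V s w * V t w\<bar>) \<le> C0 * h" if "s \<in> {1..T}" "t \<in> {1..T}" for s t
  proof -
    have "expectation (\<lambda>w. \<bar>V s w * V t w\<bar>) \<le> expectation (\<lambda>w. ((V s w)\<^sup>2 + (V t w)\<^sup>2) / 2)"
    proof (rule integral_mono)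
      fix w
      show "\<bar>V s w * V t w\<bar> \<le> ((V s w)\<^sup>2 + (V t w)\<^sup>2) / 2" by (rule abs_mult_le_half_squares)
    qed (use iVV iVV2 that in auto)
    also have "\<dots> = (expectation (\<lambda>w. (V s w)\<^sup>2) + expectation (\<lambda>w. (V t w)\<^sup>2)) / 2"
      using iVV2 that by simp
    also have "\<dots> \<le> C0 * h" using v1[OF that(1)] v1[OF that(2)] by simp
    finally show ?thesis .
  qed
  have var: "(\<Sum>t | t \<in> {1..T} \<and> \<bar>int t - int u\<bar> < int r. expectation (\<lambda>w. \<bar>V u w * V t w\<bar>)) \<le> C1 * h"
    if u: "u \<in> {1..T}" for u
  proof -
    have "(\<Sum>t | t \<in> {1..T} \<and> \<bar>int t - int u\<bar> < int r. expectation (\<lambda>w. \<bar>V u w * V t w\<bar>))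
       \<le> (\<Sum>t | t \<in> {1..T} \<and> \<bar>int t - int u\<bar> < int r. (if \<bar>int t - int u\<bar> < int ls then C0 * h else 0) + C0 * h\<^sup>2)"
    proof (rule sum_mono)
      fix t assume t: "t \<in> {t. t \<in> {1..T} \<and> \<bar>int t - int u\<bar> < int r}"
      have "0 \<le> C0 * h\<^sup>2" using C by simp
      then show "expectation (\<lambda>w. \<bar>V u w * V t w\<bar>) \<le> (if \<bar>int t - int u\<bar> < int ls then C0 * h else 0) + C0 * h\<^sup>2"
        using near[OF u, of t] v2[OF u, of t] t by (auto simp: abs_minus_commute)
    qed
    also have "\<dots> \<le> (\<Sum>t | t \<in> {1..T}. (if \<bar>int t - int u\<bar> < int ls then C0 * h else 0))
        + (\<Sum>t | t \<in> {1..T} \<and> \<bar>int t - int u\<bar> < int r. C0 * h\<^sup>2)"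
      unfolding sum.distrib by (intro add_mono sum_mono2) (use C h in auto)
    also have "(\<Sum>t | t \<in> {1..T}. (if \<bar>int t - int u\<bar> < int ls then C0 * h else 0))
        = (\<Sum>t | t \<in> {1..T} \<and> \<bar>int t - int u\<bar> < int ls. C0 * h)"
      by (subst sum.inter_filter[symmetric]) auto
    also have "\<dots> = card {t \<in> {1..T}. \<bar>int t - int u\<bar> < int ls} * (C0 * h)" by simp
    also have "\<dots> \<le> (2 * ls) * (C0 * h)"
      using card_window_le[of T u ls] C h by (intro mult_right_mono) auto
    also have "(\<Sum>t | t \<in> {1..T} \<and> \<bar>int t - int u\<bar> < int r. C0 * h\<^sup>2)
        = card {t \<in> {1..T}. \<bar>int t - int u\<bar> < int r} * (C0 * h\<^sup>2)" by simp
    also have "\<dots> \<le> (2 * r) * (C0 * h\<^sup>2)"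
      using card_window_le[of T u r] C h by (intro mult_right_mono) auto
    also have "(2 * r) * (C0 * h\<^sup>2) = 2 * C0 * h * (r * h)" by (simp add: power2_eq_square)
    also have "\<dots> \<le> 2 * C0 * h * (2 * A)" using rh C h by (intro mult_left_mono) auto
    finally show ?thesis by (simp add: C1 algebra_simps)
  qed
  \<comment> \<open>A block sum must stay below 1 after scaling. The factor
    \<open>sqrt (T * h)\<close> cancels against \<open>\<eta>'\<close>, and what remains is paid for
    by the spare power \<open>T powr - \<eta>\<close>.\<close>
  have lam: "\<eta>' * real r * (C0 * (sqrt (T * h) * T powr - \<eta>)) \<le> 1"
  proof -
    have "\<eta>' * sqrt (T * h) = sqrt (ln T)" using Th T0 h lnT by (simp add: \<eta>'_def real_sqrt_divide)
    then have "\<eta>' * real r * (C0 * (sqrt (T * h) * T powr - \<eta>)) = (C0 * sqrt (ln T) * T powr - \<eta>) * real r"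
      by (metis (no_types, opaque_lifting) mult.assoc mult.commute)
    also have "\<dots> \<le> (C0 * sqrt (ln T) * T powr - \<eta>) * (2 * T powr e)"
      using r C lnT by (intro mult_left_mono) auto
    also have "\<dots> \<le> 1" using e(2) by (simp add: mult_ac)
    finally show ?thesis .
  qed
  have "prob {w \<in> space M. \<bar>\<Sum>t=1..T. V t w - expectation (V t)\<bar> \<ge> D * sqrt (T * h * ln T)}
    \<le> 4 * (exp (1 - \<eta>' * (D * sqrt (T * h * ln T)) / 2 + \<eta>'\<^sup>2 * T * (C1 * h))
        + real T * ((2 * real T + 1) * (Cm * \<rho> ^ r)))"
    by (rule sum_tail[OF r(1) T1 V _ bd \<eta>'0 lam var]) (use C \<rho> in auto)
  also have "\<eta>' * (D * sqrt (T * h * ln T)) / 2 = D / 2 * ln T"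
  proof -
    have "\<eta>' * sqrt (T * h * ln T) = sqrt ((ln T / (T * h)) * (T * h * ln T))"
      unfolding \<eta>'_def by (rule real_sqrt_mult[symmetric])
    also have "(ln T / (T * h)) * (T * h * ln T) = ln T * ln T" using T0 h by simp
    finally have "\<eta>' * sqrt (T * h * ln T) = ln T"
      using lnT by (simp only: real_sqrt_abs2 abs_of_pos)
    then have "D / 2 * (\<eta>' * sqrt (T * h * ln T)) = D / 2 * ln T" by (simp only:)
    then show ?thesis by (simp only: mult_ac times_divide_eq_left times_divide_eq_right)
  qed
  also have "\<eta>'\<^sup>2 * T * (C1 * h) = C1 * ln T" using T0 h lnT by (simp add: \<eta>'_def)
  also have "exp (1 - D / 2 * ln T + C1 * ln T) = exp 1 * T powr (C1 - D / 2)"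
    using T0 by (simp add: powr_def algebra_simps flip: exp_add)
  also have "\<rho> ^ r \<le> \<rho> powr (T powr e)"
    using r(2) \<rho> by (simp add: powr_realpow[symmetric] powr_mono_both' powr_mono')
  finally show ?thesis using C T0 by (auto simp: mult_left_mono)
qed

text \<open>A property of \<open>T\<close> and of constants alone, so that one threshold for
  \<open>T\<close> serves all probability spaces, bandwidths and arrays at once; the later union
  bound depends on this. The first argument only fixes the type of sample points.\<close>

abbreviation concentrated :: "'a itself \<Rightarrow> real \<Rightarrow> real \<Rightarrow> real \<Rightarrow> real \<Rightarrow> real \<Rightarrow> real \<Rightarrow> nat \<Rightarrow> real \<Rightarrow> real \<Rightarrow> nat \<Rightarrow> bool" where
  "concentrated _ A b \<eta> C0 Cm \<rho> ls p D T \<equiv> \<forall>(h::real) (M :: 'a measure) V.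
    prob_space M \<longrightarrow> 0 < h \<longrightarrow> h \<le> A * real T powr - b \<longrightarrow> mixing_array M V (\<lambda>l. Cm * \<rho> ^ l) \<longrightarrow>
    (\<forall>t\<in>{1..T}. V t \<in> borel_measurable M) \<longrightarrow>
    (\<forall>t\<in>{1..T}. \<forall>w\<in>space M. \<bar>V t w\<bar> \<le> C0 * (sqrt (T * h) * T powr -\<eta>)) \<longrightarrow>
    (\<forall>t\<in>{1..T}. (\<integral>w. (V t w)\<^sup>2 \<partial>M) \<le> C0 * h) \<longrightarrow>
    (\<forall>s\<in>{1..T}. \<forall>t\<in>{1..T}. \<bar>int s - int t\<bar> \<ge> int ls \<longrightarrow> (\<integral>w. \<bar>V s w * V t w\<bar> \<partial>M) \<le> C0 * h\<^sup>2) \<longrightarrow>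
    measure M {w \<in> space M. \<bar>\<Sum>t=1..T. V t w - (\<integral>w. V t w \<partial>M)\<bar> \<ge> D * sqrt (T * h * ln T)} \<le> T powr - p"

text \<open>Any polynomial rate \<open>p\<close> is reached by enlarging \<open>D\<close>, because
  the exponential term is \<open>T powr (C1 - D / 2)\<close> and the mixing term decays faster than
  every power of \<open>T\<close>.\<close>

lemma concentration:
  fixes A b \<eta> C0 Cm \<rho> p :: real and ls :: nat
  assumes pos: "0 < A" "0 < b" "0 < \<eta>" "0 \<le> C0" "0 \<le> Cm" "0 < \<rho>" "\<rho> < 1"
  shows "\<exists>D\<ge>0. \<forall>\<^sub>F T in sequentially. concentrated TYPE('a) A b \<eta> C0 Cm \<rho> ls p D T"
proof -
  define C1 where "C1 = C0 * (2 * ls + 4 * A)"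
  \<comment> \<open>\<open>C1 - D / 2 = - \<bar>p\<bar> - 1\<close> leaves one power of
    \<open>T\<close> to absorb constants. In \<open>e\<close>, the bound by \<open>b\<close> keeps
    \<open>r * h\<close> bounded, and the bound by \<open>\<eta> / 2\<close> makes the size
    condition vanish even after multiplication by \<open>sqrt (ln T)\<close>.\<close>
  define D where "D = 2 * (C1 + \<bar>p\<bar> + 1)"
  define e where "e = min b (\<eta> / 2)"
  define c where "c = - ln \<rho>"
  have c: "0 < c" using pos by (simp add: c_def)
  have e: "0 < e" "e \<le> b" "e \<le> \<eta> / 2" using pos by (auto simp: e_def)
  have D0: "0 \<le> D" using pos by (auto simp: D_def C1_def)
  have "(\<lambda>T::nat. sqrt (ln T) * (T powr e * T powr - \<eta>)) \<longlonglongrightarrow> 0"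
    using e pos by real_asymp
  then have "(\<lambda>T::nat. 2 * C0 * (sqrt (ln T) * (T powr e * T powr - \<eta>))) \<longlonglongrightarrow> 2 * C0 * 0"
    by (intro tendsto_intros)
  then have ev1: "\<forall>\<^sub>F T in sequentially. 2 * C0 * (sqrt (ln (real T)) * (T powr e * T powr - \<eta>)) \<le> 1"
    by (intro eventually_mono[OF order_tendstoD(2)[where a = 1]]) auto
  have "(\<lambda>T::nat. real T powr p * (real T * ((2 * real T + 1) * exp (- c * T powr e)))) \<longlonglongrightarrow> 0"
    using c e by real_asymp
  then have "(\<lambda>T::nat. 4 * Cm * (real T powr p * (real T * ((2 * real T + 1) * exp (- c * T powr e))))) \<longlonglongrightarrow> 4 * Cm * 0"
    by (intro tendsto_intros)
  then have ev2: "\<forall>\<^sub>F T in sequentially. 4 * Cm * (real T powr p * (real T * ((2 * real T + 1) * exp (- c * T powr e)))) \<le> 1 / 2"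
    by (intro eventually_mono[OF order_tendstoD(2)[where a = "1/2"]]) auto
  have ev3: "\<forall>\<^sub>F T::nat in sequentially. 4 * exp 1 * T powr - 1 \<le> 1 / 2"
    by real_asymp
  show ?thesis
  proof (intro exI[of _ D] conjI D0)
    show "\<forall>\<^sub>F T in sequentially. concentrated TYPE('a) A b \<eta> C0 Cm \<rho> ls p D T"
      using ev1 ev2 ev3 eventually_ge_at_top[of 3]
    proof eventually_elim
      case (elim T)
      show ?case
      proof (intro allI impI)
        fix h :: real and M :: "'a measure" and V
        assume M: "prob_space M" and asm: "0 < h" "h \<le> A * real T powr - b" "mixing_array M V (\<lambda>l. Cm * \<rho> ^ l)"
          "\<forall>t\<in>{1..T}. V t \<in> borel_measurable M"
          "\<forall>t\<in>{1..T}. \<forall>w\<in>space M. \<bar>V t w\<bar> \<le> C0 * (sqrt (T * h) * T powr - \<eta>)"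
          "\<forall>t\<in>{1..T}. (\<integral>w. (V t w)\<^sup>2 \<partial>M) \<le> C0 * h"
          "\<forall>s\<in>{1..T}. \<forall>t\<in>{1..T}. \<bar>int s - int t\<bar> \<ge> int ls \<longrightarrow> (\<integral>w. \<bar>V s w * V t w\<bar> \<partial>M) \<le> C0 * h\<^sup>2"
        interpret prob_space M by (rule M)
        have T0: "real T > 0" using elim by simp
        have "prob {w \<in> space M. \<bar>\<Sum>t=1..T. V t w - expectation (V t)\<bar> \<ge> D * sqrt (T * h * ln T)}
          \<le> 4 * (exp 1 * T powr (C1 - D / 2) + real T * ((2 * real T + 1) * (Cm * \<rho> powr (T powr e))))"
          by (rule concentration_bound[where A = A and b = b and ?C0.0 = C0 and \<eta> = \<eta> and ls = ls])
            (use asm elim e pos in \<open>auto simp: C1_def\<close>)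
        also have "\<rho> powr (T powr e) = exp (- c * T powr e)" using pos by (simp add: powr_def c_def)
        also have "4 * (exp 1 * T powr (C1 - D / 2) + real T * ((2 * real T + 1) * (Cm * exp (- c * T powr e)))) \<le> T powr - p"
        proof -
          have "T powr (C1 - D / 2) \<le> T powr (- p - 1)"
            using elim by (intro powr_mono) (auto simp: D_def field_simps)
          then have "4 * exp 1 * T powr (C1 - D / 2) \<le> 4 * exp 1 * T powr (- p - 1)" by simp
          also have "\<dots> = (4 * exp 1 * T powr -1) * T powr - p"
            using T0 by (simp add: powr_diff powr_minus_divide)
          also have "\<dots> \<le> 1 / 2 * T powr - p" using elim by (intro mult_right_mono) auto
          finally have 1: "4 * exp 1 * T powr (C1 - D / 2) \<le> 1 / 2 * T powr - p" .
          have "4 * real T * ((2 * real T + 1) * (Cm * exp (- c * T powr e)))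
            = (4 * Cm * (real T powr p * (real T * ((2 * real T + 1) * exp (- c * T powr e))))) * T powr - p"
            using T0 by (simp add: powr_minus field_simps)
          also have "\<dots> \<le> 1 / 2 * T powr - p" using elim by (intro mult_right_mono) auto
          finally show ?thesis using 1 by (simp add: algebra_simps)
        qed
        finally show "measure M {w \<in> space M. \<bar>\<Sum>t=1..T. V t w - (\<integral>w. V t w \<partial>M)\<bar> \<ge> D * sqrt (T * h * ln T)} \<le> T powr - p" .
      qed
    qed
  qed
qed

section \<open>Uniform bounds with high probability\<close>

text \<open>
  The exceptional events \<open>E T\<close> are explicit because \<open>Q T\<close> itself need not be measurable; typically it
  involves a supremum over a continuum of points \<open>x\<close>.
\<close>

definition whp :: "(nat \<Rightarrow> 'a measure) \<Rightarrow> (nat \<Rightarrow> 'a \<Rightarrow> bool) \<Rightarrow> bool" where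
  "whp M Q \<longleftrightarrow> (\<exists>E. (\<forall>\<^sub>F T in sequentially. E T \<in> sets (M T)) \<and>
     (\<lambda>T. measure (M T) (E T)) \<longlonglongrightarrow> 0 \<and>
     (\<forall>\<^sub>F T in sequentially. \<forall>w\<in>space (M T). w \<notin> E T \<longrightarrow> Q T w))"

lemma whp_mono:
  assumes "whp M Q" "\<forall>\<^sub>F T in sequentially. \<forall>w\<in>space (M T). Q T w \<longrightarrow> R T w"
  shows "whp M R"
proof -
  obtain E where E: "\<forall>\<^sub>F T in sequentially. E T \<in> sets (M T)" "(\<lambda>T. measure (M T) (E T)) \<longlonglongrightarrow> 0"
    "\<forall>\<^sub>F T in sequentially. \<forall>w\<in>space (M T). w \<notin> E T \<longrightarrow> Q T w"
    using assms(1) unfolding whp_def by blast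
  have "\<forall>\<^sub>F T in sequentially. \<forall>w\<in>space (M T). w \<notin> E T \<longrightarrow> R T w"
    using E(3) assms(2) by eventually_elim blast
  then show ?thesis using E(1,2) unfolding whp_def by blast
qed

lemma whp_conj:
  assumes "whp M Q" "whp M R"
  shows "whp M (\<lambda>T w. Q T w \<and> R T w)"
proof -
  obtain E where E: "\<forall>\<^sub>F T in sequentially. E T \<in> sets (M T)" "(\<lambda>T. measure (M T) (E T)) \<longlonglongrightarrow> 0"
    "\<forall>\<^sub>F T in sequentially. \<forall>w\<in>space (M T). w \<notin> E T \<longrightarrow> Q T w"
    using assms(1) unfolding whp_def by blast
  obtain F where F: "\<forall>\<^sub>F T in sequentially. F T \<in> sets (M T)" "(\<lambda>T. measure (M T) (F T)) \<longlonglongrightarrow> 0"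
    "\<forall>\<^sub>F T in sequentially. \<forall>w\<in>space (M T). w \<notin> F T \<longrightarrow> R T w"
    using assms(2) unfolding whp_def by blast
  have 1: "\<forall>\<^sub>F T in sequentially. E T \<union> F T \<in> sets (M T)"
    using E(1) F(1) by eventually_elim blast
  have "(\<lambda>T. measure (M T) (E T) + measure (M T) (F T)) \<longlonglongrightarrow> 0 + 0"
    by (intro tendsto_add E F)
  then have lim: "(\<lambda>T. measure (M T) (E T) + measure (M T) (F T)) \<longlonglongrightarrow> 0" by simp
  have 2: "(\<lambda>T. measure (M T) (E T \<union> F T)) \<longlonglongrightarrow> 0"
  proof (rule tendsto_sandwich[OF _ _ tendsto_const lim])
    show "\<forall>\<^sub>F T in sequentially. measure (M T) (E T \<union> F T) \<le> measure (M T) (E T) + measure (M T) (F T)"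
      using E(1) F(1) by eventually_elim (rule measure_Un_le)
  qed auto
  have 3: "\<forall>\<^sub>F T in sequentially. \<forall>w\<in>space (M T). w \<notin> E T \<union> F T \<longrightarrow> Q T w \<and> R T w"
    using E(3) F(3)
  proof eventually_elim
    case (elim T)
    then show ?case by auto
  qed
  show ?thesis unfolding whp_def
    by (rule exI[of _ "\<lambda>T. E T \<union> F T"]) (intro conjI 1 2 3)
qed

text \<open>A union bound over an index set that may grow with \<open>T\<close>; each single
  exceptional set must be measurable, but the family need not be fixed.\<close>

lemma whp_ball:
  assumes fin: "\<forall>\<^sub>F T in sequentially. finite (I T)"
    and prob: "\<forall>\<^sub>F T in sequentially. prob_space (M T)"
    and ev: "\<forall>\<^sub>F T in sequentially. \<forall>z\<in>I T. {w \<in> space (M T). \<not> Q T z w} \<in> sets (M T) \<and>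
      measure (M T) {w \<in> space (M T). \<not> Q T z w} \<le> p T"
    and lim: "(\<lambda>T. real (card (I T)) * p T) \<longlonglongrightarrow> 0"
  shows "whp M (\<lambda>T w. \<forall>z\<in>I T. Q T z w)"
proof -
  define E where "E T = (\<Union>z\<in>I T. {w \<in> space (M T). \<not> Q T z w})" for T
  have 1: "\<forall>\<^sub>F T in sequentially. E T \<in> sets (M T)"
    using fin ev unfolding E_def by eventually_elim auto
  have le: "\<forall>\<^sub>F T in sequentially. measure (M T) (E T) \<le> real (card (I T)) * p T"
    using fin ev prob
  proof eventually_elim
    case (elim T)
    interpret prob_space "M T" by fact
    have "prob (E T) \<le> (\<Sum>z\<in>I T. prob {w \<in> space (M T). \<not> Q T z w})"
      unfolding E_def by (rule measure_UNION_le) (use elim in auto)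
    also have "\<dots> \<le> (\<Sum>z\<in>I T. p T)" by (rule sum_mono) (use elim in auto)
    finally show ?case by simp
  qed
  have 2: "(\<lambda>T. measure (M T) (E T)) \<longlonglongrightarrow> 0"
    by (rule tendsto_sandwich[OF _ le tendsto_const lim]) simp
  show ?thesis unfolding whp_def
    by (rule exI[of _ E]) (use 1 2 in \<open>auto simp: E_def\<close>)
qed

text \<open>The set in the conclusion is covered by the exceptional event, and monotonicity of
  \<open>measure\<close> only asks the larger set to be measurable.\<close>

lemma whp_measure_tendsto_0:
  assumes "whp M Q" "\<forall>\<^sub>F T in sequentially. prob_space (M T)"
    and imp: "\<forall>\<^sub>F T in sequentially. \<forall>w\<in>space (M T). Q T w \<longrightarrow> \<not> R T w"
  shows "(\<lambda>T. measure (M T) {w \<in> space (M T). R T w}) \<longlonglongrightarrow> 0"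
proof -
  obtain E where E: "\<forall>\<^sub>F T in sequentially. E T \<in> sets (M T)" "(\<lambda>T. measure (M T) (E T)) \<longlonglongrightarrow> 0"
    "\<forall>\<^sub>F T in sequentially. \<forall>w\<in>space (M T). w \<notin> E T \<longrightarrow> Q T w"
    using assms(1) unfolding whp_def by blast
  have "\<forall>\<^sub>F T in sequentially. measure (M T) {w \<in> space (M T). R T w} \<le> measure (M T) (E T)"
    using E(1,3) assms(2) imp
  proof eventually_elim
    case (elim T)
    interpret prob_space "M T" by fact
    show ?case by (rule finite_measure_mono) (use elim in auto)
  qed
  then show ?thesis by (rule tendsto_sandwich[OF _ _ tendsto_const E(2), rotated]) simp
qed

lemma unit_interval_mesh:
  assumes "x \<in> {0..1::real}" "1 \<le> N"
  shows "\<exists>k\<le>N. \<bar>x - real k / real N\<bar> \<le> 1 / real N"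
proof -
  define k where "k = nat \<lfloor>x * N\<rfloor>"
  have N: "0 < real N" using assms(2) by simp
  have xN: "x * N \<le> 1 * real N" "0 \<le> x * N"
    by (rule mult_right_mono, use assms in auto)
  have rk: "real k = of_int \<lfloor>x * N\<rfloor>" unfolding k_def using xN(2) by simp
  then have "real k \<le> real N" "\<bar>x * N - real k\<bar> \<le> 1" using xN by linarith+
  moreover have "x - real k / N = (x * N - real k) / N" using N by (simp only: diff_divide_distrib) simp
  then have "\<bar>x - real k / N\<bar> = \<bar>x * N - real k\<bar> / N" using N by (simp add: abs_divide)
  ultimately have "k \<le> N" "\<bar>x - real k / real N\<bar> \<le> 1 / real N"
    using N by (simp_all only: of_nat_le_iff divide_right_mono less_imp_le)
  then show ?thesis by blast
qed

text \<open>Of the grid only the set \<open>H T\<close> of its bandwidths is kept, because the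
  bounds are to hold for all \<open>x\<close> in the unit interval. Independence is stated for pairs
  of individuals, which is the only form in which it is applied; \<open>pn\<close> is some exponent
  bounding the growth of \<open>n\<close>, and \<open>\<eta>\<close> is the spare exponent in the
  size of the summands.\<close>

locale mixing_panel =
  fixes M :: "nat \<Rightarrow> 'a measure" and n :: "nat \<Rightarrow> nat"
    and X \<epsilon> :: "nat \<Rightarrow> nat \<Rightarrow> nat \<Rightarrow> 'a \<Rightarrow> real"
    and H :: "nat \<Rightarrow> real set" and hmin hmax :: "nat \<Rightarrow> real"
    and Cm \<rho> a A b B \<beta> CH pn \<eta> :: real
  assumes prob: "1 \<le> T \<Longrightarrow> prob_space (M T)"
    and n_ge_2: "1 \<le> T \<Longrightarrow> 2 \<le> n T"
    and X_meas: "1 \<le> T \<Longrightarrow> i \<in> {1..n T} \<Longrightarrow> 1 \<le> t \<Longrightarrow> X T i t \<in> borel_measurable (M T)"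
    and \<epsilon>_meas: "1 \<le> T \<Longrightarrow> i \<in> {1..n T} \<Longrightarrow> 1 \<le> t \<Longrightarrow> \<epsilon> T i t \<in> borel_measurable (M T)"
    and indep: "1 \<le> T \<Longrightarrow> i \<in> {1..n T} \<Longrightarrow> j \<in> {1..n T} - {i} \<Longrightarrow>
      prob_space.indep_var (M T) (PiM {1..} (\<lambda>_. borel)) (\<lambda>w. \<lambda>t\<in>{1..}. (X T i t w, \<epsilon> T i t w))
        (PiM {1..} (\<lambda>_. borel)) (\<lambda>w. \<lambda>t\<in>{1..}. (X T j t w, \<epsilon> T j t w))"
    and mix: "1 \<le> T \<Longrightarrow> i \<in> {1..n T} \<Longrightarrow> 1 \<le> t \<Longrightarrow>
      D1 \<in> events_of (M T) borel (\<lambda>t w. (X T i t w, \<epsilon> T i t w)) {1..t} \<Longrightarrow>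
      D2 \<in> events_of (M T) borel (\<lambda>t w. (X T i t w, \<epsilon> T i t w)) {t + l..} \<Longrightarrow>
      measure (M T) (D1 \<inter> D2) \<le> measure (M T) D1 * measure (M T) D2 + Cm * \<rho> ^ l"
    and mix_pos: "0 \<le> Cm" "0 < \<rho>" "\<rho> < 1"
    and hmin: "hmin T = a * real T powr - B" and hmax: "hmax T = A * real T powr - b"
    and h_pos: "0 < a" "0 < A" "0 < b" "B < 1"
    and H_finite: "1 \<le> T \<Longrightarrow> finite (H T)" and H_sub: "1 \<le> T \<Longrightarrow> H T \<subseteq> {hmin T..hmax T}"
    and H_card: "1 \<le> T \<Longrightarrow> real (card (H T)) \<le> CH * real T powr \<beta>"
    and n_le: "\<forall>\<^sub>F T in sequentially. real (n T) \<le> real T powr pn"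
    and \<eta>_pos: "0 < \<eta>"
begin

definition obs where "obs T i j t w = ((X T i t w, \<epsilon> T i t w), (X T j t w, \<epsilon> T j t w))"

text \<open>The size of the fluctuation of a kernel sum with about \<open>T * h\<close> effective
  terms; the logarithm is the price of uniformity.\<close>

abbreviation rate :: "nat \<Rightarrow> real \<Rightarrow> real" where "rate T h \<equiv> sqrt (real T * h * ln (real T))"

abbreviation dev_bound where
  "dev_bound v D T w \<equiv> \<forall>i\<in>{1..n T}. \<forall>j\<in>{1..n T} - {i}. \<forall>h\<in>H T. \<forall>x\<in>{0..1}.
    \<bar>\<Sum>t=1..T. v T i j h x (obs T i j t w) - (\<integral>w. v T i j h x (obs T i j t w) \<partial>M T)\<bar> \<le> D * rate T h"

lemma obs_meas:
  assumes "1 \<le> T" "i \<in> {1..n T}" "j \<in> {1..n T}" "1 \<le> t"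
  shows "obs T i j t \<in> measurable (M T) (borel \<Otimes>\<^sub>M borel)"
  unfolding obs_def using X_meas \<epsilon>_meas assms by (intro measurable_Pair borel_measurable_Pair) auto

lemma mixing_array_obs:
  assumes T: "1 \<le> T" "i \<in> {1..n T}" "j \<in> {1..n T} - {i}"
    and v: "\<And>t. v t \<in> borel_measurable (borel \<Otimes>\<^sub>M borel)"
  shows "mixing_array (M T) (\<lambda>t w. v t (obs T i j t w)) (\<lambda>l. (2 * Cm) * \<rho> ^ l)"
proof -
  interpret prob_space "M T" by (rule prob[OF T(1)])
  have "mixing_array (M T) (\<lambda>t w. v t (obs T i j t w)) (\<lambda>l. 2 * (Cm * \<rho> ^ l))"
    by (rule independent_processes_mixing_array[OF indep[OF T] mix[OF T(1,2)] mix[OF T(1)]])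
      (use T v mix_pos in \<open>auto simp: obs_def\<close>)
  then show ?thesis by (simp add: mult.assoc)
qed

lemma H_bounds:
  assumes "1 \<le> T" "h \<in> H T"
  shows "0 < hmin T" "hmin T \<le> h" "h \<le> hmax T" "0 < h"
proof -
  show "0 < hmin T" using assms h_pos by (simp add: hmin)
  moreover show "hmin T \<le> h" "h \<le> hmax T" using H_sub[OF assms(1)] assms(2) by auto
  ultimately show "0 < h" by simp
qed

lemma rate_ge_1: "\<forall>\<^sub>F T in sequentially. \<forall>h\<in>H T. 1 \<le> rate T h"
proof -
  have "\<forall>\<^sub>F T in sequentially. 1 \<le> real T * (a * real T powr - B) * ln (real T)"
    using h_pos by real_asymp
  then show ?thesis using eventually_ge_at_top[of 1]
  proof eventually_elim
    case (elim T)
    show ?case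
    proof
      fix h assume h: "h \<in> H T"
      have "1 \<le> real T * hmin T * ln (real T)" using elim by (simp add: hmin)
      also have "\<dots> \<le> real T * h * ln (real T)"
        using H_bounds[OF elim(2) h] elim by (intro mult_right_mono mult_left_mono) auto
      finally show "1 \<le> rate T h" by simp
    qed
  qed
qed

text \<open>A single discretisation is enough: concentration holds at the points
  \<open>k / T ^ 4\<close>, and the Lipschitz constant of order \<open>T ^ 3\<close> turns the mesh
  width into an error \<open>C0 / T\<close> per summand. Summed over \<open>t\<close>, for the
  statistic and for its mean, this is \<open>2 * C0\<close>, which is at most
  \<open>2 * C0 * rate T h\<close> eventually.\<close>

lemma whp_statistic:
  fixes v :: "nat \<Rightarrow> nat \<Rightarrow> nat \<Rightarrow> real \<Rightarrow> real \<Rightarrow> (real \<times> real) \<times> (real \<times> real) \<Rightarrow> real"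
  assumes meas: "\<And>T i j h x. v T i j h x \<in> borel_measurable (borel \<Otimes>\<^sub>M borel)"
    and C0: "0 \<le> C0"
    and bd: "\<forall>\<^sub>F T in sequentially. \<forall>i\<in>{1..n T}. \<forall>j\<in>{1..n T} - {i}. \<forall>h\<in>H T. \<forall>x\<in>{0..1}. \<forall>z.
      \<bar>v T i j h x z\<bar> \<le> C0 * (sqrt (real T * h) * real T powr - \<eta>)"
    and v1: "\<forall>\<^sub>F T in sequentially. \<forall>i\<in>{1..n T}. \<forall>j\<in>{1..n T} - {i}. \<forall>h\<in>H T. \<forall>x\<in>{0..1}. \<forall>t\<in>{1..T}.
      (\<integral>w. (v T i j h x (obs T i j t w))\<^sup>2 \<partial>M T) \<le> C0 * h"
    and v2: "\<forall>\<^sub>F T in sequentially. \<forall>i\<in>{1..n T}. \<forall>j\<in>{1..n T} - {i}. \<forall>h\<in>H T. \<forall>x\<in>{0..1}. \<forall>s\<in>{1..T}. \<forall>t\<in>{1..T}.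
      \<bar>int s - int t\<bar> \<ge> int ls \<longrightarrow>
      (\<integral>w. \<bar>v T i j h x (obs T i j s w) * v T i j h x (obs T i j t w)\<bar> \<partial>M T) \<le> C0 * h\<^sup>2"
    and lip: "\<forall>\<^sub>F T in sequentially. \<forall>i\<in>{1..n T}. \<forall>j\<in>{1..n T} - {i}. \<forall>h\<in>H T. \<forall>x\<in>{0..1}. \<forall>y\<in>{0..1}. \<forall>z.
      \<bar>v T i j h x z - v T i j h y z\<bar> \<le> C0 * real T ^ 3 * \<bar>x - y\<bar>"
  shows "\<exists>D\<ge>0. whp M (dev_bound v D)"
proof -
  \<comment> \<open>The exponents of the pairs of individuals (\<open>2 * pn\<close>), of the
    bandwidths (\<open>\<beta>\<close>) and of the mesh (4), and one more to make the union bound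
    vanish.\<close>
  define p where "p = 2 * pn + \<beta> + 5"
  obtain D0 where D0: "0 \<le> D0" and conc: "\<forall>\<^sub>F T in sequentially. concentrated TYPE('a) A b \<eta> C0 (2 * Cm) \<rho> ls p D0 T"
    using concentration[of A b \<eta> C0 "2 * Cm" \<rho> ls p] h_pos \<eta>_pos mix_pos C0 by auto
  define I where "I T = ({1..n T} \<times> {1..n T}) \<times> H T \<times> {0..T ^ 4}" for T
  define S where "S T i j h x w =
    (\<Sum>t=1..T. v T i j h x (obs T i j t w) - (\<integral>w. v T i j h x (obs T i j t w) \<partial>M T))" for T i j h x w
  \<comment> \<open>The strict inequality is the exact complement of the event bounded by
    \<open>concentrated\<close>. On the diagonal \<open>i = j\<close>, where no independence is
    available, \<open>Q\<close> holds trivially, so a full product can serve as index set.\<close>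
  define Q where "Q T z w = (case z of ((i, j), h, k) \<Rightarrow>
      i \<noteq> j \<longrightarrow> \<bar>S T i j h (real k / real (T ^ 4)) w\<bar> < D0 * rate T h)"
    for T w and z :: "(nat \<times> nat) \<times> real \<times> nat"
  have vm: "(\<lambda>w. v T i j h x (obs T i j t w)) \<in> borel_measurable (M T)"
    if "1 \<le> T" "i \<in> {1..n T}" "j \<in> {1..n T}" "1 \<le> t" for T i j h x t
    using measurable_compose[OF obs_meas[OF that] meas] .
  have Smeas: "S T i j h x \<in> borel_measurable (M T)" if "1 \<le> T" "i \<in> {1..n T}" "j \<in> {1..n T}" for T i j h x
    unfolding S_def by (intro borel_measurable_sum borel_measurable_diff borel_measurable_const vm that) auto
  have whpQ: "whp M (\<lambda>T w. \<forall>z\<in>I T. Q T z w)"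
  proof (rule whp_ball[where p = "\<lambda>T. T powr - p"])
    show "\<forall>\<^sub>F T in sequentially. finite (I T)"
      using eventually_ge_at_top[of 1] by eventually_elim (auto simp: I_def H_finite)
    show "\<forall>\<^sub>F T in sequentially. prob_space (M T)"
      using eventually_ge_at_top[of 1] by eventually_elim (rule prob)
    show "\<forall>\<^sub>F T in sequentially. \<forall>z\<in>I T. {w \<in> space (M T). \<not> Q T z w} \<in> sets (M T) \<and>
      measure (M T) {w \<in> space (M T). \<not> Q T z w} \<le> T powr - p"
      using bd v1 v2 conc eventually_ge_at_top[of 1]
    proof eventually_elim
      case (elim T)
      show ?case
      proof
        fix z assume "z \<in> I T"
        then obtain i j h k where z: "z = ((i, j), h, k)" "i \<in> {1..n T}" "j \<in> {1..n T}" "h \<in> H T" "k \<le> T ^ 4"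
          by (auto simp: I_def)
        let ?x = "real k / real (T ^ 4)"
        have "real k \<le> real (T ^ 4)" using z by (simp only: of_nat_le_iff)
        moreover have "0 < real (T ^ 4)" using elim by simp
        ultimately have x: "?x \<in> {0..1}" by (simp only: atLeastAtMost_iff divide_le_eq_1_pos) simp
        show "{w \<in> space (M T). \<not> Q T z w} \<in> sets (M T) \<and>
          measure (M T) {w \<in> space (M T). \<not> Q T z w} \<le> T powr - p"
        proof (cases "i = j")
          case True
          then show ?thesis by (simp add: Q_def z)
        next
          case False
          have eq: "{w \<in> space (M T). \<not> Q T z w} = {w \<in> space (M T). \<bar>S T i j h ?x w\<bar> \<ge> D0 * rate T h}"
            using False by (auto simp: Q_def z not_less)
          have "{w \<in> space (M T). \<bar>S T i j h ?x w\<bar> \<ge> D0 * rate T h} \<in> sets (M T)"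
            using Smeas[OF elim(5) z(2,3)] by measurable
          moreover have "measure (M T) {w \<in> space (M T). \<bar>S T i j h ?x w\<bar> \<ge> D0 * rate T h} \<le> T powr - p"
            unfolding S_def
          proof (rule elim(4)[rule_format, of "M T" h "\<lambda>t w. v T i j h ?x (obs T i j t w)"])
            have j: "j \<in> {1..n T} - {i}" using z False by simp
            show "prob_space (M T)" by (rule prob) fact
            show "0 < h" "h \<le> A * real T powr - b" using H_bounds[OF elim(5) z(4)] by (simp_all add: hmax)
            show "mixing_array (M T) (\<lambda>t w. v T i j h ?x (obs T i j t w)) (\<lambda>l. (2 * Cm) * \<rho> ^ l)"
              by (rule mixing_array_obs[OF elim(5) z(2) j meas])
            show "(\<lambda>w. v T i j h ?x (obs T i j t w)) \<in> borel_measurable (M T)" if "t \<in> {1..T}" for t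
              using vm[OF elim(5) z(2,3)] that by simp
            show "\<bar>v T i j h ?x (obs T i j t w)\<bar> \<le> C0 * (sqrt (real T * h) * real T powr - \<eta>)" for t w
              using elim(1) z(2,4) j x by blast
            show "(\<integral>w. (v T i j h ?x (obs T i j t w))\<^sup>2 \<partial>M T) \<le> C0 * h" if "t \<in> {1..T}" for t
              using elim(2) z(2,4) j x that by blast
            show "(\<integral>w. \<bar>v T i j h ?x (obs T i j s w) * v T i j h ?x (obs T i j t w)\<bar> \<partial>M T) \<le> C0 * h\<^sup>2"
              if "s \<in> {1..T}" "t \<in> {1..T}" "int ls \<le> \<bar>int s - int t\<bar>" for s t
              using elim(3) z(2,4) j x that by blast
          qed
          ultimately show ?thesis unfolding eq by blast
        qed
      qed
    qed
    have lim: "(\<lambda>T::nat. (real T powr pn)\<^sup>2 * (\<bar>CH\<bar> * real T powr \<beta>) * (real T ^ 4 + 1) * T powr - p) \<longlonglongrightarrow> 0"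
    proof -
      have lim5: "(\<lambda>T::nat. \<bar>CH\<bar> * ((real T ^ 4 + 1) * real T powr - 5)) \<longlonglongrightarrow> \<bar>CH\<bar> * 0"
        by (intro tendsto_mult tendsto_const) real_asymp
      have "\<bar>CH\<bar> * ((real T ^ 4 + 1) * real T powr - 5)
          = (real T powr pn)\<^sup>2 * (\<bar>CH\<bar> * real T powr \<beta>) * (real T ^ 4 + 1) * T powr - p" if "1 \<le> T" for T
      proof -
        have "(real T powr pn)\<^sup>2 * real T powr \<beta> * T powr - p = real T powr - 5"
          by (simp add: power2_eq_square p_def flip: powr_add)
        moreover have "(real T powr pn)\<^sup>2 * (\<bar>CH\<bar> * real T powr \<beta>) * (real T ^ 4 + 1) * T powr - p
          = \<bar>CH\<bar> * ((real T ^ 4 + 1) * ((real T powr pn)\<^sup>2 * real T powr \<beta> * T powr - p))"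
          by (simp only: mult_ac)
        ultimately show ?thesis by (simp only:)
      qed
      then have "\<forall>\<^sub>F T in sequentially. \<bar>CH\<bar> * ((real T ^ 4 + 1) * real T powr - 5)
          = (real T powr pn)\<^sup>2 * (\<bar>CH\<bar> * real T powr \<beta>) * (real T ^ 4 + 1) * T powr - p"
        by (rule eventually_mono[OF eventually_ge_at_top[of 1]])
      from Lim_transform_eventually[OF lim5 this] show ?thesis by simp
    qed
    show "(\<lambda>T. real (card (I T)) * T powr - p) \<longlonglongrightarrow> 0"
    proof (rule tendsto_sandwich[OF _ _ tendsto_const lim])
      show "\<forall>\<^sub>F T in sequentially. real (card (I T)) * T powr - p \<le>
        (real T powr pn)\<^sup>2 * (\<bar>CH\<bar> * real T powr \<beta>) * (real T ^ 4 + 1) * T powr - p"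
        using n_le eventually_ge_at_top[of 1]
      proof eventually_elim
        case (elim T)
        have "real (card (I T)) = (real (n T))\<^sup>2 * real (card (H T)) * (real T ^ 4 + 1)"
          by (simp add: I_def card_cartesian_product power2_eq_square algebra_simps)
        also have "\<dots> \<le> (real T powr pn)\<^sup>2 * (\<bar>CH\<bar> * real T powr \<beta>) * (real T ^ 4 + 1)"
        proof (intro mult_mono power_mono elim)
          have "real (card (H T)) \<le> CH * real T powr \<beta>" by (rule H_card[OF elim(2)])
          also have "\<dots> \<le> \<bar>CH\<bar> * real T powr \<beta>" by (intro mult_right_mono) auto
          finally show "real (card (H T)) \<le> \<bar>CH\<bar> * real T powr \<beta>" .
        qed auto
        finally show ?case by (rule mult_right_mono) simp
      qed
    qed auto
  qed
  have "whp M (\<lambda>T w. \<forall>i\<in>{1..n T}. \<forall>j\<in>{1..n T} - {i}. \<forall>h\<in>H T. \<forall>x\<in>{0..1}.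
      \<bar>S T i j h x w\<bar> \<le> (D0 + 2 * C0) * rate T h)"
  proof (rule whp_mono[OF whpQ])
    show "\<forall>\<^sub>F T in sequentially. \<forall>w\<in>space (M T). (\<forall>z\<in>I T. Q T z w) \<longrightarrow>
      (\<forall>i\<in>{1..n T}. \<forall>j\<in>{1..n T} - {i}. \<forall>h\<in>H T. \<forall>x\<in>{0..1}. \<bar>S T i j h x w\<bar> \<le> (D0 + 2 * C0) * rate T h)"
      using lip bd rate_ge_1 eventually_ge_at_top[of 1]
    proof eventually_elim
      case (elim T)
      interpret prob_space "M T" by (rule prob) fact
      show ?case
      proof (intro ballI impI)
        fix w i j h x
        assume w: "w \<in> space (M T)" and Q: "\<forall>z\<in>I T. Q T z w" and i: "i \<in> {1..n T}" and j: "j \<in> {1..n T} - {i}"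
          and h: "h \<in> H T" and x: "x \<in> {0..1::real}"
        have T4: "1 \<le> T ^ 4" using elim by simp
        obtain k where k: "k \<le> T ^ 4" "\<bar>x - real k / real (T ^ 4)\<bar> \<le> 1 / real (T ^ 4)"
          using unit_interval_mesh[OF x T4] by blast
        define y where "y = real k / real (T ^ 4)"
        have "real k \<le> real (T ^ 4)" using k by (simp only: of_nat_le_iff)
        moreover have "0 < real (T ^ 4)" using elim by simp
        ultimately have y: "y \<in> {0..1}" unfolding y_def by (simp only: atLeastAtMost_iff divide_le_eq_1_pos) simp
        have xy: "\<bar>v T i j h x z - v T i j h y z\<bar> \<le> C0 / T" for z
        proof -
          have "\<bar>v T i j h x z - v T i j h y z\<bar> \<le> C0 * real T ^ 3 * \<bar>x - y\<bar>" using elim(1) i j h x y by blast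
          also have "\<dots> \<le> C0 * real T ^ 3 * (1 / real (T ^ 4))"
            using k(2) C0 by (intro mult_left_mono) (auto simp: y_def)
          also have "\<dots> = C0 / T" using elim by (simp add: power_Suc numeral_eq_Suc field_simps)
          finally show ?thesis .
        qed
        have vi: "integrable (M T) (\<lambda>w. v T i j h x (obs T i j t w))" if "t \<in> {1..T}" "x \<in> {0..1}" for t x
        proof (rule integrable_const_bound[where B = "C0 * (sqrt (real T * h) * real T powr - \<eta>)"])
          have "\<bar>v T i j h x z\<bar> \<le> C0 * (sqrt (real T * h) * real T powr - \<eta>)" for z
            using elim(2) i j h that by blast
          then show "AE w in M T. norm (v T i j h x (obs T i j t w)) \<le> C0 * (sqrt (real T * h) * real T powr - \<eta>)"
            by (intro AE_I2) simp
          show "(\<lambda>w. v T i j h x (obs T i j t w)) \<in> borel_measurable (M T)"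
            using vm[OF elim(4) i, of j t] j that by simp
        qed
        have "\<bar>S T i j h x w - S T i j h y w\<bar>
          = \<bar>\<Sum>t=1..T. (v T i j h x (obs T i j t w) - v T i j h y (obs T i j t w))
             - (expectation (\<lambda>w. v T i j h x (obs T i j t w)) - expectation (\<lambda>w. v T i j h y (obs T i j t w)))\<bar>"
          unfolding S_def sum_subtractf[symmetric] by (intro arg_cong[where f = abs] sum.cong) auto
        also have "\<dots> \<le> (\<Sum>t=1..T. C0 / T + C0 / T)"
        proof (rule order_trans[OF sum_abs sum_mono])
          fix t assume t: "t \<in> {1..T}"
          have "\<bar>expectation (\<lambda>w. v T i j h x (obs T i j t w)) - expectation (\<lambda>w. v T i j h y (obs T i j t w))\<bar>
            = \<bar>expectation (\<lambda>w. v T i j h x (obs T i j t w) - v T i j h y (obs T i j t w))\<bar>"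
            using vi[OF t] x y by simp
          also have "\<dots> \<le> expectation (\<lambda>w. \<bar>v T i j h x (obs T i j t w) - v T i j h y (obs T i j t w)\<bar>)"
            by (rule integral_abs_bound)
          also have "\<dots> \<le> expectation (\<lambda>w. C0 / T)"
            using vi[OF t] x y xy by (intro integral_mono) auto
          also have "\<dots> = C0 / T" by (simp add: prob_space)
          finally show "\<bar>(v T i j h x (obs T i j t w) - v T i j h y (obs T i j t w))
             - (expectation (\<lambda>w. v T i j h x (obs T i j t w)) - expectation (\<lambda>w. v T i j h y (obs T i j t w)))\<bar>
             \<le> C0 / T + C0 / T"
            using xy[of "obs T i j t w"] by linarith
        qed
        also have "\<dots> = 2 * C0" using elim by simp
        also have "\<dots> \<le> 2 * C0 * rate T h" using elim(3) h C0 by (simp add: mult_left_mono mult_le_cancel_left1)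
        finally have "\<bar>S T i j h x w - S T i j h y w\<bar> \<le> 2 * C0 * rate T h" .
        moreover have "\<bar>S T i j h y w\<bar> < D0 * rate T h"
          using Q[rule_format, of "((i, j), h, k)"] i j h k by (auto simp: I_def Q_def y_def)
        ultimately show "\<bar>S T i j h x w\<bar> \<le> (D0 + 2 * C0) * rate T h" by (simp add: algebra_simps)
      qed
    qed
  qed
  then show ?thesis using D0 C0 unfolding S_def by (intro exI[of _ "D0 + 2 * C0"]) auto
qed

end

section \<open>Kernel sums of the panel\<close>

definition trunc :: "real \<Rightarrow> real \<Rightarrow> real" where
  "trunc c e = (if \<bar>e\<bar> \<le> c then e else 0)"

lemma trunc_meas [measurable]: "trunc c \<in> borel_measurable borel"
  unfolding trunc_def by measurable

lemma abs_trunc_le: "\<bar>trunc c e\<bar> \<le> \<bar>e\<bar>" by (simp add: trunc_def)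

lemma abs_trunc_le_level: "0 \<le> c \<Longrightarrow> \<bar>trunc c e\<bar> \<le> c" by (simp add: trunc_def)

lemma trunc_eq: "\<bar>e\<bar> \<le> c \<Longrightarrow> trunc c e = e" by (simp add: trunc_def)

definition phi :: "(real \<Rightarrow> real) \<Rightarrow> nat \<Rightarrow> real \<Rightarrow> real" where
  "phi K l u = K u * u ^ l"

text \<open>The power \<open>u ^ l\<close> is not Lipschitz on the line, but \<open>K\<close>
  vanishes outside \<open>{-1..1}\<close>, so the argument of the power may be clamped to that
  interval, where the Lipschitz constant is \<open>l\<close>.\<close>

lemma lipschitz_phi:
  fixes K :: "real \<Rightarrow> real"
  assumes K: "\<And>v. \<bar>K v\<bar> \<le> KM" "\<And>v. v \<notin> {-1..1} \<Longrightarrow> K v = 0" "\<And>v w. \<bar>K v - K w\<bar> \<le> LK * \<bar>v - w\<bar>"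
  shows "\<bar>phi K l u - phi K l v\<bar> \<le> (LK + real l * KM) * \<bar>u - v\<bar>"
proof -
  define c where "c v = max (-1) (min 1 v)" for v :: real
  have phi_c: "phi K l v = K v * c v ^ l" for v
  proof (cases "v \<in> {-1..1}")
    case True
    then show ?thesis by (simp add: phi_def c_def)
  next
    case False
    then show ?thesis using K(2)[OF False] by (simp add: phi_def)
  qed
  have c1: "\<bar>c v\<bar> \<le> 1" "\<bar>c u - c v\<bar> \<le> \<bar>u - v\<bar>" for u v by (auto simp: c_def)
  have pow: "\<bar>c u ^ l - c v ^ l\<bar> \<le> real l * \<bar>u - v\<bar>"
  proof (induction l)
    case (Suc l)
    have "c u ^ Suc l - c v ^ Suc l = c u * (c u ^ l - c v ^ l) + (c u - c v) * c v ^ l"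
      by (simp add: algebra_simps)
    also have "\<bar>\<dots>\<bar> \<le> \<bar>c u\<bar> * \<bar>c u ^ l - c v ^ l\<bar> + \<bar>c u - c v\<bar> * \<bar>c v ^ l\<bar>"
      by (rule order_trans[OF abs_triangle_ineq]) (simp add: abs_mult)
    also have "\<dots> \<le> 1 * (real l * \<bar>u - v\<bar>) + \<bar>u - v\<bar> * 1"
      by (intro add_mono mult_mono c1 Suc) (auto simp: power_abs intro!: power_le_one c1)
    finally show ?case by (simp add: algebra_simps)
  qed simp
  have "phi K l u - phi K l v = (K u - K v) * c u ^ l + K v * (c u ^ l - c v ^ l)"
    by (simp add: phi_c algebra_simps)
  also have "\<bar>\<dots>\<bar> \<le> \<bar>K u - K v\<bar> * \<bar>c u ^ l\<bar> + \<bar>K v\<bar> * \<bar>c u ^ l - c v ^ l\<bar>"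
    by (rule order_trans[OF abs_triangle_ineq]) (simp add: abs_mult)
  also have "\<dots> \<le> (LK * \<bar>u - v\<bar>) * 1 + KM * (real l * \<bar>u - v\<bar>)"
    by (intro add_mono mult_mono K pow)
      (use order_trans[OF abs_ge_zero K(3)[of u v]] order_trans[OF abs_ge_zero K(1)[of v]]
        in \<open>auto simp: power_abs intro!: power_le_one c1\<close>)
  finally show ?thesis by (simp add: algebra_simps)
qed

lemma lipschitz_measurable:
  fixes K :: "real \<Rightarrow> real"
  assumes "\<And>v w. \<bar>K v - K w\<bar> \<le> L * \<bar>v - w\<bar>"
  shows "K \<in> borel_measurable borel"
proof -
  have "0 \<le> L" using assms[of 0 1] by simp
  then have "L-lipschitz_on UNIV K"
    using assms by (intro lipschitz_onI) (auto simp: dist_real_def)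
  then show ?thesis by (intro borel_measurable_continuous_onI lipschitz_on_continuous_on)
qed

text \<open>
  \<open>\<tau> T\<close> is the truncation level for the errors and \<open>\<mu> T i\<close> is a bounded extension of the regression
  function of individual \<open>i\<close> to the real line.
\<close>

locale panel_moments = mixing_panel +
  fixes K :: "real \<Rightarrow> real" and \<mu> :: "nat \<Rightarrow> nat \<Rightarrow> real \<Rightarrow> real" and \<tau> :: "nat \<Rightarrow> real"
    and KM LK G C1 \<sigma>low :: real and ls :: nat
  assumes K_abs: "\<bar>K v\<bar> \<le> KM" and K_supp: "v \<notin> {-1..1} \<Longrightarrow> K v = 0"
    and K_lip: "\<bar>K v - K w\<bar> \<le> LK * \<bar>v - w\<bar>"
    and \<mu>_meas: "\<mu> T i \<in> borel_measurable borel" and \<mu>_bd: "\<bar>\<mu> T i x\<bar> \<le> G"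
    and \<mu>_mean: "1 \<le> T \<Longrightarrow> i \<in> {1..n T} \<Longrightarrow> 1 \<le> t \<Longrightarrow> (\<integral>w. \<mu> T i (X T i t w) \<partial>M T) = 0"
    and same_law: "1 \<le> T \<Longrightarrow> i \<in> {1..n T} \<Longrightarrow> 1 \<le> t \<Longrightarrow> distr (M T) borel (X T i t) = distr (M T) borel (X T i 1)"
    and X_near: "1 \<le> T \<Longrightarrow> i \<in> {1..n T} \<Longrightarrow> 1 \<le> t \<Longrightarrow> 0 < h \<Longrightarrow>
      (\<integral>w. indicator {x - h..x + h} (X T i t w) \<partial>M T) \<le> C1 * h"
    and X_near2: "1 \<le> T \<Longrightarrow> i \<in> {1..n T} \<Longrightarrow> 1 \<le> s \<Longrightarrow> 1 \<le> t \<Longrightarrow> s \<noteq> t \<Longrightarrow> 0 < h \<Longrightarrow>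
      (\<integral>w. indicator {x - h..x + h} (X T i s w) * indicator {x - h..x + h} (X T i t w) \<partial>M T) \<le> C1 * h\<^sup>2"
    and \<epsilon>4: "1 \<le> T \<Longrightarrow> i \<in> {1..n T} \<Longrightarrow> 1 \<le> t \<Longrightarrow> integrable (M T) (\<lambda>w. (\<epsilon> T i t w) ^ 4)"
      "1 \<le> T \<Longrightarrow> i \<in> {1..n T} \<Longrightarrow> 1 \<le> t \<Longrightarrow> (\<integral>w. (\<epsilon> T i t w) ^ 4 \<partial>M T) \<le> C1"
    and \<epsilon>2_near: "1 \<le> T \<Longrightarrow> i \<in> {1..n T} \<Longrightarrow> 1 \<le> t \<Longrightarrow> 0 < h \<Longrightarrow>
      (\<integral>w. indicator {x - h..x + h} (X T i t w) * (\<epsilon> T i t w)\<^sup>2 \<partial>M T) \<le> C1 * h"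
    and \<epsilon>\<epsilon>_near: "1 \<le> T \<Longrightarrow> i \<in> {1..n T} \<Longrightarrow> 1 \<le> s \<Longrightarrow> 1 \<le> t \<Longrightarrow> \<bar>int s - int t\<bar> \<ge> int ls \<Longrightarrow> 0 < h \<Longrightarrow>
      (\<integral>w. indicator {x - h..x + h} (X T i s w) * indicator {x - h..x + h} (X T i t w) * \<bar>\<epsilon> T i s w * \<epsilon> T i t w\<bar> \<partial>M T)
       \<le> C1 * h\<^sup>2"
    and ls_pos: "1 \<le> ls"
    and tail_near: "\<forall>\<^sub>F T in sequentially. \<forall>i\<in>{1..n T}. \<forall>t\<ge>1. \<forall>h>0. \<forall>x.
      (\<integral>w. indicator {x - h..x + h} (X T i t w) * \<bar>\<epsilon> T i t w - trunc (\<tau> T) (\<epsilon> T i t w)\<bar> \<partial>M T) \<le> C1 * h / sqrt (real T)"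
    and tail: "\<forall>\<^sub>F T in sequentially. \<forall>i\<in>{1..n T}. \<forall>t\<ge>1.
      (\<integral>w. \<bar>\<epsilon> T i t w - trunc (\<tau> T) (\<epsilon> T i t w)\<bar> \<partial>M T) \<le> C1 / sqrt (real T)"
    and \<epsilon>_centred: "1 \<le> T \<Longrightarrow> i \<in> {1..n T} \<Longrightarrow> 1 \<le> t \<Longrightarrow> f \<in> borel_measurable borel \<Longrightarrow> (\<And>x. \<bar>f x\<bar> \<le> C) \<Longrightarrow>
      (\<integral>w. f (X T i t w) * \<epsilon> T i t w \<partial>M T) = 0"
    and \<sigma>low: "0 < \<sigma>low" "1 \<le> T \<Longrightarrow> i \<in> {1..n T} \<Longrightarrow> 1 \<le> t \<Longrightarrow> \<sigma>low \<le> (\<integral>w. (\<epsilon> T i t w)\<^sup>2 \<partial>M T)"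
    and \<tau>_lim: "filterlim \<tau> at_top sequentially"
    and \<tau>_le: "\<forall>\<^sub>F T in sequentially. \<tau> T \<le> sqrt (real T * hmin T) * real T powr - \<eta> \<and> (\<tau> T)\<^sup>2 \<le> sqrt (real T) * real T powr - \<eta>"
    and whp_regular: "whp M (\<lambda>T w. \<forall>i\<in>{1..n T}. \<forall>t\<in>{1..T}. \<bar>\<epsilon> T i t w\<bar> \<le> \<tau> T \<and> X T i t w \<in> {0..1})"
    and H_nonempty: "\<forall>\<^sub>F T in sequentially. H T \<noteq> {}"
begin

abbreviation kw :: "nat \<Rightarrow> nat \<Rightarrow> nat \<Rightarrow> real \<Rightarrow> real \<Rightarrow> nat \<Rightarrow> 'a \<Rightarrow> real" where
  "kw T i l h x t w \<equiv> phi K l ((X T i t w - x) / h)"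

abbreviation near :: "nat \<Rightarrow> nat \<Rightarrow> real \<Rightarrow> real \<Rightarrow> nat \<Rightarrow> 'a \<Rightarrow> real" where
  "near T i h x t w \<equiv> indicator {x - h..x + h} (X T i t w)"

abbreviation regular :: "nat \<Rightarrow> 'a \<Rightarrow> bool" where
  "regular T w \<equiv> \<forall>i\<in>{1..n T}. \<forall>t\<in>{1..T}. \<bar>\<epsilon> T i t w\<bar> \<le> \<tau> T \<and> X T i t w \<in> {0..1}"

abbreviation kernel_dev_bound where
  "kernel_dev_bound N l D T w \<equiv> \<forall>i\<in>{1..n T}. \<forall>j\<in>{1..n T} - {i}. \<forall>h\<in>H T. \<forall>x\<in>{0..1}.
    \<bar>\<Sum>t=1..T. kw T i l h x t w * N T i j (obs T i j t w)
       - (\<integral>w. kw T i l h x t w * N T i j (obs T i j t w) \<partial>M T)\<bar> \<le> D * rate T h"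

abbreviation average_dev_bound where
  "average_dev_bound N D T w \<equiv> \<forall>i\<in>{1..n T}. \<forall>j\<in>{1..n T} - {i}. \<forall>h\<in>H T.
    h * \<bar>\<Sum>t=1..T. N T i j (obs T i j t w) - (\<integral>w. N T i j (obs T i j t w) \<partial>M T)\<bar> \<le> D * rate T h"

lemma KM_nonneg: "0 \<le> KM" using order_trans[OF abs_ge_zero K_abs[of 0]] .

lemma LK_nonneg: "0 \<le> LK" using order_trans[OF abs_ge_zero K_lip[of 0 1]] by simp

lemma G_nonneg: "0 \<le> G" using order_trans[OF abs_ge_zero \<mu>_bd] by blast

lemma C1_nonneg: "0 \<le> C1"
  using order_trans[OF _ \<epsilon>4(2)[of 1 1 1]] n_ge_2[of 1] by (simp add: integral_nonneg)

lemma K_meas [measurable]: "K \<in> borel_measurable borel"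
  using K_lip by (rule lipschitz_measurable)

lemma phi_meas [measurable]: "phi K l \<in> borel_measurable borel"
  unfolding phi_def by measurable

lemma abs_phi_le:
  assumes "0 < h"
  shows "\<bar>phi K l ((y - x) / h)\<bar> \<le> KM * indicator {x - h..x + h} y"
proof (cases "y \<in> {x - h..x + h}")
  case True
  then have "\<bar>(y - x) / h\<bar> \<le> 1" using assms by (auto simp: abs_le_iff field_simps)
  then have "\<bar>((y - x) / h) ^ l\<bar> \<le> 1" by (simp only: power_abs power_le_one abs_ge_zero)
  then have "\<bar>phi K l ((y - x) / h)\<bar> \<le> KM * 1"
    unfolding phi_def abs_mult by (intro mult_mono K_abs) (auto simp: KM_nonneg)
  then show ?thesis using True by simp
next
  case False
  then have "(y - x) / h \<notin> {-1..1}" using assms by (auto simp: field_simps)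
  then show ?thesis using False K_supp by (simp add: phi_def)
qed

text \<open>The size conditions on \<open>\<tau>\<close> are passed from \<open>hmin\<close> to
  every bandwidth in use. For the last one, \<open>h * sqrt T = sqrt h * sqrt (T * h)\<close> and
  \<open>h \<le> A\<close>.\<close>

lemma \<tau>_facts:
  "\<forall>\<^sub>F T in sequentially. 3 \<le> T \<and> 1 \<le> \<tau> T \<and> \<tau> T \<le> T \<and>
     (\<forall>h\<in>H T. \<tau> T \<le> sqrt (real T * h) * real T powr - \<eta> \<and> h * (\<tau> T)\<^sup>2 \<le> sqrt A * (sqrt (real T * h) * real T powr - \<eta>))"
proof -
  have "\<forall>\<^sub>F T in sequentially. 1 \<le> \<tau> T" using \<tau>_lim by (simp add: filterlim_at_top)
  then show ?thesis using \<tau>_le eventually_ge_at_top[of 3]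
  proof eventually_elim
    case (elim T)
    have T1: "1 \<le> T" "1 \<le> real T" using elim by auto
    have p1: "real T powr - \<eta> \<le> 1"
    proof -
      have "real T powr - \<eta> \<le> real T powr 0" using T1 \<eta>_pos by (intro powr_mono) auto
      then show ?thesis using T1 by simp
    qed
    have sq: "sqrt (real T) \<le> T" using T1 by (simp add: sqrt_le_D real_le_lsqrt power2_eq_square)
    have "\<tau> T \<le> (\<tau> T)\<^sup>2" using elim by (simp add: power2_eq_square)
    also have "\<dots> \<le> sqrt (real T) * real T powr - \<eta>" using elim by simp
    also have "\<dots> \<le> real T * 1" using sq p1 by (intro mult_mono) auto
    finally have "\<tau> T \<le> T" by simp
    moreover have "\<tau> T \<le> sqrt (real T * h) * real T powr - \<eta> \<and> h * (\<tau> T)\<^sup>2 \<le> sqrt A * (sqrt (real T * h) * real T powr - \<eta>)"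
      if h: "h \<in> H T" for h :: real
    proof
      note hb = H_bounds[OF T1(1) h]
      have "\<tau> T \<le> sqrt (real T * hmin T) * real T powr - \<eta>" using elim by blast
      also have "\<dots> \<le> sqrt (real T * h) * real T powr - \<eta>"
        using hb by (intro mult_right_mono real_sqrt_le_mono mult_left_mono) auto
      finally show "\<tau> T \<le> sqrt (real T * h) * real T powr - \<eta>" .
      have hA: "h \<le> A"
      proof -
        have "real T powr - b \<le> real T powr 0" using T1 h_pos by (intro powr_mono) auto
        then have "A * real T powr - b \<le> A * 1" using T1 h_pos by (intro mult_left_mono) auto
        then show ?thesis using hb by (simp add: hmax)
      qed
      have "h * (\<tau> T)\<^sup>2 \<le> h * (sqrt (real T) * real T powr - \<eta>)" using elim hb by (intro mult_left_mono) auto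
      also have "\<dots> = sqrt h * (sqrt (real T * h) * real T powr - \<eta>)"
        using hb by (simp add: real_sqrt_mult flip: mult.assoc)
      also have "\<dots> \<le> sqrt A * (sqrt (real T * h) * real T powr - \<eta>)"
        using hA hb by (intro mult_right_mono) auto
      finally show "h * (\<tau> T)\<^sup>2 \<le> sqrt A * (sqrt (real T * h) * real T powr - \<eta>)" .
    qed
    ultimately show ?case using elim by auto
  qed
qed

text \<open>Truncation shifts the mean of a summand by the order of \<open>h / sqrt T\<close>. The
  total shift is of order \<open>h * sqrt T\<close>, and this bound shows that it stays within the
  rate.\<close>

lemma h_sqrt_le_rate:
  assumes "3 \<le> T" "h \<in> H T"
  shows "h * sqrt (real T) \<le> sqrt A * rate T h"
proof -
  have T1: "1 \<le> T" using assms by simp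
  note hb = H_bounds[OF T1 assms(2)]
  have hA: "h \<le> A"
  proof -
    have "real T powr - b \<le> real T powr 0" using T1 h_pos by (intro powr_mono) auto
    then have "A * real T powr - b \<le> A * 1" using T1 h_pos by (intro mult_left_mono) auto
    then show ?thesis using hb by (simp add: hmax)
  qed
  have ln1: "1 \<le> ln (real T)"
  proof -
    have "3 \<le> real T" using assms by simp
    with exp_le have "exp 1 \<le> real T" by (rule order_trans)
    then show ?thesis using assms by (simp add: ln_ge_iff)
  qed
  have "h * sqrt (real T) = sqrt h * sqrt (real T * h)"
    using hb by (simp add: real_sqrt_mult flip: mult.assoc)
  also have "\<dots> \<le> sqrt A * sqrt (real T * h * ln T)"
  proof (rule mult_mono)
    have "real T * h * 1 \<le> real T * h * ln T" using ln1 hb by (intro mult_left_mono) auto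
    then show "sqrt (real T * h) \<le> sqrt (real T * h * ln T)" by simp
  qed (use hA hb h_pos in auto)
  finally show ?thesis .
qed

text \<open>Two times per individual appear because the covariance condition of the concentration
  bound involves the pair at \<open>s\<close> and at \<open>t\<close>; independence separates
  individuals, not times.\<close>

lemma indep_expectation:
  fixes f g :: "(real \<times> real) \<times> (real \<times> real) \<Rightarrow> real"
  assumes T: "1 \<le> T" "i \<in> {1..n T}" "j \<in> {1..n T} - {i}" and st: "1 \<le> s" "1 \<le> t"
    and f: "f \<in> borel_measurable borel" and g: "g \<in> borel_measurable borel"
    and fi: "integrable (M T) (\<lambda>w. f ((X T i s w, \<epsilon> T i s w), (X T i t w, \<epsilon> T i t w)))"
    and gi: "integrable (M T) (\<lambda>w. g ((X T j s w, \<epsilon> T j s w), (X T j t w, \<epsilon> T j t w)))"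
  shows "(\<integral>w. f ((X T i s w, \<epsilon> T i s w), (X T i t w, \<epsilon> T i t w)) *
      g ((X T j s w, \<epsilon> T j s w), (X T j t w, \<epsilon> T j t w)) \<partial>M T)
    = (\<integral>w. f ((X T i s w, \<epsilon> T i s w), (X T i t w, \<epsilon> T i t w)) \<partial>M T) *
      (\<integral>w. g ((X T j s w, \<epsilon> T j s w), (X T j t w, \<epsilon> T j t w)) \<partial>M T)"
proof -
  interpret prob_space "M T" by (rule prob) fact
  have c: "(\<lambda>p. k (p s, p t)) \<in> borel_measurable (PiM {1..} (\<lambda>_. borel))"
    if k: "k \<in> borel_measurable borel" for k :: "(real \<times> real) \<times> (real \<times> real) \<Rightarrow> real"
    using st by (intro measurable_compose[OF _ k] borel_measurable_Pair measurable_component_singleton) auto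
  have "indep_var borel ((\<lambda>p. f (p s, p t)) \<circ> (\<lambda>w. \<lambda>t\<in>{1..}. (X T i t w, \<epsilon> T i t w)))
     borel ((\<lambda>p. g (p s, p t)) \<circ> (\<lambda>w. \<lambda>t\<in>{1..}. (X T j t w, \<epsilon> T j t w)))"
    by (rule indep_var_compose[OF indep[OF T] c[OF f] c[OF g]])
  from indep_var_lebesgue_integral[OF this] fi gi st show ?thesis by (simp add: comp_def)
qed

lemma \<epsilon>2_integrable:
  assumes T: "1 \<le> T" "i \<in> {1..n T}" "1 \<le> t"
  shows "integrable (M T) (\<lambda>w. (\<epsilon> T i t w)\<^sup>2)" "integrable (M T) (\<epsilon> T i t)"
    "(\<integral>w. (\<epsilon> T i t w)\<^sup>2 \<partial>M T) \<le> 1 + C1"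
proof -
  interpret prob_space "M T" by (rule prob) fact
  note [measurable] = \<epsilon>_meas[OF T]
  have b: "e\<^sup>2 \<le> 1 + e ^ 4" "\<bar>e\<bar> \<le> 1 + e ^ 4" for e :: real
  proof -
    have "0 \<le> (e\<^sup>2 - 1/2)\<^sup>2" by simp
    also have "(e\<^sup>2 - 1/2)\<^sup>2 = e ^ 4 - e\<^sup>2 + 1 / 4"
      by (simp add: power2_eq_square power4_eq_xxxx algebra_simps)
    finally have *: "e\<^sup>2 \<le> 1/2 + e ^ 4" by simp
    then show "e\<^sup>2 \<le> 1 + e ^ 4" by simp
    have "0 \<le> (\<bar>e\<bar> - 1/2)\<^sup>2" by simp
    also have "(\<bar>e\<bar> - 1/2)\<^sup>2 = e\<^sup>2 - \<bar>e\<bar> + 1 / 4"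
      by (simp add: power2_eq_square algebra_simps)
    finally have "\<bar>e\<bar> \<le> 1/4 + e\<^sup>2" by simp
    then show "\<bar>e\<bar> \<le> 1 + e ^ 4" using * by simp
  qed
  have i: "integrable (M T) (\<lambda>w. 1 + (\<epsilon> T i t w) ^ 4)" using \<epsilon>4(1)[OF T] by simp
  show i2: "integrable (M T) (\<lambda>w. (\<epsilon> T i t w)\<^sup>2)"
    by (rule Bochner_Integration.integrable_bound[OF i]) (auto intro!: AE_I2 simp: b abs_of_nonneg)
  show "integrable (M T) (\<epsilon> T i t)"
    by (rule Bochner_Integration.integrable_bound[OF i]) (auto intro!: AE_I2 simp: b abs_of_nonneg)
  have "(\<integral>w. (\<epsilon> T i t w)\<^sup>2 \<partial>M T) \<le> (\<integral>w. 1 + (\<epsilon> T i t w) ^ 4 \<partial>M T)"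
    by (rule integral_mono[OF i2 i]) (rule b)
  also have "\<dots> \<le> 1 + C1" using \<epsilon>4[OF T] by (simp add: prob_space)
  finally show "(\<integral>w. (\<epsilon> T i t w)\<^sup>2 \<partial>M T) \<le> 1 + C1" .
qed

text \<open>The kernel factor is at most \<open>KM\<close> and vanishes away from \<open>x\<close>,
  so the moment conditions reduce to expectations over the window around \<open>x\<close>. Its
  Lipschitz constant in \<open>x\<close> is of order \<open>1 / h \<le> T / a\<close>, and the other
  factor is of order \<open>\<tau> T \<le> T\<close>, which together stay below
  \<open>T ^ 3\<close>.\<close>

lemma whp_kernel_statistic:
  fixes N :: "nat \<Rightarrow> nat \<Rightarrow> nat \<Rightarrow> (real \<times> real) \<times> (real \<times> real) \<Rightarrow> real"
  assumes meas: "\<And>T i j. N T i j \<in> borel_measurable (borel \<Otimes>\<^sub>M borel)"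
    and bd: "\<And>T i j z. 1 \<le> \<tau> T \<Longrightarrow> \<bar>N T i j z\<bar> \<le> G + \<tau> T"
    and C2: "0 \<le> C2"
    and v1: "\<And>T i j h x t. 1 \<le> T \<Longrightarrow> 1 \<le> \<tau> T \<Longrightarrow> i \<in> {1..n T} \<Longrightarrow> j \<in> {1..n T} - {i} \<Longrightarrow> 0 < h \<Longrightarrow> 1 \<le> t \<Longrightarrow>
      (\<integral>w. near T i h x t w * (N T i j (obs T i j t w))\<^sup>2 \<partial>M T) \<le> C2 * h"
    and v2: "\<And>T i j h x s t. 1 \<le> T \<Longrightarrow> 1 \<le> \<tau> T \<Longrightarrow> i \<in> {1..n T} \<Longrightarrow> j \<in> {1..n T} - {i} \<Longrightarrow> 0 < h \<Longrightarrow> 1 \<le> s \<Longrightarrow> 1 \<le> t \<Longrightarrow>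
      \<bar>int s - int t\<bar> \<ge> int ls \<Longrightarrow>
      (\<integral>w. near T i h x s w * near T i h x t w *
        \<bar>N T i j (obs T i j s w) * N T i j (obs T i j t w)\<bar> \<partial>M T) \<le> C2 * h\<^sup>2"
  shows "\<exists>D\<ge>0. whp M (kernel_dev_bound N l D)"
proof -
  define v where "v T i j h x z = phi K l ((fst (fst z) - x) / h) * N T i j z"
    for T i j :: nat and h x :: real and z :: "(real \<times> real) \<times> (real \<times> real)"
  define L where "L = LK + real l * KM"
  have L0: "0 \<le> L" using LK_nonneg KM_nonneg by (simp add: L_def)
  \<comment> \<open>The three summands serve the size bound, the two moment bounds and the Lipschitz
    bound.\<close>
  define C0 where "C0 = KM * (G + 1) + KM\<^sup>2 * C2 + L * (G + 1) / a"
  have parts: "0 \<le> KM * (G + 1)" "0 \<le> KM\<^sup>2 * C2" "0 \<le> L * (G + 1) / a"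
    using KM_nonneg G_nonneg C2 L0 h_pos by auto
  have vobs: "v T i j h x (obs T i j t w) = kw T i l h x t w * N T i j (obs T i j t w)" for T i j h x t w
    by (simp add: v_def obs_def)
  have Nm: "(\<lambda>w. N T i j (obs T i j t w)) \<in> borel_measurable (M T)"
    if "1 \<le> T" "i \<in> {1..n T}" "j \<in> {1..n T} - {i}" "1 \<le> t" for T i j t
    using measurable_compose[OF obs_meas meas] that by auto
  have "\<exists>D\<ge>0. whp M (dev_bound v D)"
  proof (rule whp_statistic[where ?C0.0 = C0 and ls = ls])
    show "v T i j h x \<in> borel_measurable (borel \<Otimes>\<^sub>M borel)" for T i j h x
    proof -
      have "(\<lambda>z. (fst (fst z) - x) / h) \<in> borel_measurable ((borel \<Otimes>\<^sub>M borel) :: ((real \<times> real) \<times> (real \<times> real)) measure)"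
        unfolding borel_prod[symmetric] by measurable
      then show ?thesis
        unfolding v_def by (intro borel_measurable_times meas measurable_compose[OF _ phi_meas])
    qed
    show "0 \<le> C0" using parts by (simp add: C0_def)
    show "\<forall>\<^sub>F T in sequentially. \<forall>i\<in>{1..n T}. \<forall>j\<in>{1..n T} - {i}. \<forall>h\<in>H T. \<forall>x\<in>{0..1}. \<forall>z.
      \<bar>v T i j h x z\<bar> \<le> C0 * (sqrt (real T * h) * real T powr - \<eta>)"
      using \<tau>_facts
    proof eventually_elim
      case (elim T)
      show ?case
      proof (intro ballI allI)
        fix i j h x z assume h: "h \<in> H T"
        have h0: "0 < h" using H_bounds(4)[OF _ h] elim by simp
        have "\<bar>v T i j h x z\<bar> \<le> (KM * indicator {x - h..x + h} (fst (fst z))) * (G + \<tau> T)"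
          unfolding v_def abs_mult using elim bd abs_phi_le[OF h0] KM_nonneg by (intro mult_mono) auto
        also have "\<dots> \<le> (KM * 1) * ((G + 1) * \<tau> T)"
          using elim G_nonneg KM_nonneg by (intro mult_mono) (auto simp: indicator_def algebra_simps mult_le_cancel_left1)
        also have "\<dots> \<le> (KM * (G + 1)) * (sqrt (real T * h) * real T powr - \<eta>)"
          using elim h parts by (simp only: mult.assoc mult_1_right) (intro mult_left_mono, auto simp: KM_nonneg G_nonneg)
        also have "\<dots> \<le> C0 * (sqrt (real T * h) * real T powr - \<eta>)"
          using parts h0 by (intro mult_right_mono) (auto simp: C0_def)
        finally show "\<bar>v T i j h x z\<bar> \<le> C0 * (sqrt (real T * h) * real T powr - \<eta>)" .
      qed
    qed
    show "\<forall>\<^sub>F T in sequentially. \<forall>i\<in>{1..n T}. \<forall>j\<in>{1..n T} - {i}. \<forall>h\<in>H T. \<forall>x\<in>{0..1}. \<forall>y\<in>{0..1}. \<forall>z.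
      \<bar>v T i j h x z - v T i j h y z\<bar> \<le> C0 * real T ^ 3 * \<bar>x - y\<bar>"
      using \<tau>_facts
    proof eventually_elim
      case (elim T)
      have T1: "1 \<le> T" "0 < real T" "1 \<le> real T" using elim by auto
      show ?case
      proof (intro ballI allI)
        fix i j :: nat and h x y :: real and z :: "(real \<times> real) \<times> (real \<times> real)" assume h: "h \<in> H T"
        note hb = H_bounds[OF T1(1) h]
        \<comment> \<open>Here \<open>B < 1\<close> enters: even the smallest bandwidth is at least
          of the order \<open>1 / T\<close>.\<close>
        have "1 / h \<le> 1 / hmin T" using hb by (intro divide_left_mono) auto
        also have "\<dots> = real T powr B / a" using h_pos by (simp add: hmin powr_minus field_simps)
        also have "\<dots> \<le> real T powr 1 / a" using h_pos T1 by (intro divide_right_mono powr_mono) auto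
        finally have ih: "1 / h \<le> T / a" using T1 by simp
        let ?u = "\<lambda>x. (fst (fst z) - x) / h"
        have "\<bar>v T i j h x z - v T i j h y z\<bar> = \<bar>phi K l (?u x) - phi K l (?u y)\<bar> * \<bar>N T i j z\<bar>"
          by (simp add: v_def abs_mult flip: left_diff_distrib)
        also have "\<dots> \<le> (L * \<bar>?u x - ?u y\<bar>) * ((G + 1) * \<tau> T)"
        proof (intro mult_mono)
          show "\<bar>phi K l (?u x) - phi K l (?u y)\<bar> \<le> L * \<bar>?u x - ?u y\<bar>"
            unfolding L_def by (rule lipschitz_phi[OF K_abs K_supp K_lip])
          have "\<bar>N T i j z\<bar> \<le> G + \<tau> T" using bd elim by auto
          also have "\<dots> \<le> (G + 1) * \<tau> T" using elim G_nonneg by (simp add: algebra_simps mult_le_cancel_left1)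
          finally show "\<bar>N T i j z\<bar> \<le> (G + 1) * \<tau> T" .
        qed (use L0 in auto)
        also have "\<bar>?u x - ?u y\<bar> = \<bar>x - y\<bar> * (1 / h)"
          using hb by (simp add: abs_divide flip: diff_divide_distrib)
        also have "(L * (\<bar>x - y\<bar> * (1 / h))) * ((G + 1) * \<tau> T) \<le> (L * (\<bar>x - y\<bar> * (T / a))) * ((G + 1) * T)"
          using ih L0 G_nonneg elim hb h_pos by (intro mult_mono) (auto intro!: mult_nonneg_nonneg)
        also have "\<dots> = (L * (G + 1) / a) * T ^ 2 * \<bar>x - y\<bar>" by (simp add: power2_eq_square)
        also have "\<dots> \<le> C0 * T ^ 3 * \<bar>x - y\<bar>"
          using parts T1 power_increasing[of 2 3 "real T"] by (intro mult_mono) (auto simp: C0_def)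
        finally show "\<bar>v T i j h x z - v T i j h y z\<bar> \<le> C0 * real T ^ 3 * \<bar>x - y\<bar>" by simp
      qed
    qed
    show "\<forall>\<^sub>F T in sequentially. \<forall>i\<in>{1..n T}. \<forall>j\<in>{1..n T} - {i}. \<forall>h\<in>H T. \<forall>x\<in>{0..1}. \<forall>t\<in>{1..T}.
      (\<integral>w. (v T i j h x (obs T i j t w))\<^sup>2 \<partial>M T) \<le> C0 * h"
      using \<tau>_facts
    proof eventually_elim
      case (elim T)
      then have T1: "1 \<le> T" by simp
      interpret prob_space "M T" by (rule prob) fact
      show ?case
      proof (intro ballI)
        fix i j h x t assume i: "i \<in> {1..n T}" and j: "j \<in> {1..n T} - {i}" and h: "h \<in> H T" and t: "t \<in> {1..T}"
        have h0: "0 < h" using H_bounds(4)[OF T1 h] .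
        have t1: "1 \<le> t" using t by simp
        note [measurable] = X_meas[OF T1 i t1] Nm[OF T1 i j t1]
        have "(\<integral>w. (v T i j h x (obs T i j t w))\<^sup>2 \<partial>M T)
          \<le> (\<integral>w. KM\<^sup>2 * (near T i h x t w * (N T i j (obs T i j t w))\<^sup>2) \<partial>M T)"
        proof (rule integral_mono')
          show "integrable (M T) (\<lambda>w. KM\<^sup>2 * (near T i h x t w * (N T i j (obs T i j t w))\<^sup>2))"
          proof (intro integrable_mult_right integrable_const_bound[where B = "(G + \<tau> T)\<^sup>2"])
            show "AE w in M T. norm (near T i h x t w * (N T i j (obs T i j t w))\<^sup>2) \<le> (G + \<tau> T)\<^sup>2"
            proof (rule AE_I2)
              fix w
              have "\<bar>N T i j (obs T i j t w)\<bar>\<^sup>2 \<le> (G + \<tau> T)\<^sup>2" using bd elim by (intro power_mono) auto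
              then show "norm (near T i h x t w * (N T i j (obs T i j t w))\<^sup>2) \<le> (G + \<tau> T)\<^sup>2"
                by (auto simp: indicator_def)
            qed
          qed measurable
          fix w
          have "(v T i j h x (obs T i j t w))\<^sup>2 = \<bar>kw T i l h x t w\<bar>\<^sup>2 * (N T i j (obs T i j t w))\<^sup>2"
            by (simp add: vobs power_mult_distrib)
          also have "\<dots> \<le> (KM * near T i h x t w)\<^sup>2 * (N T i j (obs T i j t w))\<^sup>2"
            by (intro mult_right_mono power_mono abs_phi_le[OF h0]) auto
          also have "\<dots> = KM\<^sup>2 * (near T i h x t w * (N T i j (obs T i j t w))\<^sup>2)"
            by (auto simp: indicator_def power_mult_distrib)
          finally show "(v T i j h x (obs T i j t w))\<^sup>2
            \<le> KM\<^sup>2 * (near T i h x t w * (N T i j (obs T i j t w))\<^sup>2)" .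
        qed simp
        also have "\<dots> = KM\<^sup>2 * (\<integral>w. (near T i h x t w * (N T i j (obs T i j t w))\<^sup>2) \<partial>M T)" by simp
        also have "\<dots> \<le> KM\<^sup>2 * (C2 * h)" using v1[OF T1 _ i j h0 t1] elim by (intro mult_left_mono) auto
        also have "\<dots> \<le> C0 * h" using parts h0 unfolding mult.assoc[symmetric] by (intro mult_right_mono) (auto simp: C0_def)
        finally show "(\<integral>w. (v T i j h x (obs T i j t w))\<^sup>2 \<partial>M T) \<le> C0 * h" .
      qed
    qed
    show "\<forall>\<^sub>F T in sequentially. \<forall>i\<in>{1..n T}. \<forall>j\<in>{1..n T} - {i}. \<forall>h\<in>H T. \<forall>x\<in>{0..1}. \<forall>s\<in>{1..T}. \<forall>t\<in>{1..T}.
      \<bar>int s - int t\<bar> \<ge> int ls \<longrightarrow>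
      (\<integral>w. \<bar>v T i j h x (obs T i j s w) * v T i j h x (obs T i j t w)\<bar> \<partial>M T) \<le> C0 * h\<^sup>2"
      using \<tau>_facts
    proof eventually_elim
      case (elim T)
      then have T1: "1 \<le> T" by simp
      interpret prob_space "M T" by (rule prob) fact
      show ?case
      proof (intro ballI impI)
        fix i j h x s t assume i: "i \<in> {1..n T}" and j: "j \<in> {1..n T} - {i}" and h: "h \<in> H T"
          and s: "s \<in> {1..T}" and t: "t \<in> {1..T}" and st: "int ls \<le> \<bar>int s - int t\<bar>"
        have h0: "0 < h" using H_bounds(4)[OF T1 h] .
        have t1: "1 \<le> t" and s1: "1 \<le> s" using t s by auto
        note [measurable] = X_meas[OF T1 i t1] Nm[OF T1 i j t1] X_meas[OF T1 i s1] Nm[OF T1 i j s1]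
        let ?I = "\<lambda>t w. near T i h x t w"
        let ?N = "\<lambda>t w. N T i j (obs T i j t w)"
        have "(\<integral>w. \<bar>v T i j h x (obs T i j s w) * v T i j h x (obs T i j t w)\<bar> \<partial>M T)
          \<le> (\<integral>w. KM\<^sup>2 * (?I s w * ?I t w * \<bar>?N s w * ?N t w\<bar>) \<partial>M T)"
        proof (rule integral_mono')
          show "integrable (M T) (\<lambda>w. KM\<^sup>2 * (?I s w * ?I t w * \<bar>?N s w * ?N t w\<bar>))"
          proof (intro integrable_mult_right integrable_const_bound[where B = "(G + \<tau> T) * (G + \<tau> T)"])
            show "AE w in M T. norm (?I s w * ?I t w * \<bar>?N s w * ?N t w\<bar>) \<le> (G + \<tau> T) * (G + \<tau> T)"
            proof (rule AE_I2)
              fix w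
              have "\<bar>?N s w\<bar> * \<bar>?N t w\<bar> \<le> (G + \<tau> T) * (G + \<tau> T)"
                using bd elim G_nonneg by (intro mult_mono) auto
              then show "norm (?I s w * ?I t w * \<bar>?N s w * ?N t w\<bar>) \<le> (G + \<tau> T) * (G + \<tau> T)"
                using elim G_nonneg by (auto simp: indicator_def abs_mult)
            qed
          qed measurable
          fix w
          have "\<bar>v T i j h x (obs T i j s w) * v T i j h x (obs T i j t w)\<bar>
            = (\<bar>kw T i l h x s w\<bar> * \<bar>kw T i l h x t w\<bar>) * \<bar>?N s w * ?N t w\<bar>"
            by (simp add: vobs abs_mult)
          also have "\<dots> \<le> ((KM * ?I s w) * (KM * ?I t w)) * \<bar>?N s w * ?N t w\<bar>"
            by (intro mult_right_mono mult_mono abs_phi_le[OF h0]) (auto simp: KM_nonneg)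
          also have "\<dots> = KM\<^sup>2 * (?I s w * ?I t w * \<bar>?N s w * ?N t w\<bar>)"
            by (simp add: power2_eq_square)
          finally show "\<bar>v T i j h x (obs T i j s w) * v T i j h x (obs T i j t w)\<bar>
            \<le> KM\<^sup>2 * (?I s w * ?I t w * \<bar>?N s w * ?N t w\<bar>)" .
        qed simp
        also have "\<dots> = KM\<^sup>2 * (\<integral>w. ?I s w * ?I t w * \<bar>?N s w * ?N t w\<bar> \<partial>M T)" by simp
        also have "\<dots> \<le> KM\<^sup>2 * (C2 * h\<^sup>2)" using v2[OF T1 _ i j h0 s1 t1 st] elim by (intro mult_left_mono) auto
        also have "\<dots> \<le> C0 * h\<^sup>2" using parts h0 unfolding mult.assoc[symmetric] by (intro mult_right_mono) (auto simp: C0_def)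
        finally show "(\<integral>w. \<bar>v T i j h x (obs T i j s w) * v T i j h x (obs T i j t w)\<bar> \<partial>M T) \<le> C0 * h\<^sup>2" .
      qed
    qed
  qed
  then show ?thesis unfolding vobs .
qed

text \<open>
  Sums without a kernel are treated as kernel sums multiplied by the bandwidth: the factor \<open>h\<close> provides
  the moments of order \<open>h\<close> and \<open>h\<^sup>2\<close> that \<open>whp_statistic\<close> requires.
\<close>

lemma whp_bandwidth_statistic:
  fixes N :: "nat \<Rightarrow> nat \<Rightarrow> nat \<Rightarrow> (real \<times> real) \<times> (real \<times> real) \<Rightarrow> real"
  assumes meas: "\<And>T i j. N T i j \<in> borel_measurable (borel \<Otimes>\<^sub>M borel)"
    and bd: "\<And>T i j z. 1 \<le> \<tau> T \<Longrightarrow> \<bar>N T i j z\<bar> \<le> C2 * (\<tau> T)\<^sup>2"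
    and C2: "0 \<le> C2"
    and v1: "\<And>T i j t. 1 \<le> T \<Longrightarrow> 1 \<le> \<tau> T \<Longrightarrow> i \<in> {1..n T} \<Longrightarrow> j \<in> {1..n T} - {i} \<Longrightarrow> 1 \<le> t \<Longrightarrow>
      (\<integral>w. (N T i j (obs T i j t w))\<^sup>2 \<partial>M T) \<le> C2"
  shows "\<exists>D\<ge>0. whp M (average_dev_bound N D)"
proof -
  define v where "v T i j h x z = h * N T i j z"
    for T i j :: nat and h x :: real and z :: "(real \<times> real) \<times> (real \<times> real)"
  define C0 where "C0 = sqrt A * C2 + C2 * A + C2"
  have parts: "0 \<le> sqrt A * C2" "0 \<le> C2 * A" using C2 h_pos by auto
  have hA: "h \<le> A" if "3 \<le> T" "h \<in> H T" for T h
  proof -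
    have T1: "1 \<le> T" using that by simp
    have "real T powr - b \<le> T powr 0" using T1 h_pos by (intro powr_mono) auto
    then have "A * real T powr - b \<le> A * 1" using T1 h_pos by (intro mult_left_mono) auto
    then show ?thesis using H_bounds[OF T1 that(2)] by (simp add: hmax)
  qed
  have Nm: "(\<lambda>w. N T i j (obs T i j t w)) \<in> borel_measurable (M T)"
    if "1 \<le> T" "i \<in> {1..n T}" "j \<in> {1..n T} - {i}" "1 \<le> t" for T i j t
    using measurable_compose[OF obs_meas meas] that by auto
  have Nsq: "integrable (M T) (\<lambda>w. (N T i j (obs T i j t w))\<^sup>2)"
    if "1 \<le> T" "1 \<le> \<tau> T" "i \<in> {1..n T}" "j \<in> {1..n T} - {i}" "1 \<le> t" for T i j t
  proof -
    interpret prob_space "M T" by (rule prob) fact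
    note [measurable] = Nm[OF that(1,3,4,5)]
    show ?thesis
    proof (rule integrable_const_bound[where B = "(C2 * (\<tau> T)\<^sup>2)\<^sup>2"])
      show "AE w in M T. norm ((N T i j (obs T i j t w))\<^sup>2) \<le> (C2 * (\<tau> T)\<^sup>2)\<^sup>2"
      proof (rule AE_I2)
        fix w
        have "\<bar>N T i j (obs T i j t w)\<bar>\<^sup>2 \<le> (C2 * (\<tau> T)\<^sup>2)\<^sup>2" using bd that by (intro power_mono) auto
        then show "norm ((N T i j (obs T i j t w))\<^sup>2) \<le> (C2 * (\<tau> T)\<^sup>2)\<^sup>2" by simp
      qed
    qed measurable
  qed
  have "\<exists>D\<ge>0. whp M (dev_bound v D)"
  proof (rule whp_statistic[where ?C0.0 = C0 and ls = ls])
    show "v T i j h x \<in> borel_measurable (borel \<Otimes>\<^sub>M borel)" for T i j h x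
      unfolding v_def by (intro borel_measurable_times meas borel_measurable_const)
    show "0 \<le> C0" using parts C2 by (simp add: C0_def)
    show "\<forall>\<^sub>F T in sequentially. \<forall>i\<in>{1..n T}. \<forall>j\<in>{1..n T} - {i}. \<forall>h\<in>H T. \<forall>x\<in>{0..1}. \<forall>z.
      \<bar>v T i j h x z\<bar> \<le> C0 * (sqrt (real T * h) * real T powr - \<eta>)"
      using \<tau>_facts
    proof eventually_elim
      case (elim T)
      show ?case
      proof (intro ballI allI)
        fix i j :: nat and h x :: real and z :: "(real \<times> real) \<times> (real \<times> real)" assume h: "h \<in> H T"
        have h0: "0 < h" using H_bounds(4)[OF _ h] elim by simp
        have "\<bar>v T i j h x z\<bar> \<le> h * (C2 * (\<tau> T)\<^sup>2)"
          unfolding v_def abs_mult using elim bd h0 by (intro mult_mono) auto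
        also have "\<dots> = C2 * (h * (\<tau> T)\<^sup>2)" by simp
        also have "\<dots> \<le> C2 * (sqrt A * (sqrt (real T * h) * real T powr - \<eta>))"
          using elim h C2 by (intro mult_left_mono) auto
        also have "\<dots> = (sqrt A * C2) * (sqrt (real T * h) * real T powr - \<eta>)" by simp
        also have "\<dots> \<le> C0 * (sqrt (real T * h) * real T powr - \<eta>)"
          using parts C2 h0 by (intro mult_right_mono) (auto simp: C0_def)
        finally show "\<bar>v T i j h x z\<bar> \<le> C0 * (sqrt (real T * h) * real T powr - \<eta>)" .
      qed
    qed
    show "\<forall>\<^sub>F T in sequentially. \<forall>i\<in>{1..n T}. \<forall>j\<in>{1..n T} - {i}. \<forall>h\<in>H T. \<forall>x\<in>{0..1}. \<forall>y\<in>{0..1}. \<forall>z.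
      \<bar>v T i j h x z - v T i j h y z\<bar> \<le> C0 * real T ^ 3 * \<bar>x - y\<bar>"
      using parts C2 by (simp add: v_def C0_def)
    show "\<forall>\<^sub>F T in sequentially. \<forall>i\<in>{1..n T}. \<forall>j\<in>{1..n T} - {i}. \<forall>h\<in>H T. \<forall>x\<in>{0..1}. \<forall>t\<in>{1..T}.
      (\<integral>w. (v T i j h x (obs T i j t w))\<^sup>2 \<partial>M T) \<le> C0 * h"
      using \<tau>_facts
    proof eventually_elim
      case (elim T)
      then have T1: "1 \<le> T" by simp
      show ?case
      proof (intro ballI)
        fix i j h x t assume i: "i \<in> {1..n T}" and j: "j \<in> {1..n T} - {i}" and h: "h \<in> H T" and t: "t \<in> {1..T}"
        have h0: "0 < h" using H_bounds(4)[OF T1 h] .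
        have t1: "1 \<le> t" using t by simp
        have "(\<integral>w. (v T i j h x (obs T i j t w))\<^sup>2 \<partial>M T) = h * h * (\<integral>w. (N T i j (obs T i j t w))\<^sup>2 \<partial>M T)"
          by (simp add: v_def power_mult_distrib) (simp add: power2_eq_square)
        also have "\<dots> \<le> h * A * C2"
          using v1[OF T1 _ i j t1] elim h0 hA[OF _ h] by (intro mult_mono) auto
        also have "\<dots> = (C2 * A) * h" by simp
        also have "\<dots> \<le> C0 * h" using parts C2 h0 by (intro mult_right_mono) (auto simp: C0_def)
        finally show "(\<integral>w. (v T i j h x (obs T i j t w))\<^sup>2 \<partial>M T) \<le> C0 * h" .
      qed
    qed
    show "\<forall>\<^sub>F T in sequentially. \<forall>i\<in>{1..n T}. \<forall>j\<in>{1..n T} - {i}. \<forall>h\<in>H T. \<forall>x\<in>{0..1}. \<forall>s\<in>{1..T}. \<forall>t\<in>{1..T}.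
      \<bar>int s - int t\<bar> \<ge> int ls \<longrightarrow>
      (\<integral>w. \<bar>v T i j h x (obs T i j s w) * v T i j h x (obs T i j t w)\<bar> \<partial>M T) \<le> C0 * h\<^sup>2"
      using \<tau>_facts
    proof eventually_elim
      case (elim T)
      then have T1: "1 \<le> T" by simp
      show ?case
      proof (intro ballI impI)
        fix i j h x s t assume i: "i \<in> {1..n T}" and j: "j \<in> {1..n T} - {i}" and h: "h \<in> H T"
          and s: "s \<in> {1..T}" and t: "t \<in> {1..T}" and st: "int ls \<le> \<bar>int s - int t\<bar>"
        have h0: "0 < h" using H_bounds(4)[OF T1 h] .
        have t1: "1 \<le> t" and s1: "1 \<le> s" using t s by auto
        let ?N = "\<lambda>t w. N T i j (obs T i j t w)"
        have iN: "integrable (M T) (\<lambda>w. (?N s w)\<^sup>2)" "integrable (M T) (\<lambda>w. (?N t w)\<^sup>2)"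
          using Nsq[OF T1 _ i j s1] Nsq[OF T1 _ i j t1] elim by auto
        have "(\<integral>w. \<bar>?N s w * ?N t w\<bar> \<partial>M T) \<le> (\<integral>w. ((?N s w)\<^sup>2 + (?N t w)\<^sup>2) / 2 \<partial>M T)"
          by (rule integral_mono') (use iN abs_mult_le_half_squares in auto)
        also have "\<dots> = ((\<integral>w. (?N s w)\<^sup>2 \<partial>M T) + (\<integral>w. (?N t w)\<^sup>2 \<partial>M T)) / 2"
          by (simp only: integral_divide_zero Bochner_Integration.integral_add[OF iN])
        also have "\<dots> \<le> (C2 + C2) / 2"
          by (intro divide_right_mono add_mono v1[OF T1 _ i j s1] v1[OF T1 _ i j t1]) (use elim in auto)
        finally have e: "(\<integral>w. \<bar>?N s w * ?N t w\<bar> \<partial>M T) \<le> C2" by (simp only: field_sum_of_halves add_divide_distrib)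
        have "\<bar>v T i j h x (obs T i j s w) * v T i j h x (obs T i j t w)\<bar> = h\<^sup>2 * \<bar>?N s w * ?N t w\<bar>" for w
          using h0 by (simp add: v_def abs_mult power2_eq_square)
        then have "(\<integral>w. \<bar>v T i j h x (obs T i j s w) * v T i j h x (obs T i j t w)\<bar> \<partial>M T)
          = h\<^sup>2 * (\<integral>w. \<bar>?N s w * ?N t w\<bar> \<partial>M T)"
          by (simp only: integral_mult_right_zero)
        also have "\<dots> \<le> h\<^sup>2 * C0"
          by (rule mult_left_mono) (use e parts C2 in \<open>auto simp: C0_def\<close>)
        finally show "(\<integral>w. \<bar>v T i j h x (obs T i j s w) * v T i j h x (obs T i j t w)\<bar> \<partial>M T) \<le> C0 * h\<^sup>2"
          by (simp only: mult.commute)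
      qed
    qed
  qed
  then obtain D where D: "D \<ge> 0" "whp M (dev_bound v D)"
    by (elim exE conjE) (rule that)
  have "whp M (average_dev_bound N D)"
  proof (rule whp_mono[OF D(2)])
    show "\<forall>\<^sub>F T in sequentially. \<forall>w\<in>space (M T). dev_bound v D T w \<longrightarrow>
      average_dev_bound N D T w"
      using eventually_ge_at_top[of 1]
    proof eventually_elim
      case (elim T)
      show ?case
      proof (intro ballI impI)
        fix w i j h assume *: "dev_bound v D T w"
          and i: "i \<in> {1..n T}" "j \<in> {1..n T} - {i}" and h: "h \<in> H T"
        \<comment> \<open>The statistic does not depend on \<open>x\<close>; the point 0 is an
          arbitrary member of the unit interval.\<close>
        have "\<bar>\<Sum>t=1..T. v T i j h 0 (obs T i j t w) - (\<integral>w. v T i j h 0 (obs T i j t w) \<partial>M T)\<bar> \<le> D * rate T h"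
          by (rule *[rule_format, OF i h]) simp
        also have "(\<Sum>t=1..T. v T i j h 0 (obs T i j t w) - (\<integral>w. v T i j h 0 (obs T i j t w) \<partial>M T))
          = h * (\<Sum>t=1..T. N T i j (obs T i j t w) - (\<integral>w. N T i j (obs T i j t w) \<partial>M T))"
          by (simp add: v_def sum_distrib_left right_diff_distrib)
        finally show "h * \<bar>\<Sum>t=1..T. N T i j (obs T i j t w) - (\<integral>w. N T i j (obs T i j t w) \<partial>M T)\<bar> \<le> D * rate T h"
          using H_bounds(4)[OF elim h] by (simp add: abs_mult)
      qed
    qed
  qed
  then show ?thesis using D(1) by blast
qed

section \<open>Population moments and the deviations of the individual sums\<close>

definition S_mean :: "nat \<Rightarrow> nat \<Rightarrow> nat \<Rightarrow> real \<Rightarrow> real \<Rightarrow> real" where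
  "S_mean T i l h x = (\<integral>w. kw T i l h x 1 w \<partial>M T)"

definition R_mean :: "nat \<Rightarrow> nat \<Rightarrow> nat \<Rightarrow> real \<Rightarrow> real \<Rightarrow> real" where
  "R_mean T i l h x = (\<integral>w. kw T i l h x 1 w * \<mu> T i (X T i 1 w) \<partial>M T)"

text \<open>An observation freed of its fixed effects. Since these cancel in \<open>Y_star\<close>,
  the estimator is a function of the regressors and of these variables.\<close>

definition noise where "noise T j t w = \<mu> T j (X T j t w) + \<epsilon> T j t w"

lemma expectation_X_eq:
  assumes "1 \<le> T" "i \<in> {1..n T}" "1 \<le> t" and f: "f \<in> borel_measurable borel"
  shows "(\<integral>w. f (X T i t w) \<partial>M T) = (\<integral>w. f (X T i 1 w) \<partial>M T :: real)"
proof -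
  have "(\<integral>w. f (X T i t w) \<partial>M T) = (\<integral>x. f x \<partial>distr (M T) borel (X T i t))"
    using X_meas[OF assms(1-3)] f by (simp add: integral_distr)
  also have "\<dots> = (\<integral>x. f x \<partial>distr (M T) borel (X T i 1))" using same_law[OF assms(1-3)] by simp
  also have "\<dots> = (\<integral>w. f (X T i 1 w) \<partial>M T)"
    using X_meas[OF assms(1,2), of 1] f by (simp add: integral_distr)
  finally show ?thesis .
qed

lemma exists_other: "1 \<le> T \<Longrightarrow> \<exists>j. j \<in> {1..n T} - {i}"
  using n_ge_2[of T] by (cases "i = 1") (auto intro: exI[of _ 1] exI[of _ 2])

text \<open>For bounded functions of an individual's own regressor the moment conditions follow from
  the density bounds alone. A second individual is chosen only to fit the format of pairs, and the
  common law of the regressors makes all \<open>T\<close> expectations equal to the one at time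
  1.\<close>

lemma whp_own_bounded:
  assumes N: "\<And>T i. N T i \<in> borel_measurable borel" "\<And>T i x. \<bar>N T i x :: real\<bar> \<le> 1 + G"
    and N': "\<And>T i x. 1 \<le> \<tau> T \<Longrightarrow> \<bar>N T i x\<bar> \<le> G + \<tau> T"
  shows "\<exists>D\<ge>0. whp M (\<lambda>T w. \<forall>i\<in>{1..n T}. \<forall>h\<in>H T. \<forall>x\<in>{0..1}.
      \<bar>(\<Sum>t=1..T. kw T i l h x t w * N T i (X T i t w))
        - T * (\<integral>w. kw T i l h x 1 w * N T i (X T i 1 w) \<partial>M T)\<bar> \<le> D * rate T h)"
proof -
  define NN where "NN T i j z = N T i (fst (fst z))" for T i j :: nat and z :: "(real \<times> real) \<times> (real \<times> real)"
  have NNobs: "NN T i j (obs T i j t w) = N T i (X T i t w)" for T i j t w by (simp add: NN_def obs_def)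
  have "\<exists>D\<ge>0. whp M (kernel_dev_bound NN l D)"
  proof (rule whp_kernel_statistic[where ?C2.0 = "(1 + G)\<^sup>2 * C1"])
    show "NN T i j \<in> borel_measurable (borel \<Otimes>\<^sub>M borel)" for T i j
      unfolding NN_def borel_prod[symmetric] by (rule measurable_compose[OF _ N(1)]) measurable
    show "\<bar>NN T i j z\<bar> \<le> G + \<tau> T" if "1 \<le> \<tau> T" for T i j z using N'[OF that] by (simp add: NN_def)
    show "0 \<le> (1 + G)\<^sup>2 * C1" using C1_nonneg by simp
    fix T i j h x assume T: "1 \<le> T" and i: "i \<in> {1..n T}" and h: "0 < (h::real)"
    interpret prob_space "M T" by (rule prob) fact
    {
      fix t :: nat assume t: "1 \<le> t"
      note [measurable] = X_meas[OF T i t]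
      have "expectation (\<lambda>w. near T i h x t w * (NN T i j (obs T i j t w))\<^sup>2)
        \<le> expectation (\<lambda>w. (1 + G)\<^sup>2 * near T i h x t w)"
      proof (rule integral_mono')
        show "integrable (M T) (\<lambda>w. (1 + G)\<^sup>2 * near T i h x t w)"
          by (intro integrable_mult_right integrable_const_bound[where B = 1]) (auto simp: indicator_def)
        fix w
        have "\<bar>N T i (X T i t w)\<bar>\<^sup>2 \<le> (1 + G)\<^sup>2" by (intro power_mono N) auto
        then show "near T i h x t w * (NN T i j (obs T i j t w))\<^sup>2
          \<le> (1 + G)\<^sup>2 * near T i h x t w" by (auto simp: NNobs indicator_def)
      qed simp
      also have "\<dots> \<le> (1 + G)\<^sup>2 * (C1 * h)" using X_near[OF T i t h] by (simp add: mult_left_mono)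
      finally show "expectation (\<lambda>w. near T i h x t w * (NN T i j (obs T i j t w))\<^sup>2)
        \<le> (1 + G)\<^sup>2 * C1 * h" by simp
    next
      fix s t :: nat assume s: "1 \<le> s" and t: "1 \<le> t" and st: "int ls \<le> \<bar>int s - int t\<bar>"
      note [measurable] = X_meas[OF T i t] X_meas[OF T i s]
      have st': "s \<noteq> t" using st ls_pos by auto
      have "expectation (\<lambda>w. near T i h x s w * near T i h x t w *
          \<bar>NN T i j (obs T i j s w) * NN T i j (obs T i j t w)\<bar>)
        \<le> expectation (\<lambda>w. (1 + G)\<^sup>2 * (near T i h x s w * near T i h x t w))"
      proof (rule integral_mono')
        show "integrable (M T) (\<lambda>w. (1 + G)\<^sup>2 * (near T i h x s w * near T i h x t w) :: real)"
          by (intro integrable_mult_right integrable_const_bound[where B = 1]) (auto simp: indicator_def)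
        fix w
        have "\<bar>N T i (X T i s w)\<bar> * \<bar>N T i (X T i t w)\<bar> \<le> (1 + G) * (1 + G)"
          using G_nonneg by (intro mult_mono N) auto
        then show "near T i h x s w * near T i h x t w *
            \<bar>NN T i j (obs T i j s w) * NN T i j (obs T i j t w)\<bar>
          \<le> (1 + G)\<^sup>2 * (near T i h x s w * near T i h x t w)"
          by (auto simp: NNobs indicator_def abs_mult power2_eq_square)
      qed (simp add: mult_nonneg_nonneg)
      also have "\<dots> \<le> (1 + G)\<^sup>2 * (C1 * h\<^sup>2)" using X_near2[OF T i s t st' h] by (simp add: mult_left_mono)
      finally show "expectation (\<lambda>w. near T i h x s w * near T i h x t w *
          \<bar>NN T i j (obs T i j s w) * NN T i j (obs T i j t w)\<bar>) \<le> (1 + G)\<^sup>2 * C1 * h\<^sup>2" by simp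
    }
  qed
  then obtain D where D: "D \<ge> 0" "whp M (kernel_dev_bound NN l D)"
    by (elim exE conjE) (rule that)
  show ?thesis
  proof (intro exI[of _ D] conjI D(1) whp_mono[OF D(2)])
    show "\<forall>\<^sub>F T in sequentially. \<forall>w\<in>space (M T). kernel_dev_bound NN l D T w \<longrightarrow>
      (\<forall>i\<in>{1..n T}. \<forall>h\<in>H T. \<forall>x\<in>{0..1}.
      \<bar>(\<Sum>t=1..T. kw T i l h x t w * N T i (X T i t w))
        - T * (\<integral>w. kw T i l h x 1 w * N T i (X T i 1 w) \<partial>M T)\<bar> \<le> D * rate T h)"
      using eventually_ge_at_top[of 1]
    proof eventually_elim
      case (elim T)
      show ?case
      proof (intro ballI impI)
        fix w i h x assume *: "kernel_dev_bound NN l D T w"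
          and i: "i \<in> {1..n T}" and h: "h \<in> H T" and x: "x \<in> {0..1::real}"
        obtain j where j: "j \<in> {1..n T} - {i}" using exists_other[OF elim] by blast
        let ?E = "(\<integral>w. kw T i l h x 1 w * N T i (X T i 1 w) \<partial>M T)"
        have E: "(\<integral>w. kw T i l h x t w * N T i (X T i t w) \<partial>M T) = ?E" if "t \<in> {1..T}" for t
          by (rule expectation_X_eq[of T i t "\<lambda>y. phi K l ((y - x) / h) * N T i y"])
            (use elim i that N(1) in \<open>auto intro!: borel_measurable_times measurable_compose[OF _ phi_meas]\<close>)
        have "(\<Sum>t=1..T. kw T i l h x t w * NN T i j (obs T i j t w)
             - (\<integral>w. kw T i l h x t w * NN T i j (obs T i j t w) \<partial>M T))
          = (\<Sum>t=1..T. kw T i l h x t w * N T i (X T i t w) - ?E)"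
          unfolding NNobs by (rule sum.cong[OF refl], simp only: E)
        also have "\<dots> = (\<Sum>t=1..T. kw T i l h x t w * N T i (X T i t w)) - T * ?E"
          by (simp add: sum_subtractf)
        finally show "\<bar>(\<Sum>t=1..T. kw T i l h x t w * N T i (X T i t w)) - T * ?E\<bar> \<le> D * rate T h"
          using *[rule_format, OF i j h x] by (simp only:)
      qed
    qed
  qed
qed

lemma whp_kernel_sum: "\<exists>D\<ge>0. whp M (\<lambda>T w. \<forall>i\<in>{1..n T}. \<forall>h\<in>H T. \<forall>x\<in>{0..1}.
    \<bar>(\<Sum>t=1..T. kw T i l h x t w) - T * S_mean T i l h x\<bar> \<le> D * rate T h)"
  using whp_own_bounded[of "\<lambda>_ _ _. 1" l] G_nonneg by (simp add: S_mean_def)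

lemma whp_regression_sum: "\<exists>D\<ge>0. whp M (\<lambda>T w. \<forall>i\<in>{1..n T}. \<forall>h\<in>H T. \<forall>x\<in>{0..1}.
    \<bar>(\<Sum>t=1..T. kw T i l h x t w * \<mu> T i (X T i t w)) - T * R_mean T i l h x\<bar> \<le> D * rate T h)"
proof -
  have "\<bar>\<mu> T i x\<bar> \<le> 1 + G" "1 \<le> \<tau> T \<Longrightarrow> \<bar>\<mu> T i x\<bar> \<le> G + \<tau> T" for T i x
    using \<mu>_bd[of T i x] by linarith+
  then show ?thesis using whp_own_bounded[of \<mu> l] \<mu>_meas by (simp add: R_mean_def)
qed

text \<open>\<open>T * hmin\<close> is of the order \<open>T powr (1 - B)\<close> and outgrows
  \<open>ln T\<close>, so the normalised fluctuation vanishes uniformly over the bandwidths.\<close>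

lemma rate_le:
  assumes c: "0 < c"
  shows "\<forall>\<^sub>F T in sequentially. \<forall>h\<in>H T. rate T h \<le> c * (real T * h)"
proof -
  have "\<forall>\<^sub>F T in sequentially. ln (real T) \<le> c\<^sup>2 * (real T * (a * real T powr - B))"
    using h_pos c by real_asymp
  then show ?thesis using eventually_ge_at_top[of 1]
  proof eventually_elim
    case (elim T)
    show ?case
    proof
      fix h assume h: "h \<in> H T"
      note hb = H_bounds[OF elim(2) h]
      have "ln (real T) \<le> c\<^sup>2 * (real T * hmin T)" using elim by (simp add: hmin)
      also have "\<dots> \<le> c\<^sup>2 * (real T * h)" using hb by (intro mult_left_mono) auto
      finally have "real T * h * ln (real T) \<le> real T * h * (c\<^sup>2 * (real T * h))"
        using hb by (intro mult_left_mono) auto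
      also have "\<dots> = (c * (real T * h))\<^sup>2" by (simp add: power2_eq_square)
      finally have "rate T h \<le> sqrt ((c * (real T * h))\<^sup>2)" by (rule real_sqrt_le_mono)
      then show "rate T h \<le> c * (real T * h)" using c hb by simp
    qed
  qed
qed

text \<open>Removes the centring from a deviation bound: means of order \<open>h / sqrt T\<close>
  only enlarge the constant.\<close>

lemma sum_le_rate:
  assumes T: "3 \<le> T" "h \<in> H T" and C: "0 \<le> C"
    and V: "\<bar>\<Sum>t=1..T. V t - e t\<bar> \<le> D * rate T h"
    and e: "\<And>t. t \<in> {1..T} \<Longrightarrow> \<bar>e t\<bar> \<le> C * h / sqrt (real T)"
  shows "\<bar>\<Sum>t=1..T. V t\<bar> \<le> (D + C * sqrt A) * rate T h"
proof -
  have "\<bar>\<Sum>t=1..T. e t\<bar> \<le> (\<Sum>t=1..T. C * h / sqrt (real T))"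
    by (rule order_trans[OF sum_abs sum_mono]) (rule e)
  also have "\<dots> = C * (h * (real T / sqrt (real T)))" by simp
  also have "real T / sqrt (real T) = sqrt (real T)" by (rule real_div_sqrt) simp
  also have "C * (h * sqrt (real T)) \<le> C * (sqrt A * rate T h)"
    by (rule mult_left_mono[OF h_sqrt_le_rate[OF T] C])
  finally have "\<bar>\<Sum>t=1..T. e t\<bar> \<le> C * sqrt A * rate T h" by simp
  moreover have "(\<Sum>t=1..T. V t) = (\<Sum>t=1..T. V t - e t) + (\<Sum>t=1..T. e t)"
    by (simp add: sum_subtractf)
  ultimately show ?thesis using V by (simp only: distrib_right)
qed

text \<open>Since the error has mean 0, the mean of its truncation is minus the mean of the
  discarded part; the last claim rests on this.\<close>

lemma trunc_moments:
  assumes T: "1 \<le> T" "i \<in> {1..n T}" "1 \<le> t" and \<tau>: "1 \<le> \<tau> T"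
  shows "integrable (M T) (\<lambda>w. (trunc (\<tau> T) (\<epsilon> T i t w))\<^sup>2)"
    "integrable (M T) (\<lambda>w. trunc (\<tau> T) (\<epsilon> T i t w))"
    "(\<integral>w. (trunc (\<tau> T) (\<epsilon> T i t w))\<^sup>2 \<partial>M T) \<le> 1 + C1"
    "\<bar>\<integral>w. trunc (\<tau> T) (\<epsilon> T i t w) \<partial>M T\<bar> \<le> (\<integral>w. \<bar>\<epsilon> T i t w - trunc (\<tau> T) (\<epsilon> T i t w)\<bar> \<partial>M T)"
proof -
  interpret prob_space "M T" by (rule prob) fact
  note [measurable] = \<epsilon>_meas[OF T]
  have tb: "\<bar>trunc (\<tau> T) e\<bar> \<le> \<tau> T" for e using \<tau> by (intro abs_trunc_le_level) simp
  have tsq: "(trunc (\<tau> T) e)\<^sup>2 \<le> e\<^sup>2" for e by (simp add: trunc_def)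
  show i2: "integrable (M T) (\<lambda>w. (trunc (\<tau> T) (\<epsilon> T i t w))\<^sup>2)"
    by (rule Bochner_Integration.integrable_bound[OF \<epsilon>2_integrable(1)[OF T]]) (auto intro!: AE_I2 simp: tsq)
  show i1: "integrable (M T) (\<lambda>w. trunc (\<tau> T) (\<epsilon> T i t w))"
    by (rule integrable_const_bound[where B = "\<tau> T"]) (auto intro!: AE_I2 simp: tb)
  have "(\<integral>w. (trunc (\<tau> T) (\<epsilon> T i t w))\<^sup>2 \<partial>M T) \<le> (\<integral>w. (\<epsilon> T i t w)\<^sup>2 \<partial>M T)"
    by (rule integral_mono[OF i2 \<epsilon>2_integrable(1)[OF T]]) (rule tsq)
  then show "(\<integral>w. (trunc (\<tau> T) (\<epsilon> T i t w))\<^sup>2 \<partial>M T) \<le> 1 + C1" using \<epsilon>2_integrable(3)[OF T] by simp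
  have "(\<integral>w. \<epsilon> T i t w \<partial>M T) = 0" using \<epsilon>_centred[OF T, of "\<lambda>_. 1" 1] by simp
  then have "(\<integral>w. trunc (\<tau> T) (\<epsilon> T i t w) \<partial>M T) = - (\<integral>w. \<epsilon> T i t w - trunc (\<tau> T) (\<epsilon> T i t w) \<partial>M T)"
    using i1 \<epsilon>2_integrable(2)[OF T] by simp
  then show "\<bar>\<integral>w. trunc (\<tau> T) (\<epsilon> T i t w) \<partial>M T\<bar> \<le> (\<integral>w. \<bar>\<epsilon> T i t w - trunc (\<tau> T) (\<epsilon> T i t w)\<bar> \<partial>M T)"
    using integral_abs_bound[of "M T" "\<lambda>w. \<epsilon> T i t w - trunc (\<tau> T) (\<epsilon> T i t w)"] by simp
qed

lemma abs_phi_le_const: "0 < h \<Longrightarrow> \<bar>phi K l ((y - x) / h)\<bar> \<le> KM"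
  by (rule order_trans[OF abs_phi_le]) (auto intro!: mult_left_le KM_nonneg simp: indicator_def)

text \<open>Concentration is applied to the truncated errors. Their kernel-weighted mean is minus
  that of the discarded part, because errors are centred given the regressor, and is thus of order
  \<open>h / sqrt T\<close>. On a regular sample no error is truncated, so the bound transfers to
  the original sums.\<close>

lemma whp_error_sum: "\<exists>D\<ge>0. whp M (\<lambda>T w. \<forall>i\<in>{1..n T}. \<forall>h\<in>H T. \<forall>x\<in>{0..1}.
    \<bar>\<Sum>t=1..T. kw T i l h x t w * \<epsilon> T i t w\<bar> \<le> D * rate T h)"
proof -
  define NN where "NN T i j z = trunc (\<tau> T) (snd (fst z))" for T i j :: nat and z :: "(real \<times> real) \<times> (real \<times> real)"
  have NNobs: "NN T i j (obs T i j t w) = trunc (\<tau> T) (\<epsilon> T i t w)" for T i j t w by (simp add: NN_def obs_def)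
  have "\<exists>D\<ge>0. whp M (kernel_dev_bound NN l D)"
  proof (rule whp_kernel_statistic[where ?C2.0 = C1])
    show "NN T i j \<in> borel_measurable (borel \<Otimes>\<^sub>M borel)" for T i j
      unfolding NN_def borel_prod[symmetric] by (rule measurable_compose[OF _ trunc_meas]) measurable
    show "\<bar>NN T i j z\<bar> \<le> G + \<tau> T" if "1 \<le> \<tau> T" for T i j z
      using abs_trunc_le_level[of "\<tau> T" "snd (fst z)"] that G_nonneg unfolding NN_def by linarith
    show "0 \<le> C1" by (rule C1_nonneg)
    fix T i j h x assume T: "1 \<le> T" and i: "i \<in> {1..n T}" and h: "0 < (h::real)" and \<tau>: "1 \<le> \<tau> T"
    interpret prob_space "M T" by (rule prob) fact
    {
      fix t :: nat assume t: "1 \<le> t"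
      note [measurable] = X_meas[OF T i t] \<epsilon>_meas[OF T i t]
      have "expectation (\<lambda>w. near T i h x t w * (NN T i j (obs T i j t w))\<^sup>2)
        \<le> expectation (\<lambda>w. near T i h x t w * (\<epsilon> T i t w)\<^sup>2)"
      proof (rule integral_mono')
        show "integrable (M T) (\<lambda>w. near T i h x t w * (\<epsilon> T i t w)\<^sup>2)"
          by (rule Bochner_Integration.integrable_bound[OF \<epsilon>2_integrable(1)[OF T i t]])
            (auto simp: indicator_def)
      qed (auto simp: NNobs indicator_def trunc_def)
      also have "\<dots> \<le> C1 * h" by (rule \<epsilon>2_near[OF T i t h])
      finally show "expectation (\<lambda>w. near T i h x t w * (NN T i j (obs T i j t w))\<^sup>2) \<le> C1 * h" .
    next
      fix s t :: nat assume s: "1 \<le> s" and t: "1 \<le> t" and st: "int ls \<le> \<bar>int s - int t\<bar>"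
      note [measurable] = X_meas[OF T i t] X_meas[OF T i s] \<epsilon>_meas[OF T i t] \<epsilon>_meas[OF T i s]
      have "expectation (\<lambda>w. near T i h x s w * near T i h x t w *
          \<bar>NN T i j (obs T i j s w) * NN T i j (obs T i j t w)\<bar>)
        \<le> expectation (\<lambda>w. near T i h x s w * near T i h x t w *
          \<bar>\<epsilon> T i s w * \<epsilon> T i t w\<bar>)"
      proof (rule integral_mono')
        have "integrable (M T) (\<lambda>w. ((\<epsilon> T i s w)\<^sup>2 + (\<epsilon> T i t w)\<^sup>2) / 2)"
          using \<epsilon>2_integrable(1)[OF T i s] \<epsilon>2_integrable(1)[OF T i t] by simp
        then show "integrable (M T) (\<lambda>w. near T i h x s w * near T i h x t w *
          \<bar>\<epsilon> T i s w * \<epsilon> T i t w\<bar>)"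
        proof (rule Bochner_Integration.integrable_bound)
          show "AE w in M T. norm (near T i h x s w * near T i h x t w *
            \<bar>\<epsilon> T i s w * \<epsilon> T i t w\<bar>) \<le> norm (((\<epsilon> T i s w)\<^sup>2 + (\<epsilon> T i t w)\<^sup>2) / 2)"
            using abs_mult_le_half_squares by (intro AE_I2) (auto simp: indicator_def)
        qed measurable
        fix w
        have "\<bar>trunc (\<tau> T) (\<epsilon> T i s w)\<bar> * \<bar>trunc (\<tau> T) (\<epsilon> T i t w)\<bar> \<le> \<bar>\<epsilon> T i s w\<bar> * \<bar>\<epsilon> T i t w\<bar>"
          by (intro mult_mono abs_trunc_le) auto
        then show "near T i h x s w * near T i h x t w *
          \<bar>NN T i j (obs T i j s w) * NN T i j (obs T i j t w)\<bar>
          \<le> near T i h x s w * near T i h x t w *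
          \<bar>\<epsilon> T i s w * \<epsilon> T i t w\<bar>" by (auto simp: NNobs abs_mult indicator_def)
      qed auto
      also have "\<dots> \<le> C1 * h\<^sup>2" by (rule \<epsilon>\<epsilon>_near[OF T i s t st h])
      finally show "expectation (\<lambda>w. near T i h x s w * near T i h x t w *
          \<bar>NN T i j (obs T i j s w) * NN T i j (obs T i j t w)\<bar>) \<le> C1 * h\<^sup>2" .
    }
  qed
  then obtain D where D: "D \<ge> 0" "whp M (kernel_dev_bound NN l D)"
    by (elim exE conjE) (rule that)
  show ?thesis
  proof (intro exI[of _ "D + KM * C1 * sqrt A"] conjI whp_mono[OF whp_conj[OF D(2) whp_regular]])
    show "0 \<le> D + KM * C1 * sqrt A" using D(1) KM_nonneg C1_nonneg h_pos by simp
    show "\<forall>\<^sub>F T in sequentially. \<forall>w\<in>space (M T). kernel_dev_bound NN l D T w \<and>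
      regular T w \<longrightarrow>
      (\<forall>i\<in>{1..n T}. \<forall>h\<in>H T. \<forall>x\<in>{0..1}.
    \<bar>\<Sum>t=1..T. kw T i l h x t w * \<epsilon> T i t w\<bar> \<le> (D + KM * C1 * sqrt A) * rate T h)"
      using \<tau>_facts tail_near
    proof eventually_elim
      case (elim T)
      have T1: "1 \<le> T" and T3: "3 \<le> T" and \<tau>1: "1 \<le> \<tau> T" using elim by auto
      interpret prob_space "M T" by (rule prob) fact
      show ?case
      proof (intro ballI impI, elim conjE)
        fix w i h x assume *: "kernel_dev_bound NN l D T w"
          and reg: "regular T w"
          and i: "i \<in> {1..n T}" and h: "h \<in> H T" and x: "x \<in> {0..1::real}"
        have h0: "0 < h" by (rule H_bounds(4)[OF T1 h])
        obtain j where j: "j \<in> {1..n T} - {i}" using exists_other[OF T1] by blast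
        have "\<bar>\<Sum>t=1..T. kw T i l h x t w * NN T i j (obs T i j t w)\<bar> \<le> (D + KM * C1 * sqrt A) * rate T h"
        proof (rule sum_le_rate[OF T3 h _ *[rule_format, OF i j h x]])
          show "0 \<le> KM * C1" using KM_nonneg C1_nonneg by simp
          fix t assume "t \<in> {1..T}"
          then have t: "1 \<le> t" by simp
          note [measurable] = X_meas[OF T1 i t] \<epsilon>_meas[OF T1 i t]
          let ?p = "\<lambda>w. kw T i l h x t w"
          have pb: "\<bar>?p w\<bar> \<le> KM * near T i h x t w" for w by (rule abs_phi_le[OF h0])
          have pb': "\<bar>?p w\<bar> \<le> KM" for w
            by (rule abs_phi_le_const[OF h0])
          have ip: "integrable (M T) (\<lambda>w. ?p w * V w)" if "integrable (M T) V" for V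
          proof (rule Bochner_Integration.integrable_bound[OF integrable_mult_right[OF that, of KM]])
            show "AE w in M T. norm (?p w * V w) \<le> norm (KM * V w)"
              using pb' KM_nonneg by (intro AE_I2) (auto simp: abs_mult intro!: mult_right_mono)
          qed (use that in measurable)
          note i1 = trunc_moments(2)[OF T1 i t \<tau>1] and ie = \<epsilon>2_integrable(2)[OF T1 i t]
          have z: "expectation (\<lambda>w. ?p w * \<epsilon> T i t w) = 0"
            by (rule \<epsilon>_centred[OF T1 i t, of "\<lambda>y. phi K l ((y - x) / h)" KM])
              (use abs_phi_le_const[OF h0] in \<open>auto intro!: measurable_compose[OF _ phi_meas]\<close>)
          let ?d = "\<lambda>w. ?p w * (\<epsilon> T i t w - trunc (\<tau> T) (\<epsilon> T i t w))"
          have "expectation (\<lambda>w. ?p w * trunc (\<tau> T) (\<epsilon> T i t w))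
            = expectation (\<lambda>w. ?p w * \<epsilon> T i t w - ?p w * (\<epsilon> T i t w - trunc (\<tau> T) (\<epsilon> T i t w)))"
            by (simp add: algebra_simps)
          also have "\<dots> = - expectation ?d"
            using z ip[OF ie] ip[of "\<lambda>w. \<epsilon> T i t w - trunc (\<tau> T) (\<epsilon> T i t w)"] i1 ie
            by (subst Bochner_Integration.integral_diff) auto
          finally have eq: "expectation (\<lambda>w. ?p w * NN T i j (obs T i j t w)) = - expectation ?d"
            by (simp only: NNobs)
          have "\<bar>expectation (\<lambda>w. ?p w * NN T i j (obs T i j t w))\<bar> \<le> expectation (\<lambda>w. \<bar>?d w\<bar>)"
            unfolding eq abs_minus_cancel by (rule integral_abs_bound)
          also have "\<dots> \<le> expectation (\<lambda>w. KM * (near T i h x t w * \<bar>\<epsilon> T i t w - trunc (\<tau> T) (\<epsilon> T i t w)\<bar>))"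
          proof (rule integral_mono')
            show "integrable (M T) (\<lambda>w. KM * (near T i h x t w * \<bar>\<epsilon> T i t w - trunc (\<tau> T) (\<epsilon> T i t w)\<bar>))"
            proof (rule integrable_mult_right, rule Bochner_Integration.integrable_bound)
              show "integrable (M T) (\<lambda>w. \<epsilon> T i t w - trunc (\<tau> T) (\<epsilon> T i t w))" using i1 ie by simp
            qed (auto simp: indicator_def)
            fix w
            show "\<bar>?p w * (\<epsilon> T i t w - trunc (\<tau> T) (\<epsilon> T i t w))\<bar>
              \<le> KM * (near T i h x t w * \<bar>\<epsilon> T i t w - trunc (\<tau> T) (\<epsilon> T i t w)\<bar>)"
              using mult_right_mono[OF pb[of w] abs_ge_zero] by (simp add: abs_mult mult.assoc)
          qed (simp add: KM_nonneg)
          also have "\<dots> = KM * expectation (\<lambda>w. near T i h x t w * \<bar>\<epsilon> T i t w - trunc (\<tau> T) (\<epsilon> T i t w)\<bar>)"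
            by simp
          also have "\<dots> \<le> KM * (C1 * h / sqrt (real T))"
            using elim(2) i t h0 by (intro mult_left_mono KM_nonneg) auto
          also have "\<dots> = KM * C1 * h / sqrt (real T)" by (simp only: mult.assoc times_divide_eq_right)
          finally show "\<bar>expectation (\<lambda>w. ?p w * NN T i j (obs T i j t w))\<bar> \<le> KM * C1 * h / sqrt (real T)" .
        qed
        also have "(\<Sum>t=1..T. kw T i l h x t w * NN T i j (obs T i j t w))
          = (\<Sum>t=1..T. kw T i l h x t w * \<epsilon> T i t w)"
          by (rule sum.cong) (use reg i in \<open>auto simp: NNobs trunc_eq\<close>)
        finally show "\<bar>\<Sum>t=1..T. kw T i l h x t w * \<epsilon> T i t w\<bar> \<le> (D + KM * C1 * sqrt A) * rate T h" .
      qed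
    qed
  qed
qed

definition tnoise where "tnoise T j t w = \<mu> T j (X T j t w) + trunc (\<tau> T) (\<epsilon> T j t w)"

lemma tnoise_facts:
  assumes T: "1 \<le> T" "j \<in> {1..n T}" "1 \<le> t" and \<tau>: "1 \<le> \<tau> T"
  shows "integrable (M T) (\<lambda>w. (tnoise T j t w)\<^sup>2)" "integrable (M T) (tnoise T j t)"
    "(\<integral>w. (tnoise T j t w)\<^sup>2 \<partial>M T) \<le> 2 * G\<^sup>2 + 2 * (1 + C1)"
    "\<bar>\<integral>w. tnoise T j t w \<partial>M T\<bar> \<le> (\<integral>w. \<bar>\<epsilon> T j t w - trunc (\<tau> T) (\<epsilon> T j t w)\<bar> \<partial>M T)"
    "tnoise T j t \<in> borel_measurable (M T)"
proof -
  interpret prob_space "M T" by (rule prob) fact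
  note [measurable] = \<epsilon>_meas[OF T] X_meas[OF T] \<mu>_meas
  show [measurable]: "tnoise T j t \<in> borel_measurable (M T)"
    unfolding tnoise_def by measurable
  note tm = trunc_moments[OF T \<tau>]
  have sq: "(p + q)\<^sup>2 \<le> 2 * p\<^sup>2 + 2 * q\<^sup>2" for p q :: real
  proof -
    have "0 \<le> (p - q)\<^sup>2" by simp
    then show ?thesis by (simp add: power2_diff power2_sum)
  qed
  have b: "(tnoise T j t w)\<^sup>2 \<le> 2 * G\<^sup>2 + 2 * (trunc (\<tau> T) (\<epsilon> T j t w))\<^sup>2" for w
  proof -
    have "\<bar>\<mu> T j (X T j t w)\<bar>\<^sup>2 \<le> G\<^sup>2" by (intro power_mono \<mu>_bd) auto
    then show ?thesis using sq[of "\<mu> T j (X T j t w)" "trunc (\<tau> T) (\<epsilon> T j t w)"] by (simp add: tnoise_def)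
  qed
  have ib: "integrable (M T) (\<lambda>w. 2 * G\<^sup>2 + 2 * (trunc (\<tau> T) (\<epsilon> T j t w))\<^sup>2)" using tm(1) by simp
  show i2: "integrable (M T) (\<lambda>w. (tnoise T j t w)\<^sup>2)"
    by (rule Bochner_Integration.integrable_bound[OF ib]) (use b in \<open>auto intro!: AE_I2 simp: abs_of_nonneg\<close>)
  have "(\<integral>w. (tnoise T j t w)\<^sup>2 \<partial>M T) \<le> (\<integral>w. 2 * G\<^sup>2 + 2 * (trunc (\<tau> T) (\<epsilon> T j t w))\<^sup>2 \<partial>M T)"
    by (rule integral_mono[OF i2 ib b])
  also have "\<dots> = 2 * G\<^sup>2 + 2 * (\<integral>w. (trunc (\<tau> T) (\<epsilon> T j t w))\<^sup>2 \<partial>M T)" using tm(1) by (simp add: prob_space)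
  finally show "(\<integral>w. (tnoise T j t w)\<^sup>2 \<partial>M T) \<le> 2 * G\<^sup>2 + 2 * (1 + C1)" using tm(3) by simp
  have i\<mu>: "integrable (M T) (\<lambda>w. \<mu> T j (X T j t w))"
    by (rule integrable_const_bound[where B = G]) (auto intro!: AE_I2 simp: \<mu>_bd)
  show "integrable (M T) (tnoise T j t)" unfolding tnoise_def using i\<mu> tm(2) by simp
  have "(\<integral>w. tnoise T j t w \<partial>M T) = (\<integral>w. trunc (\<tau> T) (\<epsilon> T j t w) \<partial>M T)"
    unfolding tnoise_def using i\<mu> tm(2) \<mu>_mean[OF T] by simp
  then show "\<bar>\<integral>w. tnoise T j t w \<partial>M T\<bar> \<le> (\<integral>w. \<bar>\<epsilon> T j t w - trunc (\<tau> T) (\<epsilon> T j t w)\<bar> \<partial>M T)"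
    using tm(4) by simp
qed

lemma abs_tnoise_le: "1 \<le> \<tau> T \<Longrightarrow> \<bar>\<mu> T j y + trunc (\<tau> T) e\<bar> \<le> G + \<tau> T"
  using \<mu>_bd[of T j y] abs_trunc_le_level[of "\<tau> T" e] by linarith

lemma indep_expectation_single:
  fixes f g :: "real \<times> real \<Rightarrow> real"
  assumes T: "1 \<le> T" "i \<in> {1..n T}" "j \<in> {1..n T} - {i}" and t: "1 \<le> t"
    and f: "f \<in> borel_measurable borel" and g: "g \<in> borel_measurable borel"
    and fi: "integrable (M T) (\<lambda>w. f (X T i t w, \<epsilon> T i t w))"
    and gi: "integrable (M T) (\<lambda>w. g (X T j t w, \<epsilon> T j t w))"
  shows "(\<integral>w. f (X T i t w, \<epsilon> T i t w) * g (X T j t w, \<epsilon> T j t w) \<partial>M T)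
    = (\<integral>w. f (X T i t w, \<epsilon> T i t w) \<partial>M T) * (\<integral>w. g (X T j t w, \<epsilon> T j t w) \<partial>M T)"
proof -
  have m: "(\<lambda>z :: (real \<times> real) \<times> (real \<times> real). k (fst z)) \<in> borel_measurable borel"
    if "k \<in> borel_measurable borel" for k :: "real \<times> real \<Rightarrow> real"
  proof -
    have "(\<lambda>z. k (fst z)) \<in> borel_measurable (borel \<Otimes>\<^sub>M (borel :: (real \<times> real) measure))"
      by (rule measurable_compose[OF measurable_fst that])
    then show ?thesis by (simp add: borel_prod)
  qed
  from indep_expectation[OF T t t m[OF f] m[OF g]] fi gi show ?thesis by simp
qed

definition CN where "CN = 2 * G\<^sup>2 + 2 * (1 + C1)"

lemma CN_nonneg: "0 \<le> CN" using C1_nonneg by (simp add: CN_def)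

lemma tnoise_meas2: "(\<lambda>z. \<mu> T j (fst z) + trunc (\<tau> T) (snd z)) \<in> borel_measurable (borel :: (real \<times> real) measure)"
  unfolding borel_prod[symmetric] using \<mu>_meas[of T j, measurable] by measurable

text \<open>The weight belongs to \<open>i\<close> and the noise to \<open>j\<close>. Independence
  splits every moment into a window probability of \<open>i\<close>, which provides the factor
  \<open>h\<close> or \<open>h\<^sup>2\<close>, and a second moment of the noise of
  \<open>j\<close>, so nothing about the location of the regressor of \<open>j\<close> is
  involved.\<close>

lemma whp_cross_sum: "\<exists>D\<ge>0. whp M (\<lambda>T w. \<forall>i\<in>{1..n T}. \<forall>j\<in>{1..n T} - {i}. \<forall>h\<in>H T. \<forall>x\<in>{0..1}.
    \<bar>\<Sum>t=1..T. kw T i l h x t w * noise T j t w\<bar> \<le> D * rate T h)"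
proof -
  define NN where "NN T i j z = \<mu> T j (fst (snd z)) + trunc (\<tau> T) (snd (snd z))"
    for T i j :: nat and z :: "(real \<times> real) \<times> (real \<times> real)"
  have NNobs: "NN T i j (obs T i j t w) = tnoise T j t w" for T i j t w by (simp add: NN_def obs_def tnoise_def)
  have "\<exists>D\<ge>0. whp M (kernel_dev_bound NN l D)"
  proof (rule whp_kernel_statistic[where ?C2.0 = "C1 * CN"])
    show "NN T i j \<in> borel_measurable (borel \<Otimes>\<^sub>M borel)" for T i j
      unfolding NN_def by (rule measurable_compose[OF measurable_snd tnoise_meas2])
    show "\<bar>NN T i j z\<bar> \<le> G + \<tau> T" if "1 \<le> \<tau> T" for T i j z
      using abs_tnoise_le[OF that] unfolding NN_def .
    show "0 \<le> C1 * CN" using C1_nonneg CN_nonneg by simp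
    fix T i j h x assume T: "1 \<le> T" and i: "i \<in> {1..n T}" and j: "j \<in> {1..n T} - {i}"
      and h: "0 < (h::real)" and \<tau>: "1 \<le> \<tau> T"
    have j': "j \<in> {1..n T}" using j by simp
    interpret prob_space "M T" by (rule prob) fact
    let ?I = "\<lambda>t w. near T i h x t w"
    {
      fix t :: nat assume t: "1 \<le> t"
      note [measurable] = X_meas[OF T i t]
      have "expectation (\<lambda>w. ?I t w * (tnoise T j t w)\<^sup>2) = expectation (?I t) * expectation (\<lambda>w. (tnoise T j t w)\<^sup>2)"
      proof (rule indep_expectation_single[OF T i j t, of "\<lambda>z. indicator {x - h..x + h} (fst z)"
            "\<lambda>z. (\<mu> T j (fst z) + trunc (\<tau> T) (snd z))\<^sup>2", folded tnoise_def, unfolded fst_conv snd_conv, folded tnoise_def])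
        show "(\<lambda>z. indicator {x - h..x + h} (fst z) :: real) \<in> borel_measurable (borel :: (real \<times> real) measure)"
          unfolding borel_prod[symmetric] by measurable
        show "(\<lambda>z. (\<mu> T j (fst z) + trunc (\<tau> T) (snd z))\<^sup>2) \<in> borel_measurable (borel :: (real \<times> real) measure)"
          by (intro borel_measurable_power tnoise_meas2)
        show "integrable (M T) (?I t)"
          by (rule integrable_const_bound[where B = 1]) (auto simp: indicator_def)
        show "integrable (M T) (\<lambda>w. (tnoise T j t w)\<^sup>2)" by (rule tnoise_facts(1)[OF T j' t \<tau>])
      qed
      also have "\<dots> \<le> (C1 * h) * CN"
        using X_near[OF T i t h] tnoise_facts(3)[OF T j' t \<tau>] C1_nonneg h
        by (intro mult_mono) (auto simp: CN_def)
      also have "\<dots> = C1 * CN * h" by simp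
      finally show "expectation (\<lambda>w. ?I t w * (NN T i j (obs T i j t w))\<^sup>2) \<le> C1 * CN * h"
        unfolding NNobs .
    next
      fix s t :: nat assume s: "1 \<le> s" and t: "1 \<le> t" and st: "int ls \<le> \<bar>int s - int t\<bar>"
      note [measurable] = X_meas[OF T i t] X_meas[OF T i s] tnoise_facts(5)[OF T j' t \<tau>] tnoise_facts(5)[OF T j' s \<tau>]
      have st': "s \<noteq> t" using st ls_pos by auto
      let ?f = "\<lambda>z :: (real \<times> real) \<times> (real \<times> real). indicator {x - h..x + h} (fst (fst z)) * indicator {x - h..x + h} (fst (snd z)) :: real"
      let ?k = "\<lambda>z. \<mu> T j (fst z) + trunc (\<tau> T) (snd z)"
      let ?g = "\<lambda>z :: (real \<times> real) \<times> (real \<times> real). \<bar>?k (fst z) * ?k (snd z)\<bar>"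
      have isq: "integrable (M T) (\<lambda>w. ((tnoise T j s w)\<^sup>2 + (tnoise T j t w)\<^sup>2) / 2)"
        using tnoise_facts(1)[OF T j' s \<tau>] tnoise_facts(1)[OF T j' t \<tau>] by simp
      have ik: "integrable (M T) (\<lambda>w. \<bar>tnoise T j s w * tnoise T j t w\<bar>)"
        by (rule Bochner_Integration.integrable_bound[OF isq]) (use abs_mult_le_half_squares in \<open>auto intro!: AE_I2 simp: abs_of_nonneg\<close>)
      have iI: "integrable (M T) (\<lambda>w. ?I s w * ?I t w)"
        by (rule integrable_const_bound[where B = 1]) (auto simp: indicator_def)
      have km: "(\<lambda>z :: (real \<times> real) \<times> (real \<times> real). ?k (fst z)) \<in> borel_measurable borel"
        "(\<lambda>z :: (real \<times> real) \<times> (real \<times> real). ?k (snd z)) \<in> borel_measurable borel"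
        using measurable_compose[OF measurable_fst[where ?M2.0 = "borel :: (real \<times> real) measure"] tnoise_meas2[of T j]]
          measurable_compose[OF measurable_snd[where ?M1.0 = "borel :: (real \<times> real) measure"] tnoise_meas2[of T j]]
        by (simp_all add: borel_prod)
      have fm: "?f \<in> borel_measurable borel" unfolding borel_prod[symmetric] by measurable
      have gm: "?g \<in> borel_measurable borel" by (intro borel_measurable_abs borel_measurable_times km)
      have "expectation (\<lambda>w. (?I s w * ?I t w) * \<bar>tnoise T j s w * tnoise T j t w\<bar>)
        = expectation (\<lambda>w. ?I s w * ?I t w) * expectation (\<lambda>w. \<bar>tnoise T j s w * tnoise T j t w\<bar>)"
        using indep_expectation[OF T i j s t fm gm] iI ik by (simp add: tnoise_def)
      also have "\<dots> \<le> (C1 * h\<^sup>2) * CN"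
      proof (rule mult_mono)
        have "expectation (\<lambda>w. \<bar>tnoise T j s w * tnoise T j t w\<bar>)
          \<le> expectation (\<lambda>w. ((tnoise T j s w)\<^sup>2 + (tnoise T j t w)\<^sup>2) / 2)"
          by (rule integral_mono[OF ik isq abs_mult_le_half_squares])
        also have "\<dots> = (expectation (\<lambda>w. (tnoise T j s w)\<^sup>2) + expectation (\<lambda>w. (tnoise T j t w)\<^sup>2)) / 2"
          by (simp only: integral_divide_zero Bochner_Integration.integral_add[OF tnoise_facts(1)[OF T j' s \<tau>] tnoise_facts(1)[OF T j' t \<tau>]])
        also have "\<dots> \<le> CN"
          using add_mono[OF tnoise_facts(3)[OF T j' s \<tau>] tnoise_facts(3)[OF T j' t \<tau>]] by (simp add: CN_def)
        finally show "expectation (\<lambda>w. \<bar>tnoise T j s w * tnoise T j t w\<bar>) \<le> CN" .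
        show "expectation (\<lambda>w. ?I s w * ?I t w) \<le> C1 * h\<^sup>2" by (rule X_near2[OF T i s t st' h])
      qed (use C1_nonneg in \<open>auto intro!: Bochner_Integration.integral_nonneg\<close>)
      also have "\<dots> = C1 * CN * h\<^sup>2" by simp
      finally show "expectation (\<lambda>w. ?I s w * ?I t w * \<bar>NN T i j (obs T i j s w) * NN T i j (obs T i j t w)\<bar>)
         \<le> C1 * CN * h\<^sup>2" unfolding NNobs .
    }
  qed
  then obtain D where D: "D \<ge> 0" "whp M (kernel_dev_bound NN l D)"
    by (elim exE conjE) (rule that)
  show ?thesis
  proof (intro exI[of _ "D + KM * C1 * C1 * sqrt A"] conjI whp_mono[OF whp_conj[OF D(2) whp_regular]])
    show "0 \<le> D + KM * C1 * C1 * sqrt A" using D(1) KM_nonneg C1_nonneg h_pos by simp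
    show "\<forall>\<^sub>F T in sequentially. \<forall>w\<in>space (M T). kernel_dev_bound NN l D T w \<and>
      regular T w \<longrightarrow>
      (\<forall>i\<in>{1..n T}. \<forall>j\<in>{1..n T} - {i}. \<forall>h\<in>H T. \<forall>x\<in>{0..1}.
    \<bar>\<Sum>t=1..T. kw T i l h x t w * noise T j t w\<bar> \<le> (D + KM * C1 * C1 * sqrt A) * rate T h)"
      using \<tau>_facts tail
    proof eventually_elim
      case (elim T)
      have T1: "1 \<le> T" and T3: "3 \<le> T" and \<tau>1: "1 \<le> \<tau> T" using elim by auto
      interpret prob_space "M T" by (rule prob) fact
      show ?case
      proof (intro ballI impI, elim conjE)
        fix w i j h x assume *: "kernel_dev_bound NN l D T w"
          and reg: "regular T w"
          and i: "i \<in> {1..n T}" and j: "j \<in> {1..n T} - {i}" and h: "h \<in> H T" and x: "x \<in> {0..1::real}"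
        have h0: "0 < h" by (rule H_bounds(4)[OF T1 h])
        have j': "j \<in> {1..n T}" using j by simp
        have "\<bar>\<Sum>t=1..T. kw T i l h x t w * NN T i j (obs T i j t w)\<bar>
          \<le> (D + KM * C1 * C1 * sqrt A) * rate T h"
        proof (rule sum_le_rate[OF T3 h _ *[rule_format, OF i j h x]])
          show "0 \<le> KM * C1 * C1" using KM_nonneg C1_nonneg by simp
          fix t assume "t \<in> {1..T}"
          then have t: "1 \<le> t" by simp
          note [measurable] = X_meas[OF T1 i t] tnoise_facts(5)[OF T1 j' t \<tau>1]
          let ?p = "\<lambda>w. kw T i l h x t w"
          have ip: "integrable (M T) ?p"
            by (rule integrable_const_bound[where B = KM]) (auto intro!: AE_I2 simp: abs_phi_le_const[OF h0])
          have pm: "(\<lambda>z :: real \<times> real. phi K l ((fst z - x) / h)) \<in> borel_measurable borel"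
            unfolding borel_prod[symmetric] by measurable
          have "expectation (\<lambda>w. ?p w * tnoise T j t w) = expectation ?p * expectation (tnoise T j t)"
            using indep_expectation_single[OF T1 i j t pm tnoise_meas2[of T j]] ip tnoise_facts(2)[OF T1 j' t \<tau>1]
            by (simp add: tnoise_def[abs_def])
          then have "\<bar>expectation (\<lambda>w. ?p w * tnoise T j t w)\<bar> = \<bar>expectation ?p\<bar> * \<bar>expectation (tnoise T j t)\<bar>"
            by (simp only: abs_mult)
          also have "\<dots> \<le> (KM * (C1 * h)) * (C1 / sqrt (real T))"
          proof (rule mult_mono)
            have "\<bar>expectation ?p\<bar> \<le> expectation (\<lambda>w. \<bar>?p w\<bar>)" by (rule integral_abs_bound)
            also have "\<dots> \<le> expectation (\<lambda>w. KM * near T i h x t w)"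
            proof (rule integral_mono')
              show "integrable (M T) (\<lambda>w. KM * near T i h x t w)"
                by (intro integrable_mult_right integrable_const_bound[where B = 1]) (auto simp: indicator_def)
            qed (auto simp: abs_phi_le[OF h0] KM_nonneg)
            also have "\<dots> = KM * expectation (\<lambda>w. near T i h x t w)" by simp
            also have "\<dots> \<le> KM * (C1 * h)" by (rule mult_left_mono[OF X_near[OF T1 i t h0] KM_nonneg])
            finally show "\<bar>expectation ?p\<bar> \<le> KM * (C1 * h)" .
            show "\<bar>expectation (tnoise T j t)\<bar> \<le> C1 / sqrt (real T)"
              by (rule order_trans[OF tnoise_facts(4)[OF T1 j' t \<tau>1]]) (use elim(2) j' t in blast)
          qed (use KM_nonneg C1_nonneg h0 in auto)
          also have "\<dots> = KM * C1 * C1 * h / sqrt (real T)" by simp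
          finally show "\<bar>expectation (\<lambda>w. ?p w * NN T i j (obs T i j t w))\<bar> \<le> KM * C1 * C1 * h / sqrt (real T)"
            unfolding NNobs .
        qed
        also have "(\<Sum>t=1..T. kw T i l h x t w * NN T i j (obs T i j t w))
          = (\<Sum>t=1..T. kw T i l h x t w * noise T j t w)"
          by (rule sum.cong[OF refl]) (use reg j' in \<open>simp add: NNobs tnoise_def noise_def trunc_eq\<close>)
        finally show "\<bar>\<Sum>t=1..T. kw T i l h x t w * noise T j t w\<bar>
          \<le> (D + KM * C1 * C1 * sqrt A) * rate T h" .
      qed
    qed
  qed
qed

lemma level_le: "1 \<le> \<tau> T \<Longrightarrow> G + \<tau> T \<le> (G + 1) * \<tau> T"
  using G_nonneg by (simp add: distrib_right mult_le_cancel_left1)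

text \<open>These are the time averages that demeaning leaves behind. They are centred up to
  truncation, through the normalisation of the regression functions and the mean zero of the
  errors.\<close>

lemma whp_noise_average: "\<exists>D\<ge>0. whp M (\<lambda>T w. \<forall>j\<in>{1..n T}. \<forall>h\<in>H T.
    h * \<bar>\<Sum>t=1..T. noise T j t w\<bar> \<le> D * rate T h)"
proof -
  define NN where "NN T i j z = \<mu> T i (fst (fst z)) + trunc (\<tau> T) (snd (fst z))"
    for T i j :: nat and z :: "(real \<times> real) \<times> (real \<times> real)"
  have NNobs: "NN T i j (obs T i j t w) = tnoise T i t w" for T i j t w by (simp add: NN_def obs_def tnoise_def)
  have "\<exists>D\<ge>0. whp M (average_dev_bound NN D)"
  proof (rule whp_bandwidth_statistic[where ?C2.0 = "G + 1 + CN"])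
    show "NN T i j \<in> borel_measurable (borel \<Otimes>\<^sub>M borel)" for T i j
      unfolding NN_def by (rule measurable_compose[OF measurable_fst tnoise_meas2])
    show "\<bar>NN T i j z\<bar> \<le> (G + 1 + CN) * (\<tau> T)\<^sup>2" if "1 \<le> \<tau> T" for T i j z
    proof -
      have "\<bar>NN T i j z\<bar> \<le> (G + 1) * \<tau> T"
        using abs_tnoise_le[OF that] level_le[OF that] unfolding NN_def by (rule order_trans)
      also have "\<dots> \<le> (G + 1 + CN) * (\<tau> T)\<^sup>2"
        using that G_nonneg CN_nonneg by (intro mult_mono) (auto simp: power2_eq_square mult_le_cancel_left1)
      finally show ?thesis .
    qed
    show "0 \<le> G + 1 + CN" using G_nonneg CN_nonneg by simp
    show "(\<integral>w. (NN T i j (obs T i j t w))\<^sup>2 \<partial>M T) \<le> G + 1 + CN"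
      if "1 \<le> T" "1 \<le> \<tau> T" "i \<in> {1..n T}" "1 \<le> t" for T i j t
      using tnoise_facts(3)[OF that(1,3,4,2)] G_nonneg unfolding NNobs CN_def by linarith
  qed
  then obtain D where D: "D \<ge> 0" "whp M (average_dev_bound NN D)"
    by (elim exE conjE) (rule that)
  show ?thesis
  proof (intro exI[of _ "D + C1 * sqrt A"] conjI whp_mono[OF whp_conj[OF D(2) whp_regular]])
    show "0 \<le> D + C1 * sqrt A" using D(1) C1_nonneg h_pos by simp
    show "\<forall>\<^sub>F T in sequentially. \<forall>w\<in>space (M T). average_dev_bound NN D T w \<and>
      regular T w \<longrightarrow>
      (\<forall>j\<in>{1..n T}. \<forall>h\<in>H T. h * \<bar>\<Sum>t=1..T. noise T j t w\<bar> \<le> (D + C1 * sqrt A) * rate T h)"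
      using \<tau>_facts tail
    proof eventually_elim
      case (elim T)
      have T1: "1 \<le> T" and T3: "3 \<le> T" and \<tau>1: "1 \<le> \<tau> T" using elim by auto
      show ?case
      proof (intro ballI impI, elim conjE)
        fix w i h assume *: "average_dev_bound NN D T w"
          and reg: "regular T w"
          and i: "i \<in> {1..n T}" and h: "h \<in> H T"
        have h0: "0 < h" by (rule H_bounds(4)[OF T1 h])
        obtain j where j: "j \<in> {1..n T} - {i}" using exists_other[OF T1] by blast
        have "\<bar>\<Sum>t=1..T. h * tnoise T i t w\<bar> \<le> (D + C1 * sqrt A) * rate T h"
        proof (rule sum_le_rate[OF T3 h C1_nonneg, where e = "\<lambda>t. h * (\<integral>w. tnoise T i t w \<partial>M T)"])
          show "\<bar>\<Sum>t=1..T. h * tnoise T i t w - h * (\<integral>w. tnoise T i t w \<partial>M T)\<bar> \<le> D * rate T h"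
            using *[rule_format, OF i j h] h0 by (simp add: NNobs abs_mult flip: right_diff_distrib sum_distrib_left)
          fix t assume "t \<in> {1..T}"
          then have t: "1 \<le> t" by simp
          have "\<bar>\<integral>w. tnoise T i t w \<partial>M T\<bar> \<le> C1 / sqrt (real T)"
            by (rule order_trans[OF tnoise_facts(4)[OF T1 i t \<tau>1]]) (use elim(2) i t in blast)
          then have "h * \<bar>\<integral>w. tnoise T i t w \<partial>M T\<bar> \<le> h * (C1 / sqrt (real T))"
            using h0 by (intro mult_left_mono) auto
          then show "\<bar>h * (\<integral>w. tnoise T i t w \<partial>M T)\<bar> \<le> C1 * h / sqrt (real T)"
            using h0 by (simp add: abs_mult mult.commute)
        qed
        also have "(\<Sum>t=1..T. h * tnoise T i t w) = h * (\<Sum>t=1..T. noise T i t w)"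
          unfolding sum_distrib_left
          by (rule sum.cong[OF refl]) (use reg i in \<open>simp add: tnoise_def noise_def trunc_eq\<close>)
        finally show "h * \<bar>\<Sum>t=1..T. noise T i t w\<bar> \<le> (D + C1 * sqrt A) * rate T h"
          using h0 by (simp add: abs_mult)
      qed
    qed
  qed
qed

text \<open>Serves the lower bound of the residual variance, where an individual's error meets the
  noise of the others. The summands are of order \<open>\<tau>\<^sup>2\<close>, which is what the
  bound on \<open>(\<tau> T)\<^sup>2\<close> was made for.\<close>

lemma whp_noise_product: "\<exists>D\<ge>0. whp M (\<lambda>T w. \<forall>i\<in>{1..n T}. \<forall>j\<in>{1..n T} - {i}. \<forall>h\<in>H T.
    h * \<bar>\<Sum>t=1..T. \<epsilon> T i t w * noise T j t w\<bar> \<le> D * rate T h)"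
proof -
  define NN where "NN T i j z = trunc (\<tau> T) (snd (fst z)) * (\<mu> T j (fst (snd z)) + trunc (\<tau> T) (snd (snd z)))"
    for T i j :: nat and z :: "(real \<times> real) \<times> (real \<times> real)"
  have NNobs: "NN T i j (obs T i j t w) = trunc (\<tau> T) (\<epsilon> T i t w) * tnoise T j t w" for T i j t w
    by (simp add: NN_def obs_def tnoise_def)
  have tm: "(\<lambda>z :: real \<times> real. trunc (\<tau> T) (snd z)) \<in> borel_measurable borel" for T
    unfolding borel_prod[symmetric] by measurable
  define C where "C = G + 1 + (1 + C1) * CN"
  have C: "0 \<le> (1 + C1) * CN" "G + 1 \<le> C" "(1 + C1) * CN \<le> C" "0 \<le> C"
    using G_nonneg CN_nonneg C1_nonneg by (auto simp: C_def)
  have "\<exists>D\<ge>0. whp M (average_dev_bound NN D)"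
  proof (rule whp_bandwidth_statistic[where ?C2.0 = C])
    show "NN T i j \<in> borel_measurable (borel \<Otimes>\<^sub>M borel)" for T i j
      unfolding NN_def
      by (intro borel_measurable_times measurable_compose[OF measurable_snd tnoise_meas2]
          measurable_compose[OF measurable_fst tm])
    show "\<bar>NN T i j z\<bar> \<le> C * (\<tau> T)\<^sup>2" if "1 \<le> \<tau> T" for T i j z
    proof -
      have "\<bar>\<mu> T j (fst (snd z)) + trunc (\<tau> T) (snd (snd z))\<bar> \<le> (G + 1) * \<tau> T"
        using abs_tnoise_le[OF that] level_le[OF that] by (rule order_trans)
      then have "\<bar>NN T i j z\<bar> \<le> \<tau> T * ((G + 1) * \<tau> T)"
        unfolding NN_def abs_mult using that by (intro mult_mono abs_trunc_le_level) auto
      also have "\<dots> = (G + 1) * (\<tau> T)\<^sup>2" by (simp add: power2_eq_square)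
      also have "\<dots> \<le> C * (\<tau> T)\<^sup>2" using C by (intro mult_right_mono) auto
      finally show ?thesis .
    qed
    show "0 \<le> C" by (rule C)
    show "(\<integral>w. (NN T i j (obs T i j t w))\<^sup>2 \<partial>M T) \<le> C"
      if "1 \<le> T" "1 \<le> \<tau> T" "i \<in> {1..n T}" "j \<in> {1..n T} - {i}" "1 \<le> t" for T i j t
    proof -
      have j': "j \<in> {1..n T}" using that by simp
      note ti = trunc_moments[OF that(1,3,5,2)] and tj = tnoise_facts[OF that(1) j' that(5,2)]
      have "(\<integral>w. (trunc (\<tau> T) (\<epsilon> T i t w))\<^sup>2 * (tnoise T j t w)\<^sup>2 \<partial>M T)
        = (\<integral>w. (trunc (\<tau> T) (\<epsilon> T i t w))\<^sup>2 \<partial>M T) * (\<integral>w. (tnoise T j t w)\<^sup>2 \<partial>M T)"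
        using indep_expectation_single[OF that(1,3,4,5)
            borel_measurable_power[OF tm[of T], of 2] borel_measurable_power[OF tnoise_meas2[of T j], of 2]]
          ti(1) tj(1) by (simp add: tnoise_def)
      also have "\<dots> \<le> (1 + C1) * CN"
        using ti(3) tj(3) C1_nonneg by (intro mult_mono) (auto simp: CN_def)
      finally show ?thesis unfolding NNobs power_mult_distrib using C by linarith
    qed
  qed
  then obtain D where D: "D \<ge> 0" "whp M (average_dev_bound NN D)"
    by (elim exE conjE) (rule that)
  show ?thesis
  proof (intro exI[of _ "D + C1 * C1 * sqrt A"] conjI whp_mono[OF whp_conj[OF D(2) whp_regular]])
    show "0 \<le> D + C1 * C1 * sqrt A" using D(1) C1_nonneg h_pos by simp
    show "\<forall>\<^sub>F T in sequentially. \<forall>w\<in>space (M T). average_dev_bound NN D T w \<and>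
      regular T w \<longrightarrow>
      (\<forall>i\<in>{1..n T}. \<forall>j\<in>{1..n T} - {i}. \<forall>h\<in>H T.
        h * \<bar>\<Sum>t=1..T. \<epsilon> T i t w * noise T j t w\<bar> \<le> (D + C1 * C1 * sqrt A) * rate T h)"
      using \<tau>_facts tail
    proof eventually_elim
      case (elim T)
      have T1: "1 \<le> T" and T3: "3 \<le> T" and \<tau>1: "1 \<le> \<tau> T" using elim by auto
      show ?case
      proof (intro ballI impI, elim conjE)
        fix w i j h assume *: "average_dev_bound NN D T w"
          and reg: "regular T w"
          and i: "i \<in> {1..n T}" and j: "j \<in> {1..n T} - {i}" and h: "h \<in> H T"
        have h0: "0 < h" by (rule H_bounds(4)[OF T1 h])
        have j': "j \<in> {1..n T}" using j by simp
        let ?E = "\<lambda>t. (\<integral>w. trunc (\<tau> T) (\<epsilon> T i t w) * tnoise T j t w \<partial>M T)"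
        have "\<bar>\<Sum>t=1..T. h * (trunc (\<tau> T) (\<epsilon> T i t w) * tnoise T j t w)\<bar> \<le> (D + C1 * C1 * sqrt A) * rate T h"
        proof (rule sum_le_rate[OF T3 h, where e = "\<lambda>t. h * ?E t"])
          show "0 \<le> C1 * C1" by simp
          show "\<bar>\<Sum>t=1..T. h * (trunc (\<tau> T) (\<epsilon> T i t w) * tnoise T j t w) - h * ?E t\<bar> \<le> D * rate T h"
            using *[rule_format, OF i j h] h0 by (simp add: NNobs abs_mult flip: right_diff_distrib sum_distrib_left)
          fix t assume "t \<in> {1..T}"
          then have t: "1 \<le> t" by simp
          note ti = trunc_moments[OF T1 i t \<tau>1] and tj = tnoise_facts[OF T1 j' t \<tau>1]
          have tl: "(\<integral>w. \<bar>\<epsilon> T k t w - trunc (\<tau> T) (\<epsilon> T k t w)\<bar> \<partial>M T) \<le> C1 / sqrt (real T)"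
            if "k \<in> {1..n T}" for k using elim(2) t that by blast
          have "\<bar>?E t\<bar> = \<bar>\<integral>w. trunc (\<tau> T) (\<epsilon> T i t w) \<partial>M T\<bar> * \<bar>\<integral>w. tnoise T j t w \<partial>M T\<bar>"
            using indep_expectation_single[OF T1 i j t tm[of T] tnoise_meas2[of T j]] ti(2) tj(2)
            by (simp add: tnoise_def[abs_def] abs_mult)
          also have "\<dots> \<le> (C1 / sqrt (real T)) * C1"
          proof (rule mult_mono)
            show "\<bar>\<integral>w. trunc (\<tau> T) (\<epsilon> T i t w) \<partial>M T\<bar> \<le> C1 / sqrt (real T)"
              by (rule order_trans[OF ti(4) tl[OF i]])
            have "\<bar>\<integral>w. tnoise T j t w \<partial>M T\<bar> \<le> C1 / sqrt (real T)"
              by (rule order_trans[OF tj(4) tl[OF j']])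
            also have "\<dots> \<le> C1 / 1" using T1 C1_nonneg by (intro divide_left_mono) auto
            finally show "\<bar>\<integral>w. tnoise T j t w \<partial>M T\<bar> \<le> C1" by simp
          qed (use C1_nonneg in auto)
          finally have "h * \<bar>?E t\<bar> \<le> h * ((C1 / sqrt (real T)) * C1)"
            using h0 by (intro mult_left_mono) auto
          then show "\<bar>h * ?E t\<bar> \<le> C1 * C1 * h / sqrt (real T)"
            using h0 by (simp add: abs_mult mult_ac)
        qed
        also have "(\<Sum>t=1..T. h * (trunc (\<tau> T) (\<epsilon> T i t w) * tnoise T j t w)) = h * (\<Sum>t=1..T. \<epsilon> T i t w * noise T j t w)"
          unfolding sum_distrib_left
          by (rule sum.cong[OF refl]) (use reg i j' in \<open>simp add: tnoise_def noise_def trunc_eq\<close>)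
        finally show "h * \<bar>\<Sum>t=1..T. \<epsilon> T i t w * noise T j t w\<bar> \<le> (D + C1 * C1 * sqrt A) * rate T h"
          using h0 by (simp add: abs_mult)
      qed
    qed
  qed
qed

text \<open>Bounds of the right order are enough here. Truncation lowers the second moment by at
  most \<open>C1 / \<tau>\<close>, eventually at most half of \<open>\<sigma>low\<close>, and the
  fluctuation of the sum takes at most another \<open>\<sigma>low / 4\<close> per
  observation.\<close>

lemma whp_error_squares: "whp M (\<lambda>T w. \<forall>i\<in>{1..n T}.
    \<sigma>low / 4 * T \<le> (\<Sum>t=1..T. (\<epsilon> T i t w)\<^sup>2) \<and> (\<Sum>t=1..T. (\<epsilon> T i t w)\<^sup>2) \<le> (2 + C1) * T)"
proof -
  define NN where "NN T i j z = (trunc (\<tau> T) (snd (fst z)))\<^sup>2"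
    for T i j :: nat and z :: "(real \<times> real) \<times> (real \<times> real)"
  have NNobs: "NN T i j (obs T i j t w) = (trunc (\<tau> T) (\<epsilon> T i t w))\<^sup>2" for T i j t w
    by (simp add: NN_def obs_def)
  have "\<exists>D\<ge>0. whp M (average_dev_bound NN D)"
  proof (rule whp_bandwidth_statistic[where ?C2.0 = "1 + C1"])
    show "NN T i j \<in> borel_measurable (borel \<Otimes>\<^sub>M borel)" for T i j
      unfolding NN_def borel_prod[symmetric] by measurable
    show "\<bar>NN T i j z\<bar> \<le> (1 + C1) * (\<tau> T)\<^sup>2" if "1 \<le> \<tau> T" for T i j z
    proof -
      have "\<bar>trunc (\<tau> T) (snd (fst z))\<bar>\<^sup>2 \<le> (\<tau> T)\<^sup>2" using that by (intro power_mono abs_trunc_le_level) auto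
      also have "\<dots> \<le> (1 + C1) * (\<tau> T)\<^sup>2" using C1_nonneg by (simp add: distrib_right)
      finally show ?thesis by (simp add: NN_def)
    qed
    show "0 \<le> 1 + C1" using C1_nonneg by simp
    show "(\<integral>w. (NN T i j (obs T i j t w))\<^sup>2 \<partial>M T) \<le> 1 + C1"
      if T: "1 \<le> T" "1 \<le> \<tau> T" "i \<in> {1..n T}" "j \<in> {1..n T} - {i}" "1 \<le> t" for T i j t
    proof -
      have "(\<integral>w. (NN T i j (obs T i j t w))\<^sup>2 \<partial>M T) \<le> (\<integral>w. (\<epsilon> T i t w) ^ 4 \<partial>M T)"
        by (rule integral_mono'[OF \<epsilon>4(1)[OF T(1,3,5)]])
          (auto simp: NNobs trunc_def simp flip: power_mult)
      then show ?thesis using \<epsilon>4(2)[OF T(1,3,5)] by simp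
    qed
  qed
  then obtain D where D: "D \<ge> 0" "whp M (average_dev_bound NN D)"
    by (elim exE conjE) (rule that)
  \<comment> \<open>\<open>c \<le> 1\<close> is for the upper bound and
    \<open>c \<le> \<sigma>low / 4\<close> for the lower one.\<close>
  define c where "c = min 1 (\<sigma>low / 4)"
  have c: "0 < c" "c \<le> 1" "c \<le> \<sigma>low / 4" using \<sigma>low(1) by (auto simp: c_def)
  have cD: "0 < c / (D + 1)" using c D(1) by simp
  have \<tau>big: "\<forall>\<^sub>F T in sequentially. max 1 (2 * C1 / \<sigma>low) \<le> \<tau> T"
    using \<tau>_lim unfolding filterlim_at_top by blast
  show ?thesis
  proof (rule whp_mono[OF whp_conj[OF D(2) whp_regular]])
    show "\<forall>\<^sub>F T in sequentially. \<forall>w\<in>space (M T). average_dev_bound NN D T w \<and>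
      regular T w \<longrightarrow>
      (\<forall>i\<in>{1..n T}. \<sigma>low / 4 * T \<le> (\<Sum>t=1..T. (\<epsilon> T i t w)\<^sup>2) \<and> (\<Sum>t=1..T. (\<epsilon> T i t w)\<^sup>2) \<le> (2 + C1) * T)"
      using \<tau>_facts \<tau>big rate_le[OF cD] H_nonempty
    proof eventually_elim
      case (elim T)
      have T1: "1 \<le> T" and \<tau>1: "1 \<le> \<tau> T" using elim by auto
      obtain h where h: "h \<in> H T" using elim by blast
      have h0: "0 < h" by (rule H_bounds(4)[OF T1 h])
      show ?case
      proof (intro ballI impI, elim conjE)
        fix w i assume *: "average_dev_bound NN D T w"
          and reg: "regular T w"
          and i: "i \<in> {1..n T}"
        obtain j where j: "j \<in> {1..n T} - {i}" using exists_other[OF T1] by blast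
        let ?E = "\<lambda>t. (\<integral>w. (trunc (\<tau> T) (\<epsilon> T i t w))\<^sup>2 \<partial>M T)"
        have E: "\<sigma>low / 2 \<le> ?E t" "?E t \<le> 1 + C1" if "t \<in> {1..T}" for t
        proof -
          have t: "1 \<le> t" using that by simp
          note ti = trunc_moments[OF T1 i t \<tau>1]
          show "?E t \<le> 1 + C1" by (rule ti(3))
          have ie: "integrable (M T) (\<lambda>w. (trunc (\<tau> T) (\<epsilon> T i t w))\<^sup>2 + (\<epsilon> T i t w) ^ 4 / \<tau> T)"
            using ti(1) \<epsilon>4(1)[OF T1 i t] by simp
          have "(\<integral>w. (\<epsilon> T i t w)\<^sup>2 \<partial>M T) \<le> (\<integral>w. (trunc (\<tau> T) (\<epsilon> T i t w))\<^sup>2 + (\<epsilon> T i t w) ^ 4 / \<tau> T \<partial>M T)"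
          proof (rule integral_mono[OF \<epsilon>2_integrable(1)[OF T1 i t] ie])
            fix w
            \<comment> \<open>Above the level, \<open>\<bar>e\<bar> > \<tau> \<ge> 1\<close> gives
              \<open>\<tau> \<le> e\<^sup>2\<close>, so the lost square is at most
              \<open>e ^ 4 / \<tau>\<close>.\<close>
            show "(\<epsilon> T i t w)\<^sup>2 \<le> (trunc (\<tau> T) (\<epsilon> T i t w))\<^sup>2 + (\<epsilon> T i t w) ^ 4 / \<tau> T"
            proof (cases "\<bar>\<epsilon> T i t w\<bar> \<le> \<tau> T")
              case True
              then show ?thesis using \<tau>1 by (simp add: trunc_eq)
            next
              case False
              let ?e = "\<bar>\<epsilon> T i t w\<bar>"
              have "?e\<^sup>2 * \<tau> T \<le> ?e\<^sup>2 * ?e\<^sup>2"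
              proof (rule mult_left_mono)
                have "\<tau> T \<le> ?e * 1" using False by simp
                also have "\<dots> \<le> ?e * ?e" using False \<tau>1 by (intro mult_left_mono) auto
                finally show "\<tau> T \<le> ?e\<^sup>2" by (simp only: power2_eq_square)
              qed simp
              also have "?e\<^sup>2 * ?e\<^sup>2 = (\<epsilon> T i t w) ^ 4" by (simp flip: power_add)
              finally have "?e\<^sup>2 \<le> (\<epsilon> T i t w) ^ 4 / \<tau> T" using \<tau>1 by (simp add: pos_le_divide_eq)
              then show ?thesis using False by (simp add: trunc_def)
            qed
          qed
          also have "\<dots> = ?E t + (\<integral>w. (\<epsilon> T i t w) ^ 4 \<partial>M T) / \<tau> T"
            using ti(1) \<epsilon>4(1)[OF T1 i t] by simp
          also have "\<dots> \<le> ?E t + C1 / \<tau> T" using \<epsilon>4(2)[OF T1 i t] \<tau>1 by (intro add_left_mono divide_right_mono) auto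
          also have "C1 / \<tau> T \<le> \<sigma>low / 2"
            using elim(2) \<tau>1 \<sigma>low(1) by (simp add: field_simps)
          finally show "\<sigma>low / 2 \<le> ?E t" using \<sigma>low(2)[OF T1 i t] by simp
        qed
        have "h * \<bar>\<Sum>t=1..T. (trunc (\<tau> T) (\<epsilon> T i t w))\<^sup>2 - ?E t\<bar> \<le> D * rate T h"
          using *[rule_format, OF i j h] unfolding NNobs .
        also have "\<dots> \<le> D * (c / (D + 1) * (real T * h))" using elim(3) h D(1) by (intro mult_left_mono) auto
        also have "\<dots> = (D / (D + 1)) * (h * (c * real T))" by simp
        also have "\<dots> \<le> 1 * (h * (c * real T))" using D(1) h0 c by (intro mult_right_mono) auto
        finally have "\<bar>\<Sum>t=1..T. (trunc (\<tau> T) (\<epsilon> T i t w))\<^sup>2 - ?E t\<bar> \<le> c * real T" using h0 by simp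
        moreover have "(\<Sum>t=1..T. (trunc (\<tau> T) (\<epsilon> T i t w))\<^sup>2) = (\<Sum>t=1..T. (\<epsilon> T i t w)\<^sup>2)"
          by (rule sum.cong[OF refl]) (use reg i in \<open>simp add: trunc_eq\<close>)
        ultimately have 1: "\<bar>(\<Sum>t=1..T. (\<epsilon> T i t w)\<^sup>2) - (\<Sum>t=1..T. ?E t)\<bar> \<le> c * real T"
          by (simp only: sum_subtractf)
        have 2: "(\<Sum>t=1..T. ?E t) \<le> (\<Sum>t=1..T. 1 + C1)" by (rule sum_mono) (rule E)
        have 3: "(\<Sum>t=1..T. \<sigma>low / 2) \<le> (\<Sum>t=1..T. ?E t)" by (rule sum_mono) (rule E)
        have "c * real T \<le> 1 * real T" "c * real T \<le> \<sigma>low / 4 * real T" using c by (intro mult_right_mono; simp)+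
        then show "\<sigma>low / 4 * T \<le> (\<Sum>t=1..T. (\<epsilon> T i t w)\<^sup>2) \<and> (\<Sum>t=1..T. (\<epsilon> T i t w)\<^sup>2) \<le> (2 + C1) * T"
          using 1 2 3 by (simp add: algebra_simps) linarith
      qed
    qed
  qed
qed

end

section \<open>Kernel moments\<close>

text \<open>The quadratic form is evaluated at its minimiser \<open>s1 / s0\<close>, where its value
  is the determinant divided by \<open>s0\<close>. Used for the moment matrix of the kernel and for
  that of the regressors.\<close>

lemma quadratic_discriminant_bound:
  fixes s0 s1 s2 c c' :: real
  assumes q: "\<And>a. c \<le> s2 - 2 * a * s1 + a\<^sup>2 * s0" and s0: "c' \<le> s0" "0 < c'" and c: "0 \<le> c"
  shows "c * c' \<le> s2 * s0 - s1\<^sup>2"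
proof -
  have p: "0 < s0" using s0 by simp
  have "c \<le> s2 - 2 * (s1 / s0) * s1 + (s1 / s0)\<^sup>2 * s0" by (rule q)
  also have "\<dots> = (s2 * s0 - s1\<^sup>2) / s0" using p by (simp add: field_simps power2_eq_square)
  finally have "c * s0 \<le> s2 * s0 - s1\<^sup>2" using p by (simp add: pos_le_divide_eq)
  moreover have "c * c' \<le> c * s0" using s0 c by (intro mult_left_mono) auto
  ultimately show ?thesis by simp
qed

text \<open>The interval of length \<open>4 * d\<close> on which \<open>K\<close> is bounded below
  leaves room for a piece of length \<open>d\<close> at distance \<open>d\<close> from any
  prescribed point. It lies in \<open>{0..1}\<close>, and by symmetry its mirror image has the same
  property.\<close>

locale kernel =
  fixes K :: "real \<Rightarrow> real" and KM LK k0 d u1 :: real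
  assumes K_nonneg: "0 \<le> K v" and K_le: "K v \<le> KM" and K_zero: "v \<notin> {-1..1} \<Longrightarrow> K v = 0"
    and K_sym: "K (- v) = K v" and K_one: "has_bochner_integral lborel K 1"
    and K_lipschitz: "\<bar>K v - K w\<bar> \<le> LK * \<bar>v - w\<bar>"
    and k0: "0 < k0" and d: "0 < d" and u1: "0 \<le> u1" "u1 + 4 * d \<le> 1"
    and K_pos: "v \<in> {u1..u1 + 4 * d} \<Longrightarrow> k0 \<le> K v"

text \<open>A symmetric kernel of integral 1 must be positive somewhere in the open unit interval,
  since otherwise it vanishes off three points; by the Lipschitz property it stays above half of
  that value nearby.\<close>

lemma cond_C9_kernel:
  assumes "cond_C9 K"
  shows "\<exists>KM LK k0 d u1. kernel K KM LK k0 d u1"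
proof -
  obtain KM LK where K: "\<And>v. 0 \<le> K v" "\<And>v. K v \<le> KM" "\<And>v. v \<notin> {-1..1} \<Longrightarrow> K v = 0"
    "\<And>v. K (- v) = K v" "has_bochner_integral lborel K 1" "\<And>v w. \<bar>K v - K w\<bar> \<le> LK * \<bar>v - w\<bar>"
    using assms unfolding cond_C9_def by blast
  have LK: "0 \<le> LK" using order_trans[OF abs_ge_zero K(6)[of 0 1]] by simp
  have "\<exists>u\<in>{0<..<1}. 0 < K u"
  proof (rule ccontr)
    assume *: "\<not> (\<exists>u\<in>{0<..<1}. 0 < K u)"
    have z: "K u = 0" if "u \<notin> {-1, 0, 1}" for u
    proof (cases "\<bar>u\<bar> < 1")
      case True
      then have "\<bar>u\<bar> \<in> {0<..<1}" using that by auto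
      then have "\<not> 0 < K \<bar>u\<bar>" using * by blast
      then have "K \<bar>u\<bar> = 0" using K(1)[of "\<bar>u\<bar>"] by linarith
      then show ?thesis using K(4)[of u] by (cases "0 \<le> u") simp_all
    next
      case False
      then show ?thesis using that by (intro K(3)) auto
    qed
    have "AE u in lborel. K u = 0"
    proof (rule AE_I[of _ _ "{-1, 0, 1}"])
      show "emeasure lborel {-1, 0, 1::real} = 0" by (rule emeasure_lborel_countable) auto
    qed (use z in auto)
    then have "has_bochner_integral lborel K 1 \<longleftrightarrow> has_bochner_integral lborel (\<lambda>_ :: real. 0 :: real) 1"
      using K(5) by (intro has_bochner_integral_cong_AE) (auto simp: has_bochner_integral_iff)
    then show False using K(5) by (simp add: has_bochner_integral_iff)
  qed
  then obtain u where u: "0 < u" "u < 1" "0 < K u" by auto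
  \<comment> \<open>The first bound keeps the interval inside \<open>{0..1}\<close>; the second lets
    \<open>K\<close> drop by at most \<open>K u / 2\<close> over the length
    \<open>4 * d\<close>.\<close>
  define d where "d = min ((1 - u) / 4) (K u / (8 * (LK + 1)))"
  have "d \<le> (1 - u) / 4" unfolding d_def by (rule min.cobounded1)
  then have d: "0 < d" "4 * d \<le> 1 - u" using u LK by (auto simp: d_def)
  have "K u / 2 \<le> K v" if "v \<in> {u..u + 4 * d}" for v
  proof -
    have "\<bar>K v - K u\<bar> \<le> LK * \<bar>v - u\<bar>" by (rule K(6))
    also have "\<dots> \<le> (LK + 1) * (4 * d)" using that LK d by (intro mult_mono) auto
    also have "\<dots> \<le> (LK + 1) * (4 * (K u / (8 * (LK + 1))))"
      using LK by (intro mult_left_mono) (auto simp: d_def)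
    also have "\<dots> = K u / 2" using LK by (simp add: field_simps)
    finally show ?thesis by linarith
  qed
  then have "kernel K KM LK (K u / 2) d u"
    using K u d by unfold_locales auto
  then show ?thesis by blast
qed

context kernel
begin

lemma KM_pos: "0 < KM"
  using K_le[of u1] K_pos[of u1] k0 d by simp

lemma kernel_meas [measurable]: "K \<in> borel_measurable borel"
  using K_lipschitz by (rule lipschitz_measurable)

text \<open>Boundary points are covered by using half of the kernel window: for
  \<open>x \<le> 1 / 2\<close> the right half lies in the unit interval because
  \<open>h \<le> 1 / 2\<close>, and otherwise the mirrored left half does. The distance from
  \<open>a\<close> keeps \<open>(u - a)\<^sup>2 * K u\<close> away from 0 there.\<close>

lemma good_interval:
  assumes x: "x \<in> {0..1}" and h: "0 < h" "h \<le> 1 / 2"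
  shows "\<exists>p. 0 \<le> x + h * p \<and> x + h * (p + d) \<le> 1 \<and> (\<forall>u\<in>{p..p + d}. k0 \<le> K u \<and> d \<le> \<bar>u - a\<bar>)"
proof -
  have pos: "\<exists>q\<ge>0. q + d \<le> 1 \<and> (\<forall>u\<in>{q..q + d}. k0 \<le> K u \<and> d \<le> \<bar>u - a\<bar>)" for a
  \<comment> \<open>The last quarter of the interval is far from \<open>a\<close> if
    \<open>a\<close> lies left of the midpoint, and the first quarter if it lies right.\<close>
  proof (cases "a \<le> u1 + 2 * d")
    case True
    have "\<forall>u\<in>{u1 + 3 * d..u1 + 3 * d + d}. k0 \<le> K u \<and> d \<le> \<bar>u - a\<bar>"
      using True d u1 by (auto intro!: K_pos)
    then show ?thesis using d u1 by (intro exI[of _ "u1 + 3 * d"]) auto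
  next
    case False
    have "\<forall>u\<in>{u1..u1 + d}. k0 \<le> K u \<and> d \<le> \<bar>u - a\<bar>"
      using False d u1 by (auto intro!: K_pos)
    then show ?thesis using d u1 by (intro exI[of _ "u1"]) auto
  qed
  show ?thesis
  proof (cases "x \<le> 1 / 2")
    case True
    obtain q where q: "0 \<le> q" "q + d \<le> 1" "\<forall>u\<in>{q..q + d}. k0 \<le> K u \<and> d \<le> \<bar>u - a\<bar>" using pos by blast
    have "h * (q + d) \<le> 1 / 2 * 1" using h q d by (intro mult_mono) auto
    then show ?thesis using q x h True by (intro exI[of _ q]) auto
  next
    case False
    obtain q where q: "0 \<le> q" "q + d \<le> 1" "\<forall>u\<in>{q..q + d}. k0 \<le> K u \<and> d \<le> \<bar>u - (- a)\<bar>" using pos by blast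
    have *: "k0 \<le> K u \<and> d \<le> \<bar>u - a\<bar>" if "u \<in> {- (q + d)..- (q + d) + d}" for u
      using q(3)[rule_format, of "- u"] that K_sym[of u] by auto
    have "h * (q + d) \<le> 1 / 2 * 1" using h q d by (intro mult_mono) auto
    moreover have "h * (- (q + d) + d) \<le> 0" using h q by simp
    moreover have "h * - (q + d) = - (h * (q + d))" by (rule mult_minus_right)
    ultimately have "0 \<le> x + h * - (q + d)" "x + h * (- (q + d) + d) \<le> 1"
      using x False unfolding atLeastAtMost_iff by linarith+
    with * show ?thesis by blast
  qed
qed

lemma window_integrable:
  fixes g :: "real \<Rightarrow> real"
  assumes "g \<in> borel_measurable borel" "\<And>u. u \<in> {-1..1} \<Longrightarrow> \<bar>g u\<bar> \<le> C" "\<And>u. u \<notin> {-1..1} \<Longrightarrow> g u = 0"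
    and I0: "I0 \<in> sets borel"
  shows "set_integrable lborel I0 g"
proof -
  have "set_integrable lborel {-1..1::real} (\<lambda>_. C)" by (rule borel_integrable_atLeastAtMost') auto
  then have "integrable lborel (\<lambda>u. indicator {-1..1::real} u *\<^sub>R C)" unfolding set_integrable_def .
  then show ?thesis unfolding set_integrable_def
  proof (rule Bochner_Integration.integrable_bound)
    show "AE u in lborel. norm (indicator I0 u *\<^sub>R g u) \<le> norm (indicator {-1..1} u *\<^sub>R C)"
    proof (rule AE_I2)
      fix u
      show "norm (indicator I0 u *\<^sub>R g u) \<le> norm (indicator {-1..1} u *\<^sub>R C)"
      proof (cases "u \<in> {-1..1}")
        case True
        then show ?thesis using assms(2)[OF True] by (auto simp: indicator_def)
      qed (simp add: assms(3))
    qed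
  qed (use assms in measurable)
qed

lemma set_integral_ge_interval:
  fixes g :: "real \<Rightarrow> real"
  assumes g: "set_integrable lborel I0 g" "\<And>u. 0 \<le> g u" and I0: "I0 \<in> sets borel" "{p..q} \<subseteq> I0" "p \<le> q"
    and c: "\<And>u. u \<in> {p..q} \<Longrightarrow> c \<le> g u"
  shows "c * (q - p) \<le> (LBINT u:I0. g u)"
proof -
  have "c * (q - p) = (LBINT u:{p..q}. c)" using I0(3) by (simp add: set_lebesgue_integral_def)
  also have "\<dots> \<le> (LBINT u:I0. g u)"
    unfolding set_lebesgue_integral_def
  proof (rule integral_mono)
    have "set_integrable lborel {p..q} (\<lambda>_. c)" by (rule borel_integrable_atLeastAtMost') auto
    then show "integrable lborel (\<lambda>u. indicator {p..q} u *\<^sub>R c)" by (simp only: set_integrable_def)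
    show "integrable lborel (\<lambda>u. indicator I0 u *\<^sub>R g u)" using g(1) by (simp add: set_integrable_def)
    show "indicator {p..q} u *\<^sub>R c \<le> indicator I0 u *\<^sub>R g u" for u
      using c[of u] g(2)[of u] I0(2) by (auto simp: indicator_def)
  qed
  finally show ?thesis .
qed

lemma K_pow_bound: "u \<in> {-1..1} \<Longrightarrow> \<bar>u ^ l * K u\<bar> \<le> K u"
  using K_nonneg[of u] by (auto simp: abs_mult power_abs intro!: mult_left_le_one_le power_le_one)

text \<open>The constants must not depend on \<open>x\<close>, including points near the boundary
  where the window is cut. The determinant is handled through the quadratic form
  \<open>(u - a)\<^sup>2\<close>, integrated against \<open>K\<close>. The lower bound of
  \<open>s_fun\<close> is the Cauchy-Schwarz inequality on a window of length at most 2.\<close>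

lemma kappa_bounds:
  assumes x: "x \<in> {0..1}" and h: "0 < h" "h \<le> 1 / 2"
  shows "\<bar>kappa K l x h\<bar> \<le> 1" "k0 * d \<le> kappa K 0 x h"
    "k0 * d ^ 3 * (k0 * d) \<le> kappa K 0 x h * kappa K 2 x h - (kappa K 1 x h)\<^sup>2"
    "1 / 2 \<le> s_fun K x h" "s_fun K x h \<le> 8 * KM\<^sup>2 / (k0 * d ^ 3 * (k0 * d))\<^sup>2"
proof -
  define I0 where "I0 = {- x / h..(1 - x) / h}"
  have I0m: "I0 \<in> sets borel" by (simp add: I0_def)
  have Ki: "set_integrable lborel I0 (\<lambda>u. u ^ l * K u)" for l
  proof (rule window_integrable[OF _ _ _ I0m, where C = KM])
    show "\<bar>u ^ l * K u\<bar> \<le> KM" if "u \<in> {-1..1}" for u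
      using K_pow_bound[OF that, of l] K_le[of u] by linarith
  qed (auto simp: K_zero)
  have kap: "kappa K l x h = (LBINT u:I0. u ^ l * K u)" for l by (simp add: kappa_def I0_def)
  have kb: "\<bar>kappa K l x h\<bar> \<le> 1" for l
  proof -
    have iK: "integrable lborel K" using K_one by (simp add: has_bochner_integral_iff)
    have "\<bar>kappa K l x h\<bar> \<le> (\<integral>u. \<bar>indicator I0 u *\<^sub>R (u ^ l * K u)\<bar> \<partial>lborel)"
      unfolding kap set_lebesgue_integral_def by (rule integral_abs_bound)
    also have "\<dots> \<le> (\<integral>u. K u \<partial>lborel)"
    proof (rule integral_mono'[OF iK])
      fix u
      show "\<bar>indicator I0 u *\<^sub>R (u ^ l * K u)\<bar> \<le> K u"
      proof (cases "u \<in> {-1..1}")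
        case True
        then show ?thesis using K_pow_bound[OF True, of l] K_nonneg[of u] by (auto simp: indicator_def)
      qed (simp add: K_zero)
    qed (rule K_nonneg)
    also have "\<dots> = 1" using K_one by (rule has_bochner_integral_integral_eq)
    finally show ?thesis .
  qed
  show "\<bar>kappa K l x h\<bar> \<le> 1" by (rule kb)
  have inI: "{p..p + d} \<subseteq> I0" if "0 \<le> x + h * p" "x + h * (p + d) \<le> 1" for p
  proof -
    have "- x / h \<le> p" "p + d \<le> (1 - x) / h" using that h by (auto simp: field_simps)
    then show ?thesis by (auto simp: I0_def)
  qed
  show k0d: "k0 * d \<le> kappa K 0 x h"
  proof -
    obtain p where p: "0 \<le> x + h * p" "x + h * (p + d) \<le> 1" "\<forall>u\<in>{p..p + d}. k0 \<le> K u \<and> d \<le> \<bar>u - 0\<bar>"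
      using good_interval[OF assms] by blast
    have "k0 * (p + d - p) \<le> (LBINT u:I0. u ^ 0 * K u)"
      by (rule set_integral_ge_interval[OF Ki _ I0m inI[OF p(1,2)]]) (use p d K_nonneg in auto)
    then show ?thesis by (simp add: kap)
  qed
  have quad: "k0 * d ^ 3 \<le> kappa K 2 x h - 2 * a * kappa K 1 x h + a\<^sup>2 * kappa K 0 x h" for a
  proof -
    obtain p where p: "0 \<le> x + h * p" "x + h * (p + d) \<le> 1" "\<forall>u\<in>{p..p + d}. k0 \<le> K u \<and> d \<le> \<bar>u - a\<bar>"
      using good_interval[OF assms] by blast
    have eq: "(u - a)\<^sup>2 * K u = u ^ 2 * K u - 2 * a * (u ^ 1 * K u) + a\<^sup>2 * (u ^ 0 * K u)" for u
      by (simp add: power2_eq_square algebra_simps)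
    have i: "set_integrable lborel I0 (\<lambda>u. (u - a)\<^sup>2 * K u)"
      unfolding eq using Ki[of 2] Ki[of 1] Ki[of 0]
      by (intro set_integral_add set_integral_diff set_integrable_mult_right) auto
    have "k0 * d\<^sup>2 * (p + d - p) \<le> (LBINT u:I0. (u - a)\<^sup>2 * K u)"
    proof (rule set_integral_ge_interval[OF i _ I0m inI[OF p(1,2)]])
      fix u assume u: "u \<in> {p..p + d}"
      have "d\<^sup>2 \<le> \<bar>u - a\<bar>\<^sup>2" using p(3) u d by (intro power_mono) auto
      then have "k0 * d\<^sup>2 \<le> K u * (u - a)\<^sup>2" using p(3) u k0 K_nonneg by (intro mult_mono) auto
      then show "k0 * d\<^sup>2 \<le> (u - a)\<^sup>2 * K u" by (simp only: mult.commute)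
    qed (use d K_nonneg in auto)
    also have "(LBINT u:I0. (u - a)\<^sup>2 * K u) = kappa K 2 x h - 2 * a * kappa K 1 x h + a\<^sup>2 * kappa K 0 x h"
      unfolding eq kap using Ki[of 2] Ki[of 1] Ki[of 0]
      by (subst set_integral_add set_integral_diff, (auto intro!: set_integral_add set_integral_diff set_integrable_mult_right)[2])+ simp
    finally show ?thesis by (simp add: power3_eq_cube power2_eq_square mult.assoc)
  qed
  have kd: "0 < k0 * d" using k0 d by simp
  show det: "k0 * d ^ 3 * (k0 * d) \<le> kappa K 0 x h * kappa K 2 x h - (kappa K 1 x h)\<^sup>2"
    using quadratic_discriminant_bound[OF quad k0d kd] k0 d by (simp add: mult.commute)
  define D where "D = kappa K 0 x h * kappa K 2 x h - (kappa K 1 x h)\<^sup>2"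
  have Dpos: "0 < D" using det k0 d by (intro less_le_trans[OF _ det[folded D_def]]) simp
  \<comment> \<open>The boundary-corrected kernel before normalisation: its integral over the cut
    window is the determinant \<open>D\<close>, and the integral of its square is the numerator of
    \<open>s_fun\<close>.\<close>
  let ?a = "\<lambda>u. K u * (kappa K 2 x h - kappa K 1 x h * u)"
  have ab: "\<bar>?a u\<bar> \<le> 2 * KM" if "u \<in> {-1..1}" for u
  proof -
    have "\<bar>kappa K 1 x h * u\<bar> \<le> 1 * 1" unfolding abs_mult using kb[of 1] that by (intro mult_mono) auto
    then have "\<bar>kappa K 2 x h - kappa K 1 x h * u\<bar> \<le> 2" using kb[of 2] by linarith
    then have "\<bar>K u\<bar> * \<bar>kappa K 2 x h - kappa K 1 x h * u\<bar> \<le> KM * 2"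
      using K_nonneg[of u] K_le[of u] KM_pos by (intro mult_mono) auto
    then show ?thesis by (simp add: abs_mult)
  qed
  have am: "?a \<in> borel_measurable borel" by measurable
  have ia: "set_integrable lborel I0 ?a"
    by (rule window_integrable[OF am ab _ I0m]) (auto simp: K_zero)
  have ia2: "set_integrable lborel I0 (\<lambda>u. (?a u)\<^sup>2)"
  proof (rule window_integrable[OF _ _ _ I0m, where C = "(2 * KM)\<^sup>2"])
    show "\<bar>(?a u)\<^sup>2\<bar> \<le> (2 * KM)\<^sup>2" if "u \<in> {-1..1}" for u
      using power_mono[OF ab[OF that], of 2] by (simp only: power2_abs abs_power2 abs_ge_zero)
  qed (use am in \<open>auto simp: K_zero\<close>)
  have Da: "(LBINT u:I0. ?a u) = D"
  proof -
    have "?a u = kappa K 2 x h * (u ^ 0 * K u) - kappa K 1 x h * (u ^ 1 * K u)" for u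
      by (simp add: algebra_simps)
    then have "(LBINT u:I0. ?a u) = kappa K 2 x h * kappa K 0 x h - kappa K 1 x h * kappa K 1 x h"
      unfolding kap[of 0] kap[of 1] using Ki[of 0] Ki[of 1]
      by (simp only: set_integral_mult_right) (subst set_integral_diff(2), auto)
    then show ?thesis by (simp add: D_def power2_eq_square mult.commute)
  qed
  let ?N = "LBINT u:I0. (?a u)\<^sup>2"
  have sN: "s_fun K x h = ?N / D\<^sup>2"
    by (simp add: s_fun_def D_def I0_def power_mult_distrib)
  have i1: "integrable lborel (\<lambda>u. indicator {-1..1::real} u * C)" for C :: real
    using borel_integrable_atLeastAtMost'[of "-1" 1 "\<lambda>_. C"] by (simp add: set_integrable_def)
  have e1: "(\<integral>u. indicator {-1..1::real} u * C \<partial>lborel) = 2 * C" for C :: real by simp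
  \<comment> \<open>Cauchy-Schwarz in elementary form: integrate
    \<open>(?a u - D / 2)\<^sup>2 \<ge> 0\<close> over the part of the window inside
    \<open>{-1..1}\<close>, and keep the constant \<open>D\<^sup>2 / 4\<close> over all of
    \<open>{-1..1}\<close>, whose length is 2.\<close>
  have "D\<^sup>2 / 2 \<le> ?N"
  proof -
    have "0 \<le> (\<integral>u. indicator I0 u * (?a u)\<^sup>2 - D * (indicator I0 u * ?a u) + indicator {-1..1} u * (D\<^sup>2 / 4) \<partial>lborel)"
    proof (rule Bochner_Integration.integral_nonneg)
      fix u
      show "0 \<le> indicator I0 u * (?a u)\<^sup>2 - D * (indicator I0 u * ?a u) + indicator {-1..1} u * (D\<^sup>2 / 4)"
      proof (cases "u \<in> {-1..1} \<and> u \<in> I0")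
        case True
        have "0 \<le> (?a u - D / 2)\<^sup>2" by simp
        also have "\<dots> = (?a u)\<^sup>2 - D * ?a u + D\<^sup>2 / 4" by (simp add: power2_diff power_divide)
        finally show ?thesis using True by simp
      next
        case False
        then show ?thesis by (auto simp: K_zero indicator_def)
      qed
    qed
    also have "\<dots> = ?N - D * (LBINT u:I0. ?a u) + 2 * (D\<^sup>2 / 4)"
      using ia ia2 i1[of "D\<^sup>2 / 4"] unfolding set_integrable_def set_lebesgue_integral_def e1[symmetric]
      by simp
    finally show ?thesis unfolding Da by (simp add: power2_eq_square)
  qed
  then show "1 / 2 \<le> s_fun K x h" unfolding sN using Dpos by (simp add: pos_le_divide_eq)
  have "?N \<le> (\<integral>u. indicator {-1..1::real} u * (2 * KM)\<^sup>2 \<partial>lborel)"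
    unfolding set_lebesgue_integral_def
  proof (rule integral_mono)
    show "integrable lborel (\<lambda>u. indicator {-1..1::real} u * (2 * KM)\<^sup>2)" using i1[of "(2 * KM)\<^sup>2"] .
    show "integrable lborel (\<lambda>u. indicator I0 u *\<^sub>R (?a u)\<^sup>2)" using ia2 by (simp add: set_integrable_def)
    fix u
    show "indicator I0 u *\<^sub>R (?a u)\<^sup>2 \<le> indicator {-1..1} u * (2 * KM)\<^sup>2"
    proof (cases "u \<in> {-1..1}")
      case True
      have "(?a u)\<^sup>2 \<le> (2 * KM)\<^sup>2" using power_mono[OF ab[OF True], of 2] by simp
      then show ?thesis using True by (auto simp: indicator_def)
    qed (simp add: K_zero)
  qed
  then have N8: "?N \<le> 8 * KM\<^sup>2" by (simp add: power_mult_distrib)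
  have "?N / D\<^sup>2 \<le> 8 * KM\<^sup>2 / D\<^sup>2" using N8 by (intro divide_right_mono) auto
  also have "\<dots> \<le> 8 * KM\<^sup>2 / (k0 * d ^ 3 * (k0 * d))\<^sup>2"
    using det k0 d Dpos by (intro divide_left_mono power_mono mult_pos_pos) (auto simp: D_def)
  finally show "s_fun K x h \<le> 8 * KM\<^sup>2 / (k0 * d ^ 3 * (k0 * d))\<^sup>2" unfolding sN .
qed

end

section \<open>The local linear estimator\<close>

lemma Kh_phi: "0 < h \<Longrightarrow> Kh K h v * (v / h) ^ l = phi K l (v / h) / h"
  by (simp add: Kh_def phi_def)

lemma S_loc_phi:
  assumes "0 < h"
  shows "S_loc K T X i l x h = (\<Sum>t=1..T. phi K l ((X i t - x) / h)) / (h * real T)"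
  unfolding S_loc_def Kh_phi[OF assms] by (simp add: sum_divide_distrib[symmetric])

text \<open>The local linear weights are linear in the two functions \<open>phi K 0\<close> and
  \<open>phi K 1\<close>, so the estimator is a quotient of quadratic expressions in five normalised
  sums, to which a perturbation argument applies.\<close>

lemma m_hat_quotient:
  fixes X Y :: "nat \<Rightarrow> nat \<Rightarrow> real" and K :: "real \<Rightarrow> real" and x h :: real and i n T :: nat
  assumes h: "0 < h" and T: "1 \<le> T"
  defines "S \<equiv> \<lambda>l. (\<Sum>t=1..T. phi K l ((X i t - x) / h)) / (h * real T)"
    and "A \<equiv> \<lambda>l. (\<Sum>t=1..T. phi K l ((X i t - x) / h) * Y_star n T Y i t) / (h * real T)"
  shows "m_hat K n T X Y i h x = (S 2 * A 0 - S 1 * A 1) / (S 2 * S 0 - (S 1)\<^sup>2)"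
proof -
  have SS: "S_loc K T X i l x h = S l" for l unfolding S_def by (rule S_loc_phi[OF h])
  have T0: "real T \<noteq> 0" using T by simp
  have W: "W_loc K T X i t x h = phi K 0 ((X i t - x) / h) / h * S 2 - phi K 1 ((X i t - x) / h) / h * S 1" for t
    using h by (simp add: W_loc_def SS Kh_def phi_def field_simps)
  have sumW: "(\<Sum>t=1..T. W_loc K T X i t x h * Z t)
      = real T * (S 2 * ((\<Sum>t=1..T. phi K 0 ((X i t - x) / h) * Z t) / (h * real T))
        - S 1 * ((\<Sum>t=1..T. phi K 1 ((X i t - x) / h) * Z t) / (h * real T)))" for Z
  proof -
    have "(\<Sum>t=1..T. W_loc K T X i t x h * Z t) = (\<Sum>t=1..T. S 2 / h * (phi K 0 ((X i t - x) / h) * Z t)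
        - S 1 / h * (phi K 1 ((X i t - x) / h) * Z t))"
      by (rule sum.cong) (simp_all add: W algebra_simps)
    also have "\<dots> = S 2 / h * (\<Sum>t=1..T. phi K 0 ((X i t - x) / h) * Z t)
        - S 1 / h * (\<Sum>t=1..T. phi K 1 ((X i t - x) / h) * Z t)"
      by (simp add: sum_subtractf sum_distrib_left)
    moreover have q: "c / h * P = real T * (c * (P / (h * real T)))" for c P
      using T0 h by simp
    ultimately show ?thesis by (simp only: q right_diff_distrib)
  qed
  have num: "(\<Sum>t=1..T. W_loc K T X i t x h * Y_star n T Y i t) = real T * (S 2 * A 0 - S 1 * A 1)"
    using sumW[of "Y_star n T Y i"] by (simp only: A_def)
  have "(\<Sum>t=1..T. W_loc K T X i t x h) = (\<Sum>t=1..T. W_loc K T X i t x h * 1)" by simp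
  also have "\<dots> = real T * (S 2 * S 0 - S 1 * S 1)"
    unfolding sumW by (simp add: S_def)
  finally have den: "(\<Sum>t=1..T. W_loc K T X i t x h) = real T * (S 2 * S 0 - (S 1)\<^sup>2)"
    by (simp only: power2_eq_square)
  show ?thesis unfolding m_hat_def num den using T0 by simp
qed

text \<open>\<open>\<alpha> i\<close> leaves with the individual's own time average and
  \<open>\<gamma> t\<close> with the average over the others at time \<open>t\<close>; the overall
  average cancels the two averages of fixed effects that these subtractions bring in.\<close>

lemma Y_star_noise:
  fixes Y Z :: "nat \<Rightarrow> nat \<Rightarrow> real"
  assumes n: "2 \<le> n" and T: "1 \<le> T" and i: "i \<in> {1..n}" and t: "t \<in> {1..T}"
    and Y: "\<And>j t. j \<in> {1..n} \<Longrightarrow> t \<in> {1..T} \<Longrightarrow> Y j t = Z j t + \<alpha> j + \<gamma> t"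
  shows "Y_star n T Y i t = Z i t - (\<Sum>s=1..T. Z i s) / T
    - (\<Sum>j\<in>{1..n} - {i}. Z j t) / (real n - 1) + (\<Sum>j\<in>{1..n} - {i}. \<Sum>s=1..T. Z j s) / ((real n - 1) * T)"
proof -
  have T0: "real T \<noteq> 0" using T by simp
  have n0: "real n - 1 \<noteq> 0" using n by simp
  have c: "real (card ({1..n} - {i})) = real n - 1" using n i by (simp add: of_nat_diff)
  have 1: "(\<Sum>s=1..T. Y j s) = (\<Sum>s=1..T. Z j s) + real T * \<alpha> j + (\<Sum>s=1..T. \<gamma> s)" if "j \<in> {1..n}" for j
  proof -
    have "(\<Sum>s=1..T. Y j s) = (\<Sum>s=1..T. Z j s + \<alpha> j + \<gamma> s)" by (rule sum.cong) (use Y that in auto)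
    then show ?thesis by (simp add: sum.distrib)
  qed
  have 2: "(\<Sum>j\<in>{1..n} - {i}. Y j t) = (\<Sum>j\<in>{1..n} - {i}. Z j t) + (\<Sum>j\<in>{1..n} - {i}. \<alpha> j) + (real n - 1) * \<gamma> t"
  proof -
    have "(\<Sum>j\<in>{1..n} - {i}. Y j t) = (\<Sum>j\<in>{1..n} - {i}. Z j t + \<alpha> j + \<gamma> t)"
      by (rule sum.cong) (use Y t in auto)
    also have "\<dots> = (\<Sum>j\<in>{1..n} - {i}. Z j t) + (\<Sum>j\<in>{1..n} - {i}. \<alpha> j) + real (card ({1..n} - {i})) * \<gamma> t"
      by (simp only: sum.distrib sum_constant)
    finally show ?thesis by (simp only: c)
  qed
  have 3: "(\<Sum>j\<in>{1..n} - {i}. \<Sum>s=1..T. Y j s) = (\<Sum>j\<in>{1..n} - {i}. \<Sum>s=1..T. Z j s)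
      + real T * (\<Sum>j\<in>{1..n} - {i}. \<alpha> j) + (real n - 1) * (\<Sum>s=1..T. \<gamma> s)"
  proof -
    have "(\<Sum>j\<in>{1..n} - {i}. \<Sum>s=1..T. Y j s)
      = (\<Sum>j\<in>{1..n} - {i}. (\<Sum>s=1..T. Z j s) + real T * \<alpha> j + (\<Sum>s=1..T. \<gamma> s))"
      by (rule sum.cong[OF refl], rule 1) simp
    also have "\<dots> = (\<Sum>j\<in>{1..n} - {i}. \<Sum>s=1..T. Z j s)
      + real T * (\<Sum>j\<in>{1..n} - {i}. \<alpha> j) + real (card ({1..n} - {i})) * (\<Sum>s=1..T. \<gamma> s)"
      by (simp only: sum.distrib sum_constant sum_distrib_left[symmetric])
    finally show ?thesis by (simp only: c)
  qed
  have q: "(a + real T * b + (real n - 1) * e) / ((real n - 1) * real T)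
      = a / ((real n - 1) * real T) + b / (real n - 1) + e / real T" for a b e :: real
    using T0 n0 by (simp add: add_divide_distrib)
  have q2: "(a + b + (real n - 1) * e) / (real n - 1) = a / (real n - 1) + b / (real n - 1) + e" for a b e :: real
    using n0 by (simp add: add_divide_distrib)
  have q3: "(a + real T * b + e) / real T = a / real T + b + e / real T" for a b e :: real
    using T0 by (simp add: add_divide_distrib)
  show ?thesis
    unfolding Y_star_def 1[OF i] 2 3 q q2 q3 Y[OF i t] by simp
qed

lemma abs_average_le:
  fixes f :: "nat \<Rightarrow> real"
  assumes n: "2 \<le> n" "i \<in> {1..n}" and f: "\<And>j. j \<in> {1..n} - {i} \<Longrightarrow> \<bar>f j\<bar> \<le> b"
  shows "\<bar>(\<Sum>j\<in>{1..n} - {i}. f j) / (real n - 1)\<bar> \<le> b"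
proof -
  have c: "real (card ({1..n} - {i})) = real n - 1" using n by (simp add: of_nat_diff)
  have "\<bar>\<Sum>j\<in>{1..n} - {i}. f j\<bar> \<le> (\<Sum>j\<in>{1..n} - {i}. b)"
    by (rule order_trans[OF sum_abs sum_mono]) (rule f)
  also have "\<dots> = real (card ({1..n} - {i})) * b" by (simp only: sum_constant)
  finally have "\<bar>\<Sum>j\<in>{1..n} - {i}. f j\<bar> \<le> (real n - 1) * b" unfolding c .
  moreover have "0 < real n - 1" using n by simp
  ultimately show ?thesis by (simp add: abs_divide pos_divide_le_eq mult.commute)
qed

text \<open>Three sums are compared with \<open>b\<close> directly: the regression part, the error
  part and the average over the other individuals. The two time averages do not depend on
  \<open>t\<close>, so they leave the weighted sum, and the factor \<open>C * h * T\<close> from the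
  weights meets \<open>b / (h * T)\<close>. This is the constant \<open>3 + 2 * C\<close>.\<close>

lemma weighted_Y_star_bound:
  fixes \<phi> \<mu>X \<epsilon> :: "nat \<Rightarrow> real" and Z :: "nat \<Rightarrow> nat \<Rightarrow> real"
  assumes n: "2 \<le> n" "i \<in> {1..n}" and T: "1 \<le> T" and h: "0 < h" and C: "0 \<le> C"
    and Ys: "\<And>t. t \<in> {1..T} \<Longrightarrow> Ys t = Z i t - (\<Sum>s=1..T. Z i s) / T
      - (\<Sum>j\<in>{1..n} - {i}. Z j t) / (real n - 1) + (\<Sum>j\<in>{1..n} - {i}. \<Sum>s=1..T. Z j s) / ((real n - 1) * T)"
    and Z: "\<And>t. t \<in> {1..T} \<Longrightarrow> Z i t = \<mu>X t + \<epsilon> t"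
    and b1: "\<bar>(\<Sum>t=1..T. \<phi> t * \<mu>X t) - r\<bar> \<le> b" and b2: "\<bar>\<Sum>t=1..T. \<phi> t * \<epsilon> t\<bar> \<le> b"
    and b3: "\<And>j. j \<in> {1..n} - {i} \<Longrightarrow> \<bar>\<Sum>t=1..T. \<phi> t * Z j t\<bar> \<le> b"
    and b4: "\<And>j. j \<in> {1..n} \<Longrightarrow> h * \<bar>\<Sum>t=1..T. Z j t\<bar> \<le> b"
    and b5: "\<bar>\<Sum>t=1..T. \<phi> t\<bar> \<le> C * (h * T)"
  shows "\<bar>(\<Sum>t=1..T. \<phi> t * Ys t) - r\<bar> \<le> (3 + 2 * C) * b"
proof -
  let ?P = "\<Sum>t=1..T. \<phi> t"
  let ?q = "(\<Sum>j\<in>{1..n} - {i}. \<Sum>s=1..T. Z j s) / (real n - 1)"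
  have T0: "0 < real T" using T by simp
  have "(\<Sum>t=1..T. \<phi> t * Ys t) = (\<Sum>t=1..T. \<phi> t * \<mu>X t + \<phi> t * \<epsilon> t - \<phi> t * ((\<Sum>s=1..T. Z i s) / T)
      - (\<Sum>j\<in>{1..n} - {i}. \<phi> t * Z j t) / (real n - 1) + \<phi> t * (?q / T))"
    by (rule sum.cong) (simp_all add: Ys Z sum_distrib_left[symmetric] algebra_simps)
  also have "\<dots> = (\<Sum>t=1..T. \<phi> t * \<mu>X t) + (\<Sum>t=1..T. \<phi> t * \<epsilon> t) - ?P * ((\<Sum>s=1..T. Z i s) / T)
      - (\<Sum>t=1..T. \<Sum>j\<in>{1..n} - {i}. \<phi> t * Z j t) / (real n - 1) + ?P * (?q / T)"
    by (simp only: sum.distrib sum_subtractf sum_distrib_right sum_divide_distrib)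
  also have "(\<Sum>t=1..T. \<Sum>j\<in>{1..n} - {i}. \<phi> t * Z j t) = (\<Sum>j\<in>{1..n} - {i}. \<Sum>t=1..T. \<phi> t * Z j t)"
    by (rule sum.swap)
  finally have eq: "(\<Sum>t=1..T. \<phi> t * Ys t) = (\<Sum>t=1..T. \<phi> t * \<mu>X t) + (\<Sum>t=1..T. \<phi> t * \<epsilon> t)
      - ?P * ((\<Sum>s=1..T. Z i s) / T) - (\<Sum>j\<in>{1..n} - {i}. \<Sum>t=1..T. \<phi> t * Z j t) / (real n - 1) + ?P * (?q / T)" .
  have PZ: "\<bar>?P * (z / T)\<bar> \<le> C * b" if "h * \<bar>z\<bar> \<le> b" for z
  proof -
    have "\<bar>?P * (z / T)\<bar> \<le> (C * (h * T)) * (\<bar>z\<bar> / T)"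
      unfolding abs_mult abs_divide using T0 by (intro mult_mono b5) (auto intro!: divide_nonneg_nonneg mult_nonneg_nonneg C less_imp_le[OF h])
    also have "\<dots> = C * (h * \<bar>z\<bar>)" using T0 by simp
    also have "\<dots> \<le> C * b" by (rule mult_left_mono[OF that C])
    finally show ?thesis .
  qed
  have p1: "\<bar>?P * ((\<Sum>s=1..T. Z i s) / T)\<bar> \<le> C * b" by (rule PZ) (rule b4[OF n(2)])
  have p2: "\<bar>?P * (?q / T)\<bar> \<le> C * b"
  proof (rule PZ)
    have "\<bar>(\<Sum>j\<in>{1..n} - {i}. h * (\<Sum>s=1..T. Z j s)) / (real n - 1)\<bar> \<le> b"
      by (rule abs_average_le[OF n]) (use b4 h in \<open>auto simp: abs_mult\<close>)
    also have "(\<Sum>j\<in>{1..n} - {i}. h * (\<Sum>s=1..T. Z j s)) / (real n - 1) = h * ?q"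
      by (simp only: sum_distrib_left[symmetric] times_divide_eq_right)
    finally show "h * \<bar>?q\<bar> \<le> b" using h by (simp only: abs_mult abs_of_pos)
  qed
  have p3: "\<bar>(\<Sum>j\<in>{1..n} - {i}. \<Sum>t=1..T. \<phi> t * Z j t) / (real n - 1)\<bar> \<le> b"
    by (rule abs_average_le[OF n b3])
  have "(3 + 2 * C) * b = 3 * b + 2 * (C * b)" by (simp add: algebra_simps)
  then show ?thesis unfolding eq using b1 b2 p1 p2 p3 by linarith
qed

text \<open>Each product of two perturbed entries moves by at most \<open>(2 * B + 1) * e\<close>,
  so numerator and denominator move by twice that. The quotients are compared by
  \<open>N / D - n / d = (N - n) / D - n * (D - d) / (D * d)\<close>, with
  \<open>D \<ge> c / 2\<close>, \<open>d \<ge> c\<close> and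
  \<open>\<bar>n\<bar> \<le> 2 * B\<^sup>2\<close>.\<close>

lemma quotient_perturbation:
  fixes S A s r :: "nat \<Rightarrow> real"
  assumes S: "\<And>l. l \<le> 2 \<Longrightarrow> \<bar>S l - s l\<bar> \<le> e" and A: "\<And>l. l \<le> 1 \<Longrightarrow> \<bar>A l - r l\<bar> \<le> e"
    and s: "\<And>l. l \<le> 2 \<Longrightarrow> \<bar>s l\<bar> \<le> B" and r: "\<And>l. l \<le> 1 \<Longrightarrow> \<bar>r l\<bar> \<le> B"
    and e: "0 \<le> e" "e \<le> 1" "2 * (2 * B + 1) * e \<le> c / 2" and c: "0 < c" "c \<le> s 2 * s 0 - (s 1)\<^sup>2"
  shows "c / 2 \<le> S 2 * S 0 - (S 1)\<^sup>2"
    and "\<bar>(S 2 * A 0 - S 1 * A 1) / (S 2 * S 0 - (S 1)\<^sup>2) - (s 2 * r 0 - s 1 * r 1) / (s 2 * s 0 - (s 1)\<^sup>2)\<bar>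
      \<le> (4 * (2 * B + 1) / c + 8 * B\<^sup>2 * (2 * B + 1) / c\<^sup>2) * e"
proof -
  have B: "0 \<le> B" using s[of 0] by linarith
  have prod: "\<bar>P * Q - p * q\<bar> \<le> (2 * B + 1) * e"
    if "\<bar>P - p\<bar> \<le> e" "\<bar>Q - q\<bar> \<le> e" "\<bar>p\<bar> \<le> B" "\<bar>q\<bar> \<le> B" for P Q p q
  proof -
    have "P * Q - p * q = (P - p) * Q + p * (Q - q)" by (simp add: algebra_simps)
    also have "\<bar>\<dots>\<bar> \<le> \<bar>P - p\<bar> * \<bar>Q\<bar> + \<bar>p\<bar> * \<bar>Q - q\<bar>"
      by (rule order_trans[OF abs_triangle_ineq]) (simp add: abs_mult)
    also have "\<dots> \<le> e * (B + 1) + B * e"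
      using that e B by (intro add_mono mult_mono) auto
    finally show ?thesis by (simp add: algebra_simps)
  qed
  define N where "N = S 2 * A 0 - S 1 * A 1"
  define n0 where "n0 = s 2 * r 0 - s 1 * r 1"
  define De where "De = S 2 * S 0 - (S 1)\<^sup>2"
  define de where "de = s 2 * s 0 - (s 1)\<^sup>2"
  define \<Delta> where "\<Delta> = 2 * (2 * B + 1) * e"
  have \<Delta>2: "\<Delta> = (2 * B + 1) * e + (2 * B + 1) * e" by (simp add: \<Delta>_def)
  have "\<bar>S 2 * A 0 - s 2 * r 0\<bar> \<le> (2 * B + 1) * e" "\<bar>S 1 * A 1 - s 1 * r 1\<bar> \<le> (2 * B + 1) * e"
    by (intro prod S A s r; simp)+
  then have N: "\<bar>N - n0\<bar> \<le> \<Delta>" unfolding N_def n0_def \<Delta>2 by linarith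
  have "\<bar>S 2 * S 0 - s 2 * s 0\<bar> \<le> (2 * B + 1) * e" "\<bar>S 1 * S 1 - s 1 * s 1\<bar> \<le> (2 * B + 1) * e"
    by (intro prod S s; simp)+
  then have D: "\<bar>De - de\<bar> \<le> \<Delta>" unfolding De_def de_def power2_eq_square \<Delta>2 by linarith
  have de: "c \<le> de" using c(2) by (simp only: de_def)
  have De: "c / 2 \<le> De" using D de e(3) unfolding \<Delta>_def by linarith
  then show "c / 2 \<le> S 2 * S 0 - (S 1)\<^sup>2" by (simp only: De_def)
  have \<Delta>0: "0 \<le> \<Delta>" using e B by (simp add: \<Delta>_def)
  have n0: "\<bar>n0\<bar> \<le> 2 * B\<^sup>2"
  proof -
    have "\<bar>s 2 * r 0\<bar> \<le> B * B" "\<bar>s 1 * r 1\<bar> \<le> B * B"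
      unfolding abs_mult using B by (intro mult_mono s r; simp)+
    then show ?thesis unfolding n0_def power2_eq_square by linarith
  qed
  have p: "0 < De" "0 < de" using c De de by linarith+
  have "N / De - n0 / de = (N - n0) / De - n0 * (De - de) / (De * de)"
    using p by (simp add: field_simps)
  also have "\<bar>\<dots>\<bar> \<le> \<bar>N - n0\<bar> / De + \<bar>n0\<bar> * \<bar>De - de\<bar> / (De * de)"
    by (rule order_trans[OF abs_triangle_ineq4]) (use p in \<open>simp add: abs_mult abs_divide\<close>)
  also have "\<dots> \<le> \<Delta> / (c / 2) + (2 * B\<^sup>2) * \<Delta> / (c / 2 * c)"
    using p c De de N D n0 \<Delta>0 by (intro add_mono frac_le mult_mono) auto
  also have "\<dots> = (4 * (2 * B + 1) / c + 8 * B\<^sup>2 * (2 * B + 1) / c\<^sup>2) * e"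
    using c(1) by (simp add: \<Delta>_def power2_eq_square field_simps)
  finally show "\<bar>(S 2 * A 0 - S 1 * A 1) / (S 2 * S 0 - (S 1)\<^sup>2) - (s 2 * r 0 - s 1 * r 1) / (s 2 * s 0 - (s 1)\<^sup>2)\<bar>
      \<le> (4 * (2 * B + 1) / c + 8 * B\<^sup>2 * (2 * B + 1) / c\<^sup>2) * e"
    unfolding N_def n0_def De_def de_def .
qed

text \<open>The average of the other individuals' noise does not vanish when there are few of them,
  so it cannot be put into the small remainder \<open>z\<close>. For the lower bound it suffices
  that its mixed sum with the individual's own error is small; for the upper bound its square is
  controlled by Cauchy-Schwarz.\<close>

lemma residual_variance_bounds:
  fixes e \<epsilon> \<eta> z :: "nat \<Rightarrow> real" and Z :: "nat \<Rightarrow> nat \<Rightarrow> real"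
  assumes n: "2 \<le> n" "i \<in> {1..n}" and T: "1 \<le> T"
    and res: "\<And>t. t \<in> {1..T} \<Longrightarrow> res t = \<epsilon> t - (\<Sum>j\<in>{1..n} - {i}. Z j t) / (real n - 1) + z t"
    and z: "\<And>t. t \<in> {1..T} \<Longrightarrow> \<bar>z t\<bar> \<le> \<delta>" and \<delta>: "0 \<le> \<delta>"
    and Z2: "\<And>j. j \<in> {1..n} - {i} \<Longrightarrow> (\<Sum>t=1..T. (Z j t)\<^sup>2) \<le> CZ * T"
    and \<epsilon>2: "cl * T \<le> (\<Sum>t=1..T. (\<epsilon> t)\<^sup>2)" "(\<Sum>t=1..T. (\<epsilon> t)\<^sup>2) \<le> cu * T"
    and cross: "\<And>j. j \<in> {1..n} - {i} \<Longrightarrow> \<bar>\<Sum>t=1..T. \<epsilon> t * Z j t\<bar> \<le> \<delta> * T"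
  shows "(cl / 2 - \<delta> - \<delta>\<^sup>2) * T \<le> (\<Sum>t=1..T. (res t)\<^sup>2)"
    and "(\<Sum>t=1..T. (res t)\<^sup>2) \<le> 3 * (cu + CZ + \<delta>\<^sup>2) * T"
proof -
  let ?J = "{1..n} - {i}"
  define q where "q t = (\<Sum>j\<in>?J. Z j t) / (real n - 1)" for t
  have m: "0 < real n - 1" using n by simp
  have c: "real (card ?J) = real n - 1" using n by (simp add: of_nat_diff)
  have zz: "(z t)\<^sup>2 \<le> \<delta>\<^sup>2" if "t \<in> {1..T}" for t
    using power_mono[OF z[OF that] abs_ge_zero, of 2] by simp
  have cr: "\<bar>\<Sum>t=1..T. \<epsilon> t * q t\<bar> \<le> \<delta> * T"
  proof -
    have "(\<Sum>t=1..T. \<epsilon> t * q t) = (\<Sum>t=1..T. \<Sum>j\<in>?J. \<epsilon> t * Z j t) / (real n - 1)"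
      by (simp only: q_def sum_distrib_left sum_divide_distrib times_divide_eq_right)
    also have "(\<Sum>t=1..T. \<Sum>j\<in>?J. \<epsilon> t * Z j t) = (\<Sum>j\<in>?J. \<Sum>t=1..T. \<epsilon> t * Z j t)" by (rule sum.swap)
    finally show ?thesis using abs_average_le[OF n, of "\<lambda>j. \<Sum>t=1..T. \<epsilon> t * Z j t"] cross by simp
  qed
  have q2: "(\<Sum>t=1..T. (q t)\<^sup>2) \<le> CZ * T"
  proof -
    have "(q t)\<^sup>2 \<le> (\<Sum>j\<in>?J. (Z j t)\<^sup>2) / (real n - 1)" for t
    proof -
      have "(\<Sum>j\<in>?J. Z j t)\<^sup>2 \<le> (\<Sum>j\<in>?J. (Z j t)\<^sup>2) * (\<Sum>j\<in>?J. 1\<^sup>2)"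
        using Cauchy_Schwarz_ineq_sum[of "\<lambda>j. Z j t" "\<lambda>_. 1" ?J] by simp
      also have "\<dots> = (\<Sum>j\<in>?J. (Z j t)\<^sup>2) * (real n - 1)" using c by simp
      finally have "(\<Sum>j\<in>?J. Z j t)\<^sup>2 / (real n - 1) \<le> (\<Sum>j\<in>?J. (Z j t)\<^sup>2)"
        using m by (simp only: pos_divide_le_eq)
      then have "(\<Sum>j\<in>?J. Z j t)\<^sup>2 / (real n - 1) / (real n - 1) \<le> (\<Sum>j\<in>?J. (Z j t)\<^sup>2) / (real n - 1)"
        using m by (intro divide_right_mono) auto
      then show ?thesis by (simp only: q_def power_divide power2_eq_square[of "real n - 1"] divide_divide_eq_left)
    qed
    then have "(\<Sum>t=1..T. (q t)\<^sup>2) \<le> (\<Sum>t=1..T. (\<Sum>j\<in>?J. (Z j t)\<^sup>2) / (real n - 1))" by (intro sum_mono)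
    also have "\<dots> = (\<Sum>t=1..T. \<Sum>j\<in>?J. (Z j t)\<^sup>2) / (real n - 1)" by (simp only: sum_divide_distrib)
    also have "(\<Sum>t=1..T. \<Sum>j\<in>?J. (Z j t)\<^sup>2) = (\<Sum>j\<in>?J. \<Sum>t=1..T. (Z j t)\<^sup>2)" by (rule sum.swap)
    also have "\<dots> / (real n - 1) \<le> CZ * T"
      using abs_average_le[OF n, of "\<lambda>j. \<Sum>t=1..T. (Z j t)\<^sup>2" "CZ * T"] Z2
      by (auto simp: sum_nonneg abs_of_nonneg intro: order_trans[OF abs_ge_self])
    finally show ?thesis .
  qed
  have low: "(\<epsilon> t)\<^sup>2 / 2 - \<epsilon> t * q t - \<delta>\<^sup>2 \<le> (res t)\<^sup>2" if "t \<in> {1..T}" for t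
  proof -
    \<comment> \<open>Chosen so that the expansion leaves twice the squared residual, minus the
      squared error, plus the mixed term and a term in \<open>z\<close>; the square of
      \<open>q\<close> disappears from the lower bound.\<close>
    have "0 \<le> (\<epsilon> t - q t + 2 * z t)\<^sup>2 + (q t)\<^sup>2" by simp
    also have "\<dots> = 2 * (\<epsilon> t - q t + z t)\<^sup>2 - (\<epsilon> t)\<^sup>2 + 2 * (\<epsilon> t * q t) + 2 * (z t)\<^sup>2"
      by (simp add: power2_eq_square algebra_simps)
    finally show ?thesis using zz[OF that] res[OF that] by (simp add: q_def)
  qed
  have "(\<Sum>t=1..T. (\<epsilon> t)\<^sup>2 / 2 - \<epsilon> t * q t - \<delta>\<^sup>2) \<le> (\<Sum>t=1..T. (res t)\<^sup>2)" by (intro sum_mono low)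
  moreover have "(\<Sum>t=1..T. (\<epsilon> t)\<^sup>2 / 2 - \<epsilon> t * q t - \<delta>\<^sup>2)
    = (\<Sum>t=1..T. (\<epsilon> t)\<^sup>2) / 2 - (\<Sum>t=1..T. \<epsilon> t * q t) - T * \<delta>\<^sup>2"
    by (simp add: sum_subtractf sum_divide_distrib)
  moreover have "(cl / 2 - \<delta> - \<delta>\<^sup>2) * T = cl * T / 2 - \<delta> * T - T * \<delta>\<^sup>2" by (simp add: algebra_simps)
  ultimately show "(cl / 2 - \<delta> - \<delta>\<^sup>2) * T \<le> (\<Sum>t=1..T. (res t)\<^sup>2)"
    using \<epsilon>2(1) cr by linarith
  have up: "(res t)\<^sup>2 \<le> 3 * ((\<epsilon> t)\<^sup>2 + (q t)\<^sup>2 + \<delta>\<^sup>2)" if "t \<in> {1..T}" for t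
  proof -
    \<comment> \<open>Lagrange's identity for three summands, giving the factor 3.\<close>
    have "0 \<le> (\<epsilon> t + q t)\<^sup>2 + (\<epsilon> t - z t)\<^sup>2 + (q t + z t)\<^sup>2" by simp
    also have "\<dots> = 3 * ((\<epsilon> t)\<^sup>2 + (q t)\<^sup>2 + (z t)\<^sup>2) - (\<epsilon> t - q t + z t)\<^sup>2"
      by (simp add: power2_eq_square algebra_simps)
    finally show ?thesis using zz[OF that] res[OF that] by (simp add: q_def)
  qed
  have "(\<Sum>t=1..T. (res t)\<^sup>2) \<le> (\<Sum>t=1..T. 3 * ((\<epsilon> t)\<^sup>2 + (q t)\<^sup>2 + \<delta>\<^sup>2))" by (intro sum_mono up)
  also have "\<dots> = 3 * ((\<Sum>t=1..T. (\<epsilon> t)\<^sup>2) + (\<Sum>t=1..T. (q t)\<^sup>2) + T * \<delta>\<^sup>2)"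
    by (simp add: sum.distrib flip: sum_distrib_left)
  also have "\<dots> \<le> 3 * (cu * T + CZ * T + T * \<delta>\<^sup>2)" using \<epsilon>2(2) q2 by simp
  also have "\<dots> = 3 * (cu + CZ + \<delta>\<^sup>2) * T" by (simp add: algebra_simps)
  finally show "(\<Sum>t=1..T. (res t)\<^sup>2) \<le> 3 * (cu + CZ + \<delta>\<^sup>2) * T" .
qed

context panel_moments
begin

text \<open>All that is random in the estimation is collected here under one constant
  \<open>D\<close>, so that the analysis of the fit is deterministic on this event. The three powers
  \<open>l \<le> 2\<close> are those occurring in the local linear weights.\<close>

definition good_sample :: "real \<Rightarrow> nat \<Rightarrow> 'a \<Rightarrow> bool" where
  "good_sample D T w \<longleftrightarrow>
    (\<forall>i\<in>{1..n T}. \<forall>h\<in>H T. \<forall>x\<in>{0..1}.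
      (\<forall>l\<le>2. \<bar>(\<Sum>t=1..T. kw T i l h x t w) - T * S_mean T i l h x\<bar> \<le> D * rate T h \<and>
        \<bar>(\<Sum>t=1..T. kw T i l h x t w * \<mu> T i (X T i t w)) - T * R_mean T i l h x\<bar> \<le> D * rate T h \<and>
        \<bar>\<Sum>t=1..T. kw T i l h x t w * \<epsilon> T i t w\<bar> \<le> D * rate T h \<and>
        (\<forall>j\<in>{1..n T} - {i}. \<bar>\<Sum>t=1..T. kw T i l h x t w * noise T j t w\<bar> \<le> D * rate T h))) \<and>
    (\<forall>i\<in>{1..n T}. \<forall>h\<in>H T. h * \<bar>\<Sum>t=1..T. noise T i t w\<bar> \<le> D * rate T h) \<and>
    (\<forall>i\<in>{1..n T}. \<forall>j\<in>{1..n T} - {i}. \<forall>h\<in>H T. h * \<bar>\<Sum>t=1..T. \<epsilon> T i t w * noise T j t w\<bar> \<le> D * rate T h) \<and>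
    (\<forall>i\<in>{1..n T}. \<sigma>low / 4 * T \<le> (\<Sum>t=1..T. (\<epsilon> T i t w)\<^sup>2) \<and> (\<Sum>t=1..T. (\<epsilon> T i t w)\<^sup>2) \<le> (2 + C1) * T) \<and>
    (\<forall>i\<in>{1..n T}. \<forall>t\<in>{1..T}. X T i t w \<in> {0..1})"

lemma whp_good_sample: "\<exists>D\<ge>0. whp M (good_sample D)"
proof -
  \<comment> \<open>Each bound comes with its own constant; since all are monotone in the constant,
    two of them can be merged at the larger one.\<close>
  have comb: "\<exists>D\<ge>0. whp M (\<lambda>T w. P D T w \<and> Q D T w)"
    if "\<exists>D\<ge>0. whp M (P D)" "\<exists>D\<ge>0. whp M (Q D)"
      and mono: "\<And>D D' T w. 1 \<le> T \<Longrightarrow> D \<le> D' \<Longrightarrow> P D T w \<Longrightarrow> P D' T w" "\<And>D D' T w. 1 \<le> T \<Longrightarrow> D \<le> D' \<Longrightarrow> Q D T w \<Longrightarrow> Q D' T w"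
    for P Q :: "real \<Rightarrow> nat \<Rightarrow> 'a \<Rightarrow> bool"
  proof -
    obtain D1 D2 where D: "0 \<le> D1" "0 \<le> D2" "whp M (P D1)" "whp M (Q D2)" using \<open>\<exists>D\<ge>0. whp M (P D)\<close> \<open>\<exists>D\<ge>0. whp M (Q D)\<close> by blast
    have "whp M (\<lambda>T w. P (max D1 D2) T w \<and> Q (max D1 D2) T w)"
    proof (rule whp_mono[OF whp_conj[OF D(3,4)]])
      show "\<forall>\<^sub>F T in sequentially. \<forall>w\<in>space (M T). P D1 T w \<and> Q D2 T w \<longrightarrow> P (max D1 D2) T w \<and> Q (max D1 D2) T w"
        using eventually_ge_at_top[of 1]
      proof eventually_elim
        case (elim T)
        then show ?case using mono(1)[OF elim, of D1 "max D1 D2"] mono(2)[OF elim, of D2 "max D1 D2"] by simp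
      qed
    qed
    then show ?thesis using D(1) by (intro exI[of _ "max D1 D2"]) simp
  qed
  define P1 where "P1 l D T w \<longleftrightarrow> (\<forall>i\<in>{1..n T}. \<forall>h\<in>H T. \<forall>x\<in>{0..1}.
    \<bar>(\<Sum>t=1..T. kw T i l h x t w) - T * S_mean T i l h x\<bar> \<le> D * rate T h)" for l D T w
  define P2 where "P2 l D T w \<longleftrightarrow> (\<forall>i\<in>{1..n T}. \<forall>h\<in>H T. \<forall>x\<in>{0..1}.
    \<bar>(\<Sum>t=1..T. kw T i l h x t w * \<mu> T i (X T i t w)) - T * R_mean T i l h x\<bar> \<le> D * rate T h)" for l D T w
  define P3 where "P3 l D T w \<longleftrightarrow> (\<forall>i\<in>{1..n T}. \<forall>h\<in>H T. \<forall>x\<in>{0..1}.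
    \<bar>\<Sum>t=1..T. kw T i l h x t w * \<epsilon> T i t w\<bar> \<le> D * rate T h)" for l D T w
  define P4 where "P4 l D T w \<longleftrightarrow> (\<forall>i\<in>{1..n T}. \<forall>j\<in>{1..n T} - {i}. \<forall>h\<in>H T. \<forall>x\<in>{0..1}.
    \<bar>\<Sum>t=1..T. kw T i l h x t w * noise T j t w\<bar> \<le> D * rate T h)" for l D T w
  define P5 where "P5 D T w \<longleftrightarrow> (\<forall>j\<in>{1..n T}. \<forall>h\<in>H T. h * \<bar>\<Sum>t=1..T. noise T j t w\<bar> \<le> D * rate T h)" for D T w
  define P6 where "P6 D T w \<longleftrightarrow> (\<forall>i\<in>{1..n T}. \<forall>j\<in>{1..n T} - {i}. \<forall>h\<in>H T.
    h * \<bar>\<Sum>t=1..T. \<epsilon> T i t w * noise T j t w\<bar> \<le> D * rate T h)" for D T w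
  \<comment> \<open>\<open>P7\<close> and \<open>P8\<close> carry a dummy constant in order to fit
    the same scheme of combination.\<close>
  define P7 where "P7 D T w \<longleftrightarrow> (\<forall>i\<in>{1..n T}.
    \<sigma>low / 4 * T \<le> (\<Sum>t=1..T. (\<epsilon> T i t w)\<^sup>2) \<and> (\<Sum>t=1..T. (\<epsilon> T i t w)\<^sup>2) \<le> (2 + C1) * T)" for D :: real and T w
  define P8 where "P8 D T w \<longleftrightarrow> (\<forall>i\<in>{1..n T}. \<forall>t\<in>{1..T}. \<bar>\<epsilon> T i t w\<bar> \<le> \<tau> T \<and> X T i t w \<in> {0..1})" for D :: real and T w
  define Pl where "Pl l D T w \<longleftrightarrow> (P1 l D T w \<and> P2 l D T w) \<and> (P3 l D T w \<and> P4 l D T w)" for l D T w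
  have r0: "0 \<le> rate T h" if "1 \<le> T" "h \<in> H T" for T h
    using H_bounds(4)[OF that] that(1) by (intro real_sqrt_ge_zero mult_nonneg_nonneg) auto
  have le: "a \<le> D' * rate T h" if "a \<le> D * rate T h" "D \<le> D'" "1 \<le> T" "h \<in> H T" for a D D' T h
    using that(1) mult_right_mono[OF that(2) r0[OF that(3,4)]] by linarith
  have m1: "P1 l D T w \<Longrightarrow> P1 l D' T w" and m2: "P2 l D T w \<Longrightarrow> P2 l D' T w" and m3: "P3 l D T w \<Longrightarrow> P3 l D' T w"
    and m4: "P4 l D T w \<Longrightarrow> P4 l D' T w" and m5: "P5 D T w \<Longrightarrow> P5 D' T w" and m6: "P6 D T w \<Longrightarrow> P6 D' T w"
    if "1 \<le> T" "D \<le> D'" for l D D' T w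
    unfolding P1_def P2_def P3_def P4_def P5_def P6_def by (meson le that)+
  have w1: "\<exists>D\<ge>0. whp M (P1 l D)" and w2: "\<exists>D\<ge>0. whp M (P2 l D)" and w3: "\<exists>D\<ge>0. whp M (P3 l D)"
    and w4: "\<exists>D\<ge>0. whp M (P4 l D)" for l
    using whp_kernel_sum[of l] whp_regression_sum[of l] whp_error_sum[of l] whp_cross_sum[of l] unfolding P1_def P2_def P3_def P4_def by this+
  have w5: "\<exists>D\<ge>0. whp M (P5 D)" and w6: "\<exists>D\<ge>0. whp M (P6 D)"
    using whp_noise_average whp_noise_product unfolding P5_def P6_def by this+
  have w7: "\<exists>D\<ge>0. whp M (P7 D)" and w8: "\<exists>D\<ge>0. whp M (P8 D)"
    using whp_error_squares whp_regular unfolding P7_def P8_def by (intro exI[of _ 0]; simp)+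
  have wl: "\<exists>D\<ge>0. whp M (Pl l D)" for l
    unfolding Pl_def by (intro comb w1 w2 w3 w4) (blast intro: m1 m2 m3 m4)+
  have ml: "1 \<le> T \<Longrightarrow> D \<le> D' \<Longrightarrow> Pl l D T w \<Longrightarrow> Pl l D' T w" for l D D' T w
    unfolding Pl_def by (blast intro: m1 m2 m3 m4)
  have m7: "P7 D T w \<Longrightarrow> P7 D' T w" and m8: "P8 D T w \<Longrightarrow> P8 D' T w" for D D' T w
    by (simp_all only: P7_def P8_def)
  have "\<exists>D\<ge>0. whp M (\<lambda>T w. (Pl 0 D T w \<and> (Pl 1 D T w \<and> Pl 2 D T w)) \<and> ((P5 D T w \<and> P6 D T w) \<and> (P7 D T w \<and> P8 D T w)))"
    by (intro comb wl w5 w6 w7 w8) (blast intro: ml m5 m6 m7 m8)+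
  then obtain D where D: "0 \<le> D"
    "whp M (\<lambda>T w. (Pl 0 D T w \<and> (Pl 1 D T w \<and> Pl 2 D T w)) \<and> ((P5 D T w \<and> P6 D T w) \<and> (P7 D T w \<and> P8 D T w)))"
    by (elim exE conjE) (rule that)
  have "whp M (good_sample D)"
  proof (rule whp_mono[OF D(2)], rule always_eventually, intro allI ballI impI)
    fix T w assume *: "(Pl 0 D T w \<and> (Pl 1 D T w \<and> Pl 2 D T w)) \<and> ((P5 D T w \<and> P6 D T w) \<and> (P7 D T w \<and> P8 D T w))"
    have "Pl l D T w" if "l \<le> 2" for l
    proof -
      have "l = 0 \<or> l = 1 \<or> l = 2" using that by auto
      then show ?thesis using * by blast
    qed
    then have l: "P1 l D T w" "P2 l D T w" "P3 l D T w" "P4 l D T w" if "l \<le> 2" for l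
      using that unfolding Pl_def by blast+
    show "good_sample D T w"
      unfolding good_sample_def
    proof (intro conjI ballI allI impI)
      fix i h x l assume a: "i \<in> {1..n T}" "h \<in> H T" "x \<in> {0..1::real}" "l \<le> (2::nat)"
      note q = l[OF a(4), unfolded P1_def P2_def P3_def P4_def]
      show "\<bar>(\<Sum>t=1..T. kw T i l h x t w) - T * S_mean T i l h x\<bar> \<le> D * rate T h"
        by (rule q(1)[rule_format, OF a(1-3)])
      show "\<bar>(\<Sum>t=1..T. kw T i l h x t w * \<mu> T i (X T i t w)) - T * R_mean T i l h x\<bar> \<le> D * rate T h"
        by (rule q(2)[rule_format, OF a(1-3)])
      show "\<bar>\<Sum>t=1..T. kw T i l h x t w * \<epsilon> T i t w\<bar> \<le> D * rate T h"
        by (rule q(3)[rule_format, OF a(1-3)])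
      show "\<bar>\<Sum>t=1..T. kw T i l h x t w * noise T j t w\<bar> \<le> D * rate T h" if "j \<in> {1..n T} - {i}" for j
        by (rule q(4)[rule_format, OF a(1) that a(2,3)])
    qed (use * in \<open>simp_all add: P5_def P6_def P7_def P8_def\<close>)
  qed
  then show ?thesis using D(1) by blast
qed

end

text \<open>The decomposition of \<open>Y\<close> is required only where the regressor lies in the
  unit interval, since \<open>\<mu>\<close> is an extension and need not agree with the regression
  function elsewhere.\<close>

locale panel_estimation =
  panel_moments M n X \<epsilon> H hmin hmax Cm \<rho> a A b B \<beta> CH pn \<eta> K \<mu> \<tau> KM LK G C1 \<sigma>low ls +
  kernel K KM LK k0 d u1
  for M :: "nat \<Rightarrow> 'a measure" and n X \<epsilon> H hmin hmax Cm \<rho> a A b B \<beta> CH pn \<eta> K \<mu> \<tau> KM LK G C1 \<sigma>low ls k0 d u1 +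
  fixes \<alpha> \<gamma> :: "nat \<Rightarrow> nat \<Rightarrow> 'a \<Rightarrow> real" and Y :: "nat \<Rightarrow> nat \<Rightarrow> nat \<Rightarrow> 'a \<Rightarrow> real"
    and clow L\<mu> :: real
  assumes clow: "0 < clow"
    and X_interval: "1 \<le> T \<Longrightarrow> i \<in> {1..n T} \<Longrightarrow> 0 \<le> p \<Longrightarrow> p \<le> q \<Longrightarrow> q \<le> 1 \<Longrightarrow>
      clow * (q - p) \<le> (\<integral>w. indicator {p..q} (X T i 1 w) \<partial>M T)"
    and \<mu>_lip: "\<bar>\<mu> T i x - \<mu> T i y\<bar> \<le> L\<mu> * \<bar>x - y\<bar>"
    and Y_eq: "1 \<le> T \<Longrightarrow> j \<in> {1..n T} \<Longrightarrow> 1 \<le> t \<Longrightarrow> w \<in> space (M T) \<Longrightarrow> X T j t w \<in> {0..1} \<Longrightarrow>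
      Y T j t w = noise T j t w + \<alpha> T j w + \<gamma> T t w"
begin

lemma L\<mu>_nonneg: "0 \<le> L\<mu>" using order_trans[OF abs_ge_zero \<mu>_lip[of 0 0 0 1]] by simp

section \<open>The population fit: bounds, nondegeneracy and bias\<close>

lemma abs_mean_phi_le:
  assumes T: "1 \<le> T" and i: "i \<in> {1..n T}" and h: "0 < h"
    and g: "g \<in> borel_measurable borel" "\<And>y. y \<in> {x - h..x + h} \<Longrightarrow> \<bar>g y\<bar> \<le> C" and C: "0 \<le> C"
  shows "\<bar>\<integral>w. phi K l ((X T i 1 w - x) / h) * g (X T i 1 w) \<partial>M T\<bar> \<le> KM * C * C1 * h"
    "integrable (M T) (\<lambda>w. phi K l ((X T i 1 w - x) / h) * g (X T i 1 w))"
proof -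
  interpret prob_space "M T" by (rule prob[OF T])
  note [measurable] = X_meas[OF T i order_refl] g(1)
  let ?V = "\<lambda>w. phi K l ((X T i 1 w - x) / h) * g (X T i 1 w)"
  have b: "\<bar>?V w\<bar> \<le> KM * C * indicator {x - h..x + h} (X T i 1 w)" for w
  proof (cases "X T i 1 w \<in> {x - h..x + h}")
    case True
    have "\<bar>?V w\<bar> \<le> KM * C"
      unfolding abs_mult by (intro mult_mono abs_phi_le_const[OF h] g(2)[OF True]) (auto simp: KM_nonneg)
    then show ?thesis using True by simp
  next
    case False
    then show ?thesis using abs_phi_le[OF h, of l "X T i 1 w" x] by simp
  qed
  have iI: "integrable (M T) (\<lambda>w. indicator {x - h..x + h} (X T i 1 w) :: real)"
    by (intro integrable_const_bound[where B = 1] AE_I2) (simp add: indicator_def, measurable)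
  show "integrable (M T) ?V"
  proof (rule integrable_const_bound[where B = "KM * C"])
    show "AE w in M T. norm (?V w) \<le> KM * C"
    proof (rule AE_I2)
      fix w
      show "norm (?V w) \<le> KM * C"
        using b[of w] KM_nonneg C by (auto simp: indicator_def split: if_splits intro: order_trans)
    qed
  qed measurable
  have "\<bar>expectation ?V\<bar> \<le> expectation (\<lambda>w. \<bar>?V w\<bar>)" by (rule integral_abs_bound)
  also have "\<dots> \<le> expectation (\<lambda>w. KM * C * indicator {x - h..x + h} (X T i 1 w))"
    by (rule integral_mono') (use b iI KM_nonneg C in auto)
  also have "\<dots> = KM * C * expectation (\<lambda>w. indicator {x - h..x + h} (X T i 1 w))" by simp
  also have "\<dots> \<le> KM * C * (C1 * h)"
    by (rule mult_left_mono[OF X_near[OF T i order_refl h]]) (use KM_nonneg C in simp)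
  finally show "\<bar>expectation ?V\<bar> \<le> KM * C * C1 * h" by simp
qed

lemma S_mean_bound:
  assumes "1 \<le> T" "i \<in> {1..n T}" "0 < h"
  shows "\<bar>S_mean T i l h x\<bar> \<le> KM * C1 * h" "integrable (M T) (\<lambda>w. phi K l ((X T i 1 w - x) / h))"
  using abs_mean_phi_le[OF assms, of "\<lambda>_. 1" x 1 l] by (simp_all add: S_mean_def)

lemma R_mean_bound:
  assumes "1 \<le> T" "i \<in> {1..n T}" "0 < h"
  shows "\<bar>R_mean T i l h x\<bar> \<le> KM * G * C1 * h"
  using abs_mean_phi_le(1)[OF assms, of "\<mu> T i" x G l] \<mu>_meas \<mu>_bd G_nonneg by (simp add: R_mean_def)

text \<open>On the window around \<open>x\<close> the Lipschitz function \<open>\<mu>\<close> varies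
  by at most \<open>L\<mu> * h\<close>. A first-order bias is enough for the rates in
  question.\<close>

lemma R_mean_bias:
  assumes "1 \<le> T" "i \<in> {1..n T}" "0 < h"
  shows "\<bar>R_mean T i l h x - \<mu> T i x * S_mean T i l h x\<bar> \<le> KM * (L\<mu> * h) * C1 * h"
proof -
  have g: "(\<lambda>y. \<mu> T i y - \<mu> T i x) \<in> borel_measurable borel" using \<mu>_meas by measurable
  have b: "\<bar>\<mu> T i y - \<mu> T i x\<bar> \<le> L\<mu> * h" if "y \<in> {x - h..x + h}" for y
  proof -
    have "\<bar>\<mu> T i y - \<mu> T i x\<bar> \<le> L\<mu> * \<bar>y - x\<bar>" by (rule \<mu>_lip)
    also have "\<dots> \<le> L\<mu> * h" using that L\<mu>_nonneg by (intro mult_left_mono) auto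
    finally show ?thesis .
  qed
  have R: "integrable (M T) (\<lambda>w. phi K l ((X T i 1 w - x) / h) * \<mu> T i (X T i 1 w))"
    by (rule abs_mean_phi_le(2)[OF assms \<mu>_meas]) (use \<mu>_bd G_nonneg in auto)
  have "(\<integral>w. phi K l ((X T i 1 w - x) / h) * (\<mu> T i (X T i 1 w) - \<mu> T i x) \<partial>M T)
    = R_mean T i l h x - \<mu> T i x * S_mean T i l h x"
    using R S_mean_bound(2)[OF assms, of l x] by (simp add: R_mean_def S_mean_def right_diff_distrib mult.commute)
  then show ?thesis using abs_mean_phi_le(1)[OF assms g b, of x l] L\<mu>_nonneg assms by simp
qed

text \<open>Only the part of the expectation over the image of \<open>{p..p + d}\<close> is kept;
  this image has length \<open>h * d\<close> inside the unit interval, where intervals have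
  probability at least \<open>clow\<close> times their length.\<close>

lemma mean_phi_lower:
  assumes T: "1 \<le> T" and i: "i \<in> {1..n T}" and h: "0 < h"
    and p: "0 \<le> x + h * p" "x + h * (p + d) \<le> 1"
    and g: "\<And>u. 0 \<le> g u" "\<And>u. u \<in> {p..p + d} \<Longrightarrow> c \<le> g u" and c: "0 \<le> c"
    and gi: "integrable (M T) (\<lambda>w. g ((X T i 1 w - x) / h))"
  shows "c * (clow * d) * h \<le> (\<integral>w. g ((X T i 1 w - x) / h) \<partial>M T)"
proof -
  interpret prob_space "M T" by (rule prob[OF T])
  note [measurable] = X_meas[OF T i order_refl]
  have "clow * (x + h * (p + d) - (x + h * p)) \<le> expectation (\<lambda>w. indicator {x + h * p..x + h * (p + d)} (X T i 1 w))"
    by (rule X_interval[OF T i p(1) _ p(2)]) (use h d in simp)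
  then have "c * (clow * (h * d)) \<le> c * expectation (\<lambda>w. indicator {x + h * p..x + h * (p + d)} (X T i 1 w))"
    using c by (intro mult_left_mono) (simp_all add: algebra_simps)
  also have "\<dots> = expectation (\<lambda>w. c * indicator {x + h * p..x + h * (p + d)} (X T i 1 w))" by simp
  also have "\<dots> \<le> expectation (\<lambda>w. g ((X T i 1 w - x) / h))"
  proof (rule integral_mono'[OF gi])
    fix w
    show "c * indicator {x + h * p..x + h * (p + d)} (X T i 1 w) \<le> g ((X T i 1 w - x) / h)"
    proof (cases "X T i 1 w \<in> {x + h * p..x + h * (p + d)}")
      case True
      then have "(X T i 1 w - x) / h \<in> {p..p + d}" using h by (auto simp: field_simps)
      then show ?thesis using True g(2) by simp
    qed (simp add: g(1))
  qed (rule g(1))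
  finally show ?thesis by (simp add: mult_ac)
qed

definition cD where "cD = (k0 * d\<^sup>2 * (clow * d)) * (k0 * (clow * d))"

lemma cD_pos: "0 < cD" using k0 d clow by (simp add: cD_def)

text \<open>The argument for the kernel moments again, with the law of the regressor in place of
  Lebesgue measure. \<open>cD\<close> is the bound for the quadratic form times the bound for its
  leading coefficient.\<close>

lemma S_mean_lower:
  assumes T: "1 \<le> T" and i: "i \<in> {1..n T}" and h: "0 < h" "h \<le> 1 / 2" and x: "x \<in> {0..1}"
  shows "k0 * (clow * d) \<le> S_mean T i 0 h x / h"
    "cD \<le> (S_mean T i 2 h x / h) * (S_mean T i 0 h x / h) - (S_mean T i 1 h x / h)\<^sup>2"
proof -
  have Si: "integrable (M T) (\<lambda>w. phi K l ((X T i 1 w - x) / h))" for l by (rule S_mean_bound(2)[OF T i h(1)])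
  show s0: "k0 * (clow * d) \<le> S_mean T i 0 h x / h"
  proof -
    obtain p where p: "0 \<le> x + h * p" "x + h * (p + d) \<le> 1" "\<forall>u\<in>{p..p + d}. k0 \<le> K u \<and> d \<le> \<bar>u - 0\<bar>"
      using good_interval[OF x h] by blast
    have "k0 * (clow * d) * h \<le> (\<integral>w. phi K 0 ((X T i 1 w - x) / h) \<partial>M T)"
      by (rule mean_phi_lower[OF T i h(1) p(1,2) _ _ _ Si]) (use p(3) K_nonneg k0 in \<open>auto simp: phi_def\<close>)
    then show ?thesis using h by (simp add: S_mean_def pos_le_divide_eq)
  qed
  have quad: "k0 * d\<^sup>2 * (clow * d) \<le> S_mean T i 2 h x / h - 2 * a * (S_mean T i 1 h x / h) + a\<^sup>2 * (S_mean T i 0 h x / h)" for a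
  proof -
    obtain p where p: "0 \<le> x + h * p" "x + h * (p + d) \<le> 1" "\<forall>u\<in>{p..p + d}. k0 \<le> K u \<and> d \<le> \<bar>u - a\<bar>"
      using good_interval[OF x h] by blast
    have eq: "K u * (u - a)\<^sup>2 = phi K 2 u - 2 * a * phi K 1 u + a\<^sup>2 * phi K 0 u" for u
      by (simp add: phi_def power2_eq_square algebra_simps)
    have "k0 * d\<^sup>2 * (clow * d) * h \<le> (\<integral>w. K ((X T i 1 w - x) / h) * ((X T i 1 w - x) / h - a)\<^sup>2 \<partial>M T)"
    proof (rule mean_phi_lower[OF T i h(1) p(1,2), where g = "\<lambda>u. K u * (u - a)\<^sup>2"])
      show "0 \<le> K u * (u - a)\<^sup>2" for u using K_nonneg by simp
      show "k0 * d\<^sup>2 \<le> K u * (u - a)\<^sup>2" if "u \<in> {p..p + d}" for u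
      proof -
        have "d\<^sup>2 \<le> \<bar>u - a\<bar>\<^sup>2" using p(3) that d by (intro power_mono) auto
        then show ?thesis using p(3) that K_nonneg by (intro mult_mono) auto
      qed
      show "0 \<le> k0 * d\<^sup>2" using k0 by simp
      show "integrable (M T) (\<lambda>w. K ((X T i 1 w - x) / h) * ((X T i 1 w - x) / h - a)\<^sup>2)"
        unfolding eq using Si by (intro Bochner_Integration.integrable_add Bochner_Integration.integrable_diff integrable_mult_right) auto
    qed
    also have "\<dots> = S_mean T i 2 h x - 2 * a * S_mean T i 1 h x + a\<^sup>2 * S_mean T i 0 h x"
      unfolding eq S_mean_def using Si by simp
    finally have "k0 * d\<^sup>2 * (clow * d) \<le> (S_mean T i 2 h x - 2 * a * S_mean T i 1 h x + a\<^sup>2 * S_mean T i 0 h x) / h"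
      using h by (simp add: pos_le_divide_eq)
    then show ?thesis by (simp add: add_divide_distrib diff_divide_distrib)
  qed
  show "cD \<le> (S_mean T i 2 h x / h) * (S_mean T i 0 h x / h) - (S_mean T i 1 h x / h)\<^sup>2"
    unfolding cD_def by (rule quadratic_discriminant_bound[OF quad s0]) (use k0 d clow in auto)
qed

text \<open>
  The local linear fit with all sums replaced by their expectations. It depends on \<open>i\<close> only through
  \<open>\<mu> T i\<close> and the law of \<open>X T i 1\<close>, so it is the same for all members of a group.
\<close>

definition m_star where "m_star T i h x =
  (S_mean T i 2 h x / h * (R_mean T i 0 h x / h) - S_mean T i 1 h x / h * (R_mean T i 1 h x / h)) /
  (S_mean T i 2 h x / h * (S_mean T i 0 h x / h) - (S_mean T i 1 h x / h)\<^sup>2)"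

definition Cb where "Cb = 2 * (KM * C1) * (KM * L\<mu> * C1) / cD"

lemma Cb_nonneg: "0 \<le> Cb"
  using KM_nonneg C1_nonneg L\<mu>_nonneg cD_pos by (simp add: Cb_def)

text \<open>The local linear weights reproduce constants, so \<open>\<mu> T i x\<close> can be moved
  into the numerator: it becomes \<open>s 2 * (r 0 - \<mu> T i x * s 0) - s 1 * (r 1 - \<mu> T i x *
  s 1)\<close>, and both brackets are of order \<open>h\<close>.\<close>

lemma m_star_bias:
  assumes T: "1 \<le> T" and i: "i \<in> {1..n T}" and h: "0 < h" "h \<le> 1 / 2" and x: "x \<in> {0..1}"
  shows "\<bar>m_star T i h x - \<mu> T i x\<bar> \<le> Cb * h"
proof -
  define s where "s l = S_mean T i l h x / h" for l
  define r where "r l = R_mean T i l h x / h" for l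
  define De where "De = s 2 * s 0 - (s 1)\<^sup>2"
  have De: "cD \<le> De" using S_mean_lower(2)[OF T i h x] by (simp add: De_def s_def)
  then have De0: "0 < De" using cD_pos by linarith
  have s: "\<bar>s l\<bar> \<le> KM * C1" for l
    using S_mean_bound(1)[OF T i h(1), of l x] h(1) by (simp add: s_def abs_divide pos_divide_le_eq)
  have r: "\<bar>r l - \<mu> T i x * s l\<bar> \<le> KM * L\<mu> * C1 * h" for l
  proof -
    have "r l - \<mu> T i x * s l = (R_mean T i l h x - \<mu> T i x * S_mean T i l h x) / h"
      by (simp add: r_def s_def diff_divide_distrib)
    then show ?thesis
      using R_mean_bias[OF T i h(1), of l x] h(1) by (simp add: abs_divide pos_divide_le_eq mult_ac)
  qed
  have nn: "0 \<le> KM * C1" "0 \<le> KM * L\<mu> * C1 * h" using KM_nonneg C1_nonneg L\<mu>_nonneg h by auto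
  have "m_star T i h x - \<mu> T i x = (s 2 * (r 0 - \<mu> T i x * s 0) - s 1 * (r 1 - \<mu> T i x * s 1)) / De"
    using De0 unfolding m_star_def s_def[symmetric] r_def[symmetric] De_def[symmetric]
    by (simp add: field_simps) (simp add: De_def power2_eq_square algebra_simps)
  then have "\<bar>m_star T i h x - \<mu> T i x\<bar> = \<bar>s 2 * (r 0 - \<mu> T i x * s 0) - s 1 * (r 1 - \<mu> T i x * s 1)\<bar> / De"
    using De0 by (simp add: abs_divide)
  also have "\<dots> \<le> (2 * (KM * C1) * (KM * L\<mu> * C1 * h)) / cD"
  proof (rule frac_le)
    have "\<bar>s k * (r l - \<mu> T i x * s l)\<bar> \<le> (KM * C1) * (KM * L\<mu> * C1 * h)" for k l
      unfolding abs_mult by (rule mult_mono[OF s r nn(1)]) simp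
    from this[of 2 0] this[of 1 1]
    show "\<bar>s 2 * (r 0 - \<mu> T i x * s 0) - s 1 * (r 1 - \<mu> T i x * s 1)\<bar> \<le> 2 * (KM * C1) * (KM * L\<mu> * C1 * h)"
      by linarith
  qed (use De cD_pos nn in auto)
  also have "\<dots> = Cb * h" by (simp add: Cb_def)
  finally show ?thesis .
qed

lemma h_small:
  assumes "0 < c"
  shows "\<forall>\<^sub>F T in sequentially. \<forall>h\<in>H T. h \<le> c"
proof -
  have "\<forall>\<^sub>F T::nat in sequentially. A * real T powr - b \<le> c" using h_pos assms by real_asymp
  then show ?thesis using eventually_ge_at_top[of 1]
  proof eventually_elim
    case (elim T)
    then show ?case using H_bounds(3)[OF elim(2)] by (auto simp: hmax intro: order_trans)
  qed
qed

text \<open>This is \<open>sqrt (ln T / (T * h))\<close>, the fluctuation of a normalised kernel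
  sum.\<close>

abbreviation rho where "rho T h \<equiv> rate T h / (h * real T)"

abbreviation XX where "XX T w \<equiv> \<lambda>i t. X T i t w"
abbreviation YY where "YY T w \<equiv> \<lambda>i t. Y T i t w"

abbreviation mhat where "mhat T w \<equiv> m_hat K (n T) T (XX T w) (YY T w)"
abbreviation fhat where "fhat T w \<equiv> f_hat K T (XX T w)"
abbreviation s2hat where "s2hat T w \<equiv> sigma2_hat K (n T) T (XX T w) (YY T w)"

abbreviation accurate where
  "accurate C c T w \<equiv> \<forall>i\<in>{1..n T}. \<forall>h\<in>H T. \<forall>x\<in>{0..1}. \<bar>mhat T w i h x - m_star T i h x\<bar> \<le> C * rho T h \<and>
    c \<le> fhat T w i h x \<and> fhat T w i h x \<le> C \<and> c \<le> s2hat T w i h \<and> s2hat T w i h \<le> C"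

lemma rho_small:
  assumes "0 < c" "0 \<le> D"
  shows "\<forall>\<^sub>F T in sequentially. \<forall>h\<in>H T. D * rho T h \<le> c"
proof -
  have "0 < c / (D + 1)" using assms by simp
  from rate_le[OF this] show ?thesis using eventually_ge_at_top[of 1]
  proof eventually_elim
    case (elim T)
    show ?case
    proof
      fix h assume h: "h \<in> H T"
      have hT: "0 < h * real T" using H_bounds(4)[OF elim(2) h] elim by simp
      have "rate T h \<le> c / (D + 1) * (h * real T)" using elim(1) h by (simp only: mult.commute)
      then have "rho T h \<le> c / (D + 1)" using hT by (simp only: pos_divide_le_eq)
      then have "D * rho T h \<le> D * (c / (D + 1))" by (rule mult_left_mono) fact
      also have "\<dots> = c * (D / (D + 1))" by simp
      also have "\<dots> \<le> c * 1" using assms by (intro mult_left_mono) auto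
      finally show "D * rho T h \<le> c" by simp
    qed
  qed
qed

text \<open>The residuals contain the fit at the observed regressors, so the accuracy of the fit at
  every point of the unit interval is established before the variance estimator is treated. Only
  positive lower and upper bounds are derived for the density and variance estimators.\<close>

lemma estimator_bounds:
  assumes D: "0 \<le> D"
  shows "\<exists>C c. 0 \<le> C \<and> 0 < c \<and> (\<forall>\<^sub>F T in sequentially. \<forall>w\<in>space (M T). good_sample D T w \<longrightarrow>
    accurate C c T w)"
proof -
  define CS where "CS = KM * C1 + 1"
  define B0 where "B0 = KM * C1 * (1 + G)"
  \<comment> \<open>\<open>3 + 2 * CS\<close> is the constant from the bound on weighted sums of
    demeaned observations. It dominates the error \<open>D\<close> of the kernel sums, so both
    errors are measured by \<open>E\<close>.\<close>
  define E where "E = (3 + 2 * CS) * D"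
  define Cm' where "Cm' = (4 * (2 * B0 + 1) / cD + 8 * B0\<^sup>2 * (2 * B0 + 1) / cD\<^sup>2) * E"
  define s0 where "s0 = k0 * (clow * d)"
  define CZ where "CZ = 2 * G\<^sup>2 + 2 * (2 + C1)"
  \<comment> \<open>With the lower bound \<open>\<sigma>low / 4\<close> for the mean squared error,
    the residual variance stays above \<open>\<sigma>low / 8 - \<delta> - \<delta>\<^sup>2 \<ge>
    \<sigma>low / 16\<close>.\<close>
  define \<delta> where "\<delta> = min 1 (\<sigma>low / 32)"
  have CS: "1 \<le> CS" using KM_nonneg C1_nonneg by (simp add: CS_def)
  have B0: "0 \<le> B0" "KM * C1 \<le> B0" "KM * G * C1 \<le> B0"
    using KM_nonneg C1_nonneg G_nonneg by (auto simp: B0_def algebra_simps)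
  have E: "0 \<le> E" "D \<le> E" "3 * D \<le> E"
  proof -
    show "0 \<le> E" using CS D by (simp add: E_def)
    have "3 * D \<le> (3 + 2 * CS) * D" using CS D by (intro mult_right_mono) auto
    then show "3 * D \<le> E" "D \<le> E" using D by (simp_all add: E_def)
  qed
  have Cm0: "0 \<le> Cm'" using B0 E cD_pos by (auto simp: Cm'_def intro!: mult_nonneg_nonneg add_nonneg_nonneg divide_nonneg_nonneg)
  have s0: "0 < s0" using k0 clow d by (simp add: s0_def)
  have \<delta>: "0 < \<delta>" "\<delta> \<le> 1" "\<delta> \<le> \<sigma>low / 32" using \<sigma>low(1) by (auto simp: \<delta>_def)
  have CZ: "0 \<le> CZ" using C1_nonneg by (simp add: CZ_def)
  \<comment> \<open>The bounds 1 and \<open>cD / (4 * (2 * B0 + 1))\<close> are what the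
    perturbation of the quotient requires; \<open>s0 / 2\<close> keeps the density estimator away
    from 0, and \<open>\<delta> / 4\<close> is the share of a time average in the residual
    remainder.\<close>
  define small where "small = min (min 1 (cD / (4 * (2 * B0 + 1)))) (min (s0 / 2) (\<delta> / 4))"
  have small: "0 < small" using cD_pos B0 s0 \<delta> by (simp add: small_def)
  have small_le: "small \<le> 1" "small \<le> cD / (4 * (2 * B0 + 1))" "small \<le> s0 / 2" "small \<le> \<delta> / 4"
    unfolding small_def by linarith+
  define C where "C = Cm' + CS / (k0 * d) + 3 * (2 + C1 + CZ + 1)"
  define c where "c = min (s0 / 2) (\<sigma>low / 16)"
  have kd: "0 < k0 * d" using k0 d by simp
  have Cparts: "Cm' \<le> C" "CS / (k0 * d) \<le> C" "3 * (2 + C1 + CZ + 1) \<le> C" "0 \<le> C"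
    using Cm0 CS kd C1_nonneg CZ by (auto simp: C_def)
  have c: "0 < c" "c \<le> s0 / 2" "c \<le> \<sigma>low / 16" using s0 \<sigma>low(1) by (auto simp: c_def)
  have half: "0 < 1 / (2 :: real)" by simp
  have \<delta>4: "0 < \<delta> / 4" using \<delta> by simp
  have Cbh: "0 < \<delta> / (4 * (Cb + 1))" using \<delta> Cb_nonneg by simp
  show ?thesis
  proof (rule exI[of _ C], rule exI[of _ c], intro conjI Cparts(4) c(1))
    show "\<forall>\<^sub>F T in sequentially. \<forall>w\<in>space (M T). good_sample D T w \<longrightarrow>
    accurate C c T w"
      using eventually_ge_at_top[of 1] rho_small[OF small E(1)] rho_small[OF \<delta>4 Cm0] h_small[OF half] h_small[OF Cbh]
    proof eventually_elim
      case (elim T)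
      note T = elim(1)
      have T0: "0 < real T" using T by simp
      have n2: "2 \<le> n T" by (rule n_ge_2[OF T])
      show ?case
      proof (intro ballI impI)
        fix w i h assume w: "w \<in> space (M T)" and good_sample: "good_sample D T w" and i: "i \<in> {1..n T}" and h: "h \<in> H T"
        have h0: "0 < h" "h \<le> 1 / 2" using H_bounds(4)[OF T h] elim(4) h by auto
        have hT: "0 < h * real T" using h0 T0 by simp
        have X01: "X T j t w \<in> {0..1}" if "j \<in> {1..n T}" "t \<in> {1..T}" for j t
          using good_sample that unfolding good_sample_def by blast
        have Er: "E * rho T h \<le> small" using elim(2) h by blast
        have r0: "0 \<le> rho T h" using T H_bounds(4)[OF T h] by (intro divide_nonneg_nonneg real_sqrt_ge_zero mult_nonneg_nonneg) auto
        have Dr: "D * rho T h \<le> E * rho T h" by (rule mult_right_mono[OF E(2) r0])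
        have norm: "\<bar>P / (h * real T) - Q / h\<bar> \<le> k * rho T h" if "\<bar>P - real T * Q\<bar> \<le> k * rate T h" for P Q k
        proof -
          have "P / (h * real T) - Q / h = (P - real T * Q) / (h * real T)" using hT h0 T0 by (simp add: field_simps)
          then have "\<bar>P / (h * real T) - Q / h\<bar> = \<bar>P - real T * Q\<bar> / (h * real T)" using hT by (simp only: abs_divide abs_of_pos)
          also have "\<dots> \<le> k * rate T h / (h * real T)" using that hT by (intro divide_right_mono) auto
          finally show ?thesis by simp
        qed
        define Ys where "Ys t = Y_star (n T) T (YY T w) i t" for t
        have Ys: "Ys t = noise T i t w - (\<Sum>s=1..T. noise T i s w) / T - (\<Sum>j\<in>{1..n T} - {i}. noise T j t w) / (real (n T) - 1)
            + (\<Sum>j\<in>{1..n T} - {i}. \<Sum>s=1..T. noise T j s w) / ((real (n T) - 1) * T)" if "t \<in> {1..T}" for t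
          unfolding Ys_def
          by (rule Y_star_noise[OF n2 T i that, where Z = "\<lambda>j t. noise T j t w" and \<alpha> = "\<lambda>j. \<alpha> T j w" and \<gamma> = "\<lambda>t. \<gamma> T t w"])
            (use Y_eq[OF T _ _ w X01] in auto)
        have avg: "h * \<bar>\<Sum>t=1..T. noise T j t w\<bar> \<le> D * rate T h" if "j \<in> {1..n T}" for j
          using good_sample h that unfolding good_sample_def by blast
        have est: "\<bar>mhat T w i h x - m_star T i h x\<bar> \<le> Cm' * rho T h \<and>
            s0 / 2 \<le> S_loc K T (XX T w) i 0 x h \<and> S_loc K T (XX T w) i 0 x h \<le> CS" if x: "x \<in> {0..1}" for x
        proof -
          define \<phi> where "\<phi> l t = phi K l ((X T i t w - x) / h)" for l t
          have g: "\<bar>(\<Sum>t=1..T. \<phi> l t) - T * S_mean T i l h x\<bar> \<le> D * rate T h"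
            "\<bar>(\<Sum>t=1..T. \<phi> l t * \<mu> T i (X T i t w)) - T * R_mean T i l h x\<bar> \<le> D * rate T h"
            "\<bar>\<Sum>t=1..T. \<phi> l t * \<epsilon> T i t w\<bar> \<le> D * rate T h"
            "\<And>j. j \<in> {1..n T} - {i} \<Longrightarrow> \<bar>\<Sum>t=1..T. \<phi> l t * noise T j t w\<bar> \<le> D * rate T h" if "l \<le> 2" for l
            using good_sample i h x that unfolding good_sample_def \<phi>_def by blast+
          define S where "S l = (\<Sum>t=1..T. \<phi> l t) / (h * real T)" for l
          define A' where "A' l = (\<Sum>t=1..T. \<phi> l t * Ys t) / (h * real T)" for l
          have S: "\<bar>S l - S_mean T i l h x / h\<bar> \<le> E * rho T h" if "l \<le> 2" for l
            using norm[OF g(1)[OF that]] Dr unfolding S_def by linarith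
          have sb: "\<bar>S_mean T i l h x / h\<bar> \<le> KM * C1" for l
            using S_mean_bound(1)[OF T i h0(1), of l x] h0(1) by (simp add: abs_divide pos_divide_le_eq)
          have rb: "\<bar>R_mean T i l h x / h\<bar> \<le> KM * G * C1" for l
            using R_mean_bound[OF T i h0(1), of l x] h0(1) by (simp add: abs_divide pos_divide_le_eq)
          have Sb: "\<bar>S l\<bar> \<le> CS" if "l \<le> 2" for l
            using S[OF that] sb[of l] Er small_le(1) unfolding CS_def by linarith
          have Sb': "\<bar>\<Sum>t=1..T. \<phi> l t\<bar> \<le> CS * (h * T)" if "l \<le> 2" for l
            using Sb[OF that] hT by (simp only: S_def abs_divide abs_of_pos pos_divide_le_eq)
          have A': "\<bar>A' l - R_mean T i l h x / h\<bar> \<le> E * rho T h" if "l \<le> 1" for l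
          proof -
            have l2: "l \<le> 2" using that by simp
            have "\<bar>(\<Sum>t=1..T. \<phi> l t * Ys t) - T * R_mean T i l h x\<bar> \<le> (3 + 2 * CS) * (D * rate T h)"
              by (rule weighted_Y_star_bound[OF n2 i T h0(1) _ Ys _ g(2,3,4)[OF l2] avg Sb'[OF l2]])
                (use CS in \<open>auto simp: noise_def\<close>)
            then have "\<bar>(\<Sum>t=1..T. \<phi> l t * Ys t) - T * R_mean T i l h x\<bar> \<le> E * rate T h" by (simp only: E_def mult.assoc)
            then show ?thesis unfolding A'_def by (rule norm)
          qed
          have e3: "2 * (2 * B0 + 1) * (E * rho T h) \<le> cD / 2"
          proof -
            have "2 * (2 * B0 + 1) * (E * rho T h) \<le> 2 * (2 * B0 + 1) * (cD / (4 * (2 * B0 + 1)))"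
              using Er small_le(2) B0(1) by (intro mult_left_mono) auto
            also have "\<dots> = cD / 2" using B0(1) by (simp add: field_simps)
            finally show ?thesis .
          qed
          have e01: "0 \<le> E * rho T h" "E * rho T h \<le> 1"
            using mult_nonneg_nonneg[OF E(1) r0] Er small_le(1) by linarith+
          have "\<bar>(S 2 * A' 0 - S 1 * A' 1) / (S 2 * S 0 - (S 1)\<^sup>2) - m_star T i h x\<bar>
            \<le> (4 * (2 * B0 + 1) / cD + 8 * B0\<^sup>2 * (2 * B0 + 1) / cD\<^sup>2) * (E * rho T h)"
            unfolding m_star_def
            by (rule quotient_perturbation(2)[of S "\<lambda>l. S_mean T i l h x / h" "E * rho T h" A' "\<lambda>l. R_mean T i l h x / h" B0 cD,
                  OF S A' _ _ _ _ e3 cD_pos S_mean_lower(2)[OF T i h0 x]])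
              (use order_trans[OF sb B0(2)] order_trans[OF rb B0(3)] e01 in \<open>simp_all only:\<close>)
          moreover have "mhat T w i h x = (S 2 * A' 0 - S 1 * A' 1) / (S 2 * S 0 - (S 1)\<^sup>2)"
            unfolding S_def A'_def \<phi>_def Ys_def by (rule m_hat_quotient[OF h0(1) T])
          ultimately have 1: "\<bar>mhat T w i h x - m_star T i h x\<bar> \<le> Cm' * rho T h"
            by (simp only: Cm'_def mult.assoc)
          have S0: "S_loc K T (XX T w) i 0 x h = S 0" unfolding S_def \<phi>_def by (rule S_loc_phi[OF h0(1)])
          have "s0 / 2 \<le> S 0"
            using S[of 0] S_mean_lower(1)[OF T i h0 x] Er small_le(3) unfolding s0_def by linarith
          then show ?thesis using 1 S0 Sb[of 0] by auto
        qed
        have f: "c \<le> fhat T w i h x \<and> fhat T w i h x \<le> C" if x: "x \<in> {0..1}" for x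
        proof -
          have eq: "fhat T w i h x = S_loc K T (XX T w) i 0 x h / kappa K 0 x h"
            by (simp add: f_hat_def S_loc_def)
          have k: "kappa K 0 x h \<le> 1" "k0 * d \<le> kappa K 0 x h"
            using kappa_bounds(1)[OF x h0, of 0] kappa_bounds(2)[OF x h0] by auto
          have "c / 1 \<le> S_loc K T (XX T w) i 0 x h / kappa K 0 x h"
            using est[OF x] c k kd s0 by (intro frac_le) auto
          moreover have "S_loc K T (XX T w) i 0 x h / kappa K 0 x h \<le> CS / (k0 * d)"
            using est[OF x] k kd CS by (intro frac_le) auto
          ultimately show ?thesis using Cparts(2) by (simp add: eq)
        qed
        \<comment> \<open>Everything in the residual that vanishes uniformly: the error of the fit,
          consisting of fluctuation and bias, the individual's own time average and the average of
          the others. Each of the four parts is at most \<open>\<delta> / 4\<close>.\<close>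
        define z where "z t = \<mu> T i (X T i t w) - mhat T w i h (X T i t w)
          - (\<Sum>s=1..T. noise T i s w) / T
          + (\<Sum>j\<in>{1..n T} - {i}. (\<Sum>s=1..T. noise T j s w) / T) / (real (n T) - 1)" for t
        have av: "\<bar>(\<Sum>s=1..T. noise T j s w) / T\<bar> \<le> \<delta> / 4" if "j \<in> {1..n T}" for j
        proof -
          have "\<bar>(\<Sum>s=1..T. noise T j s w) / T\<bar> = (h * \<bar>\<Sum>s=1..T. noise T j s w\<bar>) / (h * real T)"
            using h0 T0 by (simp add: abs_divide)
          also have "\<dots> \<le> (D * rate T h) / (h * real T)" using avg[OF that] hT by (intro divide_right_mono) auto
          also have "\<dots> = D * rho T h" by simp
          finally show ?thesis using Dr Er small_le(4) by linarith
        qed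
        have zb: "\<bar>z t\<bar> \<le> \<delta>" if t: "t \<in> {1..T}" for t
        proof -
          note x = X01[OF i t]
          have 1: "\<bar>mhat T w i h (X T i t w) - m_star T i h (X T i t w)\<bar> \<le> \<delta> / 4"
            by (rule order_trans[OF conjunct1[OF est[OF x]] elim(3)[rule_format, OF h]])
          have 2: "\<bar>m_star T i h (X T i t w) - \<mu> T i (X T i t w)\<bar> \<le> \<delta> / 4"
          proof -
            have "Cb * h \<le> Cb * (\<delta> / (4 * (Cb + 1)))" using elim(5) h Cb_nonneg by (intro mult_left_mono) auto
            also have "\<dots> = (\<delta> / 4) * (Cb / (Cb + 1))" by simp
            also have "\<dots> \<le> (\<delta> / 4) * 1" using Cb_nonneg \<delta> by (intro mult_left_mono) auto
            finally show ?thesis using m_star_bias[OF T i h0 x] by linarith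
          qed
          have 3: "\<bar>(\<Sum>j\<in>{1..n T} - {i}. (\<Sum>s=1..T. noise T j s w) / T) / (real (n T) - 1)\<bar> \<le> \<delta> / 4"
            by (rule abs_average_le[OF n2 i]) (use av in auto)
          show ?thesis using 1 2 3 av[OF i] unfolding z_def by linarith
        qed
        have res: "Y_star (n T) T (YY T w) i t - mhat T w i h (X T i t w)
          = \<epsilon> T i t w - (\<Sum>j\<in>{1..n T} - {i}. noise T j t w) / (real (n T) - 1) + z t" if "t \<in> {1..T}" for t
          using Ys[OF that] unfolding Ys_def z_def
          by (simp add: noise_def[of T i t] sum_divide_distrib[symmetric] mult.commute)
        have e2: "\<sigma>low / 4 * T \<le> (\<Sum>t=1..T. (\<epsilon> T j t w)\<^sup>2)" "(\<Sum>t=1..T. (\<epsilon> T j t w)\<^sup>2) \<le> (2 + C1) * T"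
          if "j \<in> {1..n T}" for j using good_sample that unfolding good_sample_def by blast+
        have Z2: "(\<Sum>t=1..T. (noise T j t w)\<^sup>2) \<le> CZ * T" if "j \<in> {1..n T} - {i}" for j
        proof -
          have "(noise T j t w)\<^sup>2 \<le> 2 * G\<^sup>2 + 2 * (\<epsilon> T j t w)\<^sup>2" for t
          proof -
            have "\<bar>\<mu> T j (X T j t w)\<bar>\<^sup>2 \<le> G\<^sup>2" by (intro power_mono \<mu>_bd) auto
            moreover have "0 \<le> (\<mu> T j (X T j t w) - \<epsilon> T j t w)\<^sup>2" by simp
            ultimately show ?thesis by (simp add: noise_def power2_diff power2_sum)
          qed
          then have "(\<Sum>t=1..T. (noise T j t w)\<^sup>2) \<le> (\<Sum>t=1..T. 2 * G\<^sup>2 + 2 * (\<epsilon> T j t w)\<^sup>2)" by (intro sum_mono)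
          also have "\<dots> = T * (2 * G\<^sup>2) + 2 * (\<Sum>t=1..T. (\<epsilon> T j t w)\<^sup>2)" by (simp add: sum.distrib sum_distrib_left)
          also have "\<dots> \<le> CZ * T" using e2(2)[of j] that by (simp add: CZ_def algebra_simps)
          finally show ?thesis .
        qed
        have cross: "\<bar>\<Sum>t=1..T. \<epsilon> T i t w * noise T j t w\<bar> \<le> \<delta> * T" if "j \<in> {1..n T} - {i}" for j
        proof -
          have "h * \<bar>\<Sum>t=1..T. \<epsilon> T i t w * noise T j t w\<bar> \<le> D * rate T h"
            using good_sample i that h unfolding good_sample_def by blast
          then have "h * \<bar>\<Sum>t=1..T. \<epsilon> T i t w * noise T j t w\<bar> \<le> (D * rho T h) * (h * real T)"
            using hT by simp
          also have "\<dots> \<le> \<delta> * (h * real T)" using Dr Er small_le(4) \<delta>(1) hT by (intro mult_right_mono) auto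
          finally show ?thesis using h0 by simp
        qed
        let ?rs = "\<Sum>t=1..T. (Y_star (n T) T (YY T w) i t - mhat T w i h (X T i t w))\<^sup>2"
        have rv1: "(\<sigma>low / 4 / 2 - \<delta> - \<delta>\<^sup>2) * T \<le> ?rs"
          by (rule residual_variance_bounds(1)[OF n2 i T], erule res, erule zb, rule less_imp_le[OF \<delta>(1)], erule Z2,
              rule e2(1)[OF i], rule e2(2)[OF i], erule cross)
        have rv2: "?rs \<le> 3 * (2 + C1 + CZ + \<delta>\<^sup>2) * T"
          by (rule residual_variance_bounds(2)[OF n2 i T], erule res, erule zb, rule less_imp_le[OF \<delta>(1)], erule Z2,
              rule e2(1)[OF i], rule e2(2)[OF i], erule cross)
        have \<delta>2: "\<delta>\<^sup>2 \<le> \<delta>" "\<delta>\<^sup>2 \<le> 1" using \<delta> by (auto simp: power2_eq_square mult_le_one intro: mult_left_le)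
        have sg: "c \<le> s2hat T w i h \<and> s2hat T w i h \<le> C"
        proof
          have "c * T \<le> (\<sigma>low / 4 / 2 - \<delta> - \<delta>\<^sup>2) * T" using c \<delta> \<delta>2 by (intro mult_right_mono) auto
          then show "c \<le> s2hat T w i h"
            using rv1 T0 unfolding sigma2_hat_def by (simp only: pos_le_divide_eq)
          have "3 * (2 + C1 + CZ + \<delta>\<^sup>2) * T \<le> C * T" using Cparts(3) \<delta>2 by (intro mult_right_mono) auto
          then show "s2hat T w i h \<le> C"
            using rv2 T0 unfolding sigma2_hat_def by (simp only: pos_divide_le_eq)
        qed
        fix x assume x: "x \<in> {0..1::real}"
        have "\<bar>mhat T w i h x - m_star T i h x\<bar> \<le> C * rho T h"
          using est[OF x] mult_right_mono[OF Cparts(1) r0] by linarith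
        then show "\<bar>mhat T w i h x - m_star T i h x\<bar> \<le> C * rho T h \<and>
            c \<le> fhat T w i h x \<and> fhat T w i h x \<le> C \<and>
            c \<le> s2hat T w i h \<and> s2hat T w i h \<le> C"
          using f[OF x] sg by blast
      qed
    qed
  qed
qed

end

section \<open>The multiscale statistic\<close>

context panel_estimation
begin

text \<open>Bandwidths are at least a fixed power of \<open>T\<close>, so the correction is of order
  \<open>sqrt (ln T)\<close> and never exceeds the scale of the statistic within a group; it is
  nonnegative once \<open>2 * h \<le> 1\<close>.\<close>

lemma lam_bounds:
  "\<forall>\<^sub>F T in sequentially. \<forall>h\<in>H T. 0 \<le> lam (2 * h) \<and> lam (2 * h) \<le> sqrt (2 * (\<bar>B\<bar> + \<bar>ln (2 * a)\<bar>)) * sqrt (ln (real T))"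
proof -
  have half: "0 < 1 / (2 :: real)" by simp
  show ?thesis using h_small[OF half] eventually_ge_at_top[of 3]
  proof eventually_elim
    case (elim T)
    have T1: "1 \<le> T" using elim by simp
    have "exp 1 \<le> real T" using exp_le elim(2) by (intro order_trans[OF exp_le]) simp
    then have ln1: "1 \<le> ln (real T)" using T1 by (simp add: ln_ge_iff)
    show ?case
    proof
      fix h assume h: "h \<in> H T"
      note hb = H_bounds[OF T1 h]
      have h12: "h \<le> 1 / 2" using elim(1) h by blast
      have pos: "1 \<le> 1 / (2 * h)" using hb h12 by (simp add: pos_le_divide_eq)
      have "ln (1 / (2 * h)) \<le> ln (1 / (2 * hmin T))"
        using hb pos by (intro iffD2[OF ln_le_cancel_iff] divide_left_mono) auto
      also have "1 / (2 * hmin T) = T powr B / (2 * a)"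
        using h_pos by (simp add: hmin powr_minus field_simps)
      also have "ln (T powr B / (2 * a)) = B * ln T - ln (2 * a)"
        using h_pos T1 by (simp add: ln_div ln_powr)
      also have "\<dots> \<le> \<bar>B\<bar> * ln T + \<bar>ln (2 * a)\<bar> * ln T"
      proof -
        have "B * ln T \<le> \<bar>B\<bar> * ln T" using ln1 by (intro mult_right_mono) auto
        moreover have "\<bar>ln (2 * a)\<bar> * 1 \<le> \<bar>ln (2 * a)\<bar> * ln T" using ln1 by (intro mult_left_mono) auto
        ultimately show ?thesis by linarith
      qed
      also have "\<dots> = (\<bar>B\<bar> + \<bar>ln (2 * a)\<bar>) * ln T" by (simp add: distrib_right)
      finally have "2 * ln (1 / (2 * h)) \<le> 2 * ((\<bar>B\<bar> + \<bar>ln (2 * a)\<bar>) * ln T)" by (rule mult_left_mono) simp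
      then have "2 * ln (1 / (2 * h)) \<le> 2 * (\<bar>B\<bar> + \<bar>ln (2 * a)\<bar>) * ln T" by (simp only: mult.assoc)
      then have "lam (2 * h) \<le> sqrt (2 * (\<bar>B\<bar> + \<bar>ln (2 * a)\<bar>) * ln T)"
        unfolding lam_def by (rule real_sqrt_le_mono)
      moreover have "0 \<le> lam (2 * h)" using pos unfolding lam_def by (intro real_sqrt_ge_zero) simp
      ultimately show "0 \<le> lam (2 * h) \<and> lam (2 * h) \<le> sqrt (2 * (\<bar>B\<bar> + \<bar>ln (2 * a)\<bar>)) * sqrt (ln (real T))"
        by (simp only: real_sqrt_mult)
    qed
  qed
qed

abbreviation psi where "psi T w \<equiv> psi_hat K (n T) T (XX T w) (YY T w)"

abbreviation psi_bound where
  "psi_bound C c T w \<equiv> \<forall>i\<in>{1..n T}. \<forall>j\<in>{1..n T}. \<forall>h\<in>H T. \<forall>x\<in>{0..1}.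
    (m_star T i h x = m_star T j h x \<longrightarrow> \<bar>psi T w i j x h\<bar> \<le> C * sqrt (ln (real T))) \<and>
    c * sqrt (real T * h) * (\<bar>\<mu> T i x - \<mu> T j x\<bar> - C * rho T h - C * h) \<le> \<bar>psi T w i j x h\<bar>"

text \<open>The estimated variance lies between two positive constants, so the statistic is
  comparable to \<open>sqrt (T * h)\<close> times the difference of the fits. Fluctuation
  contributes \<open>sqrt (ln T)\<close>, because
  \<open>sqrt (T * h) * rho T h = sqrt (ln T)\<close>; for different individuals the bias enters as
  well.\<close>

lemma psi_bounds:
  "\<exists>C c. 0 \<le> C \<and> 0 < c \<and> whp M (psi_bound C c)"
proof -
  obtain D where D: "0 \<le> D" "whp M (good_sample D)" using whp_good_sample by blast
  obtain C c where Cc: "0 \<le> C" "0 < c" and est: "\<forall>\<^sub>F T in sequentially. \<forall>w\<in>space (M T). good_sample D T w \<longrightarrow>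
    accurate C c T w"
    using estimator_bounds[OF D(1)] by blast
  define Cs where "Cs = 8 * KM\<^sup>2 / (k0 * d ^ 3 * (k0 * d))\<^sup>2 + 1"
  have Cs: "1 \<le> Cs" by (simp add: Cs_def)
  define lo where "lo = c / (C + 1)"
  define up where "up = 2 * ((C + 1) / c) * Cs"
  have lo: "0 < lo" using Cc by (simp add: lo_def)
  have up: "0 < up" using Cc Cs by (simp add: up_def)
  \<comment> \<open>The three summands dominate the bound for equal population fits, the two
    fluctuations and the two biases of a pair.\<close>
  define C' where "C' = 2 * C / sqrt lo + 2 * C + 2 * Cb"
  have C'parts: "0 \<le> C'" "2 * C / sqrt lo \<le> C'" "2 * C \<le> C'" "2 * Cb \<le> C'"
    using Cc Cb_nonneg lo by (auto simp: C'_def)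
  have half: "0 < 1 / (2 :: real)" by simp
  have "whp M (psi_bound C' (1 / sqrt up))"
  proof (rule whp_mono[OF D(2)])
    show "\<forall>\<^sub>F T in sequentially. \<forall>w\<in>space (M T). good_sample D T w \<longrightarrow>
      psi_bound C' (1 / sqrt up) T w"
      using est h_small[OF half] eventually_ge_at_top[of 1]
    proof eventually_elim
      case (elim T)
      note T = elim(3)
      show ?case
      proof (intro ballI impI)
        fix w i j h x assume w: "w \<in> space (M T)" and g: "good_sample D T w" and i: "i \<in> {1..n T}" and j: "j \<in> {1..n T}"
          and h: "h \<in> H T" and x: "x \<in> {0..1::real}"
        have h0: "0 < h" "h \<le> 1 / 2" using H_bounds(4)[OF T h] elim(2) h by auto
        have Th: "0 < real T * h" using T h0 by simp
        let ?m = "\<lambda>i. mhat T w i h x"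
        let ?nu = "nu_hat K (n T) T (XX T w) (YY T w) i j x h"
        let ?q = "\<lambda>i. s2hat T w i h / fhat T w i h x"
        have e: "\<bar>?m k - m_star T k h x\<bar> \<le> C * rho T h" "c \<le> fhat T w k h x" "fhat T w k h x \<le> C"
          "c \<le> s2hat T w k h" "s2hat T w k h \<le> C" if "k \<in> {1..n T}" for k
          using elim(1) w g that h x by blast+
        have q: "lo \<le> ?q k" "?q k \<le> (C + 1) / c" if "k \<in> {1..n T}" for k
        proof -
          show "lo \<le> ?q k" unfolding lo_def using e[OF that] Cc by (intro frac_le) auto
          show "?q k \<le> (C + 1) / c" using e[OF that] Cc by (intro frac_le) auto
        qed
        have s: "1 / 2 \<le> s_fun K x h" "s_fun K x h \<le> Cs"
          using kappa_bounds(4,5)[OF x h0] by (simp_all add: Cs_def)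
        have nu: "?nu = (?q i + ?q j) * s_fun K x h" by (simp only: nu_hat_def)
        have nu_lo: "lo \<le> ?nu"
        proof -
          have "(lo + lo) * (1 / 2) \<le> (?q i + ?q j) * s_fun K x h"
            using q[OF i] q[OF j] s lo by (intro mult_mono add_mono) auto
          then show ?thesis unfolding nu by simp
        qed
        have nu_up: "?nu \<le> up"
        proof -
          have "(?q i + ?q j) * s_fun K x h \<le> ((C + 1) / c + (C + 1) / c) * Cs"
            using q[OF i] q[OF j] s lo Cc by (intro mult_mono add_mono) (auto intro!: add_nonneg_nonneg divide_nonneg_pos)
          then show ?thesis unfolding nu up_def by simp
        qed
        have abs_psi: "\<bar>psi T w i j x h\<bar> = sqrt (real T * h) * (\<bar>?m i - ?m j\<bar> / sqrt ?nu)"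
          using Th nu_lo lo by (simp add: psi_hat_def abs_mult abs_divide)
        have sr: "sqrt (real T * h) * rho T h = sqrt (ln (real T))"
        proof -
          have "rate T h = sqrt (real T * h) * sqrt (ln (real T))" by (rule real_sqrt_mult)
          then have "sqrt (real T * h) * rho T h = (sqrt (real T * h) * sqrt (real T * h)) * sqrt (ln (real T)) / (h * real T)"
            by simp
          also have "sqrt (real T * h) * sqrt (real T * h) = h * real T" using Th by simp
          also have "h * real T * sqrt (ln (real T)) / (h * real T) = sqrt (ln (real T))"
            using T h0 by (intro nonzero_mult_div_cancel_left) simp
          finally show ?thesis .
        qed
        have r0: "0 \<le> rho T h" using T h0 by (intro divide_nonneg_nonneg real_sqrt_ge_zero mult_nonneg_nonneg) auto
        have factor_out: "y * (2 * u * v / z) = 2 * u / z * (y * v)" for y u v z :: real by simp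
        have "\<bar>psi T w i j x h\<bar> \<le> C' * sqrt (ln (real T))" if eq: "m_star T i h x = m_star T j h x"
        proof -
          have "\<bar>?m i - ?m j\<bar> \<le> 2 * C * rho T h" using e(1)[OF i] e(1)[OF j] eq by linarith
          then have "\<bar>?m i - ?m j\<bar> / sqrt ?nu \<le> 2 * C * rho T h / sqrt lo"
            using lo nu_lo by (intro frac_le) auto
          then have "\<bar>psi T w i j x h\<bar> \<le> sqrt (real T * h) * (2 * C * rho T h / sqrt lo)"
            unfolding abs_psi using Th by (intro mult_left_mono) auto
          also have "\<dots> = 2 * C / sqrt lo * (sqrt (real T * h) * rho T h)"
            using factor_out[of "sqrt (real T * h)" C "rho T h" "sqrt lo"] by (simp only:)
          also have "\<dots> \<le> C' * sqrt (ln (real T))" unfolding sr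
            by (rule mult_right_mono[OF C'parts(2)]) (use T in simp)
          finally show ?thesis .
        qed
        moreover have "1 / sqrt up * sqrt (real T * h) * (\<bar>\<mu> T i x - \<mu> T j x\<bar> - C' * rho T h - C' * h) \<le> \<bar>psi T w i j x h\<bar>"
        proof -
          have b: "\<bar>m_star T k h x - \<mu> T k x\<bar> \<le> Cb * h" if "k \<in> {1..n T}" for k by (rule m_star_bias[OF T that h0 x])
          have p: "2 * C * rho T h \<le> C' * rho T h" "2 * Cb * h \<le> C' * h"
            by (rule mult_right_mono[OF C'parts(3) r0], rule mult_right_mono[OF C'parts(4) less_imp_le[OF h0(1)]])
          have ge: "\<bar>\<mu> T i x - \<mu> T j x\<bar> - C' * rho T h - C' * h \<le> \<bar>?m i - ?m j\<bar>"
            using e(1)[OF i] e(1)[OF j] b[OF i] b[OF j] p by linarith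
          have "1 / sqrt up * sqrt (real T * h) * (\<bar>\<mu> T i x - \<mu> T j x\<bar> - C' * rho T h - C' * h)
            \<le> 1 / sqrt up * sqrt (real T * h) * \<bar>?m i - ?m j\<bar>"
            using ge up Th by (intro mult_left_mono) auto
          also have "\<dots> = sqrt (real T * h) * (\<bar>?m i - ?m j\<bar> / sqrt up)" by simp
          also have "\<dots> \<le> \<bar>psi T w i j x h\<bar>"
            unfolding abs_psi using up nu_up nu_lo lo Th by (intro mult_left_mono divide_left_mono) auto
          finally show ?thesis .
        qed
        ultimately show "(m_star T i h x = m_star T j h x \<longrightarrow> \<bar>psi T w i j x h\<bar> \<le> C' * sqrt (ln (real T))) \<and>
          1 / sqrt up * sqrt (real T * h) * (\<bar>\<mu> T i x - \<mu> T j x\<bar> - C' * rho T h - C' * h) \<le> \<bar>psi T w i j x h\<bar>"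
          by blast
      qed
    qed
  qed
  then show ?thesis using C'parts(1) up by (rule_tac exI[of _ C'], rule_tac exI[of _ "1 / sqrt up"]) simp
qed

abbreviation same_mean_bound where
  "same_mean_bound C T w \<equiv> \<forall>i\<in>{1..n T}. \<forall>j\<in>{1..n T}. \<forall>h\<in>H T. \<forall>x\<in>{0..1}.
    m_star T i h x = m_star T j h x \<longrightarrow> \<bar>\<bar>psi T w i j x h\<bar> - lam (2 * h)\<bar> \<le> C * sqrt (ln (real T))"

abbreviation separation_bound where
  "separation_bound \<Delta> c C T w \<equiv> \<forall>i\<in>{1..n T}. \<forall>j\<in>{1..n T}. \<forall>h\<in>H T. \<forall>x\<in>{0..1}.
    \<Delta> \<le> \<bar>\<mu> T i x - \<mu> T j x\<bar> \<longrightarrow> c * sqrt (real T * h) - C * sqrt (ln (real T)) \<le> \<bar>psi T w i j x h\<bar> - lam (2 * h)"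

lemma same_mean_statistic:
  "\<exists>C\<ge>0. whp M (same_mean_bound C)"
proof -
  obtain C c where Cc: "0 \<le> C" "whp M (psi_bound C c)"
    using psi_bounds by (elim exE conjE) (rule that)
  define CL where "CL = sqrt (2 * (\<bar>B\<bar> + \<bar>ln (2 * a)\<bar>))"
  have CL: "0 \<le> CL" by (simp add: CL_def)
  show ?thesis
  proof (intro exI[of _ "C + CL"] conjI whp_mono[OF Cc(2)])
    show "0 \<le> C + CL" using Cc(1) CL by simp
    show "\<forall>\<^sub>F T in sequentially. \<forall>w\<in>space (M T). psi_bound C c T w \<longrightarrow>
      same_mean_bound (C + CL) T w"
      using lam_bounds[folded CL_def]
    proof eventually_elim
      case (elim T)
      show ?case
      proof (intro ballI impI)
        fix w i j h x assume *: "psi_bound C c T w"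
          and i: "i \<in> {1..n T}" and j: "j \<in> {1..n T}" and h: "h \<in> H T" and x: "x \<in> {0..1::real}"
          and eq: "m_star T i h x = m_star T j h x"
        have "\<bar>psi T w i j x h\<bar> \<le> C * sqrt (ln (real T))"
          by (rule mp[OF conjunct1[OF *[rule_format, OF i j h x]] eq])
        moreover have "0 \<le> lam (2 * h) \<and> lam (2 * h) \<le> CL * sqrt (ln (real T))" using elim h by blast
        moreover have "(C + CL) * sqrt (ln (real T)) = C * sqrt (ln (real T)) + CL * sqrt (ln (real T))"
          by (rule distrib_right)
        moreover have "0 \<le> \<bar>psi T w i j x h\<bar>" by (rule abs_ge_zero)
        ultimately show "\<bar>\<bar>psi T w i j x h\<bar> - lam (2 * h)\<bar> \<le> (C + CL) * sqrt (ln (real T))" by linarith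
      qed
    qed
  qed
qed

text \<open>Fluctuation and bias each consume at most a quarter of the gap \<open>\<Delta>\<close>,
  so half of it remains in the statistic; the correction \<open>lam\<close> is left as the
  subtracted \<open>sqrt (ln T)\<close> term.\<close>

lemma separated_statistic:
  assumes \<Delta>: "0 < \<Delta>"
  shows "\<exists>c>0. \<exists>C. whp M (separation_bound \<Delta> c C)"
proof -
  obtain C c where C0: "0 \<le> C" and c: "0 < c" and Cc: "whp M (psi_bound C c)"
    using psi_bounds by (elim exE conjE) (rule that)
  define CL where "CL = sqrt (2 * (\<bar>B\<bar> + \<bar>ln (2 * a)\<bar>))"
  have \<Delta>4: "0 < \<Delta> / 4" using \<Delta> by simp
  have hb: "0 < \<Delta> / (4 * (C + 1))" using \<Delta> C0 by simp
  show ?thesis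
  proof (rule exI[of _ "c * \<Delta> / 2"], intro conjI exI[of _ CL] whp_mono[OF Cc])
    show "0 < c * \<Delta> / 2" using c \<Delta> by simp
    show "\<forall>\<^sub>F T in sequentially. \<forall>w\<in>space (M T). psi_bound C c T w \<longrightarrow>
      separation_bound \<Delta> (c * \<Delta> / 2) CL T w"
      using lam_bounds[folded CL_def] rho_small[OF \<Delta>4 C0] h_small[OF hb] eventually_ge_at_top[of 1]
    proof eventually_elim
      case (elim T)
      show ?case
      proof (intro ballI impI)
        fix w i j h x assume *: "psi_bound C c T w"
          and i: "i \<in> {1..n T}" and j: "j \<in> {1..n T}" and h: "h \<in> H T" and x: "x \<in> {0..1::real}"
          and sep: "\<Delta> \<le> \<bar>\<mu> T i x - \<mu> T j x\<bar>"
        have Th: "0 < real T * h" using H_bounds(4)[OF elim(4) h] elim(4) by simp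
        have "C * h \<le> C * (\<Delta> / (4 * (C + 1)))" using elim(3) h C0 by (intro mult_left_mono) auto
        also have "\<dots> = \<Delta> / 4 * (C / (C + 1))" by simp
        also have "\<dots> \<le> \<Delta> / 4 * 1" using C0 \<Delta> by (intro mult_left_mono) auto
        finally have "C * h \<le> \<Delta> / 4" by simp
        moreover have "C * rho T h \<le> \<Delta> / 4" using elim(2) h by blast
        ultimately have "\<Delta> / 2 \<le> \<bar>\<mu> T i x - \<mu> T j x\<bar> - C * rho T h - C * h" using sep by linarith
        then have "c * sqrt (real T * h) * (\<Delta> / 2) \<le> c * sqrt (real T * h) * (\<bar>\<mu> T i x - \<mu> T j x\<bar> - C * rho T h - C * h)"
          using c Th by (intro mult_left_mono) auto
        also have "\<dots> \<le> \<bar>psi T w i j x h\<bar>" by (rule conjunct2[OF *[rule_format, OF i j h x]])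
        finally have "c * \<Delta> / 2 * sqrt (real T * h) \<le> \<bar>psi T w i j x h\<bar>" by (simp only: mult_ac times_divide_eq_right times_divide_eq_left)
        moreover have "lam (2 * h) \<le> CL * sqrt (ln (real T))" using elim(1) h by blast
        ultimately show "c * \<Delta> / 2 * sqrt (real T * h) - CL * sqrt (ln (real T)) \<le> \<bar>psi T w i j x h\<bar> - lam (2 * h)"
          by linarith
      qed
    qed
  qed
qed

end

section \<open>Moment conditions and truncation\<close>

lemma (in prob_space) subalgebra_sigma_of:
  assumes [measurable]: "X \<in> borel_measurable M"
  shows "subalgebra M (sigma_of M X)"
  unfolding subalgebra_def sigma_of_def
  by (auto simp: space_vimage_algebra sets_vimage_algebra2 measurable_sets[OF assms])

text \<open>The conditional bound is tested on the events \<open>X w \<in> D\<close>. Integrability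
  is a conclusion, since the conditional expectation is the extended one. The type of
  \<open>X\<close> is general because conditioning on a pair of regressors is required too.\<close>

lemma (in prob_space) expectation_le_of_cond_exp_le:
  fixes X :: "'a \<Rightarrow> 'b :: topological_space" and V :: "'a \<Rightarrow> real"
  assumes [measurable]: "X \<in> borel_measurable M" "V \<in> borel_measurable M" "D \<in> sets borel"
    and V: "\<And>w. 0 \<le> V w"
    and c: "AE w in M. nn_cond_exp M (sigma_of M X) (\<lambda>w. ennreal (V w)) w \<le> ennreal c" and c0: "0 \<le> c"
  shows "integrable M (\<lambda>w. indicator D (X w) * V w)"
    "(\<integral>w. indicator D (X w) * V w \<partial>M) \<le> c * (\<integral>w. indicator D (X w) \<partial>M)"
proof -
  interpret S: finite_measure_subalgebra M "sigma_of M X"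
    by unfold_locales (rule subalgebra_sigma_of[OF assms(1)])
  have ind: "(\<lambda>w. indicator D (X w) :: ennreal) \<in> borel_measurable (sigma_of M X)"
    unfolding sigma_of_def
    by (rule measurable_compose[OF measurable_vimage_algebra1]) (auto simp: measurable_space[OF assms(1)])
  have "(\<integral>\<^sup>+w. ennreal (indicator D (X w) * V w) \<partial>M) = (\<integral>\<^sup>+w. indicator D (X w) * ennreal (V w) \<partial>M)"
    by (intro nn_integral_cong) (auto simp: indicator_def)
  also have "\<dots> = (\<integral>\<^sup>+w. indicator D (X w) * nn_cond_exp M (sigma_of M X) (\<lambda>w. ennreal (V w)) w \<partial>M)"
    by (rule S.nn_cond_exp_intg[symmetric, OF ind]) measurable
  also have "\<dots> \<le> (\<integral>\<^sup>+w. ennreal (c * indicator D (X w)) \<partial>M)"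
    by (rule nn_integral_mono_AE) (use c in \<open>auto simp: indicator_def elim: eventually_mono\<close>)
  also have "\<dots> = ennreal (\<integral>w. c * indicator D (X w) \<partial>M)"
  proof (rule nn_integral_eq_integral)
    show "integrable M (\<lambda>w. c * indicator D (X w))"
      by (rule integrable_const_bound[where B = c]) (auto simp: c0 indicator_def)
  qed (use c0 in auto)
  finally have le: "(\<integral>\<^sup>+w. ennreal (indicator D (X w) * V w) \<partial>M) \<le> ennreal (\<integral>w. c * indicator D (X w) \<partial>M)" .
  show i: "integrable M (\<lambda>w. indicator D (X w) * V w)"
  proof (rule integrableI_nonneg)
    show "(\<integral>\<^sup>+w. ennreal (indicator D (X w) * V w) \<partial>M) < \<infinity>" using le by (rule order.strict_trans1) simp
  qed (auto simp: V)
  have "ennreal (\<integral>w. indicator D (X w) * V w \<partial>M) \<le> ennreal (\<integral>w. c * indicator D (X w) \<partial>M)"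
    using le by (subst nn_integral_eq_integral[symmetric, OF i]) (auto simp: V)
  then show "(\<integral>w. indicator D (X w) * V w \<partial>M) \<le> c * (\<integral>w. indicator D (X w) \<partial>M)"
    using c0 by (subst (asm) ennreal_le_iff) (auto intro!: integral_nonneg)
qed

lemma (in prob_space) integral_mult_eq_0_of_cond_exp:
  fixes X V :: "'a \<Rightarrow> real"
  assumes [measurable]: "X \<in> borel_measurable M" "V \<in> borel_measurable M" "f \<in> borel_measurable borel"
    and V: "integrable M V" and f: "\<And>x. \<bar>f x\<bar> \<le> c"
    and AE0: "AE w in M. real_cond_exp M (sigma_of M X) V w = 0"
  shows "(\<integral>w. f (X w) * V w \<partial>M) = 0"
proof -
  interpret S: finite_measure_subalgebra M "sigma_of M X"
    by unfold_locales (rule subalgebra_sigma_of[OF assms(1)])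
  have fX: "(\<lambda>w. f (X w)) \<in> borel_measurable (sigma_of M X)"
    unfolding sigma_of_def
    by (rule measurable_compose[OF measurable_vimage_algebra1]) (auto simp: measurable_space[OF assms(1)])
  have i: "integrable M (\<lambda>w. f (X w) * V w)"
  proof (rule Bochner_Integration.integrable_bound)
    show "integrable M (\<lambda>w. c * V w)" using V by simp
    show "AE w in M. norm (f (X w) * V w) \<le> norm (c * V w)"
    proof (rule AE_I2)
      fix w
      have "\<bar>f (X w)\<bar> \<le> \<bar>c\<bar>" using f[of "X w"] by linarith
      then show "norm (f (X w) * V w) \<le> norm (c * V w)" by (simp add: abs_mult mult_right_mono)
    qed
  qed measurable
  have "(\<integral>w. f (X w) * V w \<partial>M) = (\<integral>w. f (X w) * real_cond_exp M (sigma_of M X) V w \<partial>M)"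
    by (rule S.real_cond_exp_intg(2)[symmetric, OF i fX]) measurable
  also have "\<dots> = (\<integral>w. 0 \<partial>M)"
    by (rule integral_cong_AE)
      (use AE0 in \<open>auto elim!: eventually_mono intro: borel_measurable_times measurable_compose[OF assms(1)]\<close>)
  finally show ?thesis by simp
qed

lemma (in prob_space) expectation_indicator_le_density:
  fixes X :: "'a \<Rightarrow> 'b"
  assumes X: "distributed M N X (\<lambda>x. ennreal (f x))" and D: "D \<in> sets N"
    and f: "\<And>x. x \<in> D \<Longrightarrow> f x \<le> c" and c: "0 \<le> c" and v: "emeasure N D = ennreal v" "0 \<le> v"
  shows "(\<integral>w. indicator D (X w) \<partial>M) \<le> c * v"
proof -
  have [measurable]: "X \<in> measurable M N" by (rule distributed_measurable[OF X])
  have e: "(\<integral>\<^sup>+w. indicator D (X w) \<partial>M) = (\<integral>\<^sup>+x. ennreal (f x) * indicator D x \<partial>N)"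
    using D by (intro distributed_nn_integral[symmetric, OF X]) auto
  have "(\<integral>\<^sup>+x. ennreal (f x) * indicator D x \<partial>N) \<le> (\<integral>\<^sup>+x. ennreal c * indicator D x \<partial>N)"
    by (intro nn_integral_mono) (auto simp: indicator_def f intro: ennreal_leI)
  also have "\<dots> = ennreal (c * v)" using D v c by (simp add: nn_integral_cmult ennreal_mult)
  finally have le: "(\<integral>\<^sup>+w. indicator D (X w) \<partial>M) \<le> ennreal (c * v)" unfolding e .
  have m: "(\<lambda>w. indicator D (X w) :: real) \<in> borel_measurable M" using D by measurable
  have i: "integrable M (\<lambda>w. indicator D (X w) :: real)"
    by (rule integrable_const_bound[where B = 1, OF _ m]) (auto simp: indicator_def)
  have "ennreal (\<integral>w. indicator D (X w) \<partial>M) = (\<integral>\<^sup>+w. ennreal (indicator D (X w)) \<partial>M)"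
    by (rule nn_integral_eq_integral[symmetric, OF i]) auto
  also have "\<dots> = (\<integral>\<^sup>+w. indicator D (X w) \<partial>M)" by (simp add: ennreal_indicator)
  finally have "ennreal (\<integral>w. indicator D (X w) \<partial>M) \<le> ennreal (c * v)" using le by (simp only:)
  then show ?thesis using c v by (subst (asm) ennreal_le_iff) auto
qed

lemma (in prob_space) expectation_indicator_ge_density:
  fixes X :: "'a \<Rightarrow> 'b"
  assumes X: "distributed M N X (\<lambda>x. ennreal (f x))" and D: "D \<in> sets N"
    and f: "\<And>x. x \<in> D \<Longrightarrow> c \<le> f x" and c: "0 \<le> c" and v: "emeasure N D = ennreal v" "0 \<le> v"
  shows "c * v \<le> (\<integral>w. indicator D (X w) \<partial>M)"
proof -
  have [measurable]: "X \<in> measurable M N" by (rule distributed_measurable[OF X])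
  have e: "(\<integral>\<^sup>+w. indicator D (X w) \<partial>M) = (\<integral>\<^sup>+x. ennreal (f x) * indicator D x \<partial>N)"
    using D by (intro distributed_nn_integral[symmetric, OF X]) auto
  have "ennreal (c * v) = (\<integral>\<^sup>+x. ennreal c * indicator D x \<partial>N)" using D v c by (simp add: nn_integral_cmult ennreal_mult)
  also have "\<dots> \<le> (\<integral>\<^sup>+x. ennreal (f x) * indicator D x \<partial>N)"
    by (intro nn_integral_mono) (auto simp: indicator_def f intro: ennreal_leI)
  finally have le: "ennreal (c * v) \<le> (\<integral>\<^sup>+w. indicator D (X w) \<partial>M)" unfolding e .
  have m: "(\<lambda>w. indicator D (X w) :: real) \<in> borel_measurable M" using D by measurable
  have i: "integrable M (\<lambda>w. indicator D (X w) :: real)"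
    by (rule integrable_const_bound[where B = 1, OF _ m]) (auto simp: indicator_def)
  have "ennreal (\<integral>w. indicator D (X w) \<partial>M) = (\<integral>\<^sup>+w. ennreal (indicator D (X w)) \<partial>M)"
    by (rule nn_integral_eq_integral[symmetric, OF i]) auto
  also have "\<dots> = (\<integral>\<^sup>+w. indicator D (X w) \<partial>M)" by (simp add: ennreal_indicator)
  finally have "ennreal (c * v) \<le> ennreal (\<integral>w. indicator D (X w) \<partial>M)" using le by (simp only:)
  then show ?thesis by (subst (asm) ennreal_le_iff) (auto intro!: integral_nonneg)
qed

lemma distributed_same_law:
  assumes "distributed M N X f" "distributed M' N X' f"
  shows "distr M N X = distr M' N X'"
  using assms by (simp add: distributed_distr_eq_density)

lemma (in prob_space) distributed_AE_support:
  fixes X :: "'a \<Rightarrow> real"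
  assumes X: "distributed M lborel X (\<lambda>x. ennreal (f x))" and f: "\<And>x. x \<notin> {0..1} \<Longrightarrow> f x = 0"
  shows "AE w in M. X w \<in> {0..1}"
proof -
  have [measurable]: "X \<in> borel_measurable M" using distributed_measurable[OF X] by simp
  have m: "(\<lambda>w. indicator (- {0..1}) (X w) :: ennreal) \<in> borel_measurable M" by measurable
  have "(\<integral>\<^sup>+w. indicator (- {0..1}) (X w) \<partial>M) = (\<integral>\<^sup>+x. ennreal (f x) * indicator (- {0..1}) x \<partial>lborel)"
    by (rule distributed_nn_integral[symmetric, OF X]) simp
  also have "\<dots> = (\<integral>\<^sup>+x. 0 \<partial>(lborel :: real measure))"
    by (intro nn_integral_cong) (metis ComplI f ennreal_0 indicator_simps(2) mult_zero_left mult_zero_right Compl_iff)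
  finally have "(\<integral>\<^sup>+w. indicator (- {0..1}) (X w) \<partial>M) = 0" by simp
  then have "AE w in M. (indicator (- {0..1}) (X w) :: ennreal) = 0"
    by (simp only: nn_integral_0_iff_AE[OF m])
  then show ?thesis by (auto simp: indicator_def elim!: eventually_mono split: if_splits)
qed

lemma (in prob_space) indep_vars_pair:
  assumes "indep_vars N Z I" "i \<in> I" "j \<in> I" "i \<noteq> j"
  shows "indep_var (N i) (Z i) (N j) (Z j)"
proof -
  have "indep_var (PiM {i} N) (\<lambda>w. restrict (\<lambda>k. Z k w) {i}) (PiM {j} N) (\<lambda>w. restrict (\<lambda>k. Z k w) {j})"
    by (rule indep_var_restrict[OF assms(1)]) (use assms in auto)
  from indep_var_compose[OF this, of "\<lambda>f. f i" "N i" "\<lambda>f. f j" "N j"]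
  show ?thesis by (simp add: comp_def measurable_component_singleton)
qed

text \<open>A real \<open>Sup\<close> is an upper bound only for a set that is bounded above; here
  every entry is at most 1.\<close>

lemma (in prob_space) mixing_coeff_le:
  assumes "1 \<le> t" "D1 \<in> events_of M N Z {1..t}" "D2 \<in> events_of M N Z {t + l..}" "mixing_coeff M N Z l \<le> c"
  shows "prob (D1 \<inter> D2) \<le> prob D1 * prob D2 + c"
proof -
  have "\<bar>prob (D1 \<inter> D2) - prob D1 * prob D2\<bar> \<le> mixing_coeff M N Z l"
    unfolding mixing_coeff_def
  proof (rule cSup_upper)
    show "\<bar>prob (D1 \<inter> D2) - prob D1 * prob D2\<bar> \<in>
      {\<bar>prob (A \<inter> B) - prob A * prob B\<bar> |A B t. 1 \<le> t \<and> A \<in> events_of M N Z {1..t} \<and> B \<in> events_of M N Z {t + l..}}"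
      using assms by blast
    show "bdd_above {\<bar>prob (A \<inter> B) - prob A * prob B\<bar> |A B t.
        1 \<le> t \<and> A \<in> events_of M N Z {1..t} \<and> B \<in> events_of M N Z {t + l..}}"
    proof (rule bdd_aboveI[of _ 1], safe)
      fix A B
      have "0 \<le> prob A * prob B" "prob A * prob B \<le> 1" by (auto intro: mult_le_one)
      moreover have "0 \<le> prob (A \<inter> B)" "prob (A \<inter> B) \<le> 1" by auto
      ultimately show "\<bar>prob (A \<inter> B) - prob A * prob B\<bar> \<le> 1" by linarith
    qed
  qed
  then show ?thesis using assms(4) by linarith
qed

lemma pow4_le_powr:
  fixes e \<theta> :: real
  assumes "4 < \<theta>"
  shows "e ^ 4 \<le> 1 + \<bar>e\<bar> powr \<theta>"
proof (cases "\<bar>e\<bar> \<le> 1")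
  case True
  then have "\<bar>e\<bar> ^ 4 \<le> 1" by (intro power_le_one) auto
  moreover have "\<bar>e\<bar> ^ 4 = e ^ 4" by simp
  ultimately show ?thesis using powr_ge_zero[of "\<bar>e\<bar>" \<theta>] by linarith
next
  case False
  then have "\<bar>e\<bar> powr 4 \<le> \<bar>e\<bar> powr \<theta>" using assms by (intro powr_mono) auto
  moreover have "\<bar>e\<bar> powr 4 = \<bar>e\<bar> ^ 4" using False by (simp add: powr_numeral)
  ultimately show ?thesis by (simp add: power_even_abs)
qed

text \<open>The usual moment bound for a tail: where \<open>\<bar>e\<bar> > \<tau>\<close>, the
  factor \<open>(\<bar>e\<bar> / \<tau>) powr (\<theta> - 1)\<close> exceeds 1.\<close>

lemma abs_sub_trunc_le:
  fixes e \<tau> \<theta> :: real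
  assumes "1 < \<theta>" "0 < \<tau>"
  shows "\<bar>e - trunc \<tau> e\<bar> \<le> \<tau> powr (1 - \<theta>) * \<bar>e\<bar> powr \<theta>"
proof (cases "\<bar>e\<bar> \<le> \<tau>")
  case False
  then have e: "0 < \<bar>e\<bar>" using assms by linarith
  have "\<bar>e\<bar> powr (1 - \<theta>) \<le> \<tau> powr (1 - \<theta>)" using False assms by (intro powr_mono2') auto
  then have "\<bar>e\<bar> powr (1 - \<theta>) * \<bar>e\<bar> powr \<theta> \<le> \<tau> powr (1 - \<theta>) * \<bar>e\<bar> powr \<theta>" by (rule mult_right_mono) simp
  moreover have "\<bar>e\<bar> powr (1 - \<theta>) * \<bar>e\<bar> powr \<theta> = \<bar>e\<bar>" using e by (simp flip: powr_add)
  ultimately show ?thesis using False by (simp add: trunc_def)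
qed (simp add: trunc_def)

text \<open>With \<open>q\<close> the minimum in the hypothesis on \<open>n\<close>, the level is
  \<open>sqrt q\<close> lowered by a small power of \<open>T\<close>. The size conditions hold
  because \<open>q\<close> is at most each of its two arguments. The hypothesis becomes
  \<open>n * T powr (1 + \<delta> / 2) \<le> C * \<tau> powr \<theta>\<close>, which controls the
  union over all \<open>n * T\<close> errors with \<open>T powr - (\<delta> / 2)\<close> to
  spare.\<close>

lemma truncation_level:
  fixes n :: "nat \<Rightarrow> nat" and a B \<theta> \<delta> C :: real
  assumes \<theta>: "4 < \<theta>" and pos: "0 < \<delta>" "0 < C" "0 < a" "B < 1"
    and n1: "\<And>T. 1 \<le> T \<Longrightarrow> 1 \<le> n T"
    and n: "\<And>T. 1 \<le> T \<Longrightarrow> real (n T) \<le> C * (min (real T powr (1/2)) (real T * (a * real T powr - B)) powr ((\<theta> - \<delta>) / 2) / real T powr (1 + \<delta>))"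
  shows "\<exists>\<tau> \<eta>. 0 < \<eta> \<and> (\<forall>T\<ge>1. 0 < \<tau> T) \<and> filterlim \<tau> at_top sequentially \<and>
    (\<forall>\<^sub>F T in sequentially. \<tau> T \<le> sqrt (real T * (a * real T powr - B)) * real T powr - \<eta> \<and> (\<tau> T)\<^sup>2 \<le> sqrt (real T) * real T powr - \<eta>) \<and>
    (\<forall>\<^sub>F T in sequentially. \<tau> T powr (1 - \<theta>) \<le> 1 / sqrt (real T)) \<and>
    (\<lambda>T. real (n T) * real T * \<tau> T powr - \<theta>) \<longlonglongrightarrow> 0 \<and>
    (\<forall>\<^sub>F T in sequentially. real (n T) \<le> real T powr \<theta>)"
proof -
  define q where "q T = min (real T powr (1/2)) (real T * (a * real T powr - B))" for T :: nat
  \<comment> \<open>Chosen so that raising \<open>T powr - \<eta>\<close> to the power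
    \<open>\<theta>\<close> costs \<open>T powr - (\<delta> / 2)\<close>, half of the margin in the
    hypothesis.\<close>
  define \<eta> where "\<eta> = \<delta> / (2 * \<theta>)"
  define \<tau> where "\<tau> T = sqrt (q T) * real T powr - \<eta>" for T
  have \<eta>: "0 < \<eta>" using \<theta> pos by (simp add: \<eta>_def)
  have qpos: "0 < q T" if "1 \<le> T" for T using that pos by (simp add: q_def)
  have \<tau>pos: "0 < \<tau> T" if "1 \<le> T" for T using qpos[OF that] that by (simp add: \<tau>_def)
  have q1: "\<forall>\<^sub>F T in sequentially. 1 \<le> q T"
  proof -
    have "\<forall>\<^sub>F T in sequentially. 1 \<le> real T powr (1/2)" by real_asymp
    moreover have "\<forall>\<^sub>F T in sequentially. 1 \<le> real T * (a * real T powr - B)" using pos by real_asymp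
    ultimately show ?thesis unfolding q_def by eventually_elim simp
  qed
  have key: "\<forall>\<^sub>F T in sequentially. real (n T) * real T powr (1 + \<delta> / 2) \<le> C * \<tau> T powr \<theta> \<and> real (n T) \<le> C * real T powr (\<theta> / 4)"
    using q1 eventually_ge_at_top[of 1]
  proof eventually_elim
    case (elim T)
    have T: "0 < real T" using elim by simp
    have "q T powr ((\<theta> - \<delta>) / 2) \<le> q T powr (\<theta> / 2)" using elim pos by (intro powr_mono) auto
    then have "C * (q T powr ((\<theta> - \<delta>) / 2) / real T powr (1 + \<delta>)) \<le> C * (q T powr (\<theta> / 2) / real T powr (1 + \<delta>))"
      using pos by (intro mult_left_mono divide_right_mono) auto
    then have nq: "real (n T) \<le> C * (q T powr (\<theta> / 2) / real T powr (1 + \<delta>))"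
      using n[OF elim(2)] unfolding q_def by linarith
    have "\<tau> T powr \<theta> = q T powr (\<theta> / 2) * real T powr (- \<delta> / 2)"
      using qpos[OF elim(2)] \<theta> T by (simp add: \<tau>_def \<eta>_def powr_mult powr_powr powr_half_sqrt[symmetric])
    moreover have "real T powr (1 + \<delta> / 2) = real T powr (1 + \<delta>) * real T powr (- \<delta> / 2)"
      by (simp add: add.commute flip: powr_add)
    moreover have "real (n T) * real T powr (1 + \<delta>) \<le> C * q T powr (\<theta> / 2)"
      using nq T by (simp add: field_simps)
    then have "real (n T) * real T powr (1 + \<delta>) * real T powr (- \<delta> / 2) \<le> C * q T powr (\<theta> / 2) * real T powr (- \<delta> / 2)"
      by (rule mult_right_mono) simp
    ultimately have 1: "real (n T) * real T powr (1 + \<delta> / 2) \<le> C * \<tau> T powr \<theta>" by (simp only: mult.assoc)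
    have "q T powr (\<theta> / 2) \<le> (real T powr (1/2)) powr (\<theta> / 2)"
      using qpos[OF elim(2)] \<theta> by (intro powr_mono2) (auto simp: q_def)
    then have "q T powr (\<theta> / 2) \<le> real T powr (\<theta> / 4)" by (simp add: powr_powr)
    moreover have "1 \<le> real T powr (1 + \<delta>)" using elim pos by (intro ge_one_powr_ge_zero) auto
    ultimately have "q T powr (\<theta> / 2) / real T powr (1 + \<delta>) \<le> real T powr (\<theta> / 4) / 1" by (intro frac_le) auto
    then have "C * (q T powr (\<theta> / 2) / real T powr (1 + \<delta>)) \<le> C * real T powr (\<theta> / 4)"
      using pos by (intro mult_left_mono) auto
    then show ?case using 1 nq by linarith
  qed
  \<comment> \<open>The upper bound on \<open>n\<close> is read backwards: as \<open>n\<close> is at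
    least 1, it forces \<open>\<tau> powr \<theta>\<close> to be at least \<open>T\<close>. Hence
    \<open>\<tau>\<close> diverges and the truncation tail is small.\<close>
  have T_le: "\<forall>\<^sub>F T in sequentially. real T \<le> \<tau> T powr \<theta>"
  proof -
    have "\<forall>\<^sub>F T in sequentially. C * real T \<le> real T powr (1 + \<delta> / 2)" using pos by real_asymp
    then show ?thesis using key eventually_ge_at_top[of 1]
    proof eventually_elim
      case (elim T)
      have "1 * real T powr (1 + \<delta> / 2) \<le> real (n T) * real T powr (1 + \<delta> / 2)"
        using n1[OF elim(3)] by (intro mult_right_mono) auto
      then have "C * real T \<le> C * \<tau> T powr \<theta>" using elim by linarith
      then show ?case using pos by simp
    qed
  qed
  have root_le: "\<forall>\<^sub>F T in sequentially. real T powr (1 / \<theta>) \<le> \<tau> T"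
    using T_le eventually_ge_at_top[of 1]
  proof eventually_elim
    case (elim T)
    have "real T powr (1 / \<theta>) \<le> (\<tau> T powr \<theta>) powr (1 / \<theta>)" using elim \<theta> by (intro powr_mono2) auto
    also have "\<dots> = \<tau> T" using \<theta> \<tau>pos[OF elim(2)] by (simp add: powr_powr)
    finally show ?case .
  qed
  have lim: "filterlim \<tau> at_top sequentially"
  proof (rule filterlim_at_top_mono[OF _ root_le])
    show "filterlim (\<lambda>T. real T powr (1 / \<theta>)) at_top sequentially" using \<theta> by real_asymp
  qed
  have le: "\<forall>\<^sub>F T in sequentially. \<tau> T \<le> sqrt (real T * (a * real T powr - B)) * real T powr - \<eta> \<and> (\<tau> T)\<^sup>2 \<le> sqrt (real T) * real T powr - \<eta>"
    using eventually_ge_at_top[of 1]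
  proof eventually_elim
    case (elim T)
    have "sqrt (q T) \<le> sqrt (real T * (a * real T powr - B))" by (simp add: q_def)
    then have 1: "\<tau> T \<le> sqrt (real T * (a * real T powr - B)) * real T powr - \<eta>"
      unfolding \<tau>_def by (rule mult_right_mono) simp
    have "(\<tau> T)\<^sup>2 = q T * (real T powr - \<eta>)\<^sup>2" using qpos[OF elim] by (simp add: \<tau>_def power_mult_distrib)
    also have "(real T powr - \<eta>)\<^sup>2 = real T powr (- \<eta> + - \<eta>)" by (simp only: powr_add power2_eq_square)
    also have "q T * real T powr (- \<eta> + - \<eta>) \<le> real T powr (1/2) * real T powr - \<eta>"
      using qpos[OF elim] elim \<eta> by (intro mult_mono powr_mono) (auto simp: q_def)
    also have "\<dots> = sqrt (real T) * real T powr - \<eta>" by (simp add: powr_half_sqrt)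
    finally show ?case using 1 by simp
  qed
  have tail: "\<forall>\<^sub>F T in sequentially. \<tau> T powr (1 - \<theta>) \<le> 1 / sqrt (real T)"
    using root_le eventually_ge_at_top[of 1]
  proof eventually_elim
    case (elim T)
    have "\<tau> T powr (1 - \<theta>) \<le> (real T powr (1 / \<theta>)) powr (1 - \<theta>)" using elim \<theta> by (intro powr_mono2') auto
    also have "\<dots> = real T powr (1 / \<theta> * (1 - \<theta>))" by (simp add: powr_powr)
    \<comment> \<open>\<open>1 / \<theta> - 1 \<le> - 3 / 4\<close>, by
      \<open>\<theta> > 4\<close>.\<close>
    also have "\<dots> \<le> real T powr - (1 / 2)"
    proof (rule powr_mono)
      have "1 / \<theta> * (1 - \<theta>) = 1 / \<theta> - 1" using \<theta> by (simp add: field_simps)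
      moreover have "1 / \<theta> \<le> 1 / 4" using \<theta> by (intro divide_left_mono) auto
      ultimately show "1 / \<theta> * (1 - \<theta>) \<le> - (1 / 2)" by linarith
    qed (use elim in simp)
    also have "\<dots> = 1 / sqrt (real T)" by (simp only: powr_minus powr_half_sqrt[OF of_nat_0_le_iff] inverse_eq_divide)
    finally show ?case .
  qed
  have prod: "(\<lambda>T. real (n T) * real T * \<tau> T powr - \<theta>) \<longlonglongrightarrow> 0"
  proof (rule tendsto_sandwich[OF _ _ tendsto_const])
    show "(\<lambda>T. C * real T powr - (\<delta> / 2)) \<longlonglongrightarrow> 0" using pos by real_asymp
    show "\<forall>\<^sub>F T in sequentially. real (n T) * real T * \<tau> T powr - \<theta> \<le> C * real T powr - (\<delta> / 2)"
      using key eventually_ge_at_top[of 1]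
    proof eventually_elim
      case (elim T)
      have T: "0 < real T" using elim by simp
      have \<tau>: "0 < \<tau> T powr \<theta>" using \<tau>pos[OF elim(2)] by simp
      have "real (n T) * real T * real T powr (\<delta> / 2) \<le> C * \<tau> T powr \<theta>"
        using elim T by (simp add: powr_add mult.assoc)
      then show ?case using T \<tau> by (simp add: powr_minus field_simps)
    qed
  qed auto
  have "\<forall>\<^sub>F T in sequentially. C * real T powr (\<theta> / 4) \<le> real T powr \<theta>" using pos \<theta> by real_asymp
  then have "\<forall>\<^sub>F T in sequentially. real (n T) \<le> real T powr \<theta>" using key by eventually_elim linarith
  then show ?thesis using \<eta> \<tau>pos lim le tail prod by blast
qed

section \<open>The grouped panel\<close>

lemma twice_cont_diff_bounds:
  assumes "twice_cont_diff g g' g''"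
  shows "\<exists>D L. \<forall>x\<in>{0..1}. \<bar>g x\<bar> \<le> D \<and> (\<forall>y\<in>{0..1}. \<bar>g x - g y\<bar> \<le> L * \<bar>x - y\<bar>)"
proof -
  have d: "(g has_real_derivative g' x) (at x within {0..1})" "(g' has_real_derivative g'' x) (at x within {0..1})"
    if "x \<in> {0..1}" for x
    using assms that by (auto simp: twice_cont_diff_def)
  have "continuous_on {0..1} g'" using d(2) by (rule DERIV_continuous_on)
  then have "bounded (g' ` {0..1})" by (intro compact_imp_bounded compact_continuous_image) auto
  then obtain L where L: "\<And>x. x \<in> {0..1} \<Longrightarrow> \<bar>g' x\<bar> \<le> L" unfolding bounded_iff by (metis imageI real_norm_def)
  have "continuous_on {0..1} g" using d(1) by (rule DERIV_continuous_on)
  then have "bounded (g ` {0..1})" by (intro compact_imp_bounded compact_continuous_image) auto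
  then obtain D where D: "\<And>x. x \<in> {0..1} \<Longrightarrow> \<bar>g x\<bar> \<le> D" unfolding bounded_iff by (metis imageI real_norm_def)
  have "\<bar>g x - g y\<bar> \<le> L * \<bar>x - y\<bar>" if "x \<in> {0..1}" "y \<in> {0..1}" for x y
    using field_differentiable_bound[of "{0..1}" g g' L x y] d(1) L that by simp
  then show ?thesis using D by blast
qed

lemma cond_C6_bounds:
  assumes "cond_C6 K0 g"
  shows "\<exists>D L. \<forall>k\<in>{1..K0}. \<forall>x\<in>{0..1}. \<bar>g k x\<bar> \<le> D \<and> (\<forall>y\<in>{0..1}. \<bar>g k x - g k y\<bar> \<le> L * \<bar>x - y\<bar>)"
proof -
  have "\<exists>D L. \<forall>x\<in>{0..1}. \<bar>g k x\<bar> \<le> D \<and> (\<forall>y\<in>{0..1}. \<bar>g k x - g k y\<bar> \<le> L * \<bar>x - y\<bar>)" if "k \<in> {1..K0}" for k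
    using assms that twice_cont_diff_bounds unfolding cond_C6_def by blast
  then obtain D L where DL: "\<And>k x. k \<in> {1..K0} \<Longrightarrow> x \<in> {0..1} \<Longrightarrow>
    \<bar>g k x\<bar> \<le> D k \<and> (\<forall>y\<in>{0..1}. \<bar>g k x - g k y\<bar> \<le> L k * \<bar>x - y\<bar>)" by metis
  show ?thesis
  proof (rule exI[of _ "\<Sum>k=1..K0. \<bar>D k\<bar>"], rule exI[of _ "\<Sum>k=1..K0. \<bar>L k\<bar>"], intro ballI conjI)
    fix k x assume k: "k \<in> {1..K0}" and x: "x \<in> {0..1::real}"
    have D: "\<bar>D k\<bar> \<le> (\<Sum>k=1..K0. \<bar>D k\<bar>)" and L: "\<bar>L k\<bar> \<le> (\<Sum>k=1..K0. \<bar>L k\<bar>)"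
      by (rule member_le_sum[OF k], simp, simp)+
    show "\<bar>g k x\<bar> \<le> (\<Sum>k=1..K0. \<bar>D k\<bar>)" using DL[OF k x] D by linarith
    fix y assume y: "y \<in> {0..1::real}"
    have "\<bar>g k x - g k y\<bar> \<le> L k * \<bar>x - y\<bar>" using DL[OF k x] y by blast
    also have "\<dots> \<le> (\<Sum>k=1..K0. \<bar>L k\<bar>) * \<bar>x - y\<bar>" using L by (intro mult_right_mono) auto
    finally show "\<bar>g k x - g k y\<bar> \<le> (\<Sum>k=1..K0. \<bar>L k\<bar>) * \<bar>x - y\<bar>" .
  qed
qed

text \<open>The conditions of the model with all constants named and the truncation level fixed, so
  that they can be compared with each other and with the constants of the abstract argument.\<close>

locale grouped_panel = kernel K KM LK k0 d u1
  for K :: "real \<Rightarrow> real" and KM LK k0 d u1 +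
  fixes M :: "nat \<Rightarrow> 'a measure" and n :: "nat \<Rightarrow> nat"
    and Y X \<epsilon> :: "nat \<Rightarrow> nat \<Rightarrow> nat \<Rightarrow> 'a \<Rightarrow> real"
    and \<alpha> \<gamma> :: "nat \<Rightarrow> nat \<Rightarrow> 'a \<Rightarrow> real" and m f :: "nat \<Rightarrow> nat \<Rightarrow> real \<Rightarrow> real"
    and \<sigma>2 :: "nat \<Rightarrow> nat \<Rightarrow> real" and K0 :: nat and G :: "nat \<Rightarrow> nat \<Rightarrow> nat set"
    and g :: "nat \<Rightarrow> real \<Rightarrow> real" and grid :: "nat \<Rightarrow> (real \<times> real) set" and hmin hmax \<tau> :: "nat \<Rightarrow> real"
    and \<theta> \<eta> Cm \<rho> a A b B \<beta> CH clow Cf Cj \<sigma>low C\<sigma> C\<epsilon> Gb Lg :: real and ls :: nat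
  assumes model: "panel_model M n Y X \<epsilon> \<alpha> \<gamma> m" and groups: "group_structure n m K0 G g"
    and multiscale: "multiscale_grid grid hmin hmax"
    and grid_card: "1 \<le> T \<Longrightarrow> real (card (grid T)) \<le> CH * real T powr \<beta>"
    and indep_panel: "1 \<le> T \<Longrightarrow> prob_space.indep_vars (M T) (\<lambda>_. PiM {1..} (\<lambda>_. borel))
        (\<lambda>i w. \<lambda>t\<in>{1..}. (X T i t w, \<epsilon> T i t w)) {1..n T}"
    and mixing: "1 \<le> T \<Longrightarrow> i \<in> {1..n T} \<Longrightarrow>
      mixing_coeff (M T) borel (\<lambda>t w. (X T i t w, \<epsilon> T i t w)) l \<le> Cm * \<rho> ^ l"
    and mixing_rate: "0 \<le> Cm" "0 < \<rho>" "\<rho> < 1"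
    and X_density: "1 \<le> T \<Longrightarrow> i \<in> {1..n T} \<Longrightarrow> 1 \<le> t \<Longrightarrow> distributed (M T) lborel (X T i t) (\<lambda>x. ennreal (f T i x))"
    and f_zero: "1 \<le> T \<Longrightarrow> i \<in> {1..n T} \<Longrightarrow> x \<notin> {0..1} \<Longrightarrow> f T i x = 0"
    and f_bounds: "1 \<le> T \<Longrightarrow> i \<in> {1..n T} \<Longrightarrow> x \<in> {0..1} \<Longrightarrow> clow \<le> f T i x"
      "1 \<le> T \<Longrightarrow> i \<in> {1..n T} \<Longrightarrow> x \<in> {0..1} \<Longrightarrow> f T i x \<le> Cf"
    and XX_density: "1 \<le> T \<Longrightarrow> i \<in> {1..n T} \<Longrightarrow> 1 \<le> l \<Longrightarrow> \<exists>fl :: real \<times> real \<Rightarrow> real. (\<forall>z. fl z \<le> Cj) \<and>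
      (\<forall>t\<ge>1. distributed (M T) (lborel \<Otimes>\<^sub>M lborel) (\<lambda>w. (X T i t w, X T i (t + l) w)) (\<lambda>z. ennreal (fl z)))"
    and \<epsilon>2: "1 \<le> T \<Longrightarrow> i \<in> {1..n T} \<Longrightarrow> 1 \<le> t \<Longrightarrow> (\<integral>w. (\<epsilon> T i t w)\<^sup>2 \<partial>M T) = \<sigma>2 T i"
      "1 \<le> T \<Longrightarrow> i \<in> {1..n T} \<Longrightarrow> 1 \<le> t \<Longrightarrow> AE w in M T. nn_cond_exp (M T) (sigma_of (M T) (X T i t))
           (\<lambda>w. ennreal ((\<epsilon> T i t w)\<^sup>2)) w = ennreal (\<sigma>2 T i)"
    and \<sigma>2_bounds: "1 \<le> T \<Longrightarrow> i \<in> {1..n T} \<Longrightarrow> \<sigma>low \<le> \<sigma>2 T i" "1 \<le> T \<Longrightarrow> i \<in> {1..n T} \<Longrightarrow> \<sigma>2 T i \<le> C\<sigma>"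
    and C4: "cond_C4 K0 G f \<sigma>2" and \<theta>: "4 < \<theta>"
    and \<epsilon>\<theta>: "1 \<le> T \<Longrightarrow> i \<in> {1..n T} \<Longrightarrow> 1 \<le> t \<Longrightarrow> AE w in M T. nn_cond_exp (M T) (sigma_of (M T) (X T i t))
           (\<lambda>w. ennreal (\<bar>\<epsilon> T i t w\<bar> powr \<theta>)) w \<le> ennreal C\<epsilon>"
    and \<epsilon>\<epsilon>: "1 \<le> T \<Longrightarrow> i \<in> {1..n T} \<Longrightarrow> 1 \<le> t \<Longrightarrow> 1 \<le> s \<Longrightarrow> \<bar>int s - int t\<bar> \<ge> int ls \<Longrightarrow>
      AE w in M T. nn_cond_exp (M T) (sigma_of (M T) (\<lambda>w. (X T i t w, X T i s w)))
              (\<lambda>w. ennreal \<bar>\<epsilon> T i t w * \<epsilon> T i s w\<bar>) w \<le> ennreal C\<epsilon>"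
    and g_bounds: "k \<in> {1..K0} \<Longrightarrow> x \<in> {0..1} \<Longrightarrow> \<bar>g k x\<bar> \<le> Gb"
      "k \<in> {1..K0} \<Longrightarrow> x \<in> {0..1} \<Longrightarrow> y \<in> {0..1} \<Longrightarrow> \<bar>g k x - g k y\<bar> \<le> Lg * \<bar>x - y\<bar>"
    and g_distinct: "k \<in> {1..K0} \<Longrightarrow> k' \<in> {k<..K0} \<Longrightarrow> \<exists>x\<in>{0..1}. g k x \<noteq> g k' x"
    and const_bounds: "0 < clow" "0 \<le> Cf" "0 \<le> Cj" "0 < \<sigma>low" "0 \<le> C\<sigma>" "0 \<le> C\<epsilon>" "0 \<le> Gb" "0 \<le> Lg" "1 \<le> ls" "0 < \<eta>"
    and h_eq: "1 \<le> T \<Longrightarrow> hmin T = a * real T powr - B" "1 \<le> T \<Longrightarrow> hmax T = A * real T powr - b"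
    and h_consts: "0 < a" "0 < A" "0 < b" "B < 1" "b \<le> B"
    and \<tau>: "\<And>T. 1 \<le> T \<Longrightarrow> 0 < \<tau> T" "filterlim \<tau> at_top sequentially"
      "\<forall>\<^sub>F T in sequentially. \<tau> T \<le> sqrt (real T * (a * real T powr - B)) * real T powr - \<eta> \<and> (\<tau> T)\<^sup>2 \<le> sqrt (real T) * real T powr - \<eta>"
      "\<forall>\<^sub>F T in sequentially. \<tau> T powr (1 - \<theta>) \<le> 1 / sqrt (real T)"
      "(\<lambda>T. real (n T) * real T * \<tau> T powr - \<theta>) \<longlonglongrightarrow> 0"
    and n_powr: "\<forall>\<^sub>F T in sequentially. real (n T) \<le> real T powr \<theta>"
begin

text \<open>
  The regression functions are frozen outside the unit interval, where \<open>m T i\<close> is arbitrary.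
\<close>

definition mu :: "nat \<Rightarrow> nat \<Rightarrow> real \<Rightarrow> real" where
  "mu T i y = (if 1 \<le> T \<and> i \<in> {1..n T} then m T i (max 0 (min 1 y)) else 0)"

lemma model_facts:
  assumes "1 \<le> T"
  shows "prob_space (M T)" "2 \<le> n T"
    "i \<in> {1..n T} \<Longrightarrow> 1 \<le> t \<Longrightarrow> X T i t \<in> borel_measurable (M T)"
    "i \<in> {1..n T} \<Longrightarrow> 1 \<le> t \<Longrightarrow> Y T i t \<in> borel_measurable (M T)"
    "i \<in> {1..n T} \<Longrightarrow> 1 \<le> t \<Longrightarrow> \<epsilon> T i t \<in> borel_measurable (M T)"
    "i \<in> {1..n T} \<Longrightarrow> 1 \<le> t \<Longrightarrow> integrable (M T) (\<epsilon> T i t)"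
    "i \<in> {1..n T} \<Longrightarrow> 1 \<le> t \<Longrightarrow> AE w in M T. real_cond_exp (M T) (sigma_of (M T) (X T i t)) (\<epsilon> T i t) w = 0"
    "i \<in> {1..n T} \<Longrightarrow> 1 \<le> t \<Longrightarrow> (\<integral>w. m T i (X T i t w) \<partial>M T) = 0"
    "i \<in> {1..n T} \<Longrightarrow> 1 \<le> t \<Longrightarrow> w \<in> space (M T) \<Longrightarrow> Y T i t w = m T i (X T i t w) + \<alpha> T i w + \<gamma> T t w + \<epsilon> T i t w"
    "i \<in> {1..n T} \<Longrightarrow> 1 \<le> t \<Longrightarrow> integrable (M T) (\<lambda>w. m T i (X T i t w))"
  using model assms unfolding panel_model_def by (blast dest: borel_measurable_integrable)+

lemma group_of:
  assumes "1 \<le> T" "i \<in> {1..n T}"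
  obtains k where "k \<in> {1..K0}" "i \<in> G T k" "\<And>x. x \<in> {0..1} \<Longrightarrow> m T i x = g k x"
proof -
  have "i \<in> (\<Union>k\<in>{1..K0}. G T k)" using groups assms unfolding group_structure_def by blast
  then obtain k where "k \<in> {1..K0}" "i \<in> G T k" by blast
  then show ?thesis using that groups assms unfolding group_structure_def by blast
qed

lemma group_member:
  assumes "1 \<le> T" "k \<in> {1..K0}" "i \<in> G T k"
  shows "i \<in> {1..n T}" "x \<in> {0..1} \<Longrightarrow> m T i x = g k x"
proof -
  have *: "(\<Union>k\<in>{1..K0}. G T k) = {1..n T}" "\<forall>k\<in>{1..K0}. \<forall>i\<in>G T k. \<forall>x\<in>{0..1}. m T i x = g k x"
    using groups assms(1) unfolding group_structure_def by blast+
  show "i \<in> {1..n T}" using *(1) assms(2,3) by blast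
  show "x \<in> {0..1} \<Longrightarrow> m T i x = g k x" using *(2) assms(2,3) by blast
qed

lemma clamp: "max 0 (min 1 y) \<in> {0..1::real}" by simp

lemma mu_eq_m: "1 \<le> T \<Longrightarrow> i \<in> {1..n T} \<Longrightarrow> x \<in> {0..1} \<Longrightarrow> mu T i x = m T i x"
  by (simp add: mu_def)

lemma mu_bound: "\<bar>mu T i x\<bar> \<le> Gb"
proof (cases "1 \<le> T \<and> i \<in> {1..n T}")
  case True
  then obtain k where "k \<in> {1..K0}" "\<And>x. x \<in> {0..1} \<Longrightarrow> m T i x = g k x" using group_of by metis
  then show ?thesis using True g_bounds(1)[OF _ clamp] clamp by (simp add: mu_def)
qed (auto simp: mu_def const_bounds)

lemma mu_lipschitz: "\<bar>mu T i x - mu T i y\<bar> \<le> Lg * \<bar>x - y\<bar>"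
proof (cases "1 \<le> T \<and> i \<in> {1..n T}")
  case True
  then obtain k where k: "k \<in> {1..K0}" "\<And>x. x \<in> {0..1} \<Longrightarrow> m T i x = g k x" using group_of by metis
  have "mu T i x - mu T i y = g k (max 0 (min 1 x)) - g k (max 0 (min 1 y))"
    using True k(2)[OF clamp] by (simp add: mu_def)
  also have "\<bar>\<dots>\<bar> \<le> Lg * \<bar>max 0 (min 1 x) - max 0 (min 1 y)\<bar>" by (rule g_bounds(2)[OF k(1) clamp clamp])
  also have "\<dots> \<le> Lg * \<bar>x - y\<bar>" using const_bounds(8) by (intro mult_left_mono) auto
  finally show ?thesis .
qed (auto simp: mu_def const_bounds)

lemma mu_measurable: "mu T i \<in> borel_measurable borel"
  using mu_lipschitz by (rule lipschitz_measurable)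

lemma AE_X:
  assumes "1 \<le> T" "i \<in> {1..n T}" "1 \<le> t"
  shows "AE w in M T. X T i t w \<in> {0..1}"
  by (rule prob_space.distributed_AE_support[OF model_facts(1)[OF assms(1)] X_density[OF assms] f_zero[OF assms(1,2)]])

lemma mu_centred:
  assumes "1 \<le> T" "i \<in> {1..n T}" "1 \<le> t"
  shows "(\<integral>w. mu T i (X T i t w) \<partial>M T) = 0"
proof -
  note [measurable] = model_facts(3)[OF assms] mu_measurable
  have "(\<integral>w. mu T i (X T i t w) \<partial>M T) = (\<integral>w. m T i (X T i t w) \<partial>M T)"
  proof (rule integral_cong_AE)
    show "(\<lambda>w. m T i (X T i t w)) \<in> borel_measurable (M T)" using model_facts(10)[OF assms] by blast
    show "AE w in M T. mu T i (X T i t w) = m T i (X T i t w)"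
      using AE_X[OF assms] by eventually_elim (rule mu_eq_m[OF assms(1,2)])
  qed measurable
  then show ?thesis by (simp only: model_facts(8)[OF assms])
qed

lemma f_le: "1 \<le> T \<Longrightarrow> i \<in> {1..n T} \<Longrightarrow> f T i x \<le> Cf"
  using f_bounds(2) f_zero const_bounds(2) by (cases "x \<in> {0..1}") auto

lemma X_window:
  assumes T: "1 \<le> T" "i \<in> {1..n T}" "1 \<le> t" and h: "0 < h"
  shows "(\<integral>w. indicator {x - h..x + h} (X T i t w) \<partial>M T) \<le> Cf * (2 * h)"
  by (rule prob_space.expectation_indicator_le_density[OF model_facts(1)[OF T(1)] X_density[OF T]])
    (use h f_le[OF T(1,2)] const_bounds in auto)

text \<open>The joint density is given for a time and a later one. For \<open>s > t\<close> the
  coordinates are exchanged, which does not change membership in a square window.\<close>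

lemma XX_window:
  assumes T: "1 \<le> T" "i \<in> {1..n T}" "1 \<le> s" "1 \<le> t" "s \<noteq> t" and h: "0 < h"
  shows "(\<integral>w. indicator ({x - h..x + h} \<times> {x - h..x + h}) (X T i s w, X T i t w) \<partial>M T) \<le> Cj * (4 * h\<^sup>2)"
proof -
  interpret prob_space "M T" by (rule model_facts(1)[OF T(1)])
  have window: "expectation (\<lambda>w. indicator ({x - h..x + h} \<times> {x - h..x + h}) (X T i s w, X T i (s + l) w)) \<le> Cj * (4 * h\<^sup>2)"
    if l: "1 \<le> l" and s: "1 \<le> s" for s l
  proof -
    obtain fl :: "real \<times> real \<Rightarrow> real" where fl: "\<And>z. fl z \<le> Cj"
      "\<And>t. 1 \<le> t \<Longrightarrow> distributed (M T) (lborel \<Otimes>\<^sub>M lborel) (\<lambda>w. (X T i t w, X T i (t + l) w)) (\<lambda>z. ennreal (fl z))"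
      using XX_density[OF T(1,2) l] by blast
    show ?thesis
    proof (rule expectation_indicator_le_density[OF fl(2)[OF s]])
      show "emeasure (lborel \<Otimes>\<^sub>M lborel) ({x - h..x + h} \<times> {x - h..x + h}) = ennreal (4 * h\<^sup>2)"
        using h by (simp add: lborel.emeasure_pair_measure_Times ennreal_mult[symmetric] power2_eq_square)
    qed (use fl(1) const_bounds in auto)
  qed
  show ?thesis
  proof (cases "s < t")
    case True
    then show ?thesis using window[of "t - s" s] T by simp
  next
    case False
    have "(\<lambda>w. indicator ({x - h..x + h} \<times> {x - h..x + h}) (X T i s w, X T i t w) :: real) =
      (\<lambda>w. indicator ({x - h..x + h} \<times> {x - h..x + h}) (X T i t w, X T i (t + (s - t)) w))"
      using False by (auto simp: indicator_def)
    then show ?thesis using window[of "s - t" t] T False by simp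
  qed
qed

lemma \<epsilon>_powr:
  assumes T: "1 \<le> T" "i \<in> {1..n T}" "1 \<le> t" and D: "D \<in> sets borel"
  shows "integrable (M T) (\<lambda>w. indicator D (X T i t w) * \<bar>\<epsilon> T i t w\<bar> powr \<theta>)"
    "(\<integral>w. indicator D (X T i t w) * \<bar>\<epsilon> T i t w\<bar> powr \<theta> \<partial>M T) \<le> C\<epsilon> * (\<integral>w. indicator D (X T i t w) \<partial>M T)"
proof -
  interpret prob_space "M T" by (rule model_facts(1)[OF T(1)])
  note [measurable] = model_facts(3)[OF T] model_facts(5)[OF T]
  have m: "(\<lambda>w. \<bar>\<epsilon> T i t w\<bar> powr \<theta>) \<in> borel_measurable (M T)" by measurable
  note * = expectation_le_of_cond_exp_le[OF model_facts(3)[OF T] m D powr_ge_zero \<epsilon>\<theta>[OF T] const_bounds(6)]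
  show "integrable (M T) (\<lambda>w. indicator D (X T i t w) * \<bar>\<epsilon> T i t w\<bar> powr \<theta>)" by (rule *(1))
  show "expectation (\<lambda>w. indicator D (X T i t w) * \<bar>\<epsilon> T i t w\<bar> powr \<theta>) \<le> C\<epsilon> * expectation (\<lambda>w. indicator D (X T i t w))"
    by (rule *(2))
qed

lemma \<epsilon>_powr_UNIV:
  assumes T: "1 \<le> T" "i \<in> {1..n T}" "1 \<le> t"
  shows "integrable (M T) (\<lambda>w. \<bar>\<epsilon> T i t w\<bar> powr \<theta>)" "(\<integral>w. \<bar>\<epsilon> T i t w\<bar> powr \<theta> \<partial>M T) \<le> C\<epsilon>"
proof -
  interpret prob_space "M T" by (rule model_facts(1)[OF T(1)])
  show "integrable (M T) (\<lambda>w. \<bar>\<epsilon> T i t w\<bar> powr \<theta>)" "expectation (\<lambda>w. \<bar>\<epsilon> T i t w\<bar> powr \<theta>) \<le> C\<epsilon>"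
    using \<epsilon>_powr[OF T, of UNIV] by (simp_all add: prob_space)
qed

lemma \<epsilon>_tail:
  assumes T: "1 \<le> T" "i \<in> {1..n T}" "1 \<le> t" and D: "D \<in> sets borel"
  shows "(\<integral>w. indicator D (X T i t w) * \<bar>\<epsilon> T i t w - trunc (\<tau> T) (\<epsilon> T i t w)\<bar> \<partial>M T)
    \<le> \<tau> T powr (1 - \<theta>) * (C\<epsilon> * (\<integral>w. indicator D (X T i t w) \<partial>M T))"
proof -
  have "(\<integral>w. indicator D (X T i t w) * \<bar>\<epsilon> T i t w - trunc (\<tau> T) (\<epsilon> T i t w)\<bar> \<partial>M T)
    \<le> (\<integral>w. \<tau> T powr (1 - \<theta>) * (indicator D (X T i t w) * \<bar>\<epsilon> T i t w\<bar> powr \<theta>) \<partial>M T)"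
  proof (rule integral_mono')
    show "integrable (M T) (\<lambda>w. \<tau> T powr (1 - \<theta>) * (indicator D (X T i t w) * \<bar>\<epsilon> T i t w\<bar> powr \<theta>))"
      using \<epsilon>_powr(1)[OF T D] by simp
    show "indicator D (X T i t w) * \<bar>\<epsilon> T i t w - trunc (\<tau> T) (\<epsilon> T i t w)\<bar>
      \<le> \<tau> T powr (1 - \<theta>) * (indicator D (X T i t w) * \<bar>\<epsilon> T i t w\<bar> powr \<theta>)" for w
      using abs_sub_trunc_le[of \<theta> "\<tau> T" "\<epsilon> T i t w"] \<theta> \<tau>(1)[OF T(1)] by (simp add: indicator_def)
  qed (simp add: indicator_def)
  also have "\<dots> = \<tau> T powr (1 - \<theta>) * (\<integral>w. indicator D (X T i t w) * \<bar>\<epsilon> T i t w\<bar> powr \<theta> \<partial>M T)" by simp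
  also have "\<dots> \<le> \<tau> T powr (1 - \<theta>) * (C\<epsilon> * (\<integral>w. indicator D (X T i t w) \<partial>M T))"
    by (rule mult_left_mono[OF \<epsilon>_powr(2)[OF T D]]) simp
  finally show ?thesis .
qed

text \<open>Markov's inequality with the moment of order \<open>\<theta>\<close> for each of the
  \<open>n * T\<close> errors; the regressors lie in the unit interval almost surely and cost no
  probability.\<close>

lemma whp_truncation:
  "whp M (\<lambda>T w. \<forall>i\<in>{1..n T}. \<forall>t\<in>{1..T}. \<bar>\<epsilon> T i t w\<bar> \<le> \<tau> T \<and> X T i t w \<in> {0..1})"
proof -
  have "whp M (\<lambda>T w. \<forall>z\<in>{1..n T} \<times> {1..T}. \<bar>\<epsilon> T (fst z) (snd z) w\<bar> \<le> \<tau> T \<and> X T (fst z) (snd z) w \<in> {0..1})"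
  proof (rule whp_ball[where p = "\<lambda>T. C\<epsilon> * \<tau> T powr - \<theta>"])
    show "\<forall>\<^sub>F T in sequentially. prob_space (M T)"
      using eventually_ge_at_top[of 1] by eventually_elim (rule model_facts(1))
    show "\<forall>\<^sub>F T in sequentially. \<forall>z\<in>{1..n T} \<times> {1..T}.
      {w \<in> space (M T). \<not> (\<bar>\<epsilon> T (fst z) (snd z) w\<bar> \<le> \<tau> T \<and> X T (fst z) (snd z) w \<in> {0..1})} \<in> sets (M T) \<and>
      measure (M T) {w \<in> space (M T). \<not> (\<bar>\<epsilon> T (fst z) (snd z) w\<bar> \<le> \<tau> T \<and> X T (fst z) (snd z) w \<in> {0..1})} \<le> C\<epsilon> * \<tau> T powr - \<theta>"
      using eventually_ge_at_top[of 1]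
    proof eventually_elim
      case (elim T)
      interpret prob_space "M T" by (rule model_facts(1)[OF elim])
      show ?case
      proof safe
        fix i t assume "i \<in> {1..n T}" "t \<in> {1..T}"
        then have T: "1 \<le> T" "i \<in> {1..n T}" "1 \<le> t" using elim by auto
        note [measurable] = model_facts(3)[OF T] model_facts(5)[OF T]
        let ?E = "{w \<in> space (M T). \<not> (\<bar>\<epsilon> T i t w\<bar> \<le> \<tau> T \<and> X T i t w \<in> {0..1})}"
        have E: "?E \<in> events" by measurable
        then show "{w \<in> space (M T). \<not> (\<bar>\<epsilon> T (fst (i, t)) (snd (i, t)) w\<bar> \<le> \<tau> T \<and> X T (fst (i, t)) (snd (i, t)) w \<in> {0..1})} \<in> events"
          by simp
        have "prob ?E = expectation (indicator ?E)" using E by simp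
        also have "\<dots> \<le> expectation (\<lambda>w. \<tau> T powr - \<theta> * \<bar>\<epsilon> T i t w\<bar> powr \<theta>)"
        proof (rule integral_mono_AE)
          show "integrable (M T) (indicator ?E :: _ \<Rightarrow> real)" using E by (simp add: emeasure_eq_measure)
          show "integrable (M T) (\<lambda>w. \<tau> T powr - \<theta> * \<bar>\<epsilon> T i t w\<bar> powr \<theta>)" using \<epsilon>_powr_UNIV(1)[OF T] by simp
          show "AE w in M T. indicator ?E w \<le> \<tau> T powr - \<theta> * \<bar>\<epsilon> T i t w\<bar> powr \<theta>"
            using AE_X[OF T]
          proof eventually_elim
            case (elim w)
            show ?case
            proof (cases "w \<in> ?E")
              case True
              then have "\<tau> T \<le> \<bar>\<epsilon> T i t w\<bar>" using elim by auto
              then have "\<tau> T powr \<theta> \<le> \<bar>\<epsilon> T i t w\<bar> powr \<theta>" using \<theta> \<tau>(1)[OF T(1)] by (intro powr_mono2) auto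
              then have "\<tau> T powr - \<theta> * \<tau> T powr \<theta> \<le> \<tau> T powr - \<theta> * \<bar>\<epsilon> T i t w\<bar> powr \<theta>" by (rule mult_left_mono) simp
              moreover have "\<tau> T powr - \<theta> * \<tau> T powr \<theta> = 1" using \<tau>(1)[OF T(1)] by (simp flip: powr_add)
              ultimately show ?thesis using True by simp
            qed simp
          qed
        qed
        also have "\<dots> = \<tau> T powr - \<theta> * expectation (\<lambda>w. \<bar>\<epsilon> T i t w\<bar> powr \<theta>)" by simp
        also have "\<dots> \<le> \<tau> T powr - \<theta> * C\<epsilon>" by (rule mult_left_mono[OF \<epsilon>_powr_UNIV(2)[OF T]]) simp
        finally show "prob {w \<in> space (M T). \<not> (\<bar>\<epsilon> T (fst (i, t)) (snd (i, t)) w\<bar> \<le> \<tau> T \<and> X T (fst (i, t)) (snd (i, t)) w \<in> {0..1})} \<le> C\<epsilon> * \<tau> T powr - \<theta>"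
          by (simp add: mult.commute)
      qed
    qed
    have "(\<lambda>T. C\<epsilon> * (real (n T) * real T * \<tau> T powr - \<theta>)) \<longlonglongrightarrow> C\<epsilon> * 0" by (intro tendsto_mult tendsto_const \<tau>(5))
    then show "(\<lambda>T. real (card ({1..n T} \<times> {1..T})) * (C\<epsilon> * \<tau> T powr - \<theta>)) \<longlonglongrightarrow> 0"
      by (simp add: card_cartesian_product mult_ac)
  qed simp
  then show ?thesis by (rule whp_mono) auto
qed

end

lemma (in panel_estimation) m_star_cong:
  assumes T: "1 \<le> T" "i \<in> {1..n T}" "j \<in> {1..n T}"
    and law: "distr (M T) borel (X T i 1) = distr (M T) borel (X T j 1)" and \<mu>: "\<mu> T i = \<mu> T j"
  shows "m_star T i h x = m_star T j h x"
proof -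
  note [measurable] = X_meas[OF T(1,2) order_refl] X_meas[OF T(1,3) order_refl] \<mu>_meas
  have eq: "(\<integral>w. v (X T i 1 w) \<partial>M T) = (\<integral>w. v (X T j 1 w) \<partial>M T)" if "v \<in> borel_measurable borel" for v :: "real \<Rightarrow> real"
    using integral_distr[of "X T i 1" "M T" borel v, symmetric] integral_distr[of "X T j 1" "M T" borel v, symmetric]
      that X_meas[OF T(1,2) order_refl] X_meas[OF T(1,3) order_refl] by (simp only: law)
  have "S_mean T i l h x = S_mean T j l h x" for l unfolding S_mean_def by (rule eq) measurable
  moreover have "R_mean T i l h x = R_mean T j l h x" for l unfolding R_mean_def \<mu> by (rule eq) measurable
  ultimately show ?thesis by (simp only: m_star_def)
qed

section \<open>The grouped panel satisfies the assumptions of the abstract estimation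
  argument\<close>

context grouped_panel
begin

definition C1 where "C1 = 2 * Cf + 4 * Cj + (1 + C\<epsilon>) + 2 * (C\<sigma> * Cf) + 4 * (C\<epsilon> * Cj) + 2 * (C\<epsilon> * Cf)"

lemma C1_ge: "2 * Cf \<le> C1" "4 * Cj \<le> C1" "1 + C\<epsilon> \<le> C1" "2 * (C\<sigma> * Cf) \<le> C1" "4 * (C\<epsilon> * Cj) \<le> C1" "2 * (C\<epsilon> * Cf) \<le> C1"
proof -
  have "0 \<le> C\<sigma> * Cf" "0 \<le> C\<epsilon> * Cj" "0 \<le> C\<epsilon> * Cf" using const_bounds by auto
  then show "2 * Cf \<le> C1" "4 * Cj \<le> C1" "1 + C\<epsilon> \<le> C1" "2 * (C\<sigma> * Cf) \<le> C1" "4 * (C\<epsilon> * Cj) \<le> C1" "2 * (C\<epsilon> * Cf) \<le> C1"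
    using const_bounds unfolding C1_def by linarith+
qed

lemma grid_facts:
  assumes "1 \<le> T"
  shows "finite (grid T)" "(x, h) \<in> grid T \<Longrightarrow> x \<in> {0..1}" "(x, h) \<in> grid T \<Longrightarrow> h \<in> {hmin T..hmax T}"
  using multiscale assms unfolding multiscale_grid_def by blast+

lemma grid_near:
  assumes "x \<in> {0..1}"
  shows "\<exists>xs hs. (\<forall>\<^sub>F T in sequentially. (xs T, hs T) \<in> grid T) \<and>
    xs \<longlonglongrightarrow> x \<and> liminf (\<lambda>T. ereal (hs T / hmax T)) > 0"
  using multiscale assms unfolding multiscale_grid_def by blast

text \<open>The bandwidth limits are passed as formulas, because \<open>mixing_panel\<close> asks
  for the identities at every \<open>T\<close> while \<open>hmin\<close> and \<open>hmax\<close> are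
  known only for \<open>T \<ge> 1\<close>. The exponent bounding the growth of \<open>n\<close> is
  \<open>\<theta>\<close>.\<close>

sublocale mom: panel_moments M n X \<epsilon> "\<lambda>T. snd ` grid T" "\<lambda>T. a * real T powr - B" "\<lambda>T. A * real T powr - b"
  Cm \<rho> a A b B \<beta> CH \<theta> \<eta> K mu \<tau> KM LK Gb C1 \<sigma>low ls
proof (intro panel_moments.intro mixing_panel.intro panel_moments_axioms.intro)
  fix T :: nat assume T: "1 \<le> T"
  show "prob_space (M T)" by (rule model_facts(1)[OF T])
  show "2 \<le> n T" by (rule model_facts(2)[OF T])
  show "finite (snd ` grid T)" using grid_facts(1)[OF T] by simp
  show "snd ` grid T \<subseteq> {a * real T powr - B..A * real T powr - b}"
    using grid_facts(3)[OF T] h_eq[OF T] by force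
  have "real (card (snd ` grid T)) \<le> real (card (grid T))" using card_image_le[OF grid_facts(1)[OF T]] by simp
  then show "real (card (snd ` grid T)) \<le> CH * real T powr \<beta>" using grid_card[OF T] by linarith
next
  fix T i j assume T: "1 \<le> T" "i \<in> {1..n T}" and j: "j \<in> {1..n T} - {i}"
  interpret prob_space "M T" by (rule model_facts(1)[OF T(1)])
  show "indep_var (PiM {1..} (\<lambda>_. borel)) (\<lambda>w. \<lambda>t\<in>{1..}. (X T i t w, \<epsilon> T i t w))
    (PiM {1..} (\<lambda>_. borel)) (\<lambda>w. \<lambda>t\<in>{1..}. (X T j t w, \<epsilon> T j t w))"
    using indep_vars_pair[OF indep_panel[OF T(1)] T(2), of j] j by blast
next
  fix T i t l D1 D2 assume T: "1 \<le> T" "i \<in> {1..n T}" "1 \<le> t"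
    and D: "D1 \<in> events_of (M T) borel (\<lambda>t w. (X T i t w, \<epsilon> T i t w)) {1..t}"
      "D2 \<in> events_of (M T) borel (\<lambda>t w. (X T i t w, \<epsilon> T i t w)) {t + l..}"
  show "measure (M T) (D1 \<inter> D2) \<le> measure (M T) D1 * measure (M T) D2 + Cm * \<rho> ^ l"
    by (rule prob_space.mixing_coeff_le[OF model_facts(1)[OF T(1)] T(3) D mixing[OF T(1,2)]])
next
  fix T i t :: nat assume T: "1 \<le> T" "i \<in> {1..n T}" "1 \<le> t"
  interpret prob_space "M T" by (rule model_facts(1)[OF T(1)])
  note [measurable] = model_facts(3)[OF T] model_facts(5)[OF T]
  show "X T i t \<in> borel_measurable (M T)" "\<epsilon> T i t \<in> borel_measurable (M T)" by measurable
  show "(\<integral>w. mu T i (X T i t w) \<partial>M T) = 0" by (rule mu_centred[OF T])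
  have "distr (M T) lborel (X T i t) = distr (M T) lborel (X T i 1)"
    by (rule distributed_same_law[OF X_density[OF T] X_density[OF T(1,2) order_refl]])
  then show "distr (M T) borel (X T i t) = distr (M T) borel (X T i 1)"
    by (simp only: distr_cong[OF refl sets_lborel[symmetric] refl])
  have b: "\<bar>\<epsilon> T i t w ^ 4\<bar> \<le> 1 + \<bar>\<epsilon> T i t w\<bar> powr \<theta>" for w
    using pow4_le_powr[OF \<theta>, of "\<epsilon> T i t w"] by simp
  have i1: "integrable (M T) (\<lambda>w. 1 + \<bar>\<epsilon> T i t w\<bar> powr \<theta>)" using \<epsilon>_powr_UNIV(1)[OF T] by simp
  show i4: "integrable (M T) (\<lambda>w. \<epsilon> T i t w ^ 4)"
  proof (rule Bochner_Integration.integrable_bound[OF i1])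
    show "AE w in M T. norm (\<epsilon> T i t w ^ 4) \<le> norm (1 + \<bar>\<epsilon> T i t w\<bar> powr \<theta>)"
    proof (rule AE_I2)
      fix w show "norm (\<epsilon> T i t w ^ 4) \<le> norm (1 + \<bar>\<epsilon> T i t w\<bar> powr \<theta>)"
        using b[of w] by (simp only: real_norm_def)
    qed
  qed measurable
  have "(\<integral>w. \<epsilon> T i t w ^ 4 \<partial>M T) \<le> (\<integral>w. 1 + \<bar>\<epsilon> T i t w\<bar> powr \<theta> \<partial>M T)"
    by (rule integral_mono[OF i4 i1]) (rule pow4_le_powr[OF \<theta>])
  also have "\<dots> = 1 + (\<integral>w. \<bar>\<epsilon> T i t w\<bar> powr \<theta> \<partial>M T)" using \<epsilon>_powr_UNIV(1)[OF T] by (simp add: prob_space)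
  finally show "(\<integral>w. \<epsilon> T i t w ^ 4 \<partial>M T) \<le> C1" using \<epsilon>_powr_UNIV(2)[OF T] C1_ge(3) by linarith
  show "\<sigma>low \<le> (\<integral>w. (\<epsilon> T i t w)\<^sup>2 \<partial>M T)" using \<epsilon>2(1)[OF T] \<sigma>2_bounds(1)[OF T(1,2)] by simp
  show "(\<integral>w. f (X T i t w) * \<epsilon> T i t w \<partial>M T) = 0"
    if "f \<in> borel_measurable borel" "\<And>x. \<bar>f x\<bar> \<le> C" for f C
    by (rule integral_mult_eq_0_of_cond_exp[OF model_facts(3)[OF T] model_facts(5)[OF T] that(1) model_facts(6)[OF T] that(2) model_facts(7)[OF T]])
next
  fix T i t :: nat and h x :: real assume T: "1 \<le> T" "i \<in> {1..n T}" "1 \<le> t" and h: "0 < h"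
  interpret prob_space "M T" by (rule model_facts(1)[OF T(1)])
  note [measurable] = model_facts(3)[OF T] model_facts(5)[OF T]
  have le: "c * h \<le> C1 * h" if "c \<le> C1" for c by (rule mult_right_mono[OF that less_imp_le[OF h]])
  show "expectation (\<lambda>w. indicator {x - h..x + h} (X T i t w)) \<le> C1 * h"
    using X_window[OF T h, of x] le[OF C1_ge(1)] by linarith
  have "expectation (\<lambda>w. indicator {x - h..x + h} (X T i t w) * (\<epsilon> T i t w)\<^sup>2)
    \<le> C\<sigma> * expectation (\<lambda>w. indicator {x - h..x + h} (X T i t w))"
  proof (rule expectation_le_of_cond_exp_le(2)[OF model_facts(3)[OF T]])
    show "AE w in M T. nn_cond_exp (M T) (sigma_of (M T) (X T i t)) (\<lambda>w. ennreal ((\<epsilon> T i t w)\<^sup>2)) w \<le> ennreal C\<sigma>"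
      using \<epsilon>2(2)[OF T] by eventually_elim (use \<sigma>2_bounds(2)[OF T(1,2)] in \<open>simp add: ennreal_leI\<close>)
  qed (use const_bounds in auto)
  also have "\<dots> \<le> C\<sigma> * (Cf * (2 * h))" by (rule mult_left_mono[OF X_window[OF T h] const_bounds(5)])
  also have "\<dots> = 2 * (C\<sigma> * Cf) * h" by simp
  also have "\<dots> \<le> C1 * h" by (rule le[OF C1_ge(4)])
  finally show "expectation (\<lambda>w. indicator {x - h..x + h} (X T i t w) * (\<epsilon> T i t w)\<^sup>2) \<le> C1 * h" .
next
  fix T i s t :: nat and h x :: real assume T: "1 \<le> T" "i \<in> {1..n T}" "1 \<le> s" "1 \<le> t" and st: "s \<noteq> t" and h: "0 < h"
  have "(\<integral>w. indicator {x - h..x + h} (X T i s w) * indicator {x - h..x + h} (X T i t w) \<partial>M T) \<le> Cj * (4 * h\<^sup>2)"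
    using XX_window[OF T st h, of x] by (simp add: indicator_times)
  also have "\<dots> = 4 * Cj * h\<^sup>2" by simp
  also have "\<dots> \<le> C1 * h\<^sup>2" by (rule mult_right_mono[OF C1_ge(2)]) simp
  finally show "(\<integral>w. indicator {x - h..x + h} (X T i s w) * indicator {x - h..x + h} (X T i t w) \<partial>M T) \<le> C1 * h\<^sup>2" .
next
  fix T i s t :: nat and h x :: real assume T: "1 \<le> T" "i \<in> {1..n T}" "1 \<le> s" "1 \<le> t"
    and st: "int ls \<le> \<bar>int s - int t\<bar>" and h: "0 < h"
  interpret prob_space "M T" by (rule model_facts(1)[OF T(1)])
  note [measurable] = model_facts(3)[OF T(1,2,3)] model_facts(5)[OF T(1,2,3)] model_facts(3)[OF T(1,2,4)] model_facts(5)[OF T(1,2,4)]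
  let ?D = "{x - h..x + h} \<times> {x - h..x + h}"
  have ne: "s \<noteq> t" using st const_bounds(9) by auto
  have st': "int ls \<le> \<bar>int t - int s\<bar>" using st by linarith
  have "expectation (\<lambda>w. indicator ?D (X T i s w, X T i t w) * \<bar>\<epsilon> T i s w * \<epsilon> T i t w\<bar>)
    \<le> C\<epsilon> * expectation (\<lambda>w. indicator ?D (X T i s w, X T i t w))"
    by (rule expectation_le_of_cond_exp_le(2)[OF _ _ _ _ \<epsilon>\<epsilon>[OF T(1,2,3,4) st'] const_bounds(6)])
      (measurable, auto intro!: borel_closed closed_Times)
  also have "\<dots> \<le> C\<epsilon> * (Cj * (4 * h\<^sup>2))" by (rule mult_left_mono[OF XX_window[OF T ne h] const_bounds(6)])
  also have "\<dots> = 4 * (C\<epsilon> * Cj) * h\<^sup>2" by simp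
  also have "\<dots> \<le> C1 * h\<^sup>2" by (rule mult_right_mono[OF C1_ge(5)]) simp
  finally show "expectation (\<lambda>w. indicator {x - h..x + h} (X T i s w) * indicator {x - h..x + h} (X T i t w) * \<bar>\<epsilon> T i s w * \<epsilon> T i t w\<bar>) \<le> C1 * h\<^sup>2"
    by (simp add: indicator_times)
next
  show "\<forall>\<^sub>F T in sequentially. \<forall>i\<in>{1..n T}. \<forall>t\<ge>1. \<forall>h>0. \<forall>x.
    (\<integral>w. indicator {x - h..x + h} (X T i t w) * \<bar>\<epsilon> T i t w - trunc (\<tau> T) (\<epsilon> T i t w)\<bar> \<partial>M T) \<le> C1 * h / sqrt (real T)"
    using \<tau>(4) eventually_ge_at_top[of 1]
  proof eventually_elim
    case (elim T)
    show ?case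
    proof (intro ballI allI impI)
      fix i t :: nat and h x :: real assume i: "i \<in> {1..n T}" and t: "1 \<le> t" and h: "0 < h"
      note T = elim(2) i t
      have "C\<epsilon> * (\<integral>w. indicator {x - h..x + h} (X T i t w) \<partial>M T) \<le> C\<epsilon> * (Cf * (2 * h))"
        by (rule mult_left_mono[OF X_window[OF T h] const_bounds(6)])
      also have "\<dots> = 2 * (C\<epsilon> * Cf) * h" by simp
      also have "\<dots> \<le> C1 * h" by (rule mult_right_mono[OF C1_ge(6) less_imp_le[OF h]])
      finally have "\<tau> T powr (1 - \<theta>) * (C\<epsilon> * (\<integral>w. indicator {x - h..x + h} (X T i t w) \<partial>M T)) \<le> 1 / sqrt (real T) * (C1 * h)"
        using elim(1) const_bounds(6) by (rule_tac mult_mono) (auto intro!: mult_nonneg_nonneg integral_nonneg)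
      then show "(\<integral>w. indicator {x - h..x + h} (X T i t w) * \<bar>\<epsilon> T i t w - trunc (\<tau> T) (\<epsilon> T i t w)\<bar> \<partial>M T) \<le> C1 * h / sqrt (real T)"
        using \<epsilon>_tail[OF T, of "{x - h..x + h}"] by simp
    qed
  qed
  show "\<forall>\<^sub>F T in sequentially. \<forall>i\<in>{1..n T}. \<forall>t\<ge>1.
    (\<integral>w. \<bar>\<epsilon> T i t w - trunc (\<tau> T) (\<epsilon> T i t w)\<bar> \<partial>M T) \<le> C1 / sqrt (real T)"
    using \<tau>(4) eventually_ge_at_top[of 1]
  proof eventually_elim
    case (elim T)
    show ?case
    proof (intro ballI allI impI)
      fix i t :: nat assume i: "i \<in> {1..n T}" and t: "1 \<le> t"
      note T = elim(2) i t
      interpret prob_space "M T" by (rule model_facts(1)[OF T(1)])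
      have "\<tau> T powr (1 - \<theta>) * C\<epsilon> \<le> 1 / sqrt (real T) * C1"
        using elim(1) const_bounds(6) C1_ge(3) by (intro mult_mono) auto
      then show "expectation (\<lambda>w. \<bar>\<epsilon> T i t w - trunc (\<tau> T) (\<epsilon> T i t w)\<bar>) \<le> C1 / sqrt (real T)"
        using \<epsilon>_tail[OF T, of UNIV] by (simp add: prob_space)
    qed
  qed
  show "\<forall>\<^sub>F T in sequentially. snd ` grid T \<noteq> {}"
  proof -
    obtain xs hs where "\<forall>\<^sub>F T in sequentially. (xs T, hs T) \<in> grid T" using grid_near[of 0] by auto
    then show ?thesis by eventually_elim auto
  qed
qed (use mixing_rate h_consts n_powr const_bounds K_nonneg K_le K_zero K_lipschitz mu_measurable mu_bound mu_lipschitz \<tau> whp_truncation in \<open>auto simp: abs_of_nonneg\<close>)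

sublocale est: panel_estimation M n X \<epsilon> "\<lambda>T. snd ` grid T" "\<lambda>T. a * real T powr - B" "\<lambda>T. A * real T powr - b"
  Cm \<rho> a A b B \<beta> CH \<theta> \<eta> K mu \<tau> KM LK Gb C1 \<sigma>low ls k0 d u1 \<alpha> \<gamma> Y clow Lg
proof (intro panel_estimation.intro panel_estimation_axioms.intro mom.panel_moments_axioms kernel_axioms)
  fix T i and p q :: real assume T: "1 \<le> T" "i \<in> {1..n T}" and pq: "0 \<le> p" "p \<le> q" "q \<le> 1"
  show "clow * (q - p) \<le> (\<integral>w. indicator {p..q} (X T i 1 w) \<partial>M T)"
    by (rule prob_space.expectation_indicator_ge_density[OF model_facts(1)[OF T(1)] X_density[OF T order_refl]])
      (use pq f_bounds(1)[OF T] const_bounds in auto)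
next
  fix T j t :: nat and w assume T: "1 \<le> T" "j \<in> {1..n T}" "1 \<le> t" "w \<in> space (M T)" and X: "X T j t w \<in> {0..1}"
  show "Y T j t w = panel_moments.noise X \<epsilon> mu T j t w + \<alpha> T j w + \<gamma> T t w"
    using model_facts(9)[OF T] mu_eq_m[OF T(1,2) X]
    by (simp add: mom.noise_def)
qed (use const_bounds mu_lipschitz in auto)

end

lemma whp_finite_ball:
  assumes "finite I" "\<And>z. z \<in> I \<Longrightarrow> whp M (Q z)"
  shows "whp M (\<lambda>T w. \<forall>z\<in>I. Q z T w)"
  using assms
proof (induction I rule: finite_induct)
  case empty
  show ?case unfolding whp_def by (rule exI[of _ "\<lambda>_. {}"]) simp
next
  case (insert z I)
  have "whp M (\<lambda>T w. Q z T w \<and> (\<forall>z\<in>I. Q z T w))" by (rule whp_conj) (use insert in auto)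
  then show ?case by (rule whp_mono) simp
qed

section \<open>Measurability of the statistics\<close>

context
  fixes N :: "'a measure" and K :: "real \<Rightarrow> real" and X Y :: "nat \<Rightarrow> nat \<Rightarrow> 'a \<Rightarrow> real" and n T :: nat
  assumes K: "K \<in> borel_measurable borel"
    and X: "\<And>i t. i \<in> {1..n} \<Longrightarrow> t \<in> {1..T} \<Longrightarrow> X i t \<in> borel_measurable N"
    and Y: "\<And>i t. i \<in> {1..n} \<Longrightarrow> t \<in> {1..T} \<Longrightarrow> Y i t \<in> borel_measurable N"
begin

lemma Kh_measurable: "v \<in> borel_measurable N \<Longrightarrow> (\<lambda>w. Kh K h (v w)) \<in> borel_measurable N"
  unfolding Kh_def by (intro borel_measurable_divide measurable_compose[OF _ K] borel_measurable_const)

text \<open>The point \<open>x\<close> is allowed to be random, since the variance estimator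
  evaluates the fit at the observed regressors.\<close>

lemma S_loc_measurable:
  assumes "i \<in> {1..n}" "x \<in> borel_measurable N"
  shows "(\<lambda>w. S_loc K T (\<lambda>i t. X i t w) i l (x w) h) \<in> borel_measurable N"
  unfolding S_loc_def
  by (intro borel_measurable_divide borel_measurable_sum borel_measurable_times borel_measurable_power
      borel_measurable_diff Kh_measurable X assms borel_measurable_const)

lemma W_loc_measurable:
  assumes "i \<in> {1..n}" "t \<in> {1..T}" "x \<in> borel_measurable N"
  shows "(\<lambda>w. W_loc K T (\<lambda>i t. X i t w) i t (x w) h) \<in> borel_measurable N"
  unfolding W_loc_def
  by (intro borel_measurable_divide borel_measurable_times borel_measurable_diff Kh_measurable
      S_loc_measurable X assms borel_measurable_const)

lemma Y_star_measurable:
  assumes "i \<in> {1..n}" "t \<in> {1..T}"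
  shows "(\<lambda>w. Y_star n T (\<lambda>i t. Y i t w) i t) \<in> borel_measurable N"
  unfolding Y_star_def
  by (intro borel_measurable_divide borel_measurable_add borel_measurable_sum borel_measurable_diff
      Y assms borel_measurable_const) (use assms in auto)

lemma m_hat_measurable:
  assumes "i \<in> {1..n}" "x \<in> borel_measurable N"
  shows "(\<lambda>w. m_hat K n T (\<lambda>i t. X i t w) (\<lambda>i t. Y i t w) i h (x w)) \<in> borel_measurable N"
  unfolding m_hat_def
  by (intro borel_measurable_divide borel_measurable_sum borel_measurable_times
      W_loc_measurable Y_star_measurable assms)

lemma sigma2_hat_measurable:
  assumes "i \<in> {1..n}"
  shows "(\<lambda>w. sigma2_hat K n T (\<lambda>i t. X i t w) (\<lambda>i t. Y i t w) i h) \<in> borel_measurable N"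
  unfolding sigma2_hat_def
  by (intro borel_measurable_divide borel_measurable_sum borel_measurable_power borel_measurable_diff
      m_hat_measurable Y_star_measurable X assms borel_measurable_const)

lemma f_hat_measurable:
  assumes "i \<in> {1..n}"
  shows "(\<lambda>w. f_hat K T (\<lambda>i t. X i t w) i h x) \<in> borel_measurable N"
  unfolding f_hat_def
  by (intro borel_measurable_divide borel_measurable_sum Kh_measurable borel_measurable_diff X assms borel_measurable_const)

lemma psi_hat_measurable:
  assumes "i \<in> {1..n}" "j \<in> {1..n}"
  shows "(\<lambda>w. psi_hat K n T (\<lambda>i t. X i t w) (\<lambda>i t. Y i t w) i j x h) \<in> borel_measurable N"
proof -
  note [measurable] = m_hat_measurable[OF assms(1) borel_measurable_const] m_hat_measurable[OF assms(2) borel_measurable_const]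
    sigma2_hat_measurable[OF assms(1)] sigma2_hat_measurable[OF assms(2)] f_hat_measurable[OF assms(1)] f_hat_measurable[OF assms(2)]
  show ?thesis unfolding psi_hat_def nu_hat_def by measurable
qed

lemma d_hat_measurable:
  assumes "finite D" "i \<in> {1..n}" "j \<in> {1..n}"
  shows "(\<lambda>w. d_hat K D n T (\<lambda>i t. X i t w) (\<lambda>i t. Y i t w) i j) \<in> borel_measurable N"
  unfolding d_hat_def
proof (rule borel_measurable_Max[OF assms(1)])
  fix z :: "real \<times> real"
  show "(\<lambda>w. case z of (x, h) \<Rightarrow> \<bar>psi_hat K n T (\<lambda>i t. X i t w) (\<lambda>i t. Y i t w) i j x h\<bar> - lam (2 * h)) \<in> borel_measurable N"
    by (cases z) (simp only: prod.case, intro borel_measurable_diff borel_measurable_abs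
        psi_hat_measurable assms borel_measurable_const)
qed

end

section \<open>The statistics within and between groups\<close>

context grouped_panel
begin

abbreviation D :: "nat \<Rightarrow> 'a \<Rightarrow> nat \<Rightarrow> nat \<Rightarrow> real" where
  "D T w \<equiv> d_hat K (grid T) (n T) T (\<lambda>i t. X T i t w) (\<lambda>i t. Y T i t w)"

abbreviation within_bound where
  "within_bound C T w \<equiv> \<forall>k\<in>{1..K0}. \<forall>i\<in>G T k. \<forall>j\<in>G T k. \<bar>D T w i j\<bar> \<le> C * sqrt (ln (real T))"

abbreviation between_bound where
  "between_bound c T w \<equiv> \<forall>k\<in>{1..K0}. \<forall>k'\<in>{k<..K0}. \<forall>i\<in>G T k. \<forall>j\<in>G T k'. c * sqrt (real T * hmax T) \<le> D T w i j"

lemma rate_nonneg: "1 \<le> T \<Longrightarrow> 0 \<le> sqrt (real T * hmax T)"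
  unfolding h_eq(2) using h_consts(2) by (intro real_sqrt_ge_zero mult_nonneg_nonneg) auto

lemma eventually_prob_space: "\<forall>\<^sub>F T in sequentially. prob_space (M T)"
  using eventually_ge_at_top[of 1] by eventually_elim (rule model_facts(1))

lemma D_measurable:
  assumes T: "1 \<le> T" "i \<in> {1..n T}" "j \<in> {1..n T}"
  shows "(\<lambda>w. D T w i j) \<in> borel_measurable (M T)"
  by (rule d_hat_measurable[OF mom.K_meas model_facts(3)[OF T(1)] model_facts(4)[OF T(1)] grid_facts(1)[OF T(1)] T(2,3)]) auto

text \<open>Members of a group share regression function and density, so their population fits are
  identical and no bias appears. The bound is two-sided because boundedness in probability concerns
  absolute values, and the maximum over the grid is one of its members.\<close>

lemma same_group:
  "\<exists>C\<ge>0. whp M (within_bound C)"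
proof -
  obtain C where C: "0 \<le> C" "whp M (est.same_mean_bound C)"
    using est.same_mean_statistic by (elim exE conjE) (rule that)
  show ?thesis
  proof (intro exI[of _ C] conjI C(1) whp_mono[OF C(2)])
    show "\<forall>\<^sub>F T in sequentially. \<forall>w\<in>space (M T). est.same_mean_bound C T w \<longrightarrow>
      within_bound C T w"
      using mom.H_nonempty eventually_ge_at_top[of 1]
    proof eventually_elim
      case (elim T)
      show ?case
      proof (intro ballI impI)
        fix w k i j assume *: "est.same_mean_bound C T w"
          and k: "k \<in> {1..K0}" and ik: "i \<in> G T k" and jk: "j \<in> G T k"
        have i: "i \<in> {1..n T}" and j: "j \<in> {1..n T}"
          using group_member(1)[OF elim(2) k] ik jk by blast+
        have "f T i = f T j" using C4 elim(2) k ik jk unfolding cond_C4_def by blast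
        then have "distr (M T) lborel (X T i 1) = distr (M T) lborel (X T j 1)"
          using distributed_same_law[OF X_density[OF elim(2) i order_refl]] X_density[OF elim(2) j order_refl] by simp
        then have law: "distr (M T) borel (X T i 1) = distr (M T) borel (X T j 1)"
          by (simp only: distr_cong[OF refl sets_lborel[symmetric] refl])
        have "mu T i = mu T j"
        proof
          fix y
          show "mu T i y = mu T j y"
            using group_member(2)[OF elim(2) k ik clamp] group_member(2)[OF elim(2) k jk clamp] i j elim(2)
            by (simp add: mu_def)
        qed
        note eq = est.m_star_cong[OF elim(2) i j law this]
        have b: "\<bar>\<bar>est.psi T w i j x h\<bar> - lam (2 * h)\<bar> \<le> C * sqrt (ln (real T))" if "(x, h) \<in> grid T" for x h
        proof -
          have "h \<in> snd ` grid T" using that by force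
          from *[rule_format, OF i j this grid_facts(2)[OF elim(2) that] eq] show ?thesis .
        qed
        have "D T w i j \<in> (\<lambda>(x, h). \<bar>est.psi T w i j x h\<bar> - lam (2 * h)) ` grid T"
          unfolding d_hat_def by (rule Max_in) (use elim(1) grid_facts(1)[OF elim(2)] in auto)
        then show "\<bar>D T w i j\<bar> \<le> C * sqrt (ln (real T))" using b by auto
      qed
    qed
  qed
qed

text \<open>One grid point is enough, as the statistic is a maximum. The density of the grid
  supplies points tending to an \<open>x\<close> where the two functions differ, with bandwidths
  that keep a fixed fraction \<open>r\<close> of \<open>hmax\<close>; the choice depends on the
  groups only, hence is uniform over their members.\<close>

lemma pair_separated:
  assumes k: "k \<in> {1..K0}" "k' \<in> {k<..K0}"
  shows "\<exists>c>0. whp M (\<lambda>T w. \<forall>i\<in>G T k. \<forall>j\<in>G T k'. c * sqrt (real T * hmax T) \<le> D T w i j)"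
proof -
  have k': "k' \<in> {1..K0}" using k by auto
  obtain x where x: "x \<in> {0..1}" "g k x \<noteq> g k' x" using g_distinct[OF k] by blast
  define \<Delta> where "\<Delta> = \<bar>g k x - g k' x\<bar> / 2"
  have \<Delta>: "0 < \<Delta>" using x(2) by (simp add: \<Delta>_def)
  obtain xs hs where xs: "\<forall>\<^sub>F T in sequentially. (xs T, hs T) \<in> grid T" "xs \<longlonglongrightarrow> x"
    and hs: "liminf (\<lambda>T. ereal (hs T / hmax T)) > 0"
    using grid_near[OF x(1)] by blast
  obtain r where r: "0 < ereal r" "ereal r < liminf (\<lambda>T. ereal (hs T / hmax T))"
    using ereal_dense2[OF hs] by blast
  have r0: "0 < r" using r(1) by simp
  have hr: "\<forall>\<^sub>F T in sequentially. ereal r < ereal (hs T / hmax T)" by (rule less_LiminfD[OF r(2)])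
  obtain c C where c: "0 < c" and C: "whp M (est.separation_bound \<Delta> c C)"
    using est.separated_statistic[OF \<Delta>] by (elim exE conjE) (rule that)
  \<comment> \<open>Half of \<open>c * sqrt r\<close> is given up to absorb the term of order
    \<open>sqrt (ln T)\<close>.\<close>
  define c1 where "c1 = c * sqrt r / 2"
  have c1: "0 < c1" using c r0 by (simp add: c1_def)
  have "(\<lambda>T. 2 * (Lg * \<bar>xs T - x\<bar>)) \<longlonglongrightarrow> 2 * (Lg * \<bar>x - x\<bar>)" by (intro tendsto_intros xs(2))
  then have near: "\<forall>\<^sub>F T in sequentially. 2 * (Lg * \<bar>xs T - x\<bar>) < \<Delta>"
    by (rule order_tendstoD(2)) (use \<Delta> in simp)
  have big: "\<forall>\<^sub>F T in sequentially. C * sqrt (ln (real T)) \<le> c1 * sqrt (real T * (A * real T powr - b))"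
    using c1 h_consts by real_asymp
  show ?thesis
  proof (intro exI[of _ c1] conjI c1 whp_mono[OF C])
    show "\<forall>\<^sub>F T in sequentially. \<forall>w\<in>space (M T). est.separation_bound \<Delta> c C T w \<longrightarrow>
      (\<forall>i\<in>G T k. \<forall>j\<in>G T k'. c1 * sqrt (real T * hmax T) \<le> D T w i j)"
      using xs(1) hr near big eventually_ge_at_top[of 1]
    proof eventually_elim
      case (elim T)
      have xT: "xs T \<in> {0..1}" by (rule grid_facts(2)[OF elim(5,1)])
      have hmax: "hmax T = A * real T powr - b" "0 < hmax T" using h_eq(2)[OF elim(5)] h_consts elim(5) by auto
      have "r * hmax T \<le> hs T" using elim(2) hmax(2) by (simp add: field_simps)
      then have "real T * (r * hmax T) \<le> real T * hs T" by (rule mult_left_mono) simp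
      then have "sqrt (r * (real T * hmax T)) \<le> sqrt (real T * hs T)"
        by (simp only: mult.left_commute real_sqrt_le_iff)
      then have "sqrt r * sqrt (real T * hmax T) \<le> sqrt (real T * hs T)" by (simp only: real_sqrt_mult[symmetric])
      then have "c * (sqrt r * sqrt (real T * hmax T)) \<le> c * sqrt (real T * hs T)" using c by (intro mult_left_mono) auto
      moreover have "c * (sqrt r * sqrt (real T * hmax T)) = c1 * sqrt (real T * hmax T) + c1 * sqrt (real T * hmax T)"
        by (simp add: c1_def field_simps)
      ultimately have low: "c1 * sqrt (real T * hmax T) \<le> c * sqrt (real T * hs T) - C * sqrt (ln (real T))"
        using elim(4) unfolding hmax(1) by linarith
      have "\<bar>g k (xs T) - g k x\<bar> \<le> Lg * \<bar>xs T - x\<bar>" "\<bar>g k' (xs T) - g k' x\<bar> \<le> Lg * \<bar>xs T - x\<bar>"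
        by (rule g_bounds(2)[OF k(1) xT x(1)], rule g_bounds(2)[OF k' xT x(1)])
      moreover have "\<bar>g k x - g k' x\<bar> \<le> \<bar>g k (xs T) - g k x\<bar> + \<bar>g k (xs T) - g k' (xs T)\<bar> + \<bar>g k' (xs T) - g k' x\<bar>"
        by linarith
      \<comment> \<open>Half of the gap at \<open>x\<close> survives at \<open>xs T\<close>, since
        the two Lipschitz errors together are less than the other half.\<close>
      moreover have "s / 2 \<le> v" if "p \<le> u" "q \<le> u" "s \<le> p + v + q" "2 * u < s / 2" for p q s u v :: real
        using that by linarith
      ultimately have sep: "\<Delta> \<le> \<bar>g k (xs T) - g k' (xs T)\<bar>" using elim(3) unfolding \<Delta>_def by blast
      have hT: "hs T \<in> snd ` grid T" using elim(1) by force
      show ?case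
      proof (intro ballI impI)
        fix w i j assume *: "est.separation_bound \<Delta> c C T w"
          and ik: "i \<in> G T k" and jk: "j \<in> G T k'"
        have i: "i \<in> {1..n T}" and j: "j \<in> {1..n T}"
          by (rule group_member(1)[OF elim(5) k(1) ik], rule group_member(1)[OF elim(5) k' jk])
        have "mu T i (xs T) = g k (xs T)" "mu T j (xs T) = g k' (xs T)"
          using mu_eq_m[OF elim(5) _ xT] i j group_member(2)[OF elim(5) k(1) ik xT] group_member(2)[OF elim(5) k' jk xT] by simp_all
        then have "\<Delta> \<le> \<bar>mu T i (xs T) - mu T j (xs T)\<bar>" using sep by simp
        from *[rule_format, OF i j hT xT this] low
        have "c1 * sqrt (real T * hmax T) \<le> \<bar>est.psi T w i j (xs T) (hs T)\<bar> - lam (2 * hs T)" by linarith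
        also have "\<dots> \<le> D T w i j"
          unfolding d_hat_def by (rule Max_ge) (use elim(1) grid_facts(1)[OF elim(5)] in force)+
        finally show "c1 * sqrt (real T * hmax T) \<le> D T w i j" .
      qed
    qed
  qed
qed

lemma all_separated:
  "\<exists>c>0. whp M (between_bound c)"
proof -
  let ?I = "Sigma {1..K0} (\<lambda>k. {k<..K0})"
  let ?S = "\<lambda>z c T w. \<forall>i\<in>G T (fst z). \<forall>j\<in>G T (snd z). c * sqrt (real T * hmax T) \<le> D T w i j"
  have "\<forall>z\<in>?I. \<exists>c. 0 < c \<and> whp M (?S z c)"
  proof
    fix z assume z: "z \<in> ?I"
    show "\<exists>c. 0 < c \<and> whp M (?S z c)"
      by (rule pair_separated) (use z in auto)
  qed
  from bchoice[OF this] obtain c where cw: "\<forall>z\<in>?I. 0 < c z \<and> whp M (?S z (c z))" by (elim exE)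
  have c: "0 < c z" if "z \<in> ?I" for z by (rule conjunct1[OF bspec[OF cw that]])
  have w: "whp M (?S z (c z))" if "z \<in> ?I" for z by (rule conjunct2[OF bspec[OF cw that]])
  \<comment> \<open>A minimum over finitely many pairs of groups, so it does not depend on
    \<open>T\<close>; the inserted 1 keeps it defined when there is no pair.\<close>
  define c0 where "c0 = Min (insert 1 (c ` ?I))"
  have c0: "0 < c0" using c unfolding c0_def by (subst Min_gr_iff) auto
  have c0_le: "c0 \<le> c z" if "z \<in> ?I" for z unfolding c0_def using that by (intro Min_le) auto
  have fin: "finite ?I" by simp
  have "whp M (\<lambda>T w. \<forall>z\<in>?I. ?S z (c z) T w)"
    by (rule whp_finite_ball[OF fin w])
  then show ?thesis
  proof (intro exI[of _ c0] conjI c0, elim whp_mono)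
    show "\<forall>\<^sub>F T in sequentially. \<forall>w\<in>space (M T).
      (\<forall>z\<in>?I. \<forall>i\<in>G T (fst z). \<forall>j\<in>G T (snd z). c z * sqrt (real T * hmax T) \<le> D T w i j) \<longrightarrow>
      between_bound c0 T w"
      using eventually_ge_at_top[of 1]
    proof eventually_elim
      case (elim T)
      have h: "0 \<le> sqrt (real T * hmax T)" by (rule rate_nonneg[OF elim])
      show ?case
      proof (intro ballI impI)
        fix w k k' i j
        assume *: "\<forall>z\<in>?I. \<forall>i\<in>G T (fst z). \<forall>j\<in>G T (snd z). c z * sqrt (real T * hmax T) \<le> D T w i j"
          and k: "k \<in> {1..K0}" "k' \<in> {k<..K0}" and ij: "i \<in> G T k" "j \<in> G T k'"
        have z: "(k, k') \<in> ?I" using k by simp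
        have "c (k, k') * sqrt (real T * hmax T) \<le> D T w i j" using bspec[OF * z] ij by simp
        moreover have "c0 * sqrt (real T * hmax T) \<le> c (k, k') * sqrt (real T * hmax T)"
          by (rule mult_right_mono[OF c0_le[OF z] h])
        ultimately show "c0 * sqrt (real T * hmax T) \<le> D T w i j" by linarith
      qed
    qed
  qed
qed

lemma within_groups:
  "bigO_prob M (\<lambda>T w. Max {D T w i j | k i j. k \<in> {1..K0} \<and> i \<in> G T k \<and> j \<in> G T k})
     (\<lambda>T. sqrt (ln (real (n T)) + ln (real T)))"
proof -
  define P where "P T = {(i, j). \<exists>k\<in>{1..K0}. i \<in> G T k \<and> j \<in> G T k}" for T
  have set_eq: "{D T w i j | k i j. k \<in> {1..K0} \<and> i \<in> G T k \<and> j \<in> G T k} = (\<lambda>z. D T w (fst z) (snd z)) ` P T" for T w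
    by (force simp: P_def image_iff)
  have P_sub: "P T \<subseteq> {1..n T} \<times> {1..n T}" if "1 \<le> T" for T
    using group_member(1)[OF that] unfolding P_def by blast
  then have P_fin: "finite (P T)" if "1 \<le> T" for T using that finite_subset by blast
  \<comment> \<open>\<open>Max\<close> is meaningful only on a nonempty set. Single groups may be
    empty, but individual 1 belongs to one of them.\<close>
  have P_ne: "P T \<noteq> {}" if T: "1 \<le> T" for T
  proof -
    have "1 \<in> {1..n T}" using model_facts(2)[OF T] by simp
    then obtain k where "k \<in> {1..K0}" "1 \<in> G T k" using group_of[OF T] by metis
    then show ?thesis unfolding P_def by blast
  qed
  obtain C where C: "0 \<le> C" "whp M (within_bound C)"
    using same_group by blast
  show ?thesis unfolding bigO_prob_def set_eq
  proof (intro conjI allI impI)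
    show "\<forall>\<^sub>F T in sequentially. (\<lambda>w. Max ((\<lambda>z. D T w (fst z) (snd z)) ` P T)) \<in> borel_measurable (M T)"
      using eventually_ge_at_top[of 1]
    proof eventually_elim
      case (elim T)
      show ?case by (rule borel_measurable_Max[OF P_fin[OF elim]], rule D_measurable[OF elim]) (use P_sub[OF elim] in auto)
    qed
    fix e :: real assume e: "0 < e"
    have "(\<lambda>T. measure (M T) {w \<in> space (M T). \<bar>Max ((\<lambda>z. D T w (fst z) (snd z)) ` P T)\<bar> > C * sqrt (ln (real (n T)) + ln (real T))}) \<longlonglongrightarrow> 0"
    proof (rule whp_measure_tendsto_0[OF C(2) eventually_prob_space])
      show "\<forall>\<^sub>F T in sequentially. \<forall>w\<in>space (M T).
        within_bound C T w \<longrightarrow>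
        \<not> \<bar>Max ((\<lambda>z. D T w (fst z) (snd z)) ` P T)\<bar> > C * sqrt (ln (real (n T)) + ln (real T))"
        using eventually_ge_at_top[of 1]
      proof eventually_elim
        case (elim T)
        \<comment> \<open>The bound obtained is of order \<open>sqrt (ln T)\<close> because
          \<open>n\<close> is at most a power of \<open>T\<close>; adding \<open>ln n\<close> under
          the root only enlarges it.\<close>
        have "0 \<le> ln (real (n T))" using model_facts(2)[OF elim] by simp
        then have le: "C * sqrt (ln (real T)) \<le> C * sqrt (ln (real (n T)) + ln (real T))"
          using C(1) by (intro mult_left_mono) auto
        show ?case
        proof (intro ballI impI)
          fix w assume *: "within_bound C T w"
          have "Max ((\<lambda>z. D T w (fst z) (snd z)) ` P T) \<in> (\<lambda>z. D T w (fst z) (snd z)) ` P T"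
            by (rule Max_in) (use P_fin[OF elim] P_ne[OF elim] in auto)
          then have "\<bar>Max ((\<lambda>z. D T w (fst z) (snd z)) ` P T)\<bar> \<le> C * sqrt (ln (real T))"
          proof
            fix z assume z: "Max ((\<lambda>z. D T w (fst z) (snd z)) ` P T) = D T w (fst z) (snd z)" "z \<in> P T"
            then obtain k where k: "k \<in> {1..K0}" "fst z \<in> G T k" "snd z \<in> G T k" by (auto simp: P_def)
            show ?thesis unfolding z(1) by (rule *[rule_format, OF k])
          qed
          then show "\<not> \<bar>Max ((\<lambda>z. D T w (fst z) (snd z)) ` P T)\<bar> > C * sqrt (ln (real (n T)) + ln (real T))"
            using le by linarith
        qed
      qed
    qed
    from order_tendstoD(2)[OF this e]
    show "\<exists>C. \<forall>\<^sub>F T in sequentially. measure (M T) {w \<in> space (M T).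
      \<bar>Max ((\<lambda>z. D T w (fst z) (snd z)) ` P T)\<bar> > C * sqrt (ln (real (n T)) + ln (real T))} \<le> e"
      by (intro exI[of _ C]) (auto elim: eventually_mono)
  qed
qed

text \<open>The remainder \<open>R\<close> is the largest shortfall of a statistic below
  \<open>c0 * sqrt (T * hmax)\<close>, counted as nonpositive. With it the inequality holds at every
  sample point, and with high probability it is 0. The infimum lives in the extended reals so that
  an empty one is infinite.\<close>

lemma between_groups:
  "\<exists>c0>0. \<exists>R. smallo_prob M R (\<lambda>T. sqrt (real T * hmax T)) \<and>
     (\<forall>T\<ge>1. \<forall>w\<in>space (M T).
        (INF k\<in>{1..K0}. INF k'\<in>{k<..K0}. INF i\<in>G T k. INF j\<in>G T k'. ereal (D T w i j))
          \<ge> ereal (c0 * sqrt (real T * hmax T) + R T w))"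
proof -
  obtain c0 where c0: "0 < c0" and w: "whp M (between_bound c0)"
    using all_separated by blast
  define Q where "Q T = {(i, j). \<exists>k\<in>{1..K0}. \<exists>k'\<in>{k<..K0}. i \<in> G T k \<and> j \<in> G T k'}" for T
  \<comment> \<open>The pair \<open>(0, 0)\<close> is not a pair of individuals and contributes the value 0, so that the minimum
    is nonpositive, and also defined when there is only one group.\<close>
  define F where "F T w z = (if z = (0, 0) then 0 else D T w (fst z) (snd z) - c0 * sqrt (real T * hmax T))" for T w z
  define R where "R T w = Min (F T w ` insert (0, 0) (Q T))" for T w
  have Q_mem: "\<exists>k\<in>{1..K0}. \<exists>k'\<in>{k<..K0}. fst z \<in> G T k \<and> snd z \<in> G T k'" if "z \<in> Q T" for z T
    using that by (cases z) (simp add: Q_def)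
  have Q_sub: "Q T \<subseteq> {1..n T} \<times> {1..n T}" if "1 \<le> T" for T
  proof
    fix z assume "z \<in> Q T"
    then obtain k k' where k: "k \<in> {1..K0}" "k' \<in> {k<..K0}" "fst z \<in> G T k" "snd z \<in> G T k'" using Q_mem by blast
    then have "k' \<in> {1..K0}" by auto
    then show "z \<in> {1..n T} \<times> {1..n T}"
      using group_member(1)[OF that k(1,3)] group_member(1)[OF that _ k(4)] by (simp add: mem_Times_iff)
  qed
  then have Q_fin: "finite (Q T)" if "1 \<le> T" for T using that finite_subset by blast
  have "smallo_prob M R (\<lambda>T. sqrt (real T * hmax T))" unfolding smallo_prob_def
  proof (intro conjI allI impI)
    show "\<forall>\<^sub>F T in sequentially. R T \<in> borel_measurable (M T)"
      using eventually_ge_at_top[of 1]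
    proof eventually_elim
      case (elim T)
      have "(\<lambda>w. Min ((\<lambda>z. F T w z) ` insert (0, 0) (Q T))) \<in> borel_measurable (M T)"
      proof (rule borel_measurable_Min)
        fix z assume z: "z \<in> insert (0, 0) (Q T)"
        show "(\<lambda>w. F T w z) \<in> borel_measurable (M T)"
        proof (cases "z = (0, 0)")
          case False
          then have "fst z \<in> {1..n T}" "snd z \<in> {1..n T}" using z Q_sub[OF elim] by auto
          then show ?thesis using False unfolding F_def
            by (simp only: if_False) (intro borel_measurable_diff D_measurable[OF elim] borel_measurable_const)
        qed (simp add: F_def)
      qed (use Q_fin[OF elim] in simp)
      then show ?case unfolding R_def[abs_def] .
    qed
    fix e :: real assume e: "0 < e"
    show "(\<lambda>T. measure (M T) {w \<in> space (M T). \<bar>R T w\<bar> > e * sqrt (real T * hmax T)}) \<longlonglongrightarrow> 0"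
    proof (rule whp_measure_tendsto_0[OF w eventually_prob_space])
      show "\<forall>\<^sub>F T in sequentially. \<forall>w\<in>space (M T).
        between_bound c0 T w \<longrightarrow>
        \<not> \<bar>R T w\<bar> > e * sqrt (real T * hmax T)"
        using eventually_ge_at_top[of 1]
      proof eventually_elim
        case (elim T)
        have h: "0 \<le> e * sqrt (real T * hmax T)" using rate_nonneg[OF elim] e by (intro mult_nonneg_nonneg) auto
        show ?case
        proof (intro ballI impI)
          fix w assume *: "between_bound c0 T w"
          have "R T w = 0" unfolding R_def
          proof (rule Min_eqI)
            fix y assume "y \<in> F T w ` insert (0, 0) (Q T)"
            then obtain z where z: "z \<in> insert (0, 0) (Q T)" "y = F T w z" by blast
            show "0 \<le> y"
            proof (cases "z = (0, 0)")
              case False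
              then obtain k k' where k: "k \<in> {1..K0}" "k' \<in> {k<..K0}" "fst z \<in> G T k" "snd z \<in> G T k'"
                using z(1) Q_mem by blast
              show ?thesis using z(2) False *[rule_format, OF k] by (simp add: F_def)
            qed (use z(2) in \<open>simp add: F_def\<close>)
          next
            show "0 \<in> F T w ` insert (0, 0) (Q T)" by (rule image_eqI[of _ _ "(0, 0)"]) (auto simp: F_def)
          qed (use Q_fin[OF elim] in simp)
          then show "\<not> \<bar>R T w\<bar> > e * sqrt (real T * hmax T)" using h by simp
        qed
      qed
    qed
  qed
  moreover have "ereal (c0 * sqrt (real T * hmax T) + R T w) \<le>
    (INF k\<in>{1..K0}. INF k'\<in>{k<..K0}. INF i\<in>G T k. INF j\<in>G T k'. ereal (D T w i j))"
    if T: "1 \<le> T" for T w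
  proof (intro INF_greatest)
    fix k k' i j assume "k \<in> {1..K0}" "k' \<in> {k<..K0}" "i \<in> G T k" "j \<in> G T k'"
    then have z: "(i, j) \<in> Q T" unfolding Q_def by blast
    then have "(i, j) \<noteq> (0, 0)" using Q_sub[OF T] by auto
    moreover have "R T w \<le> F T w (i, j)" unfolding R_def using z Q_fin[OF T] by (intro Min_le) auto
    ultimately have "R T w \<le> D T w i j - c0 * sqrt (real T * hmax T)" unfolding F_def by (simp only: if_False fst_conv snd_conv)
    then show "ereal (c0 * sqrt (real T * hmax T) + R T w) \<le> ereal (D T w i j)" by simp
  qed
  ultimately show ?thesis using c0 by blast
qed

end

theorem theorem6p1:
  fixes M :: "nat \<Rightarrow> 'a measure"
    and n :: "nat \<Rightarrow> nat"
    and Y X \<epsilon> :: "nat \<Rightarrow> nat \<Rightarrow> nat \<Rightarrow> 'a \<Rightarrow> real"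
    and \<alpha> \<gamma> :: "nat \<Rightarrow> nat \<Rightarrow> 'a \<Rightarrow> real"
    and m f :: "nat \<Rightarrow> nat \<Rightarrow> real \<Rightarrow> real"
    and \<sigma>2 :: "nat \<Rightarrow> nat \<Rightarrow> real"
    and K0 :: nat
    and G :: "nat \<Rightarrow> nat \<Rightarrow> nat set"
    and g :: "nat \<Rightarrow> real \<Rightarrow> real"
    and K :: "real \<Rightarrow> real"
    and grid :: "nat \<Rightarrow> (real \<times> real) set"
    and hmin hmax :: "nat \<Rightarrow> real"
    and \<theta> :: real
  assumes "panel_model M n Y X \<epsilon> \<alpha> \<gamma> m"
    and "group_structure n m K0 G g"
    and "multiscale_grid grid hmin hmax"
    and "cond_C1 M n X \<epsilon>"
    and "cond_C2 M n X f"
    and "cond_C3 M n X \<epsilon> \<sigma>2"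
    and "cond_C4 K0 G f \<sigma>2"
    and "cond_C5 M n X \<epsilon> \<theta>"
    and "cond_C6 K0 g"
    and "cond_C7 n hmin \<theta>"
    and "cond_C8 hmin hmax"
    and "cond_C9 K"
  defines "d \<equiv> \<lambda>T w. d_hat K (grid T) (n T) T (\<lambda>i t. X T i t w) (\<lambda>i t. Y T i t w)"
  shows "bigO_prob M
           (\<lambda>T w. Max {d T w i j | k i j. k \<in> {1..K0} \<and> i \<in> G T k \<and> j \<in> G T k})
           (\<lambda>T. sqrt (ln (real (n T)) + ln (real T))) \<and>
         (\<exists>c0>0. \<exists>R. smallo_prob M R (\<lambda>T. sqrt (real T * hmax T)) \<and>
           (\<forall>T\<ge>1. \<forall>w\<in>space (M T).
              (INF k\<in>{1..K0}. INF k'\<in>{k<..K0}. INF i\<in>G T k. INF j\<in>G T k'. ereal (d T w i j))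
                \<ge> ereal (c0 * sqrt (real T * hmax T) + R T w)))"
proof -
  obtain KM LK k0 v u1 where ker: "kernel K KM LK k0 v u1" using cond_C9_kernel[OF assms(12)] by blast
  obtain CH \<beta> where CH: "\<forall>T\<ge>1. real (card (grid T)) \<le> CH * real T powr \<beta>"
    using conjunct1[OF conjunct2[OF assms(3)[unfolded multiscale_grid_def]]] by (elim exE conjE) (rule that)
  note C1 = assms(4)[unfolded cond_C1_def]
  obtain mix \<rho> and Cm :: real where Cm: "0 < Cm" "0 < \<rho>" "\<rho> < 1" and mix: "\<forall>l. mix l \<le> Cm * \<rho> ^ l"
    "\<forall>T\<ge>1. \<forall>i\<in>{1..n T}. \<forall>l. mixing_coeff (M T) borel (\<lambda>t w. (X T i t w, \<epsilon> T i t w)) l \<le> mix l"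
    using conjunct2[OF conjunct2[OF C1]] by (elim exE conjE) (rule that)
  note C2 = assms(5)[unfolded cond_C2_def] and C3 = assms(6)[unfolded cond_C3_def] and C5 = assms(8)[unfolded cond_C5_def]
  note f = conjunct1[OF conjunct1[OF C2, rule_format], rule_format] conjunct2[OF conjunct1[OF C2, rule_format], rule_format]
  obtain clow Cf where cf: "0 < clow" "\<forall>T\<ge>1. \<forall>i\<in>{1..n T}. \<forall>x\<in>{0..1}. clow \<le> f T i x \<and> f T i x \<le> Cf"
    using conjunct1[OF conjunct2[OF C2]] by (elim exE conjE) (rule that)
  obtain Cj where Cj: "\<forall>T\<ge>1. \<forall>i\<in>{1..n T}. \<forall>l\<ge>1. \<exists>fl :: real \<times> real \<Rightarrow> real. (\<forall>z. 0 \<le> fl z \<and> fl z \<le> Cj) \<and>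
      (\<forall>t\<ge>1. distributed (M T) (lborel \<Otimes>\<^sub>M lborel) (\<lambda>w. (X T i t w, X T i (t + l) w)) (\<lambda>z. ennreal (fl z)))"
    using conjunct2[OF conjunct2[OF conjunct2[OF C2]]] by (elim exE) (rule that)
  note \<epsilon>2 = conjunct1[OF conjunct2[OF conjunct1[OF C3, rule_format]]] conjunct2[OF conjunct2[OF conjunct1[OF C3, rule_format]]]
  obtain \<sigma>low C\<sigma> where \<sigma>: "0 < \<sigma>low" "\<forall>T\<ge>1. \<forall>i\<in>{1..n T}. \<sigma>low \<le> \<sigma>2 T i \<and> \<sigma>2 T i \<le> C\<sigma>"
    using conjunct2[OF C3] by (elim exE conjE) (rule that)
  note \<theta> = conjunct1[OF C5]
  obtain ls :: nat and C\<epsilon> where C\<epsilon>: "\<forall>T\<ge>1. \<forall>i\<in>{1..n T}. \<forall>t\<ge>1.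
    (AE w in M T. nn_cond_exp (M T) (sigma_of (M T) (X T i t))
           (\<lambda>w. ennreal (\<bar>\<epsilon> T i t w\<bar> powr \<theta>)) w \<le> ennreal C\<epsilon>) \<and>
    (\<forall>s\<ge>1. \<bar>int s - int t\<bar> \<ge> int ls \<longrightarrow>
      (AE w in M T. nn_cond_exp (M T) (sigma_of (M T) (\<lambda>w. (X T i t w, X T i s w)))
              (\<lambda>w. ennreal \<bar>\<epsilon> T i t w * \<epsilon> T i s w\<bar>) w \<le> ennreal C\<epsilon>))"
    using conjunct2[OF C5] by (elim exE) (rule that)
  obtain Gb Lg where g: "\<And>k x. k \<in> {1..K0} \<Longrightarrow> x \<in> {0..1} \<Longrightarrow> \<bar>g k x\<bar> \<le> Gb"
    "\<And>k x y. k \<in> {1..K0} \<Longrightarrow> x \<in> {0..1} \<Longrightarrow> y \<in> {0..1} \<Longrightarrow> \<bar>g k x - g k y\<bar> \<le> Lg * \<bar>x - y\<bar>"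
    using cond_C6_bounds[OF assms(9)] by blast
  obtain \<delta> C where C7: "0 < \<delta>" "0 < C" "\<And>T. 1 \<le> T \<Longrightarrow> real (n T) \<le>
      C * (min (real T powr (1/2)) (real T * hmin T) powr ((\<theta> - \<delta>) / 2) / real T powr (1 + \<delta>))"
    using assms(10) unfolding cond_C7_def by blast
  obtain a A b B where h: "0 < a" "0 < A" "0 < b" "b \<le> B" "B < 1"
    "\<And>T. 1 \<le> T \<Longrightarrow> hmin T = a * real T powr - B" "\<And>T. 1 \<le> T \<Longrightarrow> hmax T = A * real T powr - b"
    using assms(11) unfolding cond_C8_def by blast
  have n1: "1 \<le> n T" if "1 \<le> T" for T
    using assms(1) that unfolding panel_model_def by (meson one_le_numeral order_trans)
  have n_le: "real (n T) \<le> C * (min (real T powr (1/2)) (real T * (a * real T powr - B)) powr ((\<theta> - \<delta>) / 2) / real T powr (1 + \<delta>))"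
    if "1 \<le> T" for T
    using C7(3)[OF that] unfolding h(6)[OF that] .
  obtain \<tau> \<eta> where \<tau>: "0 < \<eta>" "\<And>T. 1 \<le> T \<Longrightarrow> 0 < \<tau> T" "filterlim \<tau> at_top sequentially"
    "\<forall>\<^sub>F T in sequentially. \<tau> T \<le> sqrt (real T * (a * real T powr - B)) * real T powr - \<eta> \<and> (\<tau> T)\<^sup>2 \<le> sqrt (real T) * real T powr - \<eta>"
    "\<forall>\<^sub>F T in sequentially. \<tau> T powr (1 - \<theta>) \<le> 1 / sqrt (real T)"
    "(\<lambda>T. real (n T) * real T * \<tau> T powr - \<theta>) \<longlonglongrightarrow> 0" "\<forall>\<^sub>F T in sequentially. real (n T) \<le> real T powr \<theta>"
    using truncation_level[OF \<theta> C7(1,2) h(1,5) n1 n_le] by blast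
  \<comment> \<open>The conditions do not state a sign for their upper constants, while the locale
    wants them nonnegative; passing to absolute values weakens the bounds harmlessly.\<close>
  have abs_mono: "x \<le> ennreal C\<epsilon> \<Longrightarrow> x \<le> ennreal \<bar>C\<epsilon>\<bar>" for x
    by (rule order_trans[OF _ ennreal_leI]) auto
  \<comment> \<open>The lag \<open>ls\<close> is raised to at least 1, so that times at this
    distance are distinct and have a joint density.\<close>
  interpret grouped_panel K KM LK k0 v u1 M n Y X \<epsilon> \<alpha> \<gamma> m f \<sigma>2 K0 G g grid hmin hmax \<tau> \<theta> \<eta> Cm \<rho> a A b B \<beta> CH
    clow "\<bar>Cf\<bar>" "\<bar>Cj\<bar>" \<sigma>low "\<bar>C\<sigma>\<bar>" "\<bar>C\<epsilon>\<bar>" "\<bar>Gb\<bar>" "\<bar>Lg\<bar>" "max 1 ls"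
  proof (intro grouped_panel.intro grouped_panel_axioms.intro ker)
    fix T i assume T: "1 \<le> T" "i \<in> {1..n T}"
    show "mixing_coeff (M T) borel (\<lambda>t w. (X T i t w, \<epsilon> T i t w)) l \<le> Cm * \<rho> ^ l" for l
      by (rule order_trans[OF mix(2)[rule_format, OF T] mix(1)[rule_format]])
    show "\<sigma>low \<le> \<sigma>2 T i" "\<sigma>2 T i \<le> \<bar>C\<sigma>\<bar>" using \<sigma>(2)[rule_format, OF T] by linarith+
    show "clow \<le> f T i x" "f T i x \<le> \<bar>Cf\<bar>" if "x \<in> {0..1}" for x using cf(2)[rule_format, OF T that] by linarith+
    show "\<exists>fl :: real \<times> real \<Rightarrow> real. (\<forall>z. fl z \<le> \<bar>Cj\<bar>) \<and>
      (\<forall>t\<ge>1. distributed (M T) (lborel \<Otimes>\<^sub>M lborel) (\<lambda>w. (X T i t w, X T i (t + l) w)) (\<lambda>z. ennreal (fl z)))"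
      if l: "1 \<le> l" for l
    proof -
      obtain fl :: "real \<times> real \<Rightarrow> real" where fl: "\<forall>z. 0 \<le> fl z \<and> fl z \<le> Cj" "\<forall>t\<ge>1. distributed (M T) (lborel \<Otimes>\<^sub>M lborel)
          (\<lambda>w. (X T i t w, X T i (t + l) w)) (\<lambda>z. ennreal (fl z))"
        using Cj[rule_format, OF T l] by (elim exE conjE) (rule that)
      have "\<forall>z. fl z \<le> \<bar>Cj\<bar>" using fl(1) by (auto intro: order_trans[OF _ abs_ge_self])
      then show ?thesis using fl(2) by (rule_tac exI[of _ fl] conjI)+
    qed
    fix t :: nat assume t: "1 \<le> t"
    show "AE w in M T. nn_cond_exp (M T) (sigma_of (M T) (X T i t))
           (\<lambda>w. ennreal (\<bar>\<epsilon> T i t w\<bar> powr \<theta>)) w \<le> ennreal \<bar>C\<epsilon>\<bar>"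
      using conjunct1[OF C\<epsilon>[rule_format, OF T t]] by eventually_elim (rule abs_mono)
    show "AE w in M T. nn_cond_exp (M T) (sigma_of (M T) (\<lambda>w. (X T i t w, X T i s w)))
              (\<lambda>w. ennreal \<bar>\<epsilon> T i t w * \<epsilon> T i s w\<bar>) w \<le> ennreal \<bar>C\<epsilon>\<bar>"
      if "1 \<le> s" "int (max 1 ls) \<le> \<bar>int s - int t\<bar>" for s
    proof -
      have "int ls \<le> \<bar>int s - int t\<bar>" using that(2) by linarith
      from conjunct2[OF C\<epsilon>[rule_format, OF T t], rule_format, OF that(1) this] show ?thesis by eventually_elim (rule abs_mono)
    qed
  next
    fix k and x :: real assume k: "k \<in> {1..K0}" and x: "x \<in> {0..1}"
    show "\<bar>g k x\<bar> \<le> \<bar>Gb\<bar>" using g(1)[OF k x] by linarith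
    show "\<bar>g k x - g k y\<bar> \<le> \<bar>Lg\<bar> * \<bar>x - y\<bar>" if "y \<in> {0..1}" for y
      by (rule order_trans[OF g(2)[OF k x that] mult_right_mono]) auto
  next
    show "\<exists>x\<in>{0..1}. g k x \<noteq> g k' x" if "k \<in> {1..K0}" "k' \<in> {k<..K0}" for k k'
      using assms(9) that unfolding cond_C6_def by blast
  qed (fact assms(1-3,7) CH[rule_format] conjunct1[OF C1, rule_format] less_imp_le[OF Cm(1)] Cm f \<epsilon>2 \<theta> cf(1) \<sigma>(1) h \<tau>
      abs_ge_zero max.cobounded1)+
  show ?thesis unfolding d_def by (rule conjI[OF within_groups between_groups])
qed

end
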